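(* Let $R$ be a ring and let $\mathcal{D}$ be a definable category in $\mathrm{Mod}(R)$. Then $(\mathcal{D},\mathcal{D}^{d})$ is a symmetric, product-closed duality pair. Moreover, if $(\mathsf{A},\mathsf{B})$ is a symmetric duality pair (with $\mathsf{A}\subseteq\mathrm{Mod}(R)$, $\mathsf{B}\subseteq\mathrm{Mod}(R^{\circ})$), then the following are equivalent: (1) either class is closed under coproducts (i.e. at least one of $\mathsf{A}$, $\mathsf{B}$ is); (2) either class is closed under products (i.e. at least one of $\mathsf{A}$, $\mathsf{B}$ is); (3) $\mathsf{A}$ is definable and $\mathsf{B}=\mathsf{A}^{d}$; (4) $\mathsf{B}$ is definable and $\mathsf{A}=\mathsf{B}^{d}$. In particular, if either class is closed under (co)products, both classes are, and they are thus definable.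
   Context: $R$ is a unital associative ring; $\mathrm{Mod}(R)$ is the category of left $R$-modules, $\mathrm{mod}(R)$ the finitely presented ones, and $\mathrm{Mod}(R^{\circ})$ the category of right $R$-modules. A pair of classes $\mathsf{A}\subseteq\mathrm{Mod}(R)$, $\mathsf{B}\subseteq\mathrm{Mod}(R^{\circ})$ is a duality pair if $M\in\mathsf{A}$ if and only if $\mathrm{Hom}_{\mathbb{Z}}(M,\mathbb{Q}/\mathbb{Z})\in\mathsf{B}$, and $\mathsf{B}$ is closed under finite direct sums and direct summands. It is product-closed if $\mathsf{A}$ is closed under products, and symmetric if $(\mathsf{B},\mathsf{A})$ is also a duality pair (with the roles of $R$ and $R^{\circ}$ swapped). $(\mathrm{mod}(R),\mathbf{Ab})^{\mathrm{fp}}$ is the category of finitely presented additive functors $\mathrm{mod}(R)\to\mathbf{Ab}$, i.e. cokernels $G$ of maps $\mathrm{Hom}_R(f,-)\colon\mathrm{Hom}_R(B,-)\to\mathrm{Hom}_R(A,-)$ with $f\colon A\to B$ in $\mathrm{mod}(R)$; $\widetilde{G}\colon\mathrm{Mod}(R)\to\mathbf{Ab}$ denotes the extension given by the same cokernel computed on all of $\mathrm{Mod}(R)$. For a set $\mathcal{S}$ of finitely presented functors, $\mathrm{Ker}(\mathcal{S})=\{M:\widetilde{G}M=0\ \forall G\in\mathcal{S}\}$. A class is definable if it equals $\mathrm{Ker}(\mathcal{S})$ for some such $\mathcal{S}$ (equivalently, it is closed under direct limits, direct products and pure submodules). For definable $\mathcal{D}$, $\mathcal{S}_{\mathcal{D}}=\{G:\widetilde{G}(M)=0\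 \forall M\in\mathcal{D}\}$. The Auslander--Gruson--Jensen functor is the contravariant functor $\delta\colon(\mathrm{mod}(R),\mathbf{Ab})^{\mathrm{fp}}\to(\mathrm{mod}(R^{\circ}),\mathbf{Ab})^{\mathrm{fp}}$, $(\delta G)(M)=\mathrm{Hom}_{(\mathrm{mod}(R),\mathbf{Ab})}(G,M\otimes_R-)$, and symmetrically with $R,R^{\circ}$ exchanged. The dual definable category of $\mathcal{D}$ is $\mathcal{D}^{d}=\mathrm{Ker}(\delta(\mathcal{S}_{\mathcal{D}}))\subseteq\mathrm{Mod}(R^{\circ})$; likewise for definable categories in $\mathrm{Mod}(R^\circ)$. *)

theory Defs
  imports "HOL-Algebra.Module" "HOL-Algebra.Free_Abelian_Groups"
begin

section \<open>Universe\<close>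

text \<open>
  The category of all modules is formed inside a universe: modules are structured on subsets of a
  type \<open>'u\<close>, and a set is small if it has fewer elements than \<open>'u\<close>. The cardinality of \<open>'u\<close> is
  required to be strongly inaccessible, i.e. \<open>'u\<close> plays the role of a Grothendieck universe, so
  that small modules are closed under small products and under character modules.
\<close>

definition small :: "'u set \<Rightarrow> bool" where
  "small A \<longleftrightarrow> |A| <o |UNIV :: 'u set|"

definition inaccessible :: "'u itself \<Rightarrow> bool" where
  "inaccessible U \<longleftrightarrow>
     |UNIV :: nat set| <o |UNIV :: 'u set| \<and>
     regularCard |UNIV :: 'u set| \<and>
     (\<forall>A :: 'u set. small A \<longrightarrow> |Pow A| <o |UNIV :: 'u set| )"

section \<open>Modules over a not necessarily commutative ring\<close>

text \<open>
  The record \<^type>\<open>module\<close> is that of HOL-Algebra, whose locale of the same name insists on a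
  commutative ring. Its ring multiplication and unit fields play no role for modules.
\<close>

locale left_module = R?: ring R + M?: abelian_group M
  for R :: "'r ring" (structure) and M :: "('r, 'a) module" (structure) +
  assumes smult_closed:
      "\<lbrakk>a \<in> carrier R; x \<in> carrier M\<rbrakk> \<Longrightarrow> a \<odot>\<^bsub>M\<^esub> x \<in> carrier M"
    and smult_l_distr:
      "\<lbrakk>a \<in> carrier R; b \<in> carrier R; x \<in> carrier M\<rbrakk> \<Longrightarrow>
        (a \<oplus>\<^bsub>R\<^esub> b) \<odot>\<^bsub>M\<^esub> x = a \<odot>\<^bsub>M\<^esub> x \<oplus>\<^bsub>M\<^esub> b \<odot>\<^bsub>M\<^esub> x"
    and smult_r_distr:
      "\<lbrakk>a \<in> carrier R; x \<in> carrier M; y \<in> carrier M\<rbrakk> \<Longrightarrow>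
        a \<odot>\<^bsub>M\<^esub> (x \<oplus>\<^bsub>M\<^esub> y) = a \<odot>\<^bsub>M\<^esub> x \<oplus>\<^bsub>M\<^esub> a \<odot>\<^bsub>M\<^esub> y"
    and smult_assoc:
      "\<lbrakk>a \<in> carrier R; b \<in> carrier R; x \<in> carrier M\<rbrakk> \<Longrightarrow>
        (a \<otimes>\<^bsub>R\<^esub> b) \<odot>\<^bsub>M\<^esub> x = a \<odot>\<^bsub>M\<^esub> (b \<odot>\<^bsub>M\<^esub> x)"
    and smult_one: "x \<in> carrier M \<Longrightarrow> \<one>\<^bsub>R\<^esub> \<odot>\<^bsub>M\<^esub> x = x"

definition mk_module ::
    "'a set \<Rightarrow> 'a \<Rightarrow> ('a \<Rightarrow> 'a \<Rightarrow> 'a) \<Rightarrow> ('r \<Rightarrow> 'a \<Rightarrow> 'a) \<Rightarrow> ('r, 'a) module" where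
  "mk_module C z p s =
     \<lparr>carrier = C, monoid.mult = undefined, one = undefined, ring.zero = z, ring.add = p, smult = s\<rparr>"

text \<open>Right \<open>R\<close>-modules are left modules over the opposite ring.\<close>

definition opp :: "'r ring \<Rightarrow> 'r ring" where
  "opp R = R\<lparr>monoid.mult := \<lambda>a b. b \<otimes>\<^bsub>R\<^esub> a\<rparr>"

definition Modules :: "'r ring \<Rightarrow> ('r, 'u) module set" where
  "Modules R = {M. left_module R M \<and> small (carrier M)}"

text \<open>Homomorphisms are extensional functions, so that equality in \<open>Hom\<close> is equality on the domain.\<close>

definition mhom :: "'r ring \<Rightarrow> ('r, 'a) module \<Rightarrow> ('r, 'b) module \<Rightarrow> ('a \<Rightarrow> 'b) set" where
  "mhom R M N = {h \<in> carrier M \<rightarrow>\<^sub>E carrier N.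
     (\<forall>x\<in>carrier M. \<forall>y\<in>carrier M. h (x \<oplus>\<^bsub>M\<^esub> y) = h x \<oplus>\<^bsub>N\<^esub> h y) \<and>
     (\<forall>r\<in>carrier R. \<forall>x\<in>carrier M. h (r \<odot>\<^bsub>M\<^esub> x) = r \<odot>\<^bsub>N\<^esub> h x)}"

definition mod_iso :: "'r ring \<Rightarrow> ('r, 'a) module \<Rightarrow> ('r, 'b) module \<Rightarrow> bool" where
  "mod_iso R M N \<longleftrightarrow> (\<exists>h\<in>mhom R M N. bij_betw h (carrier M) (carrier N))"

text \<open>
  Constructions such as products leave the type \<open>'u\<close>. Membership of such a module in a class of
  modules over \<open>'u\<close> is understood up to isomorphism.
\<close>

definition belongs :: "'r ring \<Rightarrow> ('r, 'a) module \<Rightarrow> ('r, 'u) module set \<Rightarrow> bool" where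
  "belongs R X A \<longleftrightarrow> (\<exists>M\<in>A. mod_iso R X M)"

definition prod_module :: "'i set \<Rightarrow> ('i \<Rightarrow> ('r, 'a) module) \<Rightarrow> ('r, 'i \<Rightarrow> 'a) module" where
  "prod_module I F = mk_module (\<Pi>\<^sub>E i\<in>I. carrier (F i)) (\<lambda>i\<in>I. \<zero>\<^bsub>F i\<^esub>)
     (\<lambda>x y. \<lambda>i\<in>I. x i \<oplus>\<^bsub>F i\<^esub> y i) (\<lambda>r x. \<lambda>i\<in>I. r \<odot>\<^bsub>F i\<^esub> x i)"

definition coprod_module :: "'i set \<Rightarrow> ('i \<Rightarrow> ('r, 'a) module) \<Rightarrow> ('r, 'i \<Rightarrow> 'a) module" where
  "coprod_module I F = (prod_module I F)
     \<lparr>carrier := {x \<in> \<Pi>\<^sub>E i\<in>I. carrier (F i). finite {i \<in> I. x i \<noteq> \<zero>\<^bsub>F i\<^esub>}}\<rparr>"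

definition sum_module :: "('r, 'a) module \<Rightarrow> ('r, 'b) module \<Rightarrow> ('r, 'a \<times> 'b) module" where
  "sum_module M N = mk_module (carrier M \<times> carrier N) (\<zero>\<^bsub>M\<^esub>, \<zero>\<^bsub>N\<^esub>)
     (\<lambda>(x, y) (x', y'). (x \<oplus>\<^bsub>M\<^esub> x', y \<oplus>\<^bsub>N\<^esub> y')) (\<lambda>r (x, y). (r \<odot>\<^bsub>M\<^esub> x, r \<odot>\<^bsub>N\<^esub> y))"

definition free_module :: "'r ring \<Rightarrow> nat \<Rightarrow> ('r, nat \<Rightarrow> 'r) module" where
  "free_module R n =
     prod_module {..<n} (\<lambda>_. mk_module (carrier R) \<zero>\<^bsub>R\<^esub> (add R) (monoid.mult R))"

text \<open>Finite presentation: an exact sequence \<open>R\<^sup>m \<rightarrow> R\<^sup>n \<rightarrow> M \<rightarrow> 0\<close>.\<close>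

definition finitely_presented :: "'r ring \<Rightarrow> ('r, 'a) module \<Rightarrow> bool" where
  "finitely_presented R M \<longleftrightarrow> (\<exists>m n.
     \<exists>g\<in>mhom R (free_module R m) (free_module R n). \<exists>p\<in>mhom R (free_module R n) M.
       p ` carrier (free_module R n) = carrier M \<and>
       g ` carrier (free_module R m) = {x \<in> carrier (free_module R n). p x = \<zero>\<^bsub>M\<^esub>})"

definition fp_modules :: "'r ring \<Rightarrow> ('r, 'u) module set" where
  "fp_modules R = {M \<in> Modules R. finitely_presented R M}"

section \<open>Duality pairs\<close>

definition QZ :: "rat set monoid" where
  "QZ = \<lparr>carrier = UNIV, monoid.mult = (+), one = 0\<rparr> Mod (\<int> :: rat set)"

text \<open>
  \<open>Hom\<^sub>\<int>(M, \<rat>/\<int>)\<close> with the action \<open>(\<phi> r) x = \<phi> (r x)\<close>: a left \<open>R\<close>-module becomes a module over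
  \<^term>\<open>opp R\<close>, and vice versa.
\<close>

definition char_module :: "('r, 'a) module \<Rightarrow> ('r, 'a \<Rightarrow> rat set) module" where
  "char_module M = mk_module
     (hom (add_monoid M) QZ \<inter> extensional (carrier M))
     (\<lambda>x\<in>carrier M. \<one>\<^bsub>QZ\<^esub>)
     (\<lambda>\<phi> \<psi>. \<lambda>x\<in>carrier M. \<phi> x \<otimes>\<^bsub>QZ\<^esub> \<psi> x)
     (\<lambda>r \<phi>. \<lambda>x\<in>carrier M. \<phi> (r \<odot>\<^bsub>M\<^esub> x))"

definition closed_finite_sums :: "'r ring \<Rightarrow> ('r, 'u) module set \<Rightarrow> bool" where
  "closed_finite_sums R A \<longleftrightarrow> (\<forall>(I :: 'u set) F. finite I \<and> (\<forall>i\<in>I. F i \<in> A) \<longrightarrow>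
     belongs R (coprod_module I F) A)"

definition closed_summands :: "'r ring \<Rightarrow> ('r, 'u) module set \<Rightarrow> bool" where
  "closed_summands R A \<longleftrightarrow> (\<forall>X\<in>Modules R. \<forall>Y\<in>(Modules R :: ('r, 'u) module set).
     belongs R (sum_module X Y) A \<longrightarrow> X \<in> A)"

definition closed_products :: "'r ring \<Rightarrow> ('r, 'u) module set \<Rightarrow> bool" where
  "closed_products R A \<longleftrightarrow> (\<forall>(I :: 'u set) F. small I \<and> (\<forall>i\<in>I. F i \<in> A) \<longrightarrow>
     belongs R (prod_module I F) A)"

definition closed_coproducts :: "'r ring \<Rightarrow> ('r, 'u) module set \<Rightarrow> bool" where
  "closed_coproducts R A \<longleftrightarrow> (\<forall>(I :: 'u set) F. small I \<and> (\<forall>i\<in>I. F i \<in> A) \<longrightarrow>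
     belongs R (coprod_module I F) A)"

text \<open>
  Both classes of a duality pair are automatically closed under isomorphism: the second one because
  \<^const>\<open>closed_summands\<close> refers to summands up to isomorphism, hence also the first one.
\<close>

definition duality_pair ::
    "'r ring \<Rightarrow> ('r, 'u) module set \<Rightarrow> ('r, 'u) module set \<Rightarrow> bool" where
  "duality_pair R A B \<longleftrightarrow>
     A \<subseteq> Modules R \<and> B \<subseteq> Modules (opp R) \<and>
     (\<forall>M\<in>Modules R. M \<in> A \<longleftrightarrow> belongs (opp R) (char_module M) B) \<and>
     closed_finite_sums (opp R) B \<and> closed_summands (opp R) B"

definition product_closed_duality_pair ::
    "'r ring \<Rightarrow> ('r, 'u) module set \<Rightarrow> ('r, 'u) module set \<Rightarrow> bool" where
  "product_closed_duality_pair R A B \<longleftrightarrow> duality_pair R A B \<and> closed_products R A"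

definition symmetric_duality_pair ::
    "'r ring \<Rightarrow> ('r, 'u) module set \<Rightarrow> ('r, 'u) module set \<Rightarrow> bool" where
  "symmetric_duality_pair R A B \<longleftrightarrow> duality_pair R A B \<and> duality_pair (opp R) B A"

section \<open>Additive functors on finitely presented modules\<close>

text \<open>
  A functor to abelian groups (written as multiplicative \<^type>\<open>monoid\<close> records) with its value
  \<open>fmor F X Y h\<close> on \<open>h : X \<rightarrow> Y\<close>. Natural transformations are families indexed by \<^const>\<open>fp_modules\<close>,
  extensional in both arguments.
\<close>

record ('r, 'u, 'x) mod_functor =
  fob :: "('r, 'u) module \<Rightarrow> 'x monoid"
  fmor :: "('r, 'u) module \<Rightarrow> ('r, 'u) module \<Rightarrow> ('u \<Rightarrow> 'u) \<Rightarrow> 'x \<Rightarrow> 'x"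

definition hom_group :: "'r ring \<Rightarrow> ('r, 'a) module \<Rightarrow> ('r, 'b) module \<Rightarrow> ('a \<Rightarrow> 'b) monoid" where
  "hom_group R M N = \<lparr>carrier = mhom R M N,
     monoid.mult = (\<lambda>g h. \<lambda>x\<in>carrier M. g x \<oplus>\<^bsub>N\<^esub> h x), one = (\<lambda>x\<in>carrier M. \<zero>\<^bsub>N\<^esub>)\<rparr>"

definition additive_functor :: "'r ring \<Rightarrow> ('r, 'u, 'x) mod_functor \<Rightarrow> bool" where
  "additive_functor R F \<longleftrightarrow>
     (\<forall>X\<in>fp_modules R. comm_group (fob F X)) \<and>
     (\<forall>X\<in>fp_modules R. \<forall>Y\<in>fp_modules R. \<forall>h\<in>mhom R X Y.
        fmor F X Y h \<in> hom (fob F X) (fob F Y)) \<and>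
     (\<forall>X\<in>fp_modules R. \<forall>x\<in>carrier (fob F X). fmor F X X (\<lambda>u\<in>carrier X. u) x = x) \<and>
     (\<forall>X\<in>fp_modules R. \<forall>Y\<in>fp_modules R. \<forall>Z\<in>fp_modules R. \<forall>h\<in>mhom R X Y. \<forall>k\<in>mhom R Y Z.
        \<forall>x\<in>carrier (fob F X).
          fmor F X Z (compose (carrier X) k h) x = fmor F Y Z k (fmor F X Y h x)) \<and>
     (\<forall>X\<in>fp_modules R. \<forall>Y\<in>fp_modules R. \<forall>h\<in>mhom R X Y. \<forall>k\<in>mhom R X Y.
        \<forall>x\<in>carrier (fob F X).
          fmor F X Y (h \<otimes>\<^bsub>hom_group R X Y\<^esub> k) x = fmor F X Y h x \<otimes>\<^bsub>fob F Y\<^esub> fmor F X Y k x)"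

definition nat_trans ::
    "'r ring \<Rightarrow> ('r, 'u, 'x) mod_functor \<Rightarrow> ('r, 'u, 'y) mod_functor \<Rightarrow>
       (('r, 'u) module \<Rightarrow> 'x \<Rightarrow> 'y) set" where
  "nat_trans R F G =
     {\<eta> \<in> \<Pi>\<^sub>E X\<in>fp_modules R. hom (fob F X) (fob G X) \<inter> extensional (carrier (fob F X)).
        \<forall>X\<in>fp_modules R. \<forall>Y\<in>fp_modules R. \<forall>h\<in>mhom R X Y. \<forall>x\<in>carrier (fob F X).
          \<eta> Y (fmor F X Y h x) = fmor G X Y h (\<eta> X x)}"

definition nat_trans_group ::
    "'r ring \<Rightarrow> ('r, 'u, 'x) mod_functor \<Rightarrow> ('r, 'u, 'y) mod_functor \<Rightarrow>
       (('r, 'u) module \<Rightarrow> 'x \<Rightarrow> 'y) monoid" where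
  "nat_trans_group R F G = \<lparr>carrier = nat_trans R F G,
     monoid.mult = (\<lambda>\<eta> \<theta>. \<lambda>X\<in>fp_modules R. \<lambda>x\<in>carrier (fob F X). \<eta> X x \<otimes>\<^bsub>fob G X\<^esub> \<theta> X x),
     one = (\<lambda>X\<in>fp_modules R. \<lambda>x\<in>carrier (fob F X). \<one>\<^bsub>fob G X\<^esub>)\<rparr>"

definition functor_iso ::
    "'r ring \<Rightarrow> ('r, 'u, 'x) mod_functor \<Rightarrow> ('r, 'u, 'y) mod_functor \<Rightarrow> bool" where
  "functor_iso R F G \<longleftrightarrow> (\<exists>\<eta>\<in>nat_trans R F G. \<forall>X\<in>fp_modules R.
     bij_betw (\<eta> X) (carrier (fob F X)) (carrier (fob G X)))"

section \<open>Finitely presented functors and definable classes\<close>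

definition fp_morphisms :: "'r ring \<Rightarrow> (('r, 'u) module \<times> ('r, 'u) module \<times> ('u \<Rightarrow> 'u)) set" where
  "fp_morphisms R = {(A, B, f). A \<in> fp_modules R \<and> B \<in> fp_modules R \<and> f \<in> mhom R A B}"

definition hom_image ::
    "'r ring \<Rightarrow> ('r, 'u) module \<times> ('r, 'u) module \<times> ('u \<Rightarrow> 'u) \<Rightarrow> ('r, 'u) module \<Rightarrow> ('u \<Rightarrow> 'u) set"
  where
  "hom_image R = (\<lambda>(A, B, f) M. (\<lambda>g. compose (carrier A) g f) ` mhom R B M)"

text \<open>
  The cokernel of \<open>Hom(f, -) : Hom(B, -) \<rightarrow> Hom(A, -)\<close>, defined on all modules. On a homomorphism
  \<open>h\<close> it sends the coset of \<open>g\<close> to the coset of \<open>h \<circ> g\<close> (written as a union over all representatives).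
\<close>

definition coker_functor ::
    "'r ring \<Rightarrow> ('r, 'u) module \<times> ('r, 'u) module \<times> ('u \<Rightarrow> 'u) \<Rightarrow>
       ('r, 'u, ('u \<Rightarrow> 'u) set) mod_functor" where
  "coker_functor R p = \<lparr>
     fob = (\<lambda>M. hom_group R (fst p) M Mod hom_image R p M),
     fmor = (\<lambda>M N h C. \<Union>g\<in>C.
       hom_image R p N #>\<^bsub>hom_group R (fst p) N\<^esub> compose (carrier (fst p)) h g)\<rparr>"

definition fp_functor :: "'r ring \<Rightarrow> ('r, 'u, 'x) mod_functor \<Rightarrow> bool" where
  "fp_functor R G \<longleftrightarrow> additive_functor R G \<and>
     (\<exists>p\<in>fp_morphisms R. functor_iso R G (coker_functor R p))"

text \<open>
  The extension of a finitely presented functor to all modules; up to isomorphism it does not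
  depend on the chosen presentation.
\<close>

definition extension ::
    "'r ring \<Rightarrow> ('r, 'u, 'x) mod_functor \<Rightarrow> ('r, 'u, ('u \<Rightarrow> 'u) set) mod_functor" where
  "extension R G = coker_functor R
     (SOME p. p \<in> fp_morphisms R \<and> functor_iso R G (coker_functor R p))"

definition Ker :: "'r ring \<Rightarrow> ('r, 'u, 'x) mod_functor set \<Rightarrow> ('r, 'u) module set" where
  "Ker R S = {M \<in> Modules R. \<forall>G\<in>S. trivial_group (fob (extension R G) M)}"

text \<open>
  Every finitely presented functor is isomorphic to one with values on the type of
  \<^const>\<open>coker_functor\<close>, so fixing that value type below is no restriction.
\<close>

definition definable :: "'r ring \<Rightarrow> ('r, 'u) module set \<Rightarrow> bool" where
  "definable R D \<longleftrightarrow> (\<exists>S :: ('r, 'u, ('u \<Rightarrow> 'u) set) mod_functor set.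
     (\<forall>G\<in>S. fp_functor R G) \<and> D = Ker R S)"

definition vanishing_functors ::
    "'r ring \<Rightarrow> ('r, 'u) module set \<Rightarrow> ('r, 'u, ('u \<Rightarrow> 'u) set) mod_functor set" where
  "vanishing_functors R D =
     {G. fp_functor R G \<and> (\<forall>M\<in>D. trivial_group (fob (extension R G) M))}"

section \<open>Tensor products and the Auslander--Gruson--Jensen functor\<close>

text \<open>
  \<open>N \<otimes>\<^sub>R X\<close> for a right module \<open>N\<close> and a left module \<open>X\<close>, as the free abelian group on
  \<open>N \<times> X\<close> modulo bilinearity and balancedness. As \<open>N\<close> is a left module over \<^term>\<open>opp R\<close>, the
  product \<open>n r\<close> is \<^term>\<open>r \<odot>\<^bsub>N\<^esub> n\<close>.
\<close>

definition tensor_relations ::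
    "'r ring \<Rightarrow> ('r, 'a) module \<Rightarrow> ('r, 'b) module \<Rightarrow> ('a \<times> 'b \<Rightarrow>\<^sub>0 int) set" where
  "tensor_relations R N X = generate (free_Abelian_group (carrier N \<times> carrier X))
     ({frag_of (n \<oplus>\<^bsub>N\<^esub> n', x) - frag_of (n, x) - frag_of (n', x) | n n' x.
         n \<in> carrier N \<and> n' \<in> carrier N \<and> x \<in> carrier X} \<union>
      {frag_of (n, x \<oplus>\<^bsub>X\<^esub> x') - frag_of (n, x) - frag_of (n, x') | n x x'.
         n \<in> carrier N \<and> x \<in> carrier X \<and> x' \<in> carrier X} \<union>
      {frag_of (r \<odot>\<^bsub>N\<^esub> n, x) - frag_of (n, r \<odot>\<^bsub>X\<^esub> x) | r n x.
         r \<in> carrier R \<and> n \<in> carrier N \<and> x \<in> carrier X})"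

definition tensor ::
    "'r ring \<Rightarrow> ('r, 'a) module \<Rightarrow> ('r, 'b) module \<Rightarrow> ('a \<times> 'b \<Rightarrow>\<^sub>0 int) set monoid" where
  "tensor R N X = free_Abelian_group (carrier N \<times> carrier X) Mod tensor_relations R N X"

text \<open>The map \<open>g \<otimes> h\<close> into \<open>N \<otimes>\<^sub>R X\<close>, evaluated on a coset.\<close>

definition tensor_map ::
    "'r ring \<Rightarrow> ('r, 'c) module \<Rightarrow> ('r, 'd) module \<Rightarrow> ('a \<Rightarrow> 'c) \<Rightarrow> ('b \<Rightarrow> 'd) \<Rightarrow>
       ('a \<times> 'b \<Rightarrow>\<^sub>0 int) set \<Rightarrow> ('c \<times> 'd \<Rightarrow>\<^sub>0 int) set" where
  "tensor_map R N X g h C = (\<Union>c\<in>C.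
     tensor_relations R N X #>\<^bsub>free_Abelian_group (carrier N \<times> carrier X)\<^esub>
       frag_extend (\<lambda>(n, x). frag_of (g n, h x)) c)"

definition tensor_functor ::
    "'r ring \<Rightarrow> ('r, 'u) module \<Rightarrow> ('r, 'u, ('u \<times> 'u \<Rightarrow>\<^sub>0 int) set) mod_functor" where
  "tensor_functor R N = \<lparr>
     fob = (\<lambda>X. tensor R N X),
     fmor = (\<lambda>X Y h. tensor_map R N Y (\<lambda>n. n) h)\<rparr>"

definition AGJ ::
    "'r ring \<Rightarrow> ('r, 'u, 'x) mod_functor \<Rightarrow>
       ('r, 'u, ('r, 'u) module \<Rightarrow> 'x \<Rightarrow> ('u \<times> 'u \<Rightarrow>\<^sub>0 int) set) mod_functor" where
  "AGJ R G = \<lparr>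
     fob = (\<lambda>N. nat_trans_group R G (tensor_functor R N)),
     fmor = (\<lambda>N N' g \<eta>. \<lambda>X\<in>fp_modules R. \<lambda>x\<in>carrier (fob G X).
       tensor_map R N' X g (\<lambda>y. y) (\<eta> X x))\<rparr>"

definition dual_class :: "'r ring \<Rightarrow> ('r, 'u) module set \<Rightarrow> ('r, 'u) module set" where
  "dual_class R D = Ker (opp R) (AGJ R ` vanishing_functors R D)"

end

theory Submission
  imports Defs
begin

text \<open>
  A finitely presented functor is given by a morphism between modules with finite presentations, hence by
  matrices \<open>H\<close>, \<open>F\<close>, \<open>K\<close>: its extension vanishes on \<open>M\<close> iff every solution of \<open>H x = 0\<close> in \<open>M\<close> has the
  form \<open>x = F y\<close> with \<open>K y = 0\<close>. Its Auslander--Gruson--Jensen dual vanishes on a right module \<open>N\<close> iff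
  \<open>F\<^sup>T x = K\<^sup>T z\<close> in \<open>N\<close> implies that \<open>x = H\<^sup>T w\<close> for some \<open>w\<close>. By injectivity of \<open>\<rat>/\<int>\<close>, a module satisfies one
  of the two conditions iff its character module satisfies the other one, so a definable class and its dual
  form a symmetric duality pair; both conditions pass to products, coproducts and retracts.

  Conversely, let \<open>(A, B)\<close> be a symmetric duality pair with \<open>A\<close> closed under products, and let \<open>M\<close> satisfy all
  conditions of the above kind that hold on \<open>A\<close>. Each finite system with parameters that has no solution in
  \<open>M\<close> yields a condition failing in \<open>M\<close>, hence in some module of \<open>A\<close>. The product \<open>P\<close> of these modules has the
  property that, up to finitely many equations, \<open>M\<close> is a retract of \<open>P\<close>; by algebraic compactness of
  \<open>\<rat>/\<int>\<close> the character module of \<open>M\<close> is then a retract of that of \<open>P\<close>, so \<open>M\<close> lies in \<open>A\<close>. If instead \<open>B\<close> is closed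
  under coproducts, the same argument runs with the modules of \<open>A\<close> replaced by their double character
  modules, because the product of character modules is the character module of the coproduct.
\<close>

subsection \<open>Characters of abelian groups\<close>

\<comment> \<open>The matrix conditions and their duals are Prest's duality of positive primitive
  formulas: it reverses an implication between two formulas, which is why \<open>H\<close> moves
  from the hypothesis to the conclusion. Two things separate this from the functors.
  \<open>extension\<close> evaluates an arbitrarily chosen presentation, and the dual of a functor
  is given as a group of natural transformations, with no presentation in sight. So vanishing has to
  be shown independent of the presentation, and a morphism presenting the dual has to be produced;
  it comes from Yoneda, since a transformation into \<open>N \<otimes> -\<close> is an element of
  the kernel of \<open>N \<otimes> f\<close>.

  For the converse the obstacle is that a failing condition yields a map out of \<open>M\<close>
  that respects just finitely many linear relations. These approximate maps are indexed by finite
  sets of relations and assembled after dualising, where the values lie in Q/Z and can be chosen by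
  compactness. Modules are compared by retracts, because characters and products leave the type of
  the universe.\<close>
quotient_type qz = rat / "\<lambda>a b. a - b \<in> \<int>"
proof (rule equivpI)
  show "reflp (\<lambda>a b :: rat. a - b \<in> \<int>)" by (simp add: reflp_def)
  show "symp (\<lambda>a b :: rat. a - b \<in> \<int>)"
    by (rule sympI) (metis Ints_minus minus_diff_eq)
  show "transp (\<lambda>a b :: rat. a - b \<in> \<int>)"
    by (rule transpI) (metis Ints_add diff_add_cancel add_diff_eq)
qed

instantiation qz :: ab_group_add
begin

lift_definition zero_qz :: qz is 0 .
lift_definition plus_qz :: "qz \<Rightarrow> qz \<Rightarrow> qz" is "(+)"
proof -
  fix a b c d :: rat assume "a - b \<in> \<int>" "c - d \<in> \<int>"
  then have "(a - b) + (c - d) \<in> \<int>" by (rule Ints_add)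
  then show "(a + c) - (b + d) \<in> \<int>" by (simp add: algebra_simps)
qed
lift_definition uminus_qz :: "qz \<Rightarrow> qz" is uminus
proof -
  fix a b :: rat assume "a - b \<in> \<int>"
  then have "- (a - b) \<in> \<int>" by (rule Ints_minus)
  then show "(- a) - (- b) \<in> \<int>" by (simp add: algebra_simps)
qed
lift_definition minus_qz :: "qz \<Rightarrow> qz \<Rightarrow> qz" is "(-)"
proof -
  fix a b c d :: rat assume "a - b \<in> \<int>" "c - d \<in> \<int>"
  then have "(a - b) - (c - d) \<in> \<int>" by (rule Ints_diff)
  then show "(a - c) - (b - d) \<in> \<int>" by (simp add: algebra_simps)
qed

instance
  by standard (transfer; simp add: algebra_simps)+

end

lift_definition zmul :: "int \<Rightarrow> qz \<Rightarrow> qz" is "\<lambda>k a. of_int k * a"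
  by (metis Ints_mult Ints_of_int right_diff_distrib)

lemma zmul_add: "zmul (k + l) q = zmul k q + zmul l q"
  by transfer (simp add: algebra_simps)

lemma zmul_add_right: "zmul k (p + q) = zmul k p + zmul k q"
  by transfer (simp add: algebra_simps)

lemma zmul_zero [simp]: "zmul 0 q = 0" and zmul_one [simp]: "zmul 1 q = q"
  and zmul_uminus: "zmul (- k) q = - zmul k q"
  by (transfer; simp)+

lemma zmul_mult: "zmul (k * l) q = zmul k (zmul l q)"
  by transfer (simp add: algebra_simps)

text \<open>Divisibility is what makes Q/Z injective: it supplies the value at a new element in
  \<open>partial_char_extend\<close>.\<close>

lemma zmul_divisible:
  assumes "k \<noteq> 0"
  shows "\<exists>p. zmul k p = q"
  using assms
proof transfer
  fix k :: int and q :: rat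
  assume "k \<noteq> 0"
  then have "of_int k * (q / of_int k) - q = 0" by simp
  then show "\<exists>p. of_int k * p - q \<in> \<int>" by (metis Ints_0)
qed

text \<open>The class of \<open>1 / k\<close> works. This makes Q/Z a cogenerator:
  \<open>char_separates\<close> needs a nonzero value that is killed by the order of an
  element.\<close>

lemma zmul_order:
  assumes "k > 1"
  shows "\<exists>p. zmul k p = 0 \<and> p \<noteq> 0"
  using assms
proof transfer
  fix k :: int assume k: "k > 1"
  have "(1 / of_int k :: rat) \<notin> \<int>"
  proof
    assume "(1 / of_int k :: rat) \<in> \<int>"
    then obtain z where "1 / of_int k = (of_int z :: rat)" by (auto elim: Ints_cases)
    then have "(1::rat) = of_int z * of_int k" using k by (simp add: field_simps)
    then have "1 = z * k" by (metis of_int_1 of_int_eq_iff of_int_mult)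
    then show False using k zmult_eq_1_iff[of z k] by auto
  qed
  then show "\<exists>p::rat. of_int k * p - 0 \<in> \<int> \<and> \<not> p - 0 \<in> \<int>"
    using k by (intro exI[of _ "1 / of_int k"]) simp
qed

definition add_on :: "('a, 'x) monoid_scheme \<Rightarrow> ('a \<Rightarrow> qz) \<Rightarrow> bool" where
  "add_on G \<psi> \<longleftrightarrow> (\<forall>x\<in>carrier G. \<forall>y\<in>carrier G. \<psi> (x \<otimes>\<^bsub>G\<^esub> y) = \<psi> x + \<psi> y)"

text \<open>Partial characters are encoded by their graphs, ordered by inclusion.\<close>

definition partial_char :: "('a, 'x) monoid_scheme \<Rightarrow> ('a \<times> qz) set \<Rightarrow> bool" where
  "partial_char G \<Gamma> \<longleftrightarrow> \<Gamma> \<subseteq> carrier G \<times> UNIV \<and> (\<one>\<^bsub>G\<^esub>, 0) \<in> \<Gamma> \<and>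
     (\<forall>x p y q. (x, p) \<in> \<Gamma> \<longrightarrow> (y, q) \<in> \<Gamma> \<longrightarrow> (x \<otimes>\<^bsub>G\<^esub> inv\<^bsub>G\<^esub> y, p - q) \<in> \<Gamma>) \<and>
     (\<forall>q. (\<one>\<^bsub>G\<^esub>, q) \<in> \<Gamma> \<longrightarrow> q = 0)"

context comm_group
begin

lemma partial_char_inv:
  assumes "partial_char G \<Gamma>" "(x, p) \<in> \<Gamma>"
  shows "(inv x, - p) \<in> \<Gamma>"
proof -
  have "(\<one> \<otimes> inv x, 0 - p) \<in> \<Gamma>" "x \<in> carrier G" using assms unfolding partial_char_def by blast+
  then show ?thesis by simp
qed

lemma partial_char_mult:
  assumes "partial_char G \<Gamma>" "(x, p) \<in> \<Gamma>" "(y, q) \<in> \<Gamma>"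
  shows "(x \<otimes> y, p + q) \<in> \<Gamma>"
proof -
  have "(x \<otimes> inv (inv y), p - (- q)) \<in> \<Gamma>" "y \<in> carrier G"
    using assms partial_char_inv[OF assms(1,3)] unfolding partial_char_def by blast+
  then show ?thesis by simp
qed

lemma partial_char_unique:
  assumes "partial_char G \<Gamma>" "(x, p) \<in> \<Gamma>" "(x, q) \<in> \<Gamma>"
  shows "p = q"
proof -
  have "(x \<otimes> inv x, p - q) \<in> \<Gamma>" "x \<in> carrier G" using assms unfolding partial_char_def by blast+
  then have "(\<one>, p - q) \<in> \<Gamma>" by simp
  then have "p - q = 0" using assms(1) unfolding partial_char_def by blast
  then show ?thesis by simp
qed

lemma partial_char_pow:
  assumes "partial_char G \<Gamma>" "(x, p) \<in> \<Gamma>"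
  shows "(x [^] (k::int), zmul k p) \<in> \<Gamma>"
proof -
  have x: "x \<in> carrier G" using assms unfolding partial_char_def by blast
  have nat: "(x [^] (int n), zmul (int n) p) \<in> \<Gamma>" for n
  proof (induction n)
    case 0 then show ?case using assms unfolding partial_char_def by simp
  next
    case (Suc n)
    have "(x [^] int n \<otimes> x, zmul (int n) p + p) \<in> \<Gamma>"
      using partial_char_mult[OF assms(1) Suc assms(2)] .
    moreover have "x [^] int n \<otimes> x = x [^] int (Suc n)"
      using x int_pow_mult[OF x, of "int n" 1] by (simp add: add.commute)
    moreover have "zmul (int n) p + p = zmul (int (Suc n)) p"
      using zmul_add[of "int n" 1 p] by (simp add: add.commute)
    ultimately show ?case by simp
  qed
  show ?thesis
  proof (cases "k \<ge> 0")
    case True then show ?thesis using nat[of "nat k"] by simp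
  next
    case False
    then have "(inv (x [^] (- k)), - zmul (- k) p) \<in> \<Gamma>" using partial_char_inv[OF assms(1) nat[of "nat (- k)"]] by simp
    then show ?thesis using x by (simp add: int_pow_neg zmul_uminus)
  qed
qed

text \<open>Baer's argument over the integers: the exponents \<open>k\<close> for which
  \<open>x [^] k\<close> lies in the domain form an ideal, and a value \<open>q\<close> at
  \<open>x\<close> has to be compatible with the given value at a generator of that ideal, which
  divisibility permits.\<close>

lemma partial_char_extend:
  assumes \<Gamma>: "partial_char G \<Gamma>" and x: "x \<in> carrier G"
  shows "\<exists>\<Gamma>' q. partial_char G \<Gamma>' \<and> \<Gamma> \<subseteq> \<Gamma>' \<and> (x, q) \<in> \<Gamma>'"
proof -
  have sub: "\<Gamma> \<subseteq> carrier G \<times> UNIV" and one: "(\<one>, 0) \<in> \<Gamma>" using \<Gamma> unfolding partial_char_def by auto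
  have "\<exists>q. \<forall>k::int. \<forall>p. (x [^] k, p) \<in> \<Gamma> \<longrightarrow> p = zmul k q"
  proof (cases "\<exists>n::nat. n > 0 \<and> (\<exists>p. (x [^] int n, p) \<in> \<Gamma>)")
    case True
    define d where "d = (LEAST n::nat. n > 0 \<and> (\<exists>p. (x [^] int n, p) \<in> \<Gamma>))"
    have d: "d > 0" "\<exists>p. (x [^] int d, p) \<in> \<Gamma>" using LeastI_ex[OF True] unfolding d_def by auto
    then obtain p where p: "(x [^] int d, p) \<in> \<Gamma>" by blast
    obtain q where q: "zmul (int d) q = p" using zmul_divisible[of "int d" p] d by auto
    show ?thesis
    proof (intro exI allI impI)
      fix k :: int and p' assume k: "(x [^] k, p') \<in> \<Gamma>"
      have r: "(x [^] (k mod int d), p' - zmul (k div int d) p) \<in> \<Gamma>"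
      proof -
        have "((x [^] int d) [^] (- (k div int d)), zmul (- (k div int d)) p) \<in> \<Gamma>"
          using partial_char_pow[OF \<Gamma> p] .
        then have "(x [^] (- (int d * (k div int d))), - zmul (k div int d) p) \<in> \<Gamma>"
          using x by (simp add: int_pow_pow zmul_uminus)
        from partial_char_mult[OF \<Gamma> k this]
        have "(x [^] (k - int d * (k div int d)), p' - zmul (k div int d) p) \<in> \<Gamma>"
          using x by (simp flip: int_pow_mult)
        then show ?thesis by (simp add: minus_mult_div_eq_mod)
      qed
      \<comment> \<open>Minimality of \<open>d\<close>: a nonzero remainder would be a smaller
        positive exponent in the domain.\<close>
      have "k mod int d = 0"
      proof (rule ccontr)
        assume ne: "k mod int d \<noteq> 0"
        let ?n = "nat (k mod int d)"
        have pos: "?n > 0" "int ?n = k mod int d" "?n < d"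
          using d ne by (auto simp: pos_mod_sign order.not_eq_order_implies_strict nat_less_iff)
        then have "?n > 0 \<and> (\<exists>p. (x [^] int ?n, p) \<in> \<Gamma>)" using r by auto
        then have "d \<le> ?n" unfolding d_def by (rule Least_le)
        then show False using pos by simp
      qed
      then have kd: "k = (k div int d) * int d" and "(\<one>, p' - zmul (k div int d) p) \<in> \<Gamma>"
        using r x by (auto simp: mod_0_imp_dvd)
      then have "p' = zmul (k div int d) p" using \<Gamma> unfolding partial_char_def by force
      also have "\<dots> = zmul k q" using kd q by (metis zmul_mult)
      finally show "p' = zmul k q" .
    qed
  next
    case False
    \<comment> \<open>Here \<open>k = 0\<close> is the only exponent in the domain, because
      inversion turns negative exponents into positive ones; hence \<open>q = 0\<close> is
      compatible.\<close>
    have "p = zmul k 0" if "(x [^] k, p) \<in> \<Gamma>" for k :: int and p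
    proof (cases "k = 0")
      case True then show ?thesis using that \<Gamma> unfolding partial_char_def by simp
    next
      case k: False
      have "\<exists>n::nat. n > 0 \<and> (\<exists>p. (x [^] int n, p) \<in> \<Gamma>)"
      proof (cases "k > 0")
        case True then show ?thesis using that by (intro exI[of _ "nat k"]) auto
      next
        case False
        then show ?thesis using k partial_char_inv[OF \<Gamma> that] x
          by (intro exI[of _ "nat (- k)"]) (auto simp: int_pow_neg)
      qed
      with False show ?thesis by blast
    qed
    then show ?thesis by blast
  qed
  then obtain q where q: "\<And>k p. (x [^] (k::int), p) \<in> \<Gamma> \<Longrightarrow> p = zmul k q" by blast
  \<comment> \<open>The sum of the old graph and of the graph of \<open>k \<mapsto> zmul k q\<close>
    on the powers of \<open>x\<close>. The choice of \<open>q\<close> is what makes it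
    single-valued.\<close>
  define \<Gamma>' where "\<Gamma>' = {(x [^] (k::int) \<otimes> y, zmul k q + p) | k y p. (y, p) \<in> \<Gamma>}"
  have yc: "y \<in> carrier G" if "(y, p) \<in> \<Gamma>" for y p using that sub by auto
  have "partial_char G \<Gamma>'"
    unfolding partial_char_def
  proof (intro conjI allI impI)
    show "\<Gamma>' \<subseteq> carrier G \<times> UNIV" unfolding \<Gamma>'_def using x yc by auto
    show "(\<one>, 0) \<in> \<Gamma>'" unfolding \<Gamma>'_def using one by (intro CollectI exI[of _ 0] exI[of _ \<one>] exI[of _ 0]) auto
  next
    fix u a v b assume "(u, a) \<in> \<Gamma>'" "(v, b) \<in> \<Gamma>'"
    then obtain k y p l z r where *: "u = x [^] (k::int) \<otimes> y" "a = zmul k q + p" "(y, p) \<in> \<Gamma>"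
      "v = x [^] (l::int) \<otimes> z" "b = zmul l q + r" "(z, r) \<in> \<Gamma>" unfolding \<Gamma>'_def by blast
    have yz: "y \<in> carrier G" "z \<in> carrier G" using yc * by auto
    have "x [^] (k - l) = x [^] k \<otimes> inv (x [^] l)"
      using x by (metis int_pow_diff)
    then have "u \<otimes> inv v = x [^] (k - l) \<otimes> (y \<otimes> inv z)"
      using * yz x by (simp add: inv_mult m_ac)
    moreover have "a - b = zmul (k - l) q + (p - r)"
      using * zmul_add[of k "- l" q] by (simp add: zmul_uminus)
    moreover have "(y \<otimes> inv z, p - r) \<in> \<Gamma>" using \<Gamma> * unfolding partial_char_def by blast
    ultimately show "(u \<otimes> inv v, a - b) \<in> \<Gamma>'" unfolding \<Gamma>'_def by blast
  next
    fix a assume "(\<one>, a) \<in> \<Gamma>'"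
    then obtain k y p where *: "\<one> = x [^] (k::int) \<otimes> y" "a = zmul k q + p" "(y, p) \<in> \<Gamma>" unfolding \<Gamma>'_def by blast
    \<comment> \<open>When the representation gives the unit, the inverse of \<open>y\<close> is a
      power of \<open>x\<close>, and the choice of \<open>q\<close> forces the two values to
      cancel.\<close>
    have "inv y = x [^] k" using * yc x inv_equality by (metis int_pow_closed)
    then have "- p = zmul k q" using q partial_char_inv[OF \<Gamma> *(3)] by auto
    then show "a = 0" using * by (metis add.left_inverse)
  qed
  moreover have "\<Gamma> \<subseteq> \<Gamma>'"
  proof
    fix u assume "u \<in> \<Gamma>"
    then show "u \<in> \<Gamma>'" unfolding \<Gamma>'_def using yc[of "fst u" "snd u"]
      by (intro CollectI exI[of _ "0::int"] exI[of _ "fst u"] exI[of _ "snd u"]) auto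
  qed
  moreover have "(x, q) \<in> \<Gamma>'" unfolding \<Gamma>'_def
    using one x by (intro CollectI exI[of _ 1] exI[of _ \<one>] exI[of _ 0]) (auto simp: int_pow_1)
  ultimately show ?thesis by blast
qed

text \<open>Injectivity of Q/Z by Zorn's lemma: unions of chains of graphs are graphs again, and a
  maximal graph is total by \<open>partial_char_extend\<close>.\<close>

theorem partial_char_total:
  assumes \<Gamma>: "partial_char G \<Gamma>"
  shows "\<exists>\<psi>. add_on G \<psi> \<and> (\<forall>(x, q)\<in>\<Gamma>. \<psi> x = q)"
proof -
  let ?A = "{\<Delta>. partial_char G \<Delta> \<and> \<Gamma> \<subseteq> \<Delta>}"
  have "\<exists>M\<in>?A. \<forall>X\<in>?A. M \<subseteq> X \<longrightarrow> X = M"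
  proof (rule subset_Zorn_nonempty)
    show "?A \<noteq> {}" using \<Gamma> by blast
    fix C assume C: "C \<noteq> {}" "subset.chain ?A C"
    have mem: "\<Delta> \<in> ?A" if "\<Delta> \<in> C" for \<Delta> using C that unfolding subset.chain_def by blast
    have "partial_char G (\<Union>C)"
      unfolding partial_char_def
    proof (intro conjI allI impI)
      show "\<Union>C \<subseteq> carrier G \<times> UNIV" using mem unfolding partial_char_def by blast
      show "(\<one>, 0) \<in> \<Union>C" using mem C unfolding partial_char_def by blast
    next
      fix u a v b assume "(u, a) \<in> \<Union>C" "(v, b) \<in> \<Union>C"
      then obtain X Y where XY: "X \<in> C" "Y \<in> C" "(u, a) \<in> X" "(v, b) \<in> Y" by blast
      then have "X \<subseteq> Y \<or> Y \<subseteq> X" using C unfolding subset.chain_def by blast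
      then obtain Z where "Z \<in> C" "(u, a) \<in> Z" "(v, b) \<in> Z" using XY by blast
      then show "(u \<otimes> inv v, a - b) \<in> \<Union>C" using mem unfolding partial_char_def by blast
    next
      fix q assume "(\<one>, q) \<in> \<Union>C"
      then show "q = 0" using mem unfolding partial_char_def by blast
    qed
    then show "\<Union>C \<in> ?A" using mem C by blast
  qed
  then obtain \<Delta> where \<Delta>': "\<Delta> \<in> ?A" and max': "\<forall>X\<in>?A. \<Delta> \<subseteq> X \<longrightarrow> X = \<Delta>" by (rule bexE)
  then have \<Delta>: "partial_char G \<Delta>" "\<Gamma> \<subseteq> \<Delta>" by auto
  have max: "X = \<Delta>" if "partial_char G X" "\<Delta> \<subseteq> X" for X
    using bspec[OF max', of X] that \<Delta> by simp
  have tot: "\<exists>q. (x, q) \<in> \<Delta>" if "x \<in> carrier G" for x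
    using partial_char_extend[OF \<Delta>(1) that] max by blast
  define \<psi> where "\<psi> x = (SOME q. (x, q) \<in> \<Delta>)" for x
  have \<psi>: "(x, \<psi> x) \<in> \<Delta>" if "x \<in> carrier G" for x
    using tot[OF that] unfolding \<psi>_def by (rule someI_ex)
  have "add_on G \<psi>" unfolding add_on_def
    by (metis \<Delta>(1) \<psi> m_closed partial_char_mult partial_char_unique)
  moreover have "\<psi> x = q" if "(x, q) \<in> \<Gamma>" for x q
  proof -
    have "(x, q) \<in> \<Delta>" "x \<in> carrier G" using that \<Delta> unfolding partial_char_def by auto
    then show ?thesis using partial_char_unique[OF \<Delta>(1) \<psi>] by blast
  qed
  ultimately show ?thesis by blast
qed

end

text \<open>The cyclic group generated by \<open>x\<close> modulo \<open>S\<close> has a character that is nonzero at \<open>x\<close>.\<close>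

lemma (in comm_group) char_separates:
  assumes S: "subgroup S G" and x: "x \<in> carrier G" "x \<notin> S"
  shows "\<exists>\<psi>. add_on G \<psi> \<and> (\<forall>y\<in>S. \<psi> y = 0) \<and> \<psi> x \<noteq> 0"
proof -
  interpret S: subgroup S G by fact
  have pow_S: "y [^] (k::int) \<in> S" if "y \<in> S" for y k
    using that S by (metis subgroup_int_pow_closed)
  \<comment> \<open>\<open>q\<close> is to be the value at \<open>x\<close> of a character that
    vanishes on \<open>S\<close>, so every exponent that carries \<open>x\<close> into
    \<open>S\<close> must kill it. If \<open>x\<close> has finite order modulo \<open>S\<close>,
    this order exceeds 1 and \<open>zmul_order\<close> applies; otherwise any nonzero
    \<open>q\<close> will do.\<close>
  have "\<exists>q. q \<noteq> 0 \<and> (\<forall>k::int. x [^] k \<in> S \<longrightarrow> zmul k q = 0)"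
  proof (cases "\<exists>n::nat. n > 0 \<and> x [^] int n \<in> S")
    case True
    define d where "d = (LEAST n::nat. n > 0 \<and> x [^] int n \<in> S)"
    have d: "d > 0" "x [^] int d \<in> S" using LeastI_ex[OF True] unfolding d_def by auto
    have "d \<noteq> 1"
    proof
      assume "d = 1" then show False using d x by (simp add: int_pow_1)
    qed
    then obtain q where q: "zmul (int d) q = 0" "q \<noteq> 0" using zmul_order[of "int d"] d by auto
    have "zmul k q = 0" if k: "x [^] k \<in> S" for k :: int
    proof -
      have "x [^] k \<otimes> (x [^] int d) [^] (- (k div int d)) \<in> S" using k pow_S[OF d(2)] by blast
      then have "x [^] (k - int d * (k div int d)) \<in> S"
        using x by (simp add: int_pow_pow flip: int_pow_mult)
      then have r: "x [^] (k mod int d) \<in> S" by (simp add: minus_mult_div_eq_mod)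
      have "k mod int d = 0"
      proof (rule ccontr)
        assume ne: "k mod int d \<noteq> 0"
        let ?n = "nat (k mod int d)"
        have pos: "?n > 0" "int ?n = k mod int d" "?n < d"
          using d ne by (auto simp: pos_mod_sign order.not_eq_order_implies_strict nat_less_iff)
        then have "?n > 0 \<and> x [^] int ?n \<in> S" using r by auto
        then have "d \<le> ?n" unfolding d_def by (rule Least_le)
        then show False using pos by simp
      qed
      then have "k = (k div int d) * int d" by (auto simp: mod_0_imp_dvd)
      then have "zmul k q = zmul (k div int d) (zmul (int d) q)" by (metis zmul_mult)
      also have "\<dots> = 0" using q zmul_add_right[of "k div int d" 0 0] by simp
      finally show ?thesis .
    qed
    then show ?thesis using q by blast
  next
    case False
    obtain q where q: "q \<noteq> (0::qz)" using zmul_order[of 2] by auto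
    have "k = 0" if "x [^] k \<in> S" for k :: int
    proof (rule ccontr)
      assume k: "k \<noteq> 0"
      have "x [^] int (nat \<bar>k\<bar>) \<in> S"
        using that S.m_inv_closed[OF that] x by (cases "k > 0") (simp_all add: int_pow_neg)
      then show False using False k by (metis zero_less_nat_eq zero_less_abs_iff)
    qed
    then have "zmul k q = 0" if "x [^] k \<in> S" for k :: int using that by fastforce
    then show ?thesis using q by blast
  qed
  then obtain q where q: "q \<noteq> 0" "\<And>k::int. x [^] k \<in> S \<Longrightarrow> zmul k q = 0" by blast
  \<comment> \<open>The graph of the wanted character on the subgroup generated by \<open>S\<close>
    and \<open>x\<close>; the property of \<open>q\<close> makes it single-valued.\<close>
  have "partial_char G {(x [^] (k::int) \<otimes> y, zmul k q) | k y. y \<in> S}" (is "partial_char G ?\<Gamma>")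
    unfolding partial_char_def
  proof (intro conjI allI impI)
    show "?\<Gamma> \<subseteq> carrier G \<times> UNIV" using x by auto
    show "(\<one>, 0) \<in> ?\<Gamma>" by (intro CollectI exI[of _ 0] exI[of _ \<one>]) auto
  next
    fix u a v b assume "(u, a) \<in> ?\<Gamma>" "(v, b) \<in> ?\<Gamma>"
    then obtain k y l z where *: "u = x [^] (k::int) \<otimes> y" "a = zmul k q" "y \<in> S"
      "v = x [^] (l::int) \<otimes> z" "b = zmul l q" "z \<in> S" by blast
    have "x [^] (k - l) = x [^] k \<otimes> inv (x [^] l)"
      using x by (metis int_pow_diff)
    then have "u \<otimes> inv v = x [^] (k - l) \<otimes> (y \<otimes> inv z)"
      using * x by (simp add: inv_mult m_ac)
    moreover have "a - b = zmul (k - l) q"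
      using * zmul_add[of k "- l" q] by (simp add: zmul_uminus)
    moreover have "y \<otimes> inv z \<in> S" using * by simp
    ultimately show "(u \<otimes> inv v, a - b) \<in> ?\<Gamma>" by blast
  next
    fix a assume "(\<one>, a) \<in> ?\<Gamma>"
    then obtain k y where *: "\<one> = x [^] (k::int) \<otimes> y" "a = zmul k q" "y \<in> S" by blast
    have "inv y = x [^] k" using * x inv_equality by (metis int_pow_closed S.mem_carrier)
    then have "x [^] k \<in> S" using * by (metis S.m_inv_closed)
    then show "a = 0" using * q by simp
  qed
  from partial_char_total[OF this] obtain \<psi> where \<psi>: "add_on G \<psi>" "\<forall>(x, q)\<in>?\<Gamma>. \<psi> x = q" by blast
  have "\<psi> y = 0" if "y \<in> S" for y
  proof -
    have "(y, 0) \<in> ?\<Gamma>" using that by (intro CollectI exI[of _ 0] exI[of _ y]) auto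
    from bspec[OF \<psi>(2) this] show ?thesis by simp
  qed
  moreover have "\<psi> x = q"
  proof -
    have "(x, q) \<in> ?\<Gamma>" using x by (intro CollectI exI[of _ 1] exI[of _ \<one>]) (auto simp: int_pow_1)
    from bspec[OF \<psi>(2) this] show ?thesis by simp
  qed
  ultimately show ?thesis using \<psi> q by auto
qed

section \<open>Compactness of systems of equations over Q/Z\<close>

definition qz_group :: "qz monoid" where
  "qz_group = \<lparr>carrier = UNIV, monoid.mult = (+), one = 0\<rparr>"

lemma comm_group_qz: "comm_group qz_group"
proof (rule comm_groupI)
  fix x :: qz
  assume "x \<in> carrier qz_group"
  show "\<exists>y\<in>carrier qz_group. y \<otimes>\<^bsub>qz_group\<^esub> x = \<one>\<^bsub>qz_group\<^esub>"
    by (rule bexI[of _ "- x"]) (auto simp: qz_group_def)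
qed (auto simp: qz_group_def algebra_simps)

lemma free_char:
  fixes x :: "'i \<Rightarrow> qz"
  shows "\<exists>\<Phi>. add_on (free_Abelian_group S) \<Phi> \<and> (\<forall>i\<in>S. \<Phi> (frag_of i) = x i)"
proof -
  obtain h where "h \<in> hom (free_Abelian_group S) qz_group" "\<And>i. i \<in> S \<Longrightarrow> h (frag_of i) = x i"
    by (rule comm_group.free_Abelian_group_universal[OF comm_group_qz, of x S]) (auto simp: qz_group_def)
  then show ?thesis unfolding add_on_def by (intro exI[of _ h]) (auto simp: hom_def qz_group_def)
qed

text \<open>All consequences of a set of equations: the subgroup generated by pairs of an integral
  combination of unknowns and its required value. It is inductive so that a consequence can be
  traced back, by rule induction, to the equations it uses.\<close>

inductive_set eq_span :: "(('i \<Rightarrow>\<^sub>0 int) \<times> qz) set \<Rightarrow> (('i \<Rightarrow>\<^sub>0 int) \<times> qz) set" for E where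
  zero: "(0, 0) \<in> eq_span E"
| base: "(e, q) \<in> E \<Longrightarrow> (e, q) \<in> eq_span E"
| diff: "(e, q) \<in> eq_span E \<Longrightarrow> (e', q') \<in> eq_span E \<Longrightarrow> (e - e', q - q') \<in> eq_span E"

lemma add_on_free: "add_on (free_Abelian_group UNIV) \<Phi> \<longleftrightarrow> (\<forall>x y. \<Phi> (x + y) = \<Phi> x + \<Phi> y)"
  by (simp add: add_on_def free_Abelian_group_def)

lemma add_on_free_diff:
  assumes "add_on (free_Abelian_group UNIV) \<Phi>"
  shows "\<Phi> (a - b) = \<Phi> a - \<Phi> b"
proof -
  have "\<Phi> ((a - b) + b) = \<Phi> (a - b) + \<Phi> b" using assms unfolding add_on_free by blast
  then show ?thesis by simp
qed

text \<open>A derivation uses finitely many equations, and every additive \<open>\<Phi>\<close> that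
  satisfies those also satisfies the derived one.\<close>

lemma eq_span_finite:
  fixes E :: "(('i \<Rightarrow>\<^sub>0 int) \<times> qz) set"
  shows "(e, q) \<in> eq_span E \<Longrightarrow> \<exists>E'. finite E' \<and> E' \<subseteq> E \<and>
     (\<forall>\<Phi>. add_on (free_Abelian_group UNIV) \<Phi> \<longrightarrow> (\<forall>(e, q)\<in>E'. \<Phi> e = q) \<longrightarrow> \<Phi> e = q)"
proof (induction rule: eq_span.induct)
  case zero
  have "\<Phi> 0 = 0" if "add_on (free_Abelian_group UNIV) \<Phi>" for \<Phi> :: "('i \<Rightarrow>\<^sub>0 int) \<Rightarrow> qz"
    using add_on_free_diff[OF that, of 0 0] by simp
  then show ?case by blast
next
  case (base e q)
  then show ?case by (intro exI[of _ "{(e, q)}"]) auto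
next
  case (diff e q e' q')
  then obtain E1 E2 :: "(('i \<Rightarrow>\<^sub>0 int) \<times> qz) set" where *: "finite E1" "E1 \<subseteq> E" "finite E2" "E2 \<subseteq> E"
    "\<And>\<Phi>. add_on (free_Abelian_group UNIV) \<Phi> \<Longrightarrow> (\<forall>(e, q)\<in>E1. \<Phi> e = q) \<Longrightarrow> \<Phi> e = q"
    "\<And>\<Phi>. add_on (free_Abelian_group UNIV) \<Phi> \<Longrightarrow> (\<forall>(e, q)\<in>E2. \<Phi> e = q) \<Longrightarrow> \<Phi> e' = q'" by metis
  have "\<Phi> (e - e') = q - q'" if "add_on (free_Abelian_group UNIV) \<Phi>" "\<forall>(e, q)\<in>E1 \<union> E2. \<Phi> e = q"
    for \<Phi> :: "('i \<Rightarrow>\<^sub>0 int) \<Rightarrow> qz"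
    using add_on_free_diff[OF that(1)] *(5)[OF that(1)] *(6)[OF that(1)] that(2) by (simp add: ball_Un)
  then show ?case
    using * by (intro exI[of _ "E1 \<union> E2"]) blast
qed

text \<open>Algebraic compactness of \<open>\<rat>/\<int>\<close>: a finitely solvable system is a partial character of a free abelian
  group, and partial characters extend.\<close>

theorem qz_compact:
  fixes E1 :: "('i \<times> 'i \<times> 'i) set" and E2 :: "('i \<times> qz) set"
  assumes fin: "\<And>F1 F2. finite F1 \<Longrightarrow> F1 \<subseteq> E1 \<Longrightarrow> finite F2 \<Longrightarrow> F2 \<subseteq> E2 \<Longrightarrow>
    \<exists>x. (\<forall>(i, j, k)\<in>F1. x k = x i + x j) \<and> (\<forall>(i, q)\<in>F2. x i = q)"
  shows "\<exists>x. (\<forall>(i, j, k)\<in>E1. x k = x i + x j) \<and> (\<forall>(i, q)\<in>E2. x i = q)"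
proof -
  let ?G = "free_Abelian_group (UNIV :: 'i set)"
  interpret G: comm_group ?G by (rule abelian_free_Abelian_group)
  \<comment> \<open>An assignment of values to the unknowns is an additive function on the free
    abelian group over them. \<open>e1\<close> encodes an additivity equation as a combination with
    value 0, and \<open>e2\<close> a prescribed value.\<close>
  define e1 where "e1 = (\<lambda>(i, j, k). (frag_of k - frag_of i - frag_of j :: 'i \<Rightarrow>\<^sub>0 int, 0 :: qz))"
  define e2 where "e2 = (\<lambda>(i, q :: qz). (frag_of i :: 'i \<Rightarrow>\<^sub>0 int, q))"
  note diff = add_on_free_diff
  let ?E = "eq_span (e1 ` E1 \<union> e2 ` E2)"
  have "partial_char ?G ?E"
    unfolding partial_char_def
  proof (intro conjI allI impI)
    show "?E \<subseteq> carrier ?G \<times> UNIV" by (auto simp: free_Abelian_group_def)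
    show "(\<one>\<^bsub>?G\<^esub>, 0) \<in> ?E" by (simp add: eq_span.zero)
  next
    fix u a v b assume *: "(u, a) \<in> ?E" "(v, b) \<in> ?E"
    have "u \<otimes>\<^bsub>?G\<^esub> inv\<^bsub>?G\<^esub> v = u - v" by simp
    then show "(u \<otimes>\<^bsub>?G\<^esub> inv\<^bsub>?G\<^esub> v, a - b) \<in> ?E" using eq_span.diff[OF *] by simp
  next
    fix q assume "(\<one>\<^bsub>?G\<^esub>, q) \<in> ?E"
    then have "(0, q) \<in> ?E" by simp
    \<comment> \<open>Finite solvability enters here: a derived equation \<open>0 = q\<close> rests
      on finitely many equations, and a solution of these forces \<open>q = 0\<close>.\<close>
    from eq_span_finite[OF this] obtain E' where E': "finite E'" "E' \<subseteq> e1 ` E1 \<union> e2 ` E2"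
      "\<And>\<Phi>. add_on ?G \<Phi> \<Longrightarrow> (\<forall>(e, q)\<in>E'. \<Phi> e = q) \<Longrightarrow> \<Phi> 0 = q" by blast
    have "\<exists>F1 F2. finite F1 \<and> F1 \<subseteq> E1 \<and> finite F2 \<and> F2 \<subseteq> E2 \<and> E' = e1 ` F1 \<union> e2 ` F2"
    proof -
      obtain F1 where F1: "finite F1" "F1 \<subseteq> E1" "E' \<inter> e1 ` E1 = e1 ` F1"
        using finite_subset_image[of "E' \<inter> e1 ` E1" e1 E1] E' by auto
      obtain F2 where F2: "finite F2" "F2 \<subseteq> E2" "E' \<inter> e2 ` E2 = e2 ` F2"
        using finite_subset_image[of "E' \<inter> e2 ` E2" e2 E2] E' by auto
      have "E' = (E' \<inter> e1 ` E1) \<union> (E' \<inter> e2 ` E2)" using E'(2) by blast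
      then have "E' = e1 ` F1 \<union> e2 ` F2" unfolding F1(3) F2(3) .
      then show ?thesis using F1(1,2) F2(1,2) by (intro exI[of _ F1] exI[of _ F2] conjI)
    qed
    then obtain F1 F2 where F: "finite F1" "F1 \<subseteq> E1" "finite F2" "F2 \<subseteq> E2" "E' = e1 ` F1 \<union> e2 ` F2" by blast
    from fin[OF F(1-4)] obtain x where x: "\<forall>(i, j, k)\<in>F1. x k = x i + x j" "\<forall>(i, q)\<in>F2. x i = q" by blast
    obtain \<Phi> where \<Phi>: "add_on ?G \<Phi>" "\<forall>i. \<Phi> (frag_of i) = x i" using free_char[of UNIV x] by blast
    have "\<forall>(e, q)\<in>E'. \<Phi> e = q" using F x \<Phi> by (auto simp: e1_def e2_def diff)
    with E'(3) \<Phi> have "\<Phi> 0 = q" by blast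
    then show "q = 0" using diff[OF \<Phi>(1), of 0 0] by simp
  qed
  from G.partial_char_total[OF this] obtain \<psi> where \<psi>: "add_on ?G \<psi>" "\<forall>(x, q)\<in>?E. \<psi> x = q" by blast
  show ?thesis
  proof (intro exI[of _ "\<lambda>i. \<psi> (frag_of i)"] conjI ballI; clarify)
    fix i j k assume "(i, j, k) \<in> E1"
    then have "e1 (i, j, k) \<in> ?E" using eq_span.base[of "fst (e1 (i,j,k))" "snd (e1 (i,j,k))"] by auto
    then have "\<psi> (frag_of k - frag_of i - frag_of j) = 0" using \<psi>(2) by (auto simp: e1_def)
    then show "\<psi> (frag_of k) = \<psi> (frag_of i) + \<psi> (frag_of j)"
      unfolding diff[OF \<psi>(1)] by (simp add: algebra_simps)
  next
    fix i q assume "(i, q) \<in> E2"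
    then have "e2 (i, q) \<in> ?E" using eq_span.base[of "fst (e2 (i,q))" "snd (e2 (i,q))"] by auto
    then show "\<psi> (frag_of i) = q" using \<psi>(2) by (auto simp: e2_def)
  qed
qed

subsection \<open>Cardinalities\<close>

text \<open>\<open>small\<close> speaks about subsets of the universe type; this version also
  measures sets in other types, such as products, characters and sets of systems of
  equations.\<close>

definition tiny :: "'u itself \<Rightarrow> 'a set \<Rightarrow> bool" where
  "tiny U A \<longleftrightarrow> |A| <o |UNIV :: 'u set|"

lemma small_iff_tiny: "small (A :: 'u set) \<longleftrightarrow> tiny TYPE('u) A"
  by (simp add: small_def tiny_def)

lemma tiny_inj_on:
  assumes "tiny TYPE('u) B" "inj_on f A" "f ` A \<subseteq> B"
  shows "tiny TYPE('u) A"
  using assms unfolding tiny_def by (meson card_of_ordLeq ordLeq_ordLess_trans)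

lemma tiny_subset: "tiny TYPE('u) B \<Longrightarrow> A \<subseteq> B \<Longrightarrow> tiny TYPE('u) A"
  by (rule tiny_inj_on[where f = id]) auto

lemma tiny_image: "tiny TYPE('u) A \<Longrightarrow> tiny TYPE('u) (f ` A)"
  unfolding tiny_def by (meson card_of_image ordLeq_ordLess_trans)

lemma tiny_embed:
  assumes "tiny TYPE('u) A"
  obtains f :: "'a \<Rightarrow> 'u" where "inj_on f A" "small (f ` A)"
proof -
  have "|A| \<le>o |UNIV :: 'u set|" using assms unfolding tiny_def by (rule ordLess_imp_ordLeq)
  then obtain f :: "'a \<Rightarrow> 'u" where "inj_on f A" by (metis card_of_ordLeq)
  then show thesis using that tiny_image[OF assms] small_iff_tiny by blast
qed

lemma inaccessible_infinite:
  assumes "inaccessible TYPE('u)"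
  shows "Cinfinite |UNIV :: 'u set|"
proof -
  have "|UNIV :: nat set| \<le>o |UNIV :: 'u set|"
    using assms unfolding inaccessible_def by (meson ordLess_imp_ordLeq)
  then have "infinite (UNIV :: 'u set)" by (metis infinite_iff_card_of_nat)
  then show ?thesis by (simp add: cinfinite_def card_of_Card_order Field_card_of)
qed

lemma tiny_finite:
  assumes "inaccessible TYPE('u)" "finite A"
  shows "tiny TYPE('u) A"
  using inaccessible_infinite[OF assms(1)] assms(2) unfolding tiny_def cinfinite_def
  by (metis finite_iff_ordLess_natLeq Field_card_of card_of_ordLess infinite_iff_natLeq_ordLeq ordLess_ordLeq_trans)

lemma tiny_nat: "inaccessible TYPE('u) \<Longrightarrow> tiny TYPE('u) (A :: nat set)"
  using tiny_subset[of UNIV A] unfolding inaccessible_def tiny_def by blast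

lemma tiny_Times:
  assumes "inaccessible TYPE('u)" "tiny TYPE('u) A" "tiny TYPE('u) B"
  shows "tiny TYPE('u) (A \<times> B)"
  using assms inaccessible_infinite[OF assms(1)] unfolding tiny_def cinfinite_def
  by (intro card_of_Times_ordLess_infinite_Field) auto

text \<open>Inaccessibility bounds the power sets of subsets of the universe type, so the set is
  first moved there along an embedding.\<close>

lemma tiny_Pow:
  assumes "inaccessible TYPE('u)" "tiny TYPE('u) A"
  shows "tiny TYPE('u) (Pow A)"
proof -
  obtain f :: "'a \<Rightarrow> 'u" where f: "inj_on f A" "small (f ` A)" using tiny_embed[OF assms(2)] .
  have "tiny TYPE('u) (Pow (f ` A))" using assms(1) f(2) unfolding inaccessible_def tiny_def by blast
  then show ?thesis by (rule tiny_inj_on[where f = "image f"]) (use f in \<open>auto simp: inj_on_image_Pow\<close>)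
qed

lemma tiny_UN:
  assumes "inaccessible TYPE('u)" "tiny TYPE('u) I" "\<And>i. i \<in> I \<Longrightarrow> tiny TYPE('u) (A i)"
  shows "tiny TYPE('u) (\<Union>i\<in>I. A i)"
  using assms unfolding tiny_def inaccessible_def
  by (intro card_of_UNION_ordLess_infinite_Field_regularCard inaccessible_infinite) (auto simp: inaccessible_def)

text \<open>Functions are coded by their graphs, which reduces the bound to power sets, binary
  products and, by regularity, unions.\<close>

lemma tiny_PiE:
  assumes "inaccessible TYPE('u)" "tiny TYPE('u) I" "\<And>i. i \<in> I \<Longrightarrow> tiny TYPE('u) (A i)"
  shows "tiny TYPE('u) (\<Pi>\<^sub>E i\<in>I. A i)"
proof (rule tiny_inj_on)
  show "tiny TYPE('u) (Pow (I \<times> (\<Union>i\<in>I. A i)))"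
    using assms by (intro tiny_Pow tiny_Times tiny_UN)
  show "inj_on (\<lambda>f. {(i, f i) | i. i \<in> I}) (\<Pi>\<^sub>E i\<in>I. A i)"
  proof (rule inj_onI)
    fix f g assume fg: "f \<in> (\<Pi>\<^sub>E i\<in>I. A i)" "g \<in> (\<Pi>\<^sub>E i\<in>I. A i)"
      and eq: "{(i, f i) | i. i \<in> I} = {(i, g i) | i. i \<in> I}"
    show "f = g" by (rule PiE_ext[OF fg]) (use eq in blast)
  qed
  show "(\<lambda>f. {(i, f i) | i. i \<in> I}) ` (\<Pi>\<^sub>E i\<in>I. A i) \<subseteq> Pow (I \<times> (\<Union>i\<in>I. A i))"
    by (auto simp: PiE_def Pi_def)
qed

subsection \<open>Modules and homomorphisms\<close>

lemma mk_module_simps [simp]: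
  "carrier (mk_module C z p s) = C" "\<zero>\<^bsub>mk_module C z p s\<^esub> = z"
  "x \<oplus>\<^bsub>mk_module C z p s\<^esub> y = p x y" "r \<odot>\<^bsub>mk_module C z p s\<^esub> x = s r x"
  by (simp_all add: mk_module_def)

lemma opp_simps [simp]:
  "carrier (opp R) = carrier R" "\<zero>\<^bsub>opp R\<^esub> = \<zero>\<^bsub>R\<^esub>" "\<one>\<^bsub>opp R\<^esub> = \<one>\<^bsub>R\<^esub>"
  "x \<oplus>\<^bsub>opp R\<^esub> y = x \<oplus>\<^bsub>R\<^esub> y" "x \<otimes>\<^bsub>opp R\<^esub> y = y \<otimes>\<^bsub>R\<^esub> x" "opp (opp R) = R"
  by (simp_all add: opp_def)

lemma add_monoid_opp: "add_monoid (opp R) = add_monoid R"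
  by (simp add: opp_def)

lemma ring_opp: "ring R \<Longrightarrow> ring (opp R)"
proof -
  assume "ring R"
  interpret ring R by fact
  have "abelian_group (opp R)"
    using abelian_group_axioms unfolding abelian_group_def abelian_group_axioms_def abelian_monoid_def add_monoid_opp .
  moreover have "monoid (opp R)"
    by unfold_locales (auto simp: m_assoc)
  ultimately show ?thesis
    unfolding ring_def ring_axioms_def by (auto simp: l_distr r_distr)
qed

lemma ring_opp_iff [simp]: "ring (opp R) \<longleftrightarrow> ring R"
  using ring_opp[of R] ring_opp[of "opp R"] by auto

lemma a_inv_opp [simp]: "\<ominus>\<^bsub>opp R\<^esub> x = \<ominus>\<^bsub>R\<^esub> x"
  by (simp only: a_inv_def add_monoid_opp)

lemma left_module_mk:
  assumes "ring R" "z \<in> C" "\<And>x y. x \<in> C \<Longrightarrow> y \<in> C \<Longrightarrow> p x y \<in> C"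
    "\<And>x y w. x \<in> C \<Longrightarrow> y \<in> C \<Longrightarrow> w \<in> C \<Longrightarrow> p (p x y) w = p x (p y w)"
    "\<And>x y. x \<in> C \<Longrightarrow> y \<in> C \<Longrightarrow> p x y = p y x"
    "\<And>x. x \<in> C \<Longrightarrow> p z x = x"
    "\<And>x. x \<in> C \<Longrightarrow> \<exists>y\<in>C. p y x = z"
    "\<And>r x. r \<in> carrier R \<Longrightarrow> x \<in> C \<Longrightarrow> s r x \<in> C"
    "\<And>r r' x. r \<in> carrier R \<Longrightarrow> r' \<in> carrier R \<Longrightarrow> x \<in> C \<Longrightarrow> s (r \<oplus>\<^bsub>R\<^esub> r') x = p (s r x) (s r' x)"
    "\<And>r x y. r \<in> carrier R \<Longrightarrow> x \<in> C \<Longrightarrow> y \<in> C \<Longrightarrow> s r (p x y) = p (s r x) (s r y)"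
    "\<And>r r' x. r \<in> carrier R \<Longrightarrow> r' \<in> carrier R \<Longrightarrow> x \<in> C \<Longrightarrow> s (r \<otimes>\<^bsub>R\<^esub> r') x = s r (s r' x)"
    "\<And>x. x \<in> C \<Longrightarrow> s \<one>\<^bsub>R\<^esub> x = x"
  shows "left_module R (mk_module C z p s)"
proof -
  have "abelian_group (mk_module C z p s)"
    by (rule abelian_groupI) (use assms in auto)
  then show ?thesis
    using assms unfolding left_module_def left_module_axioms_def by auto
qed

lemma (in abelian_group) idem_zero: "x \<in> carrier G \<Longrightarrow> x \<oplus> x = x \<Longrightarrow> x = \<zero>"
  using r_neg1[of x x] l_neg[of x] by simp

lemma (in abelian_group) uminus_zero [simp]: "\<ominus> \<zero> = \<zero>"
  by (rule minus_equality) simp_all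

context left_module
begin

declare smult_closed [simp, intro]

lemma ring_R: "ring R" and abelian_group_M: "abelian_group M"
  by (rule R.ring_axioms, rule M.abelian_group_axioms)

lemma smult_zero [simp]: "r \<in> carrier R \<Longrightarrow> r \<odot>\<^bsub>M\<^esub> \<zero>\<^bsub>M\<^esub> = \<zero>\<^bsub>M\<^esub>"
  by (rule M.idem_zero) (simp_all flip: smult_r_distr)

lemma zero_smult [simp]: "x \<in> carrier M \<Longrightarrow> \<zero>\<^bsub>R\<^esub> \<odot>\<^bsub>M\<^esub> x = \<zero>\<^bsub>M\<^esub>"
  by (rule M.idem_zero) (simp_all flip: smult_l_distr)

lemma uminus_smult: "r \<in> carrier R \<Longrightarrow> x \<in> carrier M \<Longrightarrow> (\<ominus>\<^bsub>R\<^esub> r) \<odot>\<^bsub>M\<^esub> x = \<ominus>\<^bsub>M\<^esub> (r \<odot>\<^bsub>M\<^esub> x)"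
  by (rule M.minus_equality[symmetric]) (simp_all add: R.l_neg flip: smult_l_distr)

lemma smult_uminus: "r \<in> carrier R \<Longrightarrow> x \<in> carrier M \<Longrightarrow> r \<odot>\<^bsub>M\<^esub> (\<ominus>\<^bsub>M\<^esub> x) = \<ominus>\<^bsub>M\<^esub> (r \<odot>\<^bsub>M\<^esub> x)"
  by (rule M.minus_equality[symmetric]) (simp_all add: M.l_neg flip: smult_r_distr)

end

lemma mhomI:
  assumes "h \<in> extensional (carrier M)" "\<And>x. x \<in> carrier M \<Longrightarrow> h x \<in> carrier N"
    "\<And>x y. x \<in> carrier M \<Longrightarrow> y \<in> carrier M \<Longrightarrow> h (x \<oplus>\<^bsub>M\<^esub> y) = h x \<oplus>\<^bsub>N\<^esub> h y"
    "\<And>r x. r \<in> carrier R \<Longrightarrow> x \<in> carrier M \<Longrightarrow> h (r \<odot>\<^bsub>M\<^esub> x) = r \<odot>\<^bsub>N\<^esub> h x"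
  shows "h \<in> mhom R M N"
  using assms unfolding mhom_def by (auto simp: PiE_def)

lemma mhom_ext: "h \<in> mhom R M N \<Longrightarrow> h \<in> extensional (carrier M)"
  and mhom_closed: "h \<in> mhom R M N \<Longrightarrow> x \<in> carrier M \<Longrightarrow> h x \<in> carrier N"
  and mhom_add: "h \<in> mhom R M N \<Longrightarrow> x \<in> carrier M \<Longrightarrow> y \<in> carrier M \<Longrightarrow> h (x \<oplus>\<^bsub>M\<^esub> y) = h x \<oplus>\<^bsub>N\<^esub> h y"
  and mhom_smult: "h \<in> mhom R M N \<Longrightarrow> r \<in> carrier R \<Longrightarrow> x \<in> carrier M \<Longrightarrow> h (r \<odot>\<^bsub>M\<^esub> x) = r \<odot>\<^bsub>N\<^esub> h x"
  unfolding mhom_def by (auto simp: PiE_def)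

lemma mhom_eqI:
  assumes "h \<in> mhom R M N" "k \<in> mhom R M N'" "\<And>x. x \<in> carrier M \<Longrightarrow> h x = k x"
  shows "h = k"
  using assms by (intro extensionalityI[OF mhom_ext mhom_ext]) auto

lemma mhom_zero:
  assumes "abelian_group M" "abelian_group N" "h \<in> mhom R M N"
  shows "h \<zero>\<^bsub>M\<^esub> = \<zero>\<^bsub>N\<^esub>"
proof -
  interpret M: abelian_group M by fact
  interpret N: abelian_group N by fact
  show ?thesis
    using mhom_add[OF assms(3), of "\<zero>\<^bsub>M\<^esub>" "\<zero>\<^bsub>M\<^esub>"] mhom_closed[OF assms(3), of "\<zero>\<^bsub>M\<^esub>"]
    by (intro N.idem_zero) simp_all
qed

lemma mhom_uminus:
  assumes "abelian_group M" "abelian_group N" "h \<in> mhom R M N" "x \<in> carrier M"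
  shows "h (\<ominus>\<^bsub>M\<^esub> x) = \<ominus>\<^bsub>N\<^esub> h x"
proof -
  interpret M: abelian_group M by fact
  interpret N: abelian_group N by fact
  have "h (\<ominus>\<^bsub>M\<^esub> x) \<oplus>\<^bsub>N\<^esub> h x = \<zero>\<^bsub>N\<^esub>"
    using assms mhom_zero[OF assms(1-3)] by (simp add: M.l_neg flip: mhom_add[OF assms(3)])
  then show ?thesis using assms mhom_closed[OF assms(3)] by (metis M.a_inv_closed N.minus_equality)
qed

lemma mhom_compose:
  assumes "left_module R L" "h \<in> mhom R L M" "k \<in> mhom R M N"
  shows "compose (carrier L) k h \<in> mhom R L N"
proof -
  interpret left_module R L by fact
  show ?thesis
    by (rule mhomI) (use assms in \<open>auto simp: compose_def mhom_add mhom_smult mhom_closed\<close>)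
qed

lemma mhom_id: "left_module R M \<Longrightarrow> (\<lambda>x\<in>carrier M. x) \<in> mhom R M M"
proof -
  assume "left_module R M"
  then interpret left_module R M .
  show ?thesis by (rule mhomI) auto
qed

lemma mod_iso_trans: "left_module R L \<Longrightarrow> mod_iso R L M \<Longrightarrow> mod_iso R M N \<Longrightarrow> mod_iso R L N"
proof -
  assume L: "left_module R L" and "mod_iso R L M" "mod_iso R M N"
  then obtain h k where hk: "h \<in> mhom R L M" "bij_betw h (carrier L) (carrier M)"
    "k \<in> mhom R M N" "bij_betw k (carrier M) (carrier N)" unfolding mod_iso_def by blast
  have "bij_betw (compose (carrier L) k h) (carrier L) (carrier N)"
    using bij_betw_trans[OF hk(2,4)] by (rule bij_betw_cong[THEN iffD1, rotated]) (auto simp: compose_def)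
  then show ?thesis unfolding mod_iso_def using mhom_compose[OF L hk(1,3)] by blast
qed

lemma mod_iso_sym:
  assumes "left_module R M" "mod_iso R M N"
  shows "mod_iso R N M"
proof -
  interpret left_module R M by fact
  obtain h where h: "h \<in> mhom R M N" "bij_betw h (carrier M) (carrier N)"
    using assms unfolding mod_iso_def by blast
  define g where "g = (\<lambda>y\<in>carrier N. the_inv_into (carrier M) h y)"
  have gh: "g (h x) = x" if "x \<in> carrier M" for x
    using h that by (auto simp: g_def mhom_closed the_inv_into_f_f bij_betw_def)
  have ex: "\<exists>x\<in>carrier M. y = h x" if "y \<in> carrier N" for y using h that by (auto simp: bij_betw_def)
  have "g \<in> mhom R N M"
  proof (rule mhomI)
    show "g \<in> extensional (carrier N)" by (simp add: g_def)
    show "g y \<in> carrier M" if "y \<in> carrier N" for y using ex[OF that] gh by auto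
    show "g (y \<oplus>\<^bsub>N\<^esub> z) = g y \<oplus>\<^bsub>M\<^esub> g z" if "y \<in> carrier N" "z \<in> carrier N" for y z
      using ex[OF that(1)] ex[OF that(2)] gh by (auto simp flip: mhom_add[OF h(1)])
    show "g (r \<odot>\<^bsub>N\<^esub> y) = r \<odot>\<^bsub>M\<^esub> g y" if "r \<in> carrier R" "y \<in> carrier N" for r y
      using ex[OF that(2)] gh that by (auto simp flip: mhom_smult[OF h(1)])
  qed
  moreover have "bij_betw g (carrier N) (carrier M)"
    using h by (auto simp: g_def intro!: bij_betw_the_inv_into cong: bij_betw_cong)
  ultimately show ?thesis unfolding mod_iso_def by blast
qed

text \<open>The common substitute for isomorphic copies and direct summands: retracts compose,
  relate modules on different types, and are preserved by \<open>cm\<close>.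
  \<open>closed_summands_retract\<close> leads back to the summands that occur in duality
  pairs.\<close>

definition retract :: "'r ring \<Rightarrow> ('r, 'a) module \<Rightarrow> ('r, 'b) module \<Rightarrow> bool" where
  "retract R X Y \<longleftrightarrow> (\<exists>s\<in>mhom R X Y. \<exists>p\<in>mhom R Y X. \<forall>x\<in>carrier X. p (s x) = x)"

lemma retract_trans:
  assumes "left_module R X" "left_module R Z" "retract R X Y" "retract R Y Z"
  shows "retract R X Z"
proof -
  obtain s p where 1: "s \<in> mhom R X Y" "p \<in> mhom R Y X" "\<forall>x\<in>carrier X. p (s x) = x"
    using assms(3) unfolding retract_def by blast
  obtain s' p' where 2: "s' \<in> mhom R Y Z" "p' \<in> mhom R Z Y" "\<forall>x\<in>carrier Y. p' (s' x) = x"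
    using assms(4) unfolding retract_def by blast
  show ?thesis unfolding retract_def
  proof (intro bexI ballI)
    show "compose (carrier X) s' s \<in> mhom R X Z" "compose (carrier Z) p p' \<in> mhom R Z X"
      using 1 2 assms mhom_compose by blast+
    show "compose (carrier Z) p p' (compose (carrier X) s' s x) = x" if "x \<in> carrier X" for x
      using that 1 2 by (simp add: compose_def mhom_closed[OF 1(1)] mhom_closed[OF 2(1)])
  qed
qed

lemma mod_iso_retract:
  assumes "left_module R X" "mod_iso R X Y"
  shows "retract R X Y" "retract R Y X"
proof -
  obtain h where h: "h \<in> mhom R X Y" "bij_betw h (carrier X) (carrier Y)"
    using assms(2) unfolding mod_iso_def by blast
  interpret left_module R X by fact
  define g where "g = (\<lambda>y\<in>carrier Y. the_inv_into (carrier X) h y)"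
  have gh: "g (h x) = x" if "x \<in> carrier X" for x
    using h that by (auto simp: g_def mhom_closed the_inv_into_f_f bij_betw_def)
  have ex: "\<exists>x\<in>carrier X. y = h x" if "y \<in> carrier Y" for y using h that by (auto simp: bij_betw_def)
  have g: "g \<in> mhom R Y X"
  proof (rule mhomI)
    show "g \<in> extensional (carrier Y)" by (simp add: g_def)
    show "g y \<in> carrier X" if "y \<in> carrier Y" for y using ex[OF that] gh by auto
    show "g (y \<oplus>\<^bsub>Y\<^esub> z) = g y \<oplus>\<^bsub>X\<^esub> g z" if "y \<in> carrier Y" "z \<in> carrier Y" for y z
      using ex[OF that(1)] ex[OF that(2)] gh by (auto simp flip: mhom_add[OF h(1)])
    show "g (r \<odot>\<^bsub>Y\<^esub> y) = r \<odot>\<^bsub>X\<^esub> g y" if "r \<in> carrier R" "y \<in> carrier Y" for r y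
      using ex[OF that(2)] gh that by (auto simp flip: mhom_smult[OF h(1)])
  qed
  have "h (g y) = y" if "y \<in> carrier Y" for y using ex[OF that] gh by auto
  then show "retract R X Y" "retract R Y X" unfolding retract_def using h(1) g gh by blast+
qed

lemma left_module_transport:
  fixes f :: "'a \<Rightarrow> 'b"
  assumes "left_module R X" and f: "inj_on f (carrier X)"
  shows "\<exists>Y :: ('r, 'b) module. left_module R Y \<and> carrier Y = f ` carrier X \<and> mod_iso R X Y"
proof -
  interpret left_module R X by fact
  define g where "g = the_inv_into (carrier X) f"
  have gf [simp]: "g (f x) = x" if "x \<in> carrier X" for x
    using f that by (simp add: g_def the_inv_into_f_f)
  let ?Y = "mk_module (f ` carrier X) (f \<zero>\<^bsub>X\<^esub>) (\<lambda>a b. f (g a \<oplus>\<^bsub>X\<^esub> g b)) (\<lambda>r a. f (r \<odot>\<^bsub>X\<^esub> g a))"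
  have "left_module R ?Y"
  proof (rule left_module_mk)
    show "ring R" by (rule ring_R)
    show "\<exists>y\<in>f ` carrier X. f (g y \<oplus>\<^bsub>X\<^esub> g x) = f \<zero>\<^bsub>X\<^esub>" if "x \<in> f ` carrier X" for x
      using that by (auto simp: M.l_neg intro!: bexI[of _ "\<ominus>\<^bsub>X\<^esub> g x"])
  qed (auto simp: M.a_ac smult_l_distr smult_r_distr smult_assoc smult_one)
  moreover have "mod_iso R X ?Y"
    unfolding mod_iso_def
  proof (rule bexI)
    show "(\<lambda>x\<in>carrier X. f x) \<in> mhom R X ?Y" by (rule mhomI) auto
    show "bij_betw (\<lambda>x\<in>carrier X. f x) (carrier X) (carrier ?Y)"
      using f by (auto simp: bij_betw_def inj_on_def)
  qed
  ultimately show ?thesis by (intro exI[of _ ?Y]) simp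
qed

text \<open>The way back into the universe for modules that are built on other types: quotients,
  products and character modules.\<close>

lemma tiny_copy:
  assumes "left_module R X" "tiny TYPE('u) (carrier X)"
  shows "\<exists>Y :: ('r, 'u) module. Y \<in> Modules R \<and> mod_iso R X Y"
proof -
  obtain f :: "'a \<Rightarrow> 'u" where f: "inj_on f (carrier X)" "small (f ` carrier X)" using tiny_embed[OF assms(2)] .
  then show ?thesis using left_module_transport[OF assms(1) f(1)] unfolding Modules_def by auto
qed

subsection \<open>Finite sums and matrices\<close>

text \<open>A plain recursion, so that congruence, passage to \<open>opp R\<close>, to a coordinate
  of a product and to the value of a character hold without closure assumptions on the
  summands.\<close>

primrec msum :: "('a, 'b) ring_scheme \<Rightarrow> (nat \<Rightarrow> 'a) \<Rightarrow> nat \<Rightarrow> 'a" where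
  "msum M f 0 = \<zero>\<^bsub>M\<^esub>"
| "msum M f (Suc n) = msum M f n \<oplus>\<^bsub>M\<^esub> f n"

lemma msum_cong: "(\<And>i. i < n \<Longrightarrow> f i = g i) \<Longrightarrow> msum M f n = msum M g n"
  by (induction n) auto

lemma msum_opp [simp]: "msum (opp R) f n = msum R f n"
  by (induction n) auto

context abelian_group
begin

lemma msum_closed [simp, intro]: "(\<And>i. i < n \<Longrightarrow> f i \<in> carrier G) \<Longrightarrow> msum G f n \<in> carrier G"
  by (induction n) auto

lemma msum_zero [simp]: "msum G (\<lambda>i. \<zero>) n = \<zero>"
  by (induction n) auto

lemma msum_zero': "(\<And>i. i < n \<Longrightarrow> f i = \<zero>) \<Longrightarrow> msum G f n = \<zero>"
  by (induction n) auto

lemma msum_add: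
  "(\<And>i. i < n \<Longrightarrow> f i \<in> carrier G) \<Longrightarrow> (\<And>i. i < n \<Longrightarrow> g i \<in> carrier G) \<Longrightarrow>
    msum G (\<lambda>i. f i \<oplus> g i) n = msum G f n \<oplus> msum G g n"
proof (induction n)
  case (Suc n)
  have c: "msum G f n \<in> carrier G" "msum G g n \<in> carrier G" "f n \<in> carrier G" "g n \<in> carrier G"
    using Suc.prems by auto
  show ?case using Suc c by (simp add: a_ac)
qed auto

lemma msum_uminus:
  "(\<And>i. i < n \<Longrightarrow> f i \<in> carrier G) \<Longrightarrow> msum G (\<lambda>i. \<ominus> f i) n = \<ominus> msum G f n"
  by (induction n) (auto simp: minus_add)

lemma msum_swap:
  "(\<And>i j. i < n \<Longrightarrow> j < m \<Longrightarrow> f i j \<in> carrier G) \<Longrightarrow>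
    msum G (\<lambda>i. msum G (\<lambda>j. f i j) m) n = msum G (\<lambda>j. msum G (\<lambda>i. f i j) n) m"
proof (induction n)
  case 0 then show ?case by simp
next
  case (Suc n)
  then show ?case by (simp add: msum_add less_Suc_eq)
qed

lemma msum_delta:
  "i < n \<Longrightarrow> a \<in> carrier G \<Longrightarrow> msum G (\<lambda>j. if j = i then a else \<zero>) n = a"
proof (induction n)
  case (Suc n)
  show ?case
  proof (cases "i = n")
    case True
    have "msum G (\<lambda>j. if j = n then a else \<zero>) n = \<zero>" by (rule msum_zero') auto
    then show ?thesis using True Suc by simp
  next
    case False then show ?thesis using Suc by auto
  qed
qed auto

lemma msum_append:
  "(\<And>i. i < n + k \<Longrightarrow> f i \<in> carrier G) \<Longrightarrow>
    msum G f (n + k) = msum G f n \<oplus> msum G (\<lambda>i. f (n + i)) k"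
  by (induction k) (auto simp: a_assoc)

end

lemma mhom_msum:
  assumes "abelian_group M" "abelian_group N" "h \<in> mhom R M N"
  shows "(\<And>i. i < n \<Longrightarrow> f i \<in> carrier M) \<Longrightarrow> h (msum M f n) = msum N (\<lambda>i. h (f i)) n"
proof (induction n)
  case 0 then show ?case using mhom_zero[OF assms] by simp
next
  case (Suc n)
  then show ?case using assms(3) abelian_group.msum_closed[OF assms(1), of n f] by (simp add: mhom_add)
qed

context left_module
begin

lemma smult_msum:
  "r \<in> carrier R \<Longrightarrow> (\<And>i. i < n \<Longrightarrow> f i \<in> carrier M) \<Longrightarrow>
    r \<odot>\<^bsub>M\<^esub> msum M f n = msum M (\<lambda>i. r \<odot>\<^bsub>M\<^esub> f i) n"
  by (induction n) (auto simp: smult_r_distr M.msum_closed)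

lemma msum_smult:
  "x \<in> carrier M \<Longrightarrow> (\<And>i. i < n \<Longrightarrow> f i \<in> carrier R) \<Longrightarrow>
    msum R f n \<odot>\<^bsub>M\<^esub> x = msum M (\<lambda>i. f i \<odot>\<^bsub>M\<^esub> x) n"
  by (induction n) (auto simp: smult_l_distr R.msum_closed)

end

text \<open>Row \<open>i\<close> of a matrix applied to a vector; \<open>n\<close> is the number of
  columns. Matrices and vectors are total functions, and their sizes are recorded by
  \<open>mat\<close> and \<open>vec\<close>, so entries outside the range are ignored.\<close>

definition act :: "('r, 'a) module \<Rightarrow> nat \<Rightarrow> (nat \<Rightarrow> nat \<Rightarrow> 'r) \<Rightarrow> (nat \<Rightarrow> 'a) \<Rightarrow> nat \<Rightarrow> 'a" where
  "act M n c x i = msum M (\<lambda>j. c i j \<odot>\<^bsub>M\<^esub> x j) n"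

definition vec :: "('r, 'a) module \<Rightarrow> nat \<Rightarrow> (nat \<Rightarrow> 'a) \<Rightarrow> bool" where
  "vec M n x \<longleftrightarrow> (\<forall>i<n. x i \<in> carrier M)"

definition mat :: "'r ring \<Rightarrow> nat \<Rightarrow> nat \<Rightarrow> (nat \<Rightarrow> nat \<Rightarrow> 'r) \<Rightarrow> bool" where
  "mat R m n c \<longleftrightarrow> (\<forall>i<m. \<forall>j<n. c i j \<in> carrier R)"

text \<open>The transpose of a matrix over \<open>R\<close> is read as a matrix over
  \<open>opp R\<close>: it is how a system on left modules acts on right modules.\<close>

definition tr :: "(nat \<Rightarrow> nat \<Rightarrow> 'r) \<Rightarrow> nat \<Rightarrow> nat \<Rightarrow> 'r" where
  "tr c i j = c j i"

lemma tr_tr [simp]: "tr (tr c) = c"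
  by (simp add: tr_def fun_eq_iff)

lemma mat_tr: "mat R m n c \<Longrightarrow> mat R n m (tr c)"
  by (simp add: mat_def tr_def)

lemma mat_opp [simp]: "mat (opp R) m n c = mat R m n c"
  by (simp add: mat_def)

lemma act_cong: "(\<And>j. j < n \<Longrightarrow> x j = y j) \<Longrightarrow> act M n c x i = act M n c y i"
  unfolding act_def by (rule msum_cong) simp

lemma (in left_module) act_closed:
  "mat R m n c \<Longrightarrow> vec M n x \<Longrightarrow> i < m \<Longrightarrow> act M n c x i \<in> carrier M"
  unfolding act_def mat_def vec_def by auto

lemma act_hom:
  assumes "left_module R M" "left_module R N" "h \<in> mhom R M N" "mat R m n c" "vec M n x" "i < m"
  shows "h (act M n c x i) = act N n c (\<lambda>j. h (x j)) i"
proof -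
  interpret M: left_module R M by fact
  interpret N: left_module R N by fact
  show ?thesis using assms unfolding act_def mat_def vec_def
    by (auto simp: mhom_msum[OF M.abelian_group_M N.abelian_group_M assms(3)] mhom_smult[OF assms(3)] intro!: msum_cong)
qed

subsection \<open>Products\<close>

lemma prod_module_simps [simp]:
  "carrier (prod_module I F) = (\<Pi>\<^sub>E i\<in>I. carrier (F i))" "\<zero>\<^bsub>prod_module I F\<^esub> = (\<lambda>i\<in>I. \<zero>\<^bsub>F i\<^esub>)"
  "x \<oplus>\<^bsub>prod_module I F\<^esub> y = (\<lambda>i\<in>I. x i \<oplus>\<^bsub>F i\<^esub> y i)"
  "r \<odot>\<^bsub>prod_module I F\<^esub> x = (\<lambda>i\<in>I. r \<odot>\<^bsub>F i\<^esub> x i)"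
  by (simp_all add: prod_module_def)

lemma left_module_prod:
  assumes "ring R" "\<And>i. i \<in> I \<Longrightarrow> left_module R (F i)"
  shows "left_module R (prod_module I F)"
proof -
  let ?C = "\<Pi>\<^sub>E i\<in>I. carrier (F i)"
  have mem: "x i \<in> carrier (F i)" if "x \<in> ?C" "i \<in> I" for x i using that by (rule PiE_mem)
  have res: "(\<lambda>i\<in>I. x i) = x" if "x \<in> ?C" for x using that by (auto simp: PiE_def extensional_restrict)
  have ab: "abelian_group (F i)" if "i \<in> I" for i using left_module.abelian_group_M[OF assms(2)[OF that]] .
  note mon = abelian_group.axioms(1)[OF ab]
  note laws = abelian_monoid.a_closed[OF mon] abelian_monoid.zero_closed[OF mon] abelian_group.a_inv_closed[OF ab]
    left_module.smult_closed[OF assms(2)] mem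
  show ?thesis
    unfolding prod_module_def
  proof (rule left_module_mk)
    show "\<exists>y\<in>?C. (\<lambda>i\<in>I. y i \<oplus>\<^bsub>F i\<^esub> x i) = (\<lambda>i\<in>I. \<zero>\<^bsub>F i\<^esub>)" if "x \<in> ?C" for x
      by (rule bexI[of _ "\<lambda>i\<in>I. \<ominus>\<^bsub>F i\<^esub> x i"])
        (simp_all add: abelian_group.l_neg[OF ab] laws that cong: restrict_cong)
    show "(\<lambda>i\<in>I. x i \<oplus>\<^bsub>F i\<^esub> y i) = (\<lambda>i\<in>I. y i \<oplus>\<^bsub>F i\<^esub> x i)" if "x \<in> ?C" "y \<in> ?C" for x y
      using that by (intro restrict_ext abelian_monoid.a_comm[OF mon] mem)
    show "(\<lambda>i\<in>I. (\<lambda>i\<in>I. \<zero>\<^bsub>F i\<^esub>) i \<oplus>\<^bsub>F i\<^esub> x i) = x" if "x \<in> ?C" for x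
      using res[OF that] by (simp add: abelian_monoid.l_zero[OF mon] laws that cong: restrict_cong)
    show "(\<lambda>i\<in>I. \<one>\<^bsub>R\<^esub> \<odot>\<^bsub>F i\<^esub> x i) = x" if "x \<in> ?C" for x
      using res[OF that] by (simp add: left_module.smult_one[OF assms(2)] laws that cong: restrict_cong)
  qed (use assms(1) in \<open>simp_all add: laws abelian_monoid.a_assoc[OF mon] left_module.smult_l_distr[OF assms(2)]
      left_module.smult_r_distr[OF assms(2)] left_module.smult_assoc[OF assms(2)] cong: restrict_cong\<close>)
qed

lemma msum_prod: "i \<in> I \<Longrightarrow> msum (prod_module I F) f n i = msum (F i) (\<lambda>j. f j i) n"
  by (induction n) auto

lemma act_prod: "i \<in> I \<Longrightarrow> act (prod_module I F) n c x k i = act (F i) n c (\<lambda>j. x j i) k"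
  unfolding act_def by (simp add: msum_prod)

subsection \<open>Character modules\<close>

lemma add_on_extend_closed:
  "add_on (add_monoid M) \<phi> \<Longrightarrow> x \<in> carrier M \<Longrightarrow> y \<in> carrier M \<Longrightarrow> \<phi> (x \<oplus>\<^bsub>M\<^esub> y) = \<phi> x + \<phi> y"
  by (simp add: add_on_def)

text \<open>The character module with values in the type \<open>qz\<close> rather than in the cosets
  forming \<open>QZ\<close>, so that values can be subtracted and summed with the type class
  operations. \<open>char_module_iso\<close> returns to \<open>char_module\<close>.\<close>

definition cm :: "('r, 'a) module \<Rightarrow> ('r, 'a \<Rightarrow> qz) module" where
  "cm M = mk_module {\<phi> \<in> extensional (carrier M). add_on (add_monoid M) \<phi>}
     (\<lambda>x\<in>carrier M. 0) (\<lambda>\<phi> \<psi>. \<lambda>x\<in>carrier M. \<phi> x + \<psi> x) (\<lambda>r \<phi>. \<lambda>x\<in>carrier M. \<phi> (r \<odot>\<^bsub>M\<^esub> x))"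

lemma cm_carrier: "\<phi> \<in> carrier (cm M) \<longleftrightarrow> \<phi> \<in> extensional (carrier M) \<and>
    (\<forall>x\<in>carrier M. \<forall>y\<in>carrier M. \<phi> (x \<oplus>\<^bsub>M\<^esub> y) = \<phi> x + \<phi> y)"
  by (auto simp: cm_def add_on_def)

lemma cm_simps [simp]:
  "\<zero>\<^bsub>cm M\<^esub> = (\<lambda>x\<in>carrier M. 0)" "\<phi> \<oplus>\<^bsub>cm M\<^esub> \<psi> = (\<lambda>x\<in>carrier M. \<phi> x + \<psi> x)"
  "r \<odot>\<^bsub>cm M\<^esub> \<phi> = (\<lambda>x\<in>carrier M. \<phi> (r \<odot>\<^bsub>M\<^esub> x))"
  by (simp_all add: cm_def)

lemma cm_ext: "\<phi> \<in> carrier (cm M) \<Longrightarrow> \<phi> \<in> extensional (carrier M)"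
  and cm_add: "\<phi> \<in> carrier (cm M) \<Longrightarrow> x \<in> carrier M \<Longrightarrow> y \<in> carrier M \<Longrightarrow> \<phi> (x \<oplus>\<^bsub>M\<^esub> y) = \<phi> x + \<phi> y"
  by (auto simp: cm_carrier)

lemma cm_eqI: "\<phi> \<in> carrier (cm M) \<Longrightarrow> \<psi> \<in> carrier (cm M) \<Longrightarrow> (\<And>x. x \<in> carrier M \<Longrightarrow> \<phi> x = \<psi> x) \<Longrightarrow> \<phi> = \<psi>"
  by (rule extensionalityI[OF cm_ext cm_ext]) auto

lemma cm_zero:
  assumes "abelian_group M" "\<phi> \<in> carrier (cm M)"
  shows "\<phi> \<zero>\<^bsub>M\<^esub> = 0"
proof -
  interpret abelian_group M by fact
  show ?thesis using cm_add[OF assms(2), of "\<zero>\<^bsub>M\<^esub>" "\<zero>\<^bsub>M\<^esub>"] by simp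
qed

lemma left_module_cm:
  assumes "left_module R M"
  shows "left_module (opp R) (cm M)"
proof -
  interpret left_module R M by fact
  show ?thesis unfolding cm_def
  proof (rule left_module_mk)
    show "\<exists>y\<in>{\<phi> \<in> extensional (carrier M). add_on (add_monoid M) \<phi>}. (\<lambda>z\<in>carrier M. y z + x z) = (\<lambda>z\<in>carrier M. 0)"
      if "x \<in> {\<phi> \<in> extensional (carrier M). add_on (add_monoid M) \<phi>}" for x
      using that by (intro bexI[of _ "\<lambda>z\<in>carrier M. - x z"]) (auto simp: add_on_def)
  qed (auto simp: ring_R add_on_def fun_eq_iff extensional_def algebra_simps smult_l_distr smult_r_distr smult_assoc smult_one)
qed

lemma tiny_qz:
  assumes "inaccessible TYPE('u)"
  shows "tiny TYPE('u) (A :: qz set)"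
proof -
  obtain f :: "rat \<Rightarrow> nat" where "inj f" using ex_inj by blast
  then have "tiny TYPE('u) (UNIV :: rat set)" by (rule tiny_inj_on[OF tiny_nat[OF assms, of UNIV]]) auto
  then have "tiny TYPE('u) (range abs_qz)" by (rule tiny_image)
  moreover have "range abs_qz = UNIV" by (metis Quotient_abs_rep Quotient_qz surjI)
  ultimately show ?thesis using tiny_subset by (metis subset_UNIV)
qed

lemma tiny_cm:
  assumes "inaccessible TYPE('u)" "tiny TYPE('u) (carrier M)"
  shows "tiny TYPE('u) (carrier (cm M))"
proof (rule tiny_subset)
  show "tiny TYPE('u) (\<Pi>\<^sub>E x\<in>carrier M. (UNIV :: qz set))"
    using assms by (intro tiny_PiE tiny_qz)
  show "carrier (cm M) \<subseteq> (\<Pi>\<^sub>E x\<in>carrier M. UNIV)" by (auto simp: cm_carrier PiE_def)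
qed

definition coset_of :: "qz \<Rightarrow> rat set" where
  "coset_of q = {x. abs_qz x = q}"

lemma coset_of_abs: "coset_of (abs_qz x) = {y. y - x \<in> \<int>}"
  by (auto simp: coset_of_def qz.abs_eq_iff)

lemma QZ_coset: "\<int> #>\<^bsub>\<lparr>carrier = UNIV, monoid.mult = (+), one = 0\<rparr>\<^esub> (x :: rat) = coset_of (abs_qz x)"
proof -
  have "y \<in> \<int> #>\<^bsub>\<lparr>carrier = UNIV, monoid.mult = (+), one = 0\<rparr>\<^esub> x \<longleftrightarrow> y - x \<in> \<int>" for y
    unfolding r_coset_def by (auto intro!: bexI[of _ "y - x"])
  then show ?thesis by (auto simp: coset_of_abs)
qed

lemma inj_coset_of: "inj coset_of"
proof (rule injI)
  fix p q assume "coset_of p = coset_of q"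
  moreover obtain x where "p = abs_qz x" by (metis Quotient_abs_rep Quotient_qz)
  ultimately show "p = q" unfolding coset_of_def by auto
qed

lemma QZ_carrier: "carrier QZ = range coset_of"
proof -
  have "carrier QZ = range (\<lambda>x. coset_of (abs_qz x))"
    unfolding QZ_def FactGroup_def RCOSETS_def by (auto simp: QZ_coset)
  also have "\<dots> = range coset_of"
    by (metis Quotient_abs_rep Quotient_qz surjI image_image)
  finally show ?thesis .
qed

lemma QZ_mult: "coset_of p \<otimes>\<^bsub>QZ\<^esub> coset_of q = coset_of (p + q)"
proof -
  obtain x y where xy: "p = abs_qz x" "q = abs_qz y" by (metis Quotient_abs_rep Quotient_qz)
  have "{h + k | h k. h - x \<in> \<int> \<and> k - y \<in> \<int>} = {z. z - (x + y) \<in> \<int>}"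
  proof (rule Set.set_eqI, rule iffI)
    fix z assume "z \<in> {h + k | h k. h - x \<in> \<int> \<and> k - y \<in> \<int>}"
    then obtain h k where z: "z = h + k" and "h - x \<in> \<int>" "k - y \<in> \<int>" by blast
    then have "(h - x) + (k - y) \<in> \<int>" by (intro Ints_add)
    then show "z \<in> {z. z - (x + y) \<in> \<int>}" unfolding z by (simp add: algebra_simps)
  next
    fix z assume "z \<in> {z. z - (x + y) \<in> \<int>}"
    then show "z \<in> {h + k | h k. h - x \<in> \<int> \<and> k - y \<in> \<int>}"
      by (intro CollectI exI[of _ x] exI[of _ "z - x"]) (auto simp: algebra_simps)
  qed
  moreover have "coset_of p \<otimes>\<^bsub>QZ\<^esub> coset_of q = {h + k | h k. h \<in> coset_of p \<and> k \<in> coset_of q}"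
    by (auto simp: QZ_def FactGroup_def set_mult_def)
  ultimately show ?thesis by (simp add: xy coset_of_abs plus_qz.abs_eq)
qed

text \<open>Composition with \<open>coset_of\<close>, an additive bijection from \<open>qz\<close>
  onto the carrier of \<open>QZ\<close>.\<close>

lemma char_module_iso:
  assumes "left_module R M"
  shows "mod_iso (opp R) (cm M) (char_module M)"
proof -
  interpret left_module R M by fact
  have one: "\<one>\<^bsub>QZ\<^esub> = coset_of 0"
  proof -
    have "coset_of 0 = \<int>" by (simp add: zero_qz.abs_eq coset_of_abs)
    then show ?thesis by (simp add: QZ_def FactGroup_def)
  qed
  have carr: "carrier (char_module M) = hom (add_monoid M) QZ \<inter> extensional (carrier M)"
    by (simp add: char_module_def)
  show ?thesis unfolding mod_iso_def
  proof (rule bexI)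
    let ?h = "\<lambda>\<phi>\<in>carrier (cm M). \<lambda>x\<in>carrier M. coset_of (\<phi> x)"
    show "?h \<in> mhom (opp R) (cm M) (char_module M)"
    proof (rule mhomI)
      interpret C: left_module "opp R" "cm M" by (rule left_module_cm[OF assms])
      show "?h (\<phi> \<oplus>\<^bsub>cm M\<^esub> \<psi>) = ?h \<phi> \<oplus>\<^bsub>char_module M\<^esub> ?h \<psi>" if "\<phi> \<in> carrier (cm M)" "\<psi> \<in> carrier (cm M)" for \<phi> \<psi>
        using that C.M.a_closed[OF that] by (auto simp: char_module_def QZ_mult fun_eq_iff)
      show "?h (r \<odot>\<^bsub>cm M\<^esub> \<phi>) = r \<odot>\<^bsub>char_module M\<^esub> ?h \<phi>" if "\<phi> \<in> carrier (cm M)" "r \<in> carrier (opp R)" for \<phi> r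
        using that C.smult_closed[of r \<phi>] by (auto simp: char_module_def fun_eq_iff)
    qed (auto simp: carr hom_def QZ_carrier QZ_mult cm_add)
    show "bij_betw ?h (carrier (cm M)) (carrier (char_module M))"
      unfolding bij_betw_def
    proof (intro conjI inj_onI equalityI subsetI)
      fix \<phi> \<psi> assume *: "\<phi> \<in> carrier (cm M)" "\<psi> \<in> carrier (cm M)" "?h \<phi> = ?h \<psi>"
      have "coset_of (\<phi> x) = coset_of (\<psi> x)" if "x \<in> carrier M" for x
        using fun_cong[OF *(3), of x] * that by simp
      then show "\<phi> = \<psi>" using * by (intro cm_eqI[of \<phi> M \<psi>]) (auto dest: injD[OF inj_coset_of])
    next
      fix \<chi> assume "\<chi> \<in> ?h ` carrier (cm M)"
      then show "\<chi> \<in> carrier (char_module M)" by (auto simp: carr hom_def QZ_carrier QZ_mult cm_add)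
    next
      fix \<chi> assume \<chi>: "\<chi> \<in> carrier (char_module M)"
      define \<phi> where "\<phi> = (\<lambda>x\<in>carrier M. inv_into UNIV coset_of (\<chi> x))"
      have \<chi>': "\<chi> x = coset_of (\<phi> x)" if "x \<in> carrier M" for x
        using \<chi> that unfolding carr hom_def \<phi>_def by (auto simp: QZ_carrier f_inv_into_f Pi_def)
      have "\<phi> \<in> carrier (cm M)"
      proof -
        have "coset_of (\<phi> (x \<oplus>\<^bsub>M\<^esub> y)) = coset_of (\<phi> x + \<phi> y)" if "x \<in> carrier M" "y \<in> carrier M" for x y
        proof -
          have "\<chi> (x \<oplus>\<^bsub>M\<^esub> y) = \<chi> x \<otimes>\<^bsub>QZ\<^esub> \<chi> y" using \<chi> that unfolding carr hom_def by simp
          then show ?thesis using \<chi>'[OF that(1)] \<chi>'[OF that(2)] \<chi>'[OF M.a_closed[OF that]] by (simp add: QZ_mult)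
        qed
        then show ?thesis by (auto simp: cm_carrier \<phi>_def dest: injD[OF inj_coset_of])
      qed
      moreover have "\<chi> = ?h \<phi>" using \<chi> calculation \<chi>' unfolding carr
        by (auto simp: fun_eq_iff extensional_def)
      ultimately show "\<chi> \<in> ?h ` carrier (cm M)" by blast
    qed
  qed
qed

definition cmap :: "('r, 'a) module \<Rightarrow> ('r, 'b) module \<Rightarrow> ('a \<Rightarrow> 'b) \<Rightarrow> ('b \<Rightarrow> qz) \<Rightarrow> 'a \<Rightarrow> qz" where
  "cmap M N h = (\<lambda>\<phi>\<in>carrier (cm N). \<lambda>x\<in>carrier M. \<phi> (h x))"

lemma cmap_mhom:
  assumes "left_module R M" "left_module R N" "h \<in> mhom R M N"
  shows "cmap M N h \<in> mhom (opp R) (cm N) (cm M)"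
proof -
  interpret M: left_module R M by fact
  interpret CN: left_module "opp R" "cm N" by (rule left_module_cm[OF assms(2)])
  note h = mhom_closed[OF assms(3)] mhom_add[OF assms(3)] mhom_smult[OF assms(3)]
  show ?thesis
  proof (rule mhomI)
    show "cmap M N h (\<phi> \<oplus>\<^bsub>cm N\<^esub> \<psi>) = cmap M N h \<phi> \<oplus>\<^bsub>cm M\<^esub> cmap M N h \<psi>"
      if "\<phi> \<in> carrier (cm N)" "\<psi> \<in> carrier (cm N)" for \<phi> \<psi>
      using that CN.M.a_closed[OF that] h by (auto simp: cmap_def)
    show "cmap M N h (r \<odot>\<^bsub>cm N\<^esub> \<phi>) = r \<odot>\<^bsub>cm M\<^esub> cmap M N h \<phi>"
      if "r \<in> carrier (opp R)" "\<phi> \<in> carrier (cm N)" for r \<phi>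
      using that CN.smult_closed[OF that] h by (auto simp: cmap_def)
  qed (use h in \<open>auto simp: cmap_def cm_carrier\<close>)
qed

text \<open>Dualising reverses maps and exchanges section with retraction, so the direction of the
  retract is kept.\<close>

lemma retract_cm:
  assumes "left_module R X" "left_module R Y" "retract R X Y"
  shows "retract (opp R) (cm X) (cm Y)"
proof -
  obtain s p where *: "s \<in> mhom R X Y" "p \<in> mhom R Y X" "\<forall>x\<in>carrier X. p (s x) = x"
    using assms(3) unfolding retract_def by blast
  note c = cmap_mhom[OF assms(2,1) *(2)] cmap_mhom[OF assms(1,2) *(1)]
  show ?thesis unfolding retract_def
  proof (intro bexI ballI)
    fix \<phi> assume \<phi>: "\<phi> \<in> carrier (cm X)"
    have "cmap Y X p \<phi> \<in> carrier (cm Y)" using mhom_closed[OF c(1) \<phi>] .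
    then show "cmap X Y s (cmap Y X p \<phi>) = \<phi>"
      using * \<phi> cm_ext[OF \<phi>] by (auto simp: cmap_def fun_eq_iff mhom_closed[OF *(1)] extensional_def)
  qed (use c in auto)
qed

subsection \<open>Linear duality\<close>

lemma cm_msum:
  assumes "x \<in> carrier M"
  shows "msum (cm M) \<Phi> n x = (\<Sum>i<n. \<Phi> i x)"
  by (induction n) (use assms in auto)

lemma char_msum:
  assumes "abelian_group M" "\<phi> \<in> carrier (cm M)"
  shows "(\<And>i. i < n \<Longrightarrow> f i \<in> carrier M) \<Longrightarrow> \<phi> (msum M f n) = (\<Sum>i<n. \<phi> (f i))"
proof (induction n)
  case 0 then show ?case using cm_zero[OF assms] by simp
next
  case (Suc n)
  then show ?case using abelian_group.msum_closed[OF assms(1), of n f] by (simp add: cm_add[OF assms(2)])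
qed

text \<open>For the pairing of a vector of characters with a vector of elements, the transpose is
  the adjoint. The transfers of linear systems between a module and its characters rest on this
  identity.\<close>

lemma act_adjoint:
  assumes "left_module R M" "mat R m n c" "vec (cm M) m X" "vec M n x"
  shows "(\<Sum>i<m. X i (act M n c x i)) = (\<Sum>j<n. act (cm M) m (tr c) X j (x j))"
proof -
  interpret left_module R M by fact
  have "(\<Sum>i<m. X i (act M n c x i)) = (\<Sum>i<m. \<Sum>j<n. X i (c i j \<odot>\<^bsub>M\<^esub> x j))"
    using assms unfolding act_def by (intro sum.cong refl char_msum[OF abelian_group_M]) (auto simp: vec_def mat_def)
  also have "\<dots> = (\<Sum>j<n. \<Sum>i<m. X i (c i j \<odot>\<^bsub>M\<^esub> x j))" by (rule sum.swap)
  also have "\<dots> = (\<Sum>j<n. act (cm M) m (tr c) X j (x j))"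
    using assms(4) unfolding act_def by (intro sum.cong) (auto simp: cm_msum vec_def tr_def)
  finally show ?thesis .
qed

section \<open>Characters of finite powers of a module\<close>

definition unit_vec :: "('r, 'a) module \<Rightarrow> nat \<Rightarrow> 'a \<Rightarrow> nat \<Rightarrow> 'a" where
  "unit_vec M j a = (\<lambda>i. if i = j then a else \<zero>\<^bsub>M\<^esub>)"

lemma (in left_module) vec_unit_vec: "a \<in> carrier M \<Longrightarrow> vec M n (unit_vec M j a)"
  by (simp add: vec_def unit_vec_def)

lemma sum_unit_vec:
  assumes "abelian_group M" "vec (cm M) n X" "j < n"
  shows "(\<Sum>i<n. X i (unit_vec M j a i)) = X j a"
proof -
  have "(\<Sum>i<n. X i (unit_vec M j a i)) = (\<Sum>i<n. if i = j then X j a else 0)"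
    using assms by (intro sum.cong) (auto simp: unit_vec_def vec_def cm_zero)
  also have "\<dots> = X j a" using assms(3) by simp
  finally show ?thesis .
qed

context left_module
begin

lemma act_add:
  assumes "mat R m n c" "vec M n x" "vec M n y" "i < m"
  shows "act M n c (\<lambda>j. x j \<oplus>\<^bsub>M\<^esub> y j) i = act M n c x i \<oplus>\<^bsub>M\<^esub> act M n c y i"
proof -
  have "act M n c (\<lambda>j. x j \<oplus>\<^bsub>M\<^esub> y j) i = msum M (\<lambda>j. c i j \<odot>\<^bsub>M\<^esub> x j \<oplus>\<^bsub>M\<^esub> c i j \<odot>\<^bsub>M\<^esub> y j) n"
    unfolding act_def using assms by (intro msum_cong) (auto simp: mat_def vec_def smult_r_distr)
  also have "\<dots> = act M n c x i \<oplus>\<^bsub>M\<^esub> act M n c y i"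
    unfolding act_def using assms by (intro M.msum_add) (auto simp: mat_def vec_def)
  finally show ?thesis .
qed

lemma act_uminus:
  assumes "mat R m n c" "vec M n x" "i < m"
  shows "act M n c (\<lambda>j. \<ominus>\<^bsub>M\<^esub> x j) i = \<ominus>\<^bsub>M\<^esub> act M n c x i"
proof -
  have "act M n c (\<lambda>j. \<ominus>\<^bsub>M\<^esub> x j) i = msum M (\<lambda>j. \<ominus>\<^bsub>M\<^esub> (c i j \<odot>\<^bsub>M\<^esub> x j)) n"
    unfolding act_def using assms by (intro msum_cong) (auto simp: mat_def vec_def smult_uminus)
  also have "\<dots> = \<ominus>\<^bsub>M\<^esub> act M n c x i"
    unfolding act_def using assms by (intro M.msum_uminus) (auto simp: mat_def vec_def)
  finally show ?thesis .
qed

lemma act_zero: "mat R m n c \<Longrightarrow> i < m \<Longrightarrow> act M n c (\<lambda>j. \<zero>\<^bsub>M\<^esub>) i = \<zero>\<^bsub>M\<^esub>"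
  unfolding act_def by (rule M.msum_zero') (auto simp: mat_def)

end

text \<open>The extension and separation theorems for characters apply to groups, so the power of
  \<open>M\<close> is realised as a product module; \<open>pack\<close> makes a total function
  extensional so that it becomes an element of it.\<close>

locale vectors = left_module +
  fixes m :: nat
begin

abbreviation P where "P \<equiv> prod_module {..<m} (\<lambda>_. M)"

sublocale P: left_module R P
  by (rule left_module_prod) (auto intro: left_module_axioms R.ring_axioms)

lemmas comm_group_P = P.M.a_comm_group
lemmas group_P = comm_group.axioms(2)[OF comm_group_P]

abbreviation pack :: "(nat \<Rightarrow> 'b) \<Rightarrow> nat \<Rightarrow> 'b" where
  "pack x \<equiv> restrict x {..<m}"

lemma pack_closed: "vec M m x \<Longrightarrow> pack x \<in> carrier P"
  by (auto simp: vec_def)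

lemma inv_pack: "vec M m x \<Longrightarrow> inv\<^bsub>add_monoid P\<^esub> pack x = pack (\<lambda>i. \<ominus>\<^bsub>M\<^esub> x i)"
  by (rule group.inv_equality[OF group_P]) (auto simp: vec_def M.l_neg)

text \<open>A character of a finite power is the sum of its restrictions to the single copies;
  \<open>X i\<close> is the restriction to copy number \<open>i\<close>.\<close>

lemma char_vec:
  assumes "add_on (add_monoid P) \<psi>"
  shows "\<exists>X. vec (cm M) m X \<and> (\<forall>x. vec M m x \<longrightarrow> \<psi> (pack x) = (\<Sum>i<m. X i (x i)))"
proof -
  define X where "X i = (\<lambda>a\<in>carrier M. \<psi> (pack (unit_vec M i a)))" for i
  have add: "\<psi> (pack (\<lambda>i. x i \<oplus>\<^bsub>M\<^esub> y i)) = \<psi> (pack x) + \<psi> (pack y)" if "vec M m x" "vec M m y" for x y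
  proof -
    have "pack (\<lambda>i. x i \<oplus>\<^bsub>M\<^esub> y i) = pack x \<oplus>\<^bsub>P\<^esub> pack y" by (auto simp: fun_eq_iff)
    then show ?thesis using add_on_extend_closed[OF assms pack_closed[OF that(1)] pack_closed[OF that(2)]] by (simp only:)
  qed
  have zero: "\<psi> (pack (\<lambda>i. \<zero>\<^bsub>M\<^esub>)) = 0"
    using add[of "\<lambda>i. \<zero>\<^bsub>M\<^esub>" "\<lambda>i. \<zero>\<^bsub>M\<^esub>"] by (simp add: vec_def)
  have "vec (cm M) m X" unfolding vec_def
  proof (intro allI impI)
    fix i
    have "\<psi> (pack (unit_vec M i (a \<oplus>\<^bsub>M\<^esub> b))) = \<psi> (pack (unit_vec M i a)) + \<psi> (pack (unit_vec M i b))"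
      if "a \<in> carrier M" "b \<in> carrier M" for a b
    proof -
      have "unit_vec M i (a \<oplus>\<^bsub>M\<^esub> b) = (\<lambda>j. unit_vec M i a j \<oplus>\<^bsub>M\<^esub> unit_vec M i b j)"
        using that by (auto simp: unit_vec_def)
      then show ?thesis using add vec_unit_vec that by simp
    qed
    then show "X i \<in> carrier (cm M)" by (auto simp: X_def cm_carrier)
  qed
  moreover have "\<psi> (pack x) = (\<Sum>i<m. X i (x i))" if x: "vec M m x" for x
  proof -
    \<comment> \<open>Induction on the number of coordinates that have been switched on; each step
      adds a vector concentrated in place \<open>k\<close>.\<close>
    have "k \<le> m \<Longrightarrow> \<psi> (pack (\<lambda>i. if i < k then x i else \<zero>\<^bsub>M\<^esub>)) = (\<Sum>i<k. X i (x i))" for k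
    proof (induction k)
      case 0 then show ?case using zero by (simp add: restrict_def)
    next
      case (Suc k)
      let ?y = "\<lambda>i. if i < k then x i else \<zero>\<^bsub>M\<^esub>"
      have xk: "x k \<in> carrier M" using x Suc by (simp add: vec_def)
      have y: "vec M m ?y" using x by (simp add: vec_def)
      have "pack (\<lambda>i. if i < Suc k then x i else \<zero>\<^bsub>M\<^esub>) = pack (\<lambda>i. ?y i \<oplus>\<^bsub>M\<^esub> unit_vec M k (x k) i)"
        using x xk by (auto simp: unit_vec_def fun_eq_iff vec_def less_Suc_eq)
      then have "\<psi> (pack (\<lambda>i. if i < Suc k then x i else \<zero>\<^bsub>M\<^esub>)) = \<psi> (pack ?y) + \<psi> (pack (unit_vec M k (x k)))"
        using add[OF y vec_unit_vec[OF xk]] by (simp only:)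
      moreover have "\<psi> (pack ?y) = (\<Sum>i<k. X i (x i))" by (rule Suc.IH[OF Suc_leD[OF Suc.prems]])
      moreover have "\<psi> (pack (unit_vec M k (x k))) = X k (x k)" using xk by (simp add: X_def)
      ultimately show ?case by (simp only: sum.lessThan_Suc)
    qed
    from this[of m] have "\<psi> (pack (\<lambda>i. if i < m then x i else \<zero>\<^bsub>M\<^esub>)) = (\<Sum>i<m. X i (x i))" by simp
    moreover have "pack (\<lambda>i. if i < m then x i else \<zero>\<^bsub>M\<^esub>) = pack x" by (auto simp: fun_eq_iff)
    ultimately show ?thesis by simp
  qed
  ultimately show ?thesis by blast
qed

text \<open>The adjunction at a vector concentrated in place \<open>j\<close>. In this way an
  identity between vectors of characters is recovered from identities between values of the
  pairing.\<close>

lemma act_char_eq: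
  assumes c: "mat R m n c" and X: "vec (cm M) m X" and j: "j < n" and a: "a \<in> carrier M"
  shows "act (cm M) m (tr c) X j a = (\<Sum>i<m. X i (act M n c (unit_vec M j a) i))"
proof -
  interpret C: left_module "opp R" "cm M" by (rule left_module_cm[OF left_module_axioms])
  have "vec (cm M) n (act (cm M) m (tr c) X)"
    unfolding vec_def using C.act_closed[of n m "tr c" X] mat_tr[OF c] X by simp
  from sum_unit_vec[OF abelian_group_M this j, of a] show ?thesis
    using act_adjoint[OF left_module_axioms c X vec_unit_vec[OF a]] by simp
qed

text \<open>The functional \<open>X\<close> descends to the image of \<open>c\<close>, and extends from there by injectivity of \<open>\<rat>/\<int>\<close>.\<close>

lemma functional_factors:
  assumes c: "mat R m n c" and X: "vec (cm M) n X"
    and ker: "\<And>v. vec M n v \<Longrightarrow> (\<And>i. i < m \<Longrightarrow> act M n c v i = \<zero>\<^bsub>M\<^esub>) \<Longrightarrow> (\<Sum>j<n. X j (v j)) = 0"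
  shows "\<exists>W. vec (cm M) m W \<and> (\<forall>j<n. X j = act (cm M) m (tr c) W j)"
proof -
  interpret C: left_module "opp R" "cm M" by (rule left_module_cm[OF left_module_axioms])
  let ?s = "\<lambda>v. (\<Sum>j<n. X j (v j))"
  let ?\<Gamma> = "{(pack (act M n c v), ?s v) | v. vec M n v}"
  have Xz: "X j \<zero>\<^bsub>M\<^esub> = 0" if "j < n" for j using X that cm_zero[OF abelian_group_M] by (simp add: vec_def)
  have Xm: "X j (\<ominus>\<^bsub>M\<^esub> a) = - X j a" if "j < n" "a \<in> carrier M" for j a
  proof -
    have "X j (\<ominus>\<^bsub>M\<^esub> a \<oplus>\<^bsub>M\<^esub> a) = X j (\<ominus>\<^bsub>M\<^esub> a) + X j a"
      using X that by (intro cm_add) (auto simp: vec_def)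
    then show ?thesis using Xz that by (simp add: M.l_neg eq_neg_iff_add_eq_0)
  qed
  have actv: "vec M m (act M n c v)" if "vec M n v" for v
    using act_closed[OF c that] by (simp add: vec_def)
  have "partial_char (add_monoid P) ?\<Gamma>"
    unfolding partial_char_def
  proof (intro conjI allI impI)
    show "?\<Gamma> \<subseteq> carrier (add_monoid P) \<times> UNIV" using pack_closed[OF actv] by (auto simp del: prod_module_simps)
    show "(\<one>\<^bsub>add_monoid P\<^esub>, 0) \<in> ?\<Gamma>"
    proof (intro CollectI exI conjI)
      show "vec M n (\<lambda>j. \<zero>\<^bsub>M\<^esub>)" by (simp add: vec_def)
      show "(\<one>\<^bsub>add_monoid P\<^esub>, 0) = (pack (act M n c (\<lambda>j. \<zero>\<^bsub>M\<^esub>)), ?s (\<lambda>j. \<zero>\<^bsub>M\<^esub>))"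
        using act_zero[OF c] Xz by (auto simp: fun_eq_iff)
    qed
  next
    fix x a y b assume "(x, a) \<in> ?\<Gamma>" "(y, b) \<in> ?\<Gamma>"
    then obtain v w where v: "vec M n v" "x = pack (act M n c v)" "a = ?s v"
      and w: "vec M n w" "y = pack (act M n c w)" "b = ?s w" by blast
    have w': "vec M n (\<lambda>j. \<ominus>\<^bsub>M\<^esub> w j)" using w by (simp add: vec_def)
    show "(x \<otimes>\<^bsub>add_monoid P\<^esub> inv\<^bsub>add_monoid P\<^esub> y, a - b) \<in> ?\<Gamma>"
    proof (intro CollectI exI conjI)
      show "vec M n (\<lambda>j. v j \<oplus>\<^bsub>M\<^esub> \<ominus>\<^bsub>M\<^esub> w j)" using v w by (simp add: vec_def)
      have "x \<otimes>\<^bsub>add_monoid P\<^esub> inv\<^bsub>add_monoid P\<^esub> y = pack (act M n c (\<lambda>j. v j \<oplus>\<^bsub>M\<^esub> \<ominus>\<^bsub>M\<^esub> w j))"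
        unfolding v(2) w(2) inv_pack[OF actv[OF w(1)]]
        using act_add[OF c v(1) w'] act_uminus[OF c w(1)] by (auto simp: fun_eq_iff)
      moreover have "a - b = ?s (\<lambda>j. v j \<oplus>\<^bsub>M\<^esub> \<ominus>\<^bsub>M\<^esub> w j)"
      proof -
        have "?s (\<lambda>j. v j \<oplus>\<^bsub>M\<^esub> \<ominus>\<^bsub>M\<^esub> w j) = (\<Sum>j<n. X j (v j) - X j (w j))"
          using v w X Xm by (intro sum.cong) (auto simp: vec_def cm_add)
        then show ?thesis by (simp add: sum_subtractf v(3) w(3))
      qed
      ultimately show "(x \<otimes>\<^bsub>add_monoid P\<^esub> inv\<^bsub>add_monoid P\<^esub> y, a - b) =
        (pack (act M n c (\<lambda>j. v j \<oplus>\<^bsub>M\<^esub> \<ominus>\<^bsub>M\<^esub> w j)), ?s (\<lambda>j. v j \<oplus>\<^bsub>M\<^esub> \<ominus>\<^bsub>M\<^esub> w j))" by simp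
    qed
  next
    fix q assume "(\<one>\<^bsub>add_monoid P\<^esub>, q) \<in> ?\<Gamma>"
    then obtain v where v: "vec M n v" "\<one>\<^bsub>add_monoid P\<^esub> = pack (act M n c v)" "q = ?s v" by blast
    have "act M n c v i = \<zero>\<^bsub>M\<^esub>" if "i < m" for i using fun_cong[OF v(2), of i] that by simp
    then show "q = 0" using ker v by blast
  qed
  from comm_group.partial_char_total[OF comm_group_P this] obtain \<psi> where \<psi>: "add_on (add_monoid P) \<psi>" "\<forall>(x, q)\<in>?\<Gamma>. \<psi> x = q" by blast
  have \<psi>': "\<psi> (pack (act M n c v)) = ?s v" if "vec M n v" for v
  proof -
    have "(pack (act M n c v), ?s v) \<in> ?\<Gamma>" using that by blast
    from bspec[OF \<psi>(2) this] show ?thesis by simp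
  qed
  obtain W where W: "vec (cm M) m W" "\<And>x. vec M m x \<Longrightarrow> \<psi> (pack x) = (\<Sum>i<m. W i (x i))" using char_vec[OF \<psi>(1)] by blast
  have "X j = act (cm M) m (tr c) W j" if j: "j < n" for j
  proof (rule cm_eqI)
    show "X j \<in> carrier (cm M)" using X j by (simp add: vec_def)
    show "act (cm M) m (tr c) W j \<in> carrier (cm M)"
      using C.act_closed[of n m "tr c" W j] mat_tr[OF c] W j by simp
    fix a assume a: "a \<in> carrier M"
    show "X j a = act (cm M) m (tr c) W j a"
      using act_char_eq[OF c W(1) j a] \<psi>'[OF vec_unit_vec[OF a, of n j]] W(2)[OF actv[OF vec_unit_vec[OF a]]]
        sum_unit_vec[OF abelian_group_M X j, of a] by simp
  qed
  then show ?thesis using W(1) by blast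
qed

text \<open>If \<open>v\<close> were outside the image, a character of the power would vanish on the
  image but not at \<open>v\<close>; its coordinates form a vector annihilated by the transpose,
  which contradicts \<open>ann\<close>.\<close>

lemma image_detected:
  assumes c: "mat R m n c" and v: "vec M m v"
    and ann: "\<And>X. vec (cm M) m X \<Longrightarrow> (\<And>j. j < n \<Longrightarrow> act (cm M) m (tr c) X j = \<zero>\<^bsub>cm M\<^esub>) \<Longrightarrow> (\<Sum>i<m. X i (v i)) = 0"
  shows "\<exists>u. vec M n u \<and> (\<forall>i<m. v i = act M n c u i)"
proof (rule ccontr)
  assume no: "\<not> ?thesis"
  interpret C: left_module "opp R" "cm M" by (rule left_module_cm[OF left_module_axioms])
  let ?S = "{pack (act M n c u) | u. vec M n u}"
  have actv: "vec M m (act M n c u)" if "vec M n u" for u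
    using act_closed[OF c that] by (simp add: vec_def)
  have "subgroup ?S (add_monoid P)"
  proof (rule group.subgroupI[OF group_P])
    show "?S \<subseteq> carrier (add_monoid P)" using pack_closed[OF actv] by (auto simp del: prod_module_simps)
    show "?S \<noteq> {}" by (auto simp: vec_def intro!: exI[of _ "\<lambda>_. \<zero>\<^bsub>M\<^esub>"])
  next
    fix x assume "x \<in> ?S"
    then obtain u where u: "vec M n u" "x = pack (act M n c u)" by blast
    have "inv\<^bsub>add_monoid P\<^esub> x = pack (act M n c (\<lambda>j. \<ominus>\<^bsub>M\<^esub> u j))"
      unfolding u(2) inv_pack[OF actv[OF u(1)]] using act_uminus[OF c u(1)] by (auto simp: fun_eq_iff)
    moreover have "vec M n (\<lambda>j. \<ominus>\<^bsub>M\<^esub> u j)" using u by (simp add: vec_def)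
    ultimately show "inv\<^bsub>add_monoid P\<^esub> x \<in> ?S" by blast
  next
    fix x y assume "x \<in> ?S" "y \<in> ?S"
    then obtain u w where u: "vec M n u" "x = pack (act M n c u)" and w: "vec M n w" "y = pack (act M n c w)" by blast
    have "x \<otimes>\<^bsub>add_monoid P\<^esub> y = pack (act M n c (\<lambda>j. u j \<oplus>\<^bsub>M\<^esub> w j))"
      using act_add[OF c u(1) w(1)] by (auto simp: u(2) w(2) fun_eq_iff)
    moreover have "vec M n (\<lambda>j. u j \<oplus>\<^bsub>M\<^esub> w j)" using u w by (simp add: vec_def)
    ultimately show "x \<otimes>\<^bsub>add_monoid P\<^esub> y \<in> ?S" by blast
  qed
  moreover have "pack v \<in> carrier (add_monoid P)" using pack_closed[OF v] by simp
  moreover have "pack v \<notin> ?S"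
  proof
    assume "pack v \<in> ?S"
    then obtain u where u: "vec M n u" "pack v = pack (act M n c u)" by blast
    have "v i = act M n c u i" if "i < m" for i using fun_cong[OF u(2), of i] that by simp
    then show False using no u by blast
  qed
  ultimately obtain \<psi> where \<psi>: "add_on (add_monoid P) \<psi>" "\<forall>y\<in>?S. \<psi> y = 0" "\<psi> (pack v) \<noteq> 0"
    using comm_group.char_separates[OF comm_group_P] by blast
  obtain X where X: "vec (cm M) m X" "\<And>x. vec M m x \<Longrightarrow> \<psi> (pack x) = (\<Sum>i<m. X i (x i))" using char_vec[OF \<psi>(1)] by blast
  have "act (cm M) m (tr c) X j = \<zero>\<^bsub>cm M\<^esub>" if j: "j < n" for j
  proof (rule cm_eqI)
    show "act (cm M) m (tr c) X j \<in> carrier (cm M)"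
      using C.act_closed[of n m "tr c" X j] mat_tr[OF c] X j by simp
    show "\<zero>\<^bsub>cm M\<^esub> \<in> carrier (cm M)" by (rule C.M.zero_closed)
    fix a assume a: "a \<in> carrier M"
    have "act (cm M) m (tr c) X j a = \<psi> (pack (act M n c (unit_vec M j a)))"
      using act_char_eq[OF c X(1) j a] X(2)[OF actv[OF vec_unit_vec[OF a]]] by simp
    also have "\<dots> = 0" using \<psi>(2) vec_unit_vec[OF a] by blast
    finally show "act (cm M) m (tr c) X j a = \<zero>\<^bsub>cm M\<^esub> a" using a by simp
  qed
  from ann[OF X(1) this] show False using \<psi>(3) X(2)[OF v] by simp
qed

end

lemmas functional_factors = vectors.functional_factors[OF vectors.intro]
lemmas image_detected = vectors.image_detected[OF vectors.intro]

subsection \<open>Pairs of linear systems and their duals\<close>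

text \<open>An implication between two positive primitive formulas in \<open>x\<close>: the premise
  is quantifier-free, the conclusion has the existential variables \<open>y\<close>.\<close>

definition pp_cond :: "('r, 'a) module \<Rightarrow> nat \<Rightarrow> nat \<Rightarrow> nat \<Rightarrow> nat \<Rightarrow> (nat \<Rightarrow> nat \<Rightarrow> 'r) \<Rightarrow>
    (nat \<Rightarrow> nat \<Rightarrow> 'r) \<Rightarrow> (nat \<Rightarrow> nat \<Rightarrow> 'r) \<Rightarrow> bool" where
  "pp_cond M n m l k H F K \<longleftrightarrow> (\<forall>x. vec M n x \<longrightarrow> (\<forall>i<m. act M n H x i = \<zero>\<^bsub>M\<^esub>) \<longrightarrow>
     (\<exists>y. vec M l y \<and> (\<forall>i<k. act M l K y i = \<zero>\<^bsub>M\<^esub>) \<and> (\<forall>i<n. x i = act M l F y i)))"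

text \<open>The reversed implication between the dual formulas: the hypothesis, \<open>tr F\<close>
  applied to \<open>x\<close> lies in the image of \<open>tr K\<close>, is dual to
  \<open>x = F y\<close> with \<open>K y = 0\<close>; the conclusion, \<open>x\<close> lies in the
  image of \<open>tr H\<close>, is dual to \<open>H x = 0\<close>.\<close>

definition pp_dual :: "('r, 'a) module \<Rightarrow> nat \<Rightarrow> nat \<Rightarrow> nat \<Rightarrow> nat \<Rightarrow> (nat \<Rightarrow> nat \<Rightarrow> 'r) \<Rightarrow>
    (nat \<Rightarrow> nat \<Rightarrow> 'r) \<Rightarrow> (nat \<Rightarrow> nat \<Rightarrow> 'r) \<Rightarrow> bool" where
  "pp_dual N n m l k H F K \<longleftrightarrow> (\<forall>x z. vec N n x \<longrightarrow> vec N k z \<longrightarrow>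
     (\<forall>j<l. act N n (tr F) x j = act N k (tr K) z j) \<longrightarrow>
     (\<exists>w. vec N m w \<and> (\<forall>i<n. x i = act N m (tr H) w i)))"

definition append_vec :: "nat \<Rightarrow> (nat \<Rightarrow> 'a) \<Rightarrow> (nat \<Rightarrow> 'a) \<Rightarrow> nat \<Rightarrow> 'a" where
  "append_vec n x z i = (if i < n then x i else z (i - n))"

lemma append_vec_simps [simp]: "i < n \<Longrightarrow> append_vec n x z i = x i" "append_vec n x z (n + i) = z i"
  by (simp_all add: append_vec_def)

lemma vec_append: "vec M n x \<Longrightarrow> vec M k z \<Longrightarrow> vec M (n + k) (append_vec n x z)"
  by (auto simp: vec_def append_vec_def)

lemma vec_take: "vec M (n + k) x \<Longrightarrow> vec M n x" and vec_drop: "vec M (n + k) x \<Longrightarrow> vec M k (\<lambda>i. x (n + i))"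
  by (auto simp: vec_def)

lemma sum_append:
  fixes f :: "nat \<Rightarrow> 'a :: comm_monoid_add"
  shows "(\<Sum>i<n + k. f i) = (\<Sum>i<n. f i) + (\<Sum>i<k. f (n + i))"
  by (induction k) (auto simp: add.assoc)

lemma act_coeff_cong: "(\<And>j. j < n \<Longrightarrow> c i j = d i' j) \<Longrightarrow> (\<And>j. j < n \<Longrightarrow> x j = y j) \<Longrightarrow> act M n c x i = act M n d y i'"
  unfolding act_def by (rule msum_cong) simp

context left_module
begin

lemma act_append:
  assumes "mat R m (n + k) c" "vec M (n + k) x" "i < m"
  shows "act M (n + k) c x i = act M n c x i \<oplus>\<^bsub>M\<^esub> act M k (\<lambda>i j. c i (n + j)) (\<lambda>j. x (n + j)) i"
  unfolding act_def using assms by (intro M.msum_append) (auto simp: mat_def vec_def)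

lemma act_coeff_uminus:
  assumes "mat R m n c" "vec M n x" "i < m"
  shows "act M n (\<lambda>i j. \<ominus>\<^bsub>R\<^esub> c i j) x i = \<ominus>\<^bsub>M\<^esub> act M n c x i"
proof -
  have "act M n (\<lambda>i j. \<ominus>\<^bsub>R\<^esub> c i j) x i = msum M (\<lambda>j. \<ominus>\<^bsub>M\<^esub> (c i j \<odot>\<^bsub>M\<^esub> x j)) n"
    unfolding act_def using assms by (intro msum_cong) (auto simp: mat_def vec_def uminus_smult)
  also have "\<dots> = \<ominus>\<^bsub>M\<^esub> act M n c x i"
    unfolding act_def using assms by (intro M.msum_uminus) (auto simp: mat_def vec_def)
  finally show ?thesis .
qed

lemma act_delta: "vec M n x \<Longrightarrow> i < n \<Longrightarrow> act M n (\<lambda>i j. if j = i then \<one>\<^bsub>R\<^esub> else \<zero>\<^bsub>R\<^esub>) x i = x i"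
proof -
  assume x: "vec M n x" "i < n"
  have "act M n (\<lambda>i j. if j = i then \<one>\<^bsub>R\<^esub> else \<zero>\<^bsub>R\<^esub>) x i = msum M (\<lambda>j. if j = i then x i else \<zero>\<^bsub>M\<^esub>) n"
    unfolding act_def using x by (intro msum_cong) (auto simp: vec_def smult_one)
  also have "\<dots> = x i" using x by (intro M.msum_delta) (auto simp: vec_def)
  finally show ?thesis .
qed

lemma act_coeff_zero: "vec M n x \<Longrightarrow> (\<And>j. j < n \<Longrightarrow> c i j = \<zero>\<^bsub>R\<^esub>) \<Longrightarrow> act M n c x i = \<zero>\<^bsub>M\<^esub>"
  unfolding act_def by (rule M.msum_zero') (auto simp: vec_def)

lemma eq_of_add_uminus: "x \<in> carrier M \<Longrightarrow> y \<in> carrier M \<Longrightarrow> x \<oplus>\<^bsub>M\<^esub> \<ominus>\<^bsub>M\<^esub> y = \<zero>\<^bsub>M\<^esub> \<longleftrightarrow> x = y"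
  by (metis M.minus_equality M.minus_minus M.r_neg M.a_inv_closed)

end

locale system_pair =
  fixes R :: "'r ring" and n m l k :: nat and H F K :: "nat \<Rightarrow> nat \<Rightarrow> 'r"
  assumes ring_R: "ring R" and H: "mat R m n H" and F: "mat R n l F" and K: "mat R k l K"
begin

abbreviation cond where "cond M \<equiv> pp_cond M n m l k H F K"
abbreviation dual where "dual N \<equiv> pp_dual N n m l k H F K"

text \<open>Forwards, \<open>x\<close> pairs to zero with every solution \<open>v = F y\<close> of
  \<open>H\<close>, because the pairing can be moved to \<open>z\<close> paired with
  \<open>K y = 0\<close>; then \<open>x\<close> factors through \<open>H\<close>. Backwards,
  \<open>v\<close> is put into an image by \<open>image_detected\<close>, where the dual condition
  rewrites an annihilating \<open>X\<close> through \<open>H\<close>.\<close>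

theorem cond_iff_dual_cm:
  assumes M: "left_module R M"
  shows "cond M \<longleftrightarrow> dual (cm M)"
proof
  interpret M: left_module R M by fact
  interpret C: left_module "opp R" "cm M" by (rule left_module_cm[OF M])
  assume c: "cond M"
  show "dual (cm M)" unfolding pp_dual_def
  proof (intro allI impI)
    fix x z assume x: "vec (cm M) n x" and z: "vec (cm M) k z"
      and eq: "\<forall>j<l. act (cm M) n (tr F) x j = act (cm M) k (tr K) z j"
    show "\<exists>w. vec (cm M) m w \<and> (\<forall>i<n. x i = act (cm M) m (tr H) w i)"
    proof (rule functional_factors[OF M H x])
      fix v assume v: "vec M n v" "\<And>i. i < m \<Longrightarrow> act M n H v i = \<zero>\<^bsub>M\<^esub>"
      then obtain y where y: "vec M l y" "\<forall>i<k. act M l K y i = \<zero>\<^bsub>M\<^esub>" "\<forall>i<n. v i = act M l F y i"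
        using c unfolding pp_cond_def by blast
      have "(\<Sum>j<n. x j (v j)) = (\<Sum>j<n. x j (act M l F y j))" using y(3) by (intro sum.cong) auto
      also have "\<dots> = (\<Sum>j<l. act (cm M) n (tr F) x j (y j))" by (rule act_adjoint[OF M F x y(1)])
      also have "\<dots> = (\<Sum>j<l. act (cm M) k (tr K) z j (y j))" using eq by (intro sum.cong) auto
      also have "\<dots> = (\<Sum>j<k. z j (act M l K y j))" by (rule act_adjoint[OF M K z y(1), symmetric])
      also have "\<dots> = 0" using y(2) z by (intro sum.neutral) (auto simp: vec_def cm_zero[OF M.abelian_group_M])
      finally show "(\<Sum>j<n. x j (v j)) = 0" .
    qed
  qed
next
  interpret M: left_module R M by fact
  interpret C: left_module "opp R" "cm M" by (rule left_module_cm[OF M])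
  assume d: "dual (cm M)"
  \<comment> \<open>\<open>F\<close> stacked on \<open>K\<close>: the requirements
    \<open>v = F u\<close> and \<open>K u = 0\<close> say that the vector \<open>(v, 0)\<close> lies
    in the image of this one matrix.\<close>
  let ?c = "\<lambda>i j. if i < n then F i j else K (i - n) j"
  have c: "mat R (n + k) l ?c" using F K by (auto simp: mat_def)
  show "cond M" unfolding pp_cond_def
  proof (intro allI impI)
    fix v assume v: "vec M n v" "\<forall>i<m. act M n H v i = \<zero>\<^bsub>M\<^esub>"
    let ?v = "append_vec n v (\<lambda>_. \<zero>\<^bsub>M\<^esub>)"
    have "\<exists>u. vec M l u \<and> (\<forall>i<n + k. ?v i = act M l ?c u i)"
    proof (rule image_detected[OF M c])
      show "vec M (n + k) ?v" using v by (intro vec_append) (auto simp: vec_def)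
    next
      fix X assume X: "vec (cm M) (n + k) X"
        and zero: "\<And>j. j < l \<Longrightarrow> act (cm M) (n + k) (tr ?c) X j = \<zero>\<^bsub>cm M\<^esub>"
      \<comment> \<open>The sign turns the vanishing of the sum of the two blocks into the equation
        between \<open>x\<close> and \<open>z\<close> required by \<open>dual\<close>.\<close>
      define z where "z = (\<lambda>j. \<ominus>\<^bsub>cm M\<^esub> X (n + j))"
      have z0: "vec (cm M) k (\<lambda>j. X (n + j))" and x: "vec (cm M) n X" using X by (auto simp: vec_def)
      then have z: "vec (cm M) k z" unfolding vec_def z_def using C.M.a_inv_closed by blast
      have FT: "mat (opp R) l n (tr F)" and KT: "mat (opp R) l k (tr K)" using mat_tr F K by auto
      have "act (cm M) n (tr F) X j = act (cm M) k (tr K) z j" if j: "j < l" for j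
      proof -
        have "act (cm M) (n + k) (tr ?c) X j =
            act (cm M) n (tr ?c) X j \<oplus>\<^bsub>cm M\<^esub> act (cm M) k (\<lambda>i j. tr ?c i (n + j)) (\<lambda>j. X (n + j)) j"
          using mat_tr[OF c] X j by (intro C.act_append[of l]) auto
        also have "act (cm M) n (tr ?c) X j = act (cm M) n (tr F) X j"
          by (rule act_coeff_cong) (auto simp: tr_def)
        also have "act (cm M) k (\<lambda>i j. tr ?c i (n + j)) (\<lambda>j. X (n + j)) j = act (cm M) k (tr K) (\<lambda>j. X (n + j)) j"
          by (rule act_coeff_cong) (auto simp: tr_def)
        finally have 1: "act (cm M) n (tr F) X j \<oplus>\<^bsub>cm M\<^esub> act (cm M) k (tr K) (\<lambda>j. X (n + j)) j = \<zero>\<^bsub>cm M\<^esub>"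
          using zero[OF j] by (simp only:)
        have 2: "act (cm M) k (tr K) z j = \<ominus>\<^bsub>cm M\<^esub> act (cm M) k (tr K) (\<lambda>j. X (n + j)) j"
          unfolding z_def by (rule C.act_uminus[OF KT z0 j])
        show ?thesis unfolding 2
          by (rule C.M.minus_equality[symmetric, OF 1 C.act_closed[OF KT z0 j] C.act_closed[OF FT x j]])
      qed
      then obtain w where w: "vec (cm M) m w" "\<forall>i<n. X i = act (cm M) m (tr H) w i"
        using d x z unfolding pp_dual_def by blast
      have "(\<Sum>i<n + k. X i (?v i)) = (\<Sum>i<n. X i (v i)) + (\<Sum>i<k. X (n + i) \<zero>\<^bsub>M\<^esub>)"
        unfolding sum_append by simp
      also have "(\<Sum>i<k. X (n + i) \<zero>\<^bsub>M\<^esub>) = 0"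
        using z0 by (intro sum.neutral) (auto simp: vec_def cm_zero[OF M.abelian_group_M])
      also have "(\<Sum>i<n. X i (v i)) = (\<Sum>i<n. act (cm M) m (tr H) w i (v i))" using w(2) by (intro sum.cong) auto
      also have "\<dots> = (\<Sum>i<m. w i (act M n H v i))" by (rule act_adjoint[OF M H w(1) v(1), symmetric])
      also have "\<dots> = 0" using w(1) v(2) by (intro sum.neutral) (auto simp: vec_def cm_zero[OF M.abelian_group_M])
      finally show "(\<Sum>i<n + k. X i (?v i)) = 0" by simp
    qed
    then obtain u where u: "vec M l u" "\<forall>i<n + k. ?v i = act M l ?c u i" by blast
    have "act M l K u i = \<zero>\<^bsub>M\<^esub>" if "i < k" for i
    proof -
      have "\<zero>\<^bsub>M\<^esub> = act M l ?c u (n + i)" using spec[OF u(2), of "n + i"] that by simp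
      also have "\<dots> = act M l K u i" by (rule act_coeff_cong) auto
      finally show ?thesis by simp
    qed
    moreover have "v i = act M l F u i" if "i < n" for i
    proof -
      have "v i = act M l ?c u i" using spec[OF u(2), of i] that by simp
      also have "\<dots> = act M l F u i" using that by (intro act_coeff_cong) auto
      finally show ?thesis .
    qed
    ultimately show "\<exists>y. vec M l y \<and> (\<forall>i<k. act M l K y i = \<zero>\<^bsub>M\<^esub>) \<and> (\<forall>i<n. v i = act M l F y i)"
      using u(1) by blast
  qed
qed

text \<open>The mirror image, with the dual condition imposed on the module and the original one on
  its characters: the two detection principles for linear systems exchange their places.\<close>

theorem dual_iff_cond_cm:
  assumes N: "left_module (opp R) N"
  shows "dual N \<longleftrightarrow> cond (cm N)"
proof
  interpret N: left_module "opp R" N by fact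
  interpret C: left_module R "cm N" using left_module_cm[OF N] by simp
  \<comment> \<open>The block matrix of \<open>tr F\<close> and minus \<open>tr K\<close>: its
    kernel consists of the pairs that satisfy the hypothesis of \<open>dual\<close>. Functionals are
    extended from it with zeros on the last \<open>k\<close> places, which yields
    \<open>K Y = 0\<close>.\<close>
  let ?c = "\<lambda>j i. if i < n then F i j else \<ominus>\<^bsub>R\<^esub> K (i - n) j"
  have FT: "mat (opp R) l n (tr F)" and KT: "mat (opp R) l k (tr K)" and HT: "mat (opp R) n m (tr H)"
    using mat_tr F K H by auto
  assume d: "dual N"
  interpret RR: ring R by (rule ring_R)
  have c: "mat (opp R) l (n + k) ?c" using F K by (auto simp: mat_def)
  show "cond (cm N)" unfolding pp_cond_def
  proof (intro allI impI)
    fix X assume X: "vec (cm N) n X" "\<forall>i<m. act (cm N) n H X i = \<zero>\<^bsub>cm N\<^esub>"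
    let ?X = "append_vec n X (\<lambda>_. \<zero>\<^bsub>cm N\<^esub>)"
    have X': "vec (cm N) (n + k) ?X" using X by (intro vec_append) (auto simp: vec_def simp del: cm_simps)
    have "\<exists>Y. vec (cm N) l Y \<and> (\<forall>j<n + k. ?X j = act (cm N) l (tr ?c) Y j)"
    proof (rule functional_factors[OF N c X'])
      fix v assume v: "vec N (n + k) v" "\<And>i. i < l \<Longrightarrow> act N (n + k) ?c v i = \<zero>\<^bsub>N\<^esub>"
      let ?z = "\<lambda>i. v (n + i)"
      have v1: "vec N n v" and v2: "vec N k ?z" using v by (auto simp: vec_def)
      have "act N n (tr F) v j = act N k (tr K) ?z j" if j: "j < l" for j
      proof -
        have "act N (n + k) ?c v j = act N n ?c v j \<oplus>\<^bsub>N\<^esub> act N k (\<lambda>j i. ?c j (n + i)) ?z j"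
          using c v(1) j by (intro N.act_append[of l]) auto
        also have "act N n ?c v j = act N n (tr F) v j" by (rule act_coeff_cong) (auto simp: tr_def)
        also have "act N k (\<lambda>j i. ?c j (n + i)) ?z j = act N k (\<lambda>i j. \<ominus>\<^bsub>opp R\<^esub> tr K i j) ?z j"
          by (rule act_coeff_cong) (auto simp: tr_def)
        also have "\<dots> = \<ominus>\<^bsub>N\<^esub> act N k (tr K) ?z j" by (rule N.act_coeff_uminus[OF KT v2 j])
        finally have "act N n (tr F) v j \<oplus>\<^bsub>N\<^esub> \<ominus>\<^bsub>N\<^esub> act N k (tr K) ?z j = \<zero>\<^bsub>N\<^esub>" using v(2)[OF j] by simp
        then show ?thesis using N.eq_of_add_uminus[OF N.act_closed[OF FT v1 j] N.act_closed[OF KT v2 j]] by simp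
      qed
      then obtain w where w: "vec N m w" "\<forall>i<n. v i = act N m (tr H) w i"
        using d v1 v2 unfolding pp_dual_def by blast
      have "(\<Sum>j<n + k. ?X j (v j)) = (\<Sum>j<n. X j (v j)) + (\<Sum>j<k. \<zero>\<^bsub>cm N\<^esub> (?z j))"
        unfolding sum_append by simp
      also have "(\<Sum>j<k. \<zero>\<^bsub>cm N\<^esub> (?z j)) = 0" using v2 by (intro sum.neutral) (auto simp: vec_def)
      also have "(\<Sum>j<n. X j (v j)) = (\<Sum>j<n. X j (act N m (tr H) w j))" using w(2) by (intro sum.cong) auto
      also have "\<dots> = (\<Sum>j<m. act (cm N) n H X j (w j))" using act_adjoint[OF N HT X(1) w(1)] by simp
      also have "\<dots> = 0" using w(1) X(2) by (intro sum.neutral) (auto simp: vec_def)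
      finally show "(\<Sum>j<n + k. ?X j (v j)) = 0" by (simp only: add_0_left)
    qed
    then obtain Y where Y: "vec (cm N) l Y" "\<forall>j<n + k. ?X j = act (cm N) l (tr ?c) Y j" by blast
    have "act (cm N) l K Y i = \<zero>\<^bsub>cm N\<^esub>" if "i < k" for i
    proof -
      have "\<zero>\<^bsub>cm N\<^esub> = act (cm N) l (tr ?c) Y (n + i)" using spec[OF Y(2), of "n + i"] that by simp
      also have "\<dots> = act (cm N) l (\<lambda>i j. \<ominus>\<^bsub>R\<^esub> K i j) Y i" by (rule act_coeff_cong) (auto simp: tr_def)
      also have "\<dots> = \<ominus>\<^bsub>cm N\<^esub> act (cm N) l K Y i" by (rule C.act_coeff_uminus[OF K Y(1) that])
      finally show ?thesis using C.act_closed[OF K Y(1) that]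
        by (metis C.M.minus_minus C.M.uminus_zero)
    qed
    moreover have "X i = act (cm N) l F Y i" if "i < n" for i
    proof -
      have "X i = act (cm N) l (tr ?c) Y i" using spec[OF Y(2), of i] that by simp
      also have "\<dots> = act (cm N) l F Y i" using that by (intro act_coeff_cong) (auto simp: tr_def)
      finally show ?thesis .
    qed
    ultimately show "\<exists>y. vec (cm N) l y \<and> (\<forall>i<k. act (cm N) l K y i = \<zero>\<^bsub>cm N\<^esub>) \<and> (\<forall>i<n. X i = act (cm N) l F y i)"
      using Y(1) by blast
  qed
next
  interpret N: left_module "opp R" N by fact
  interpret C: left_module R "cm N" using left_module_cm[OF N] by simp
  have FT: "mat (opp R) l n (tr F)" and KT: "mat (opp R) l k (tr K)" and HT: "mat (opp R) n m (tr H)"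
    using mat_tr F K H by auto
  assume c: "cond (cm N)"
  show "dual N" unfolding pp_dual_def
  proof (intro allI impI)
    fix x z assume x: "vec N n x" and z: "vec N k z" and eq: "\<forall>j<l. act N n (tr F) x j = act N k (tr K) z j"
    show "\<exists>w. vec N m w \<and> (\<forall>i<n. x i = act N m (tr H) w i)"
    proof (rule image_detected[OF N HT x])
      fix X assume X: "vec (cm N) n X" "\<And>j. j < m \<Longrightarrow> act (cm N) n (tr (tr H)) X j = \<zero>\<^bsub>cm N\<^esub>"
      then obtain Y where Y: "vec (cm N) l Y" "\<forall>i<k. act (cm N) l K Y i = \<zero>\<^bsub>cm N\<^esub>" "\<forall>i<n. X i = act (cm N) l F Y i"
        using c unfolding pp_cond_def by auto
      have "(\<Sum>i<n. X i (x i)) = (\<Sum>i<n. act (cm N) l F Y i (x i))" using Y(3) by (intro sum.cong) auto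
      also have "\<dots> = (\<Sum>j<l. Y j (act N n (tr F) x j))" using act_adjoint[OF N FT Y(1) x] by simp
      also have "\<dots> = (\<Sum>j<l. Y j (act N k (tr K) z j))" using eq by (intro sum.cong) auto
      also have "\<dots> = (\<Sum>j<k. act (cm N) l K Y j (z j))" using act_adjoint[OF N KT Y(1) z] by simp
      also have "\<dots> = 0" using Y(2) z by (intro sum.neutral) (auto simp: vec_def)
      finally show "(\<Sum>i<n. X i (x i)) = 0" .
    qed
  qed
qed

end

subsection \<open>Finite presentations by generators and relations\<close>

definition lin :: "('r, 'a) module \<Rightarrow> nat \<Rightarrow> (nat \<Rightarrow> 'r) \<Rightarrow> (nat \<Rightarrow> 'a) \<Rightarrow> 'a" where
  "lin M n r x = msum M (\<lambda>j. r j \<odot>\<^bsub>M\<^esub> x j) n"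

definition coeffs :: "'r ring \<Rightarrow> nat \<Rightarrow> (nat \<Rightarrow> 'r) \<Rightarrow> bool" where
  "coeffs R n r \<longleftrightarrow> (\<forall>j<n. r j \<in> carrier R)"

lemma act_eq_lin: "act M n c x i = lin M n (c i) x"
  by (simp add: act_def lin_def)

lemma mat_coeffs: "mat R m n c \<Longrightarrow> i < m \<Longrightarrow> coeffs R n (c i)"
  by (simp add: mat_def coeffs_def)

lemma lin_cong: "(\<And>j. j < n \<Longrightarrow> r j = s j) \<Longrightarrow> (\<And>j. j < n \<Longrightarrow> x j = y j) \<Longrightarrow> lin M n r x = lin M n s y"
  unfolding lin_def by (rule msum_cong) simp

lemma lin_hom:
  assumes "left_module R M" "left_module R N" "h \<in> mhom R M N" "coeffs R n r" "vec M n x"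
  shows "h (lin M n r x) = lin N n r (\<lambda>j. h (x j))"
  using act_hom[OF assms(1-3), of 1 n "\<lambda>_. r" x 0] assms(4,5) by (simp add: act_eq_lin mat_def coeffs_def)

context left_module
begin

lemma lin_closed: "coeffs R n r \<Longrightarrow> vec M n x \<Longrightarrow> lin M n r x \<in> carrier M"
  unfolding lin_def coeffs_def vec_def by auto

lemma lin_add:
  "coeffs R n r \<Longrightarrow> coeffs R n s \<Longrightarrow> vec M n x \<Longrightarrow> lin M n (\<lambda>j. r j \<oplus>\<^bsub>R\<^esub> s j) x = lin M n r x \<oplus>\<^bsub>M\<^esub> lin M n s x"
  unfolding lin_def coeffs_def vec_def
  by (subst M.msum_add[symmetric]) (auto simp: smult_l_distr intro!: msum_cong)

lemma lin_uminus:
  "coeffs R n r \<Longrightarrow> vec M n x \<Longrightarrow> lin M n (\<lambda>j. \<ominus>\<^bsub>R\<^esub> r j) x = \<ominus>\<^bsub>M\<^esub> lin M n r x"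
  unfolding lin_def coeffs_def vec_def
  by (subst M.msum_uminus[symmetric]) (auto simp: uminus_smult intro!: msum_cong)

lemma lin_smult:
  "t \<in> carrier R \<Longrightarrow> coeffs R n r \<Longrightarrow> vec M n x \<Longrightarrow> lin M n (\<lambda>j. t \<otimes>\<^bsub>R\<^esub> r j) x = t \<odot>\<^bsub>M\<^esub> lin M n r x"
  unfolding lin_def coeffs_def vec_def
  by (subst smult_msum) (auto simp: smult_assoc intro!: msum_cong)

lemma lin_matrix:
  assumes "mat R m n c" "coeffs R m s" "vec M n x"
  shows "lin M n (\<lambda>j. msum R (\<lambda>i. s i \<otimes>\<^bsub>R\<^esub> c i j) m) x = lin M m s (act M n c x)"
proof -
  have "lin M n (\<lambda>j. msum R (\<lambda>i. s i \<otimes>\<^bsub>R\<^esub> c i j) m) x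
      = msum M (\<lambda>j. msum M (\<lambda>i. s i \<odot>\<^bsub>M\<^esub> (c i j \<odot>\<^bsub>M\<^esub> x j)) m) n"
    unfolding lin_def
  proof (rule msum_cong)
    fix j assume "j < n"
    then show "msum R (\<lambda>i. s i \<otimes>\<^bsub>R\<^esub> c i j) m \<odot>\<^bsub>M\<^esub> x j = msum M (\<lambda>i. s i \<odot>\<^bsub>M\<^esub> (c i j \<odot>\<^bsub>M\<^esub> x j)) m"
      using assms by (subst msum_smult) (auto simp: mat_def coeffs_def vec_def smult_assoc intro!: msum_cong)
  qed
  also have "\<dots> = msum M (\<lambda>i. msum M (\<lambda>j. s i \<odot>\<^bsub>M\<^esub> (c i j \<odot>\<^bsub>M\<^esub> x j)) n) m"
    using assms by (intro M.msum_swap) (auto simp: mat_def coeffs_def vec_def)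
  also have "\<dots> = lin M m s (act M n c x)"
    unfolding lin_def act_def
    using assms by (intro msum_cong) (auto simp: mat_def coeffs_def vec_def smult_msum)
  finally show ?thesis .
qed

end

text \<open>Generators \<open>\<alpha>\<close> with relations given by the rows of \<open>H\<close>;
  the last clause says that these rows generate all relations. In this form homomorphisms out of
  \<open>A\<close> are the solutions of \<open>H\<close> in the target.\<close>

definition presents :: "'r ring \<Rightarrow> ('r, 'a) module \<Rightarrow> nat \<Rightarrow> (nat \<Rightarrow> 'a) \<Rightarrow> nat \<Rightarrow> (nat \<Rightarrow> nat \<Rightarrow> 'r) \<Rightarrow> bool" where
  "presents R A n \<alpha> m H \<longleftrightarrow> left_module R A \<and> mat R m n H \<and> vec A n \<alpha> \<and>
     (\<forall>a\<in>carrier A. \<exists>r. coeffs R n r \<and> a = lin A n r \<alpha>) \<and>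
     (\<forall>i<m. lin A n (H i) \<alpha> = \<zero>\<^bsub>A\<^esub>) \<and>
     (\<forall>r. coeffs R n r \<longrightarrow> lin A n r \<alpha> = \<zero>\<^bsub>A\<^esub> \<longrightarrow>
        (\<exists>s. coeffs R m s \<and> (\<forall>j<n. r j = msum R (\<lambda>i. s i \<otimes>\<^bsub>R\<^esub> H i j) m)))"

context
  fixes R :: "'r ring" and A :: "('r, 'a) module" and n \<alpha> m H
  assumes pres: "presents R A n \<alpha> m H"
begin

interpretation A: left_module R A using pres by (simp add: presents_def)

lemma presents_solution:
  assumes "left_module R M" "g \<in> mhom R A M"
  shows "vec M n (\<lambda>j. g (\<alpha> j))" "i < m \<Longrightarrow> act M n H (\<lambda>j. g (\<alpha> j)) i = \<zero>\<^bsub>M\<^esub>"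
proof -
  have \<alpha>: "vec A n \<alpha>" and H: "mat R m n H" using pres by (auto simp: presents_def)
  show "vec M n (\<lambda>j. g (\<alpha> j))" using \<alpha> assms(2) by (auto simp: vec_def mhom_closed)
  show "act M n H (\<lambda>j. g (\<alpha> j)) i = \<zero>\<^bsub>M\<^esub>" if "i < m"
  proof -
    have "act M n H (\<lambda>j. g (\<alpha> j)) i = g (act A n H \<alpha> i)"
      using act_hom[OF A.left_module_axioms assms H \<alpha> that] by simp
    also have "act A n H \<alpha> i = \<zero>\<^bsub>A\<^esub>" using pres that by (simp add: presents_def act_eq_lin)
    also have "g \<zero>\<^bsub>A\<^esub> = \<zero>\<^bsub>M\<^esub>"
      using mhom_zero[OF A.abelian_group_M left_module.abelian_group_M[OF assms(1)] assms(2)] .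
    finally show ?thesis .
  qed
qed

lemma presents_unique:
  assumes "left_module R M" "g \<in> mhom R A M" "h \<in> mhom R A M" "\<And>j. j < n \<Longrightarrow> g (\<alpha> j) = h (\<alpha> j)"
  shows "g = h"
proof (rule mhom_eqI[OF assms(2,3)])
  fix a assume "a \<in> carrier A"
  then obtain r where r: "coeffs R n r" "a = lin A n r \<alpha>" using pres unfolding presents_def by blast
  have \<alpha>: "vec A n \<alpha>" using pres by (simp add: presents_def)
  have "lin M n r (\<lambda>j. g (\<alpha> j)) = lin M n r (\<lambda>j. h (\<alpha> j))" using assms(4) by (intro lin_cong) auto
  then show "g a = h a"
    unfolding r(2) lin_hom[OF A.left_module_axioms assms(1,2) r(1) \<alpha>] lin_hom[OF A.left_module_axioms assms(1,3) r(1) \<alpha>] .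
qed

text \<open>A solution of \<open>H\<close> satisfies every relation between the generators, these
  being combinations of rows. Hence the value of a linear combination at \<open>x\<close> depends
  only on the element of \<open>A\<close> that it represents.\<close>

lemma presents_hom:
  assumes M: "left_module R M" and x: "vec M n x" and sol: "\<And>i. i < m \<Longrightarrow> act M n H x i = \<zero>\<^bsub>M\<^esub>"
  shows "\<exists>g\<in>mhom R A M. \<forall>j<n. g (\<alpha> j) = x j"
proof -
  interpret M: left_module R M by fact
  have H: "mat R m n H" and \<alpha>: "vec A n \<alpha>" using pres by (auto simp: presents_def)
  define rep where "rep a = (SOME r. coeffs R n r \<and> a = lin A n r \<alpha>)" for a
  have rep: "coeffs R n (rep a)" "a = lin A n (rep a) \<alpha>" if "a \<in> carrier A" for a
    using pres that someI_ex[of "\<lambda>r. coeffs R n r \<and> a = lin A n r \<alpha>"] unfolding presents_def rep_def by blast+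
  have zero: "lin M n r x = \<zero>\<^bsub>M\<^esub>" if r: "coeffs R n r" "lin A n r \<alpha> = \<zero>\<^bsub>A\<^esub>" for r
  proof -
    obtain s where s: "coeffs R m s" "\<And>j. j < n \<Longrightarrow> r j = msum R (\<lambda>i. s i \<otimes>\<^bsub>R\<^esub> H i j) m"
      using pres r unfolding presents_def by blast
    have "lin M n r x = lin M n (\<lambda>j. msum R (\<lambda>i. s i \<otimes>\<^bsub>R\<^esub> H i j) m) x" using s(2) by (intro lin_cong) auto
    also have "\<dots> = lin M m s (act M n H x)" by (rule M.lin_matrix[OF H s(1) x])
    also have "\<dots> = \<zero>\<^bsub>M\<^esub>" unfolding lin_def using sol s(1) by (intro M.M.msum_zero') (auto simp: coeffs_def)
    finally show ?thesis .
  qed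
  have wd: "lin M n r x = lin M n s x" if rs: "coeffs R n r" "coeffs R n s" "lin A n r \<alpha> = lin A n s \<alpha>" for r s
  proof -
    have s': "coeffs R n (\<lambda>j. \<ominus>\<^bsub>R\<^esub> s j)" using rs by (simp add: coeffs_def)
    have d: "coeffs R n (\<lambda>j. r j \<oplus>\<^bsub>R\<^esub> \<ominus>\<^bsub>R\<^esub> s j)" using rs by (simp add: coeffs_def)
    have "lin A n (\<lambda>j. r j \<oplus>\<^bsub>R\<^esub> \<ominus>\<^bsub>R\<^esub> s j) \<alpha> = \<zero>\<^bsub>A\<^esub>"
      using rs A.lin_add[OF rs(1) s' \<alpha>] A.lin_uminus[OF rs(2) \<alpha>] A.lin_closed[OF rs(2) \<alpha>] by (simp add: A.M.r_neg)
    then have "lin M n (\<lambda>j. r j \<oplus>\<^bsub>R\<^esub> \<ominus>\<^bsub>R\<^esub> s j) x = \<zero>\<^bsub>M\<^esub>" by (rule zero[OF d])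
    then show ?thesis
      using M.lin_add[OF rs(1) s' x] M.lin_uminus[OF rs(2) x] M.eq_of_add_uminus[OF M.lin_closed[OF rs(1) x] M.lin_closed[OF rs(2) x]]
      by simp
  qed
  define g where "g = (\<lambda>a\<in>carrier A. lin M n (rep a) x)"
  have g: "g (lin A n r \<alpha>) = lin M n r x" if "coeffs R n r" for r
    using wd[OF rep(1) that] rep(2) A.lin_closed[OF that \<alpha>] unfolding g_def by simp
  have "g \<in> mhom R A M"
  proof (rule mhomI)
    show "g \<in> extensional (carrier A)" by (simp add: g_def)
    show "g a \<in> carrier M" if "a \<in> carrier A" for a using M.lin_closed[OF rep(1)[OF that] x] that by (simp add: g_def)
    show "g (a \<oplus>\<^bsub>A\<^esub> b) = g a \<oplus>\<^bsub>M\<^esub> g b" if "a \<in> carrier A" "b \<in> carrier A" for a b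
    proof -
      note ra = rep[OF that(1)] and rb = rep[OF that(2)]
      have s: "coeffs R n (\<lambda>j. rep a j \<oplus>\<^bsub>R\<^esub> rep b j)" using ra rb by (simp add: coeffs_def)
      have "a \<oplus>\<^bsub>A\<^esub> b = lin A n (\<lambda>j. rep a j \<oplus>\<^bsub>R\<^esub> rep b j) \<alpha>"
        using A.lin_add[OF ra(1) rb(1) \<alpha>] ra(2) rb(2) by simp
      then have "g (a \<oplus>\<^bsub>A\<^esub> b) = lin M n (\<lambda>j. rep a j \<oplus>\<^bsub>R\<^esub> rep b j) x" using g[OF s] by simp
      then show ?thesis using M.lin_add[OF ra(1) rb(1) x] that by (simp add: g_def)
    qed
    show "g (t \<odot>\<^bsub>A\<^esub> a) = t \<odot>\<^bsub>M\<^esub> g a" if "t \<in> carrier R" "a \<in> carrier A" for t a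
    proof -
      note ra = rep[OF that(2)]
      have s: "coeffs R n (\<lambda>j. t \<otimes>\<^bsub>R\<^esub> rep a j)" using ra that by (simp add: coeffs_def)
      have "t \<odot>\<^bsub>A\<^esub> a = lin A n (\<lambda>j. t \<otimes>\<^bsub>R\<^esub> rep a j) \<alpha>"
        using A.lin_smult[OF that(1) ra(1) \<alpha>] ra(2) by simp
      then have "g (t \<odot>\<^bsub>A\<^esub> a) = lin M n (\<lambda>j. t \<otimes>\<^bsub>R\<^esub> rep a j) x" using g[OF s] by simp
      then show ?thesis using M.lin_smult[OF that(1) ra(1) x] that by (simp add: g_def)
    qed
  qed
  moreover have "g (\<alpha> j) = x j" if j: "j < n" for j
  proof -
    let ?\<delta> = "\<lambda>i. if i = j then \<one>\<^bsub>R\<^esub> else \<zero>\<^bsub>R\<^esub>"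
    have \<delta>: "coeffs R n ?\<delta>" by (simp add: coeffs_def)
    have "lin A n ?\<delta> \<alpha> = \<alpha> j" using A.act_delta[OF \<alpha> j] by (simp add: act_eq_lin)
    moreover have "lin M n ?\<delta> x = x j" using M.act_delta[OF x j] by (simp add: act_eq_lin)
    ultimately show ?thesis using g[OF \<delta>] by simp
  qed
  ultimately show ?thesis by blast
qed

end

section \<open>Free modules and presentations by matrices\<close>

definition reg :: "'r ring \<Rightarrow> ('r, 'r) module" where
  "reg R = mk_module (carrier R) \<zero>\<^bsub>R\<^esub> (add R) (monoid.mult R)"

lemma reg_simps [simp]:
  "carrier (reg R) = carrier R" "\<zero>\<^bsub>reg R\<^esub> = \<zero>\<^bsub>R\<^esub>" "x \<oplus>\<^bsub>reg R\<^esub> y = x \<oplus>\<^bsub>R\<^esub> y" "r \<odot>\<^bsub>reg R\<^esub> x = r \<otimes>\<^bsub>R\<^esub> x"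
  by (simp_all add: reg_def)

lemma msum_reg: "msum (reg R) f n = msum R f n"
  by (induction n) auto

lemma left_module_reg: "ring R \<Longrightarrow> left_module R (reg R)"
proof -
  assume "ring R"
  then interpret ring R .
  show ?thesis unfolding reg_def
  proof (rule left_module_mk)
    show "\<exists>y\<in>carrier R. y \<oplus>\<^bsub>R\<^esub> x = \<zero>\<^bsub>R\<^esub>" if "x \<in> carrier R" for x
      using that by (intro bexI[of _ "\<ominus>\<^bsub>R\<^esub> x"]) (auto simp: l_neg)
  qed (auto simp: ring_axioms a_ac l_distr r_distr m_assoc)
qed

lemma free_module_eq: "free_module R n = prod_module {..<n} (\<lambda>_. reg R)"
  by (simp add: free_module_def reg_def)

lemma left_module_free: "ring R \<Longrightarrow> left_module R (free_module R n)"
  unfolding free_module_eq by (intro left_module_prod left_module_reg)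

definition unit_row :: "'r ring \<Rightarrow> nat \<Rightarrow> nat \<Rightarrow> nat \<Rightarrow> 'r" where
  "unit_row R n j = (\<lambda>i\<in>{..<n}. if i = j then \<one>\<^bsub>R\<^esub> else \<zero>\<^bsub>R\<^esub>)"

lemma free_carrier: "v \<in> carrier (free_module R n) \<longleftrightarrow> coeffs R n v \<and> v \<in> extensional {..<n}"
  by (auto simp: free_module_eq coeffs_def PiE_iff)

lemma vec_unit_row: "ring R \<Longrightarrow> vec (free_module R n) n (unit_row R n)"
proof -
  assume "ring R"
  then interpret ring R .
  show ?thesis by (auto simp: vec_def free_carrier coeffs_def unit_row_def)
qed

lemma lin_unit_row:
  assumes "ring R" "coeffs R n r"
  shows "lin (free_module R n) n r (unit_row R n) = restrict r {..<n}"
proof -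
  interpret ring R by fact
  interpret F: left_module R "free_module R n" by (rule left_module_free[OF assms(1)])
  interpret L: left_module R "reg R" by (rule left_module_reg[OF assms(1)])
  have c: "lin (free_module R n) n r (unit_row R n) \<in> carrier (free_module R n)"
    by (rule F.lin_closed[OF assms(2) vec_unit_row[OF assms(1)]])
  show ?thesis
  proof (rule extensionalityI[where A = "{..<n}"])
    show "lin (free_module R n) n r (unit_row R n) \<in> extensional {..<n}" using c by (simp add: free_carrier)
    fix i assume i: "i \<in> {..<n}"
    have "lin (free_module R n) n r (unit_row R n) i
        = msum (reg R) (\<lambda>j. (r j \<odot>\<^bsub>free_module R n\<^esub> unit_row R n j) i) n"
      using i unfolding lin_def free_module_eq by (simp add: msum_prod)
    also have "\<dots> = msum (reg R) (\<lambda>j. if j = i then r i else \<zero>\<^bsub>reg R\<^esub>) n"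
      using i assms(2) by (intro msum_cong) (auto simp: free_module_eq unit_row_def coeffs_def)
    also have "\<dots> = r i" using i assms(2) by (intro L.M.msum_delta) (auto simp: coeffs_def)
    finally show "lin (free_module R n) n r (unit_row R n) i = restrict r {..<n} i" using i by simp
  qed simp
qed

lemma presents_free:
  assumes "ring R"
  shows "presents R (free_module R n) n (unit_row R n) 0 H"
proof -
  interpret ring R by fact
  have "\<exists>r. coeffs R n r \<and> a = lin (free_module R n) n r (unit_row R n)" if "a \<in> carrier (free_module R n)" for a
    using that lin_unit_row[OF assms, of n a] by (intro exI[of _ a]) (auto simp: free_carrier extensional_restrict)
  moreover have "\<exists>s. coeffs R 0 s \<and> (\<forall>j<n. r j = msum R (\<lambda>i. s i \<otimes>\<^bsub>R\<^esub> H i j) 0)"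
    if r: "coeffs R n r" "lin (free_module R n) n r (unit_row R n) = \<zero>\<^bsub>free_module R n\<^esub>" for r
  proof -
    have eq: "restrict r {..<n} = (\<lambda>i\<in>{..<n}. \<zero>\<^bsub>R\<^esub>)" using r lin_unit_row[OF assms r(1)] by (simp add: free_module_eq)
    have "r j = \<zero>\<^bsub>R\<^esub>" if "j < n" for j using fun_cong[OF eq, of j] that by simp
    then show ?thesis by (auto simp: coeffs_def)
  qed
  ultimately show ?thesis
    unfolding presents_def using left_module_free[OF assms] vec_unit_row[OF assms] by (auto simp: mat_def)
qed

text \<open>The generators are the images of the unit rows under \<open>p\<close>, and the rows of
  the relation matrix are their images under \<open>g\<close>; exactness says that the relations are
  the combinations of these rows.\<close>

lemma presents_of_maps:
  assumes R: "ring R" and A: "left_module R A"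
    and g: "g \<in> mhom R (free_module R m) (free_module R n)" and p: "p \<in> mhom R (free_module R n) A"
    and surj: "p ` carrier (free_module R n) = carrier A"
    and ker: "g ` carrier (free_module R m) = {x \<in> carrier (free_module R n). p x = \<zero>\<^bsub>A\<^esub>}"
  shows "presents R A n (\<lambda>j. p (unit_row R n j)) m (\<lambda>i. g (unit_row R m i))"
proof -
  interpret A: left_module R A by fact
  note F = left_module_free[OF R] and e = vec_unit_row[OF R]
  have gm: "mat R m n (\<lambda>i. g (unit_row R m i))"
    using mhom_closed[OF g] e[of m] by (auto simp: mat_def vec_def free_carrier coeffs_def)
  have lp: "p (restrict r {..<n}) = lin A n r (\<lambda>j. p (unit_row R n j))" if "coeffs R n r" for r
    using lin_hom[OF F A p that e] lin_unit_row[OF R that] by simp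
  show ?thesis unfolding presents_def
  proof (intro conjI ballI allI impI)
    show "left_module R A" by fact
    show "mat R m n (\<lambda>i. g (unit_row R m i))" by fact
    show "vec A n (\<lambda>j. p (unit_row R n j))" using mhom_closed[OF p] e[of n] by (auto simp: vec_def)
  next
    fix a assume "a \<in> carrier A"
    then obtain v where v: "v \<in> carrier (free_module R n)" "a = p v" using surj by blast
    then show "\<exists>r. coeffs R n r \<and> a = lin A n r (\<lambda>j. p (unit_row R n j))"
      using lp[of v] by (intro exI[of _ v]) (auto simp: free_carrier extensional_restrict)
  next
    fix i assume i: "i < m"
    have v: "g (unit_row R m i) \<in> {x \<in> carrier (free_module R n). p x = \<zero>\<^bsub>A\<^esub>}"
      using ker e[of m] i unfolding vec_def by blast
    then show "lin A n (g (unit_row R m i)) (\<lambda>j. p (unit_row R n j)) = \<zero>\<^bsub>A\<^esub>"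
      using lp[of "g (unit_row R m i)"] by (auto simp: free_carrier extensional_restrict)
  next
    fix r assume r: "coeffs R n r" "lin A n r (\<lambda>j. p (unit_row R n j)) = \<zero>\<^bsub>A\<^esub>"
    have "restrict r {..<n} \<in> carrier (free_module R n)" using r(1) by (auto simp: free_carrier coeffs_def)
    then have "restrict r {..<n} \<in> g ` carrier (free_module R m)" using ker lp[OF r(1)] r(2) by simp
    then obtain s where s: "s \<in> carrier (free_module R m)" "restrict r {..<n} = g s" by blast
    then have cs: "coeffs R m s" "restrict s {..<m} = s" by (auto simp: free_carrier extensional_restrict)
    have gs: "g s = lin (free_module R n) m s (\<lambda>i. g (unit_row R m i))"
      using lin_hom[OF F F g cs(1) e] lin_unit_row[OF R cs(1)] cs(2) by simp
    have "r j = msum R (\<lambda>i. s i \<otimes>\<^bsub>R\<^esub> g (unit_row R m i) j) m" if j: "j < n" for j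
    proof -
      have "r j = g s j" using fun_cong[OF s(2), of j] j by simp
      also have "\<dots> = msum (reg R) (\<lambda>i. (s i \<odot>\<^bsub>free_module R n\<^esub> g (unit_row R m i)) j) m"
        unfolding gs lin_def using j by (simp add: free_module_eq msum_prod)
      also have "\<dots> = msum (reg R) (\<lambda>i. s i \<otimes>\<^bsub>R\<^esub> g (unit_row R m i) j) m"
        using j by (intro msum_cong) (simp add: free_module_eq)
      also have "\<dots> = msum R (\<lambda>i. s i \<otimes>\<^bsub>R\<^esub> g (unit_row R m i) j) m"
        by (rule msum_reg)
      finally show ?thesis .
    qed
    then show "\<exists>s. coeffs R m s \<and> (\<forall>j<n. r j = msum R (\<lambda>i. s i \<otimes>\<^bsub>R\<^esub> g (unit_row R m i) j) m)" using cs by blast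
  qed
qed

lemma finitely_presented_presents:
  assumes "left_module R A" "finitely_presented R A"
  shows "\<exists>n \<alpha> m H. presents R A n \<alpha> m H"
proof -
  obtain m n g p where "g \<in> mhom R (free_module R m) (free_module R n)" "p \<in> mhom R (free_module R n) A"
    "p ` carrier (free_module R n) = carrier A"
    "g ` carrier (free_module R m) = {x \<in> carrier (free_module R n). p x = \<zero>\<^bsub>A\<^esub>}"
    using assms(2) unfolding finitely_presented_def by (elim exE bexE conjE)
  from presents_of_maps[OF left_module.ring_R[OF assms(1)] assms(1) this] show ?thesis by (intro exI)
qed

section \<open>Realising matrices by modules and morphisms of the universe\<close>

lemma presents_cong:
  assumes "presents R A n \<alpha> m H" "\<And>i j. i < m \<Longrightarrow> j < n \<Longrightarrow> H i j = H' i j"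
  shows "presents R A n \<alpha> m H'"
proof -
  have "lin A n (H' i) \<alpha> = lin A n (H i) \<alpha>" if "i < m" for i using assms(2) that by (intro lin_cong) auto
  moreover have "msum R (\<lambda>i. s i \<otimes>\<^bsub>R\<^esub> H' i j) m = msum R (\<lambda>i. s i \<otimes>\<^bsub>R\<^esub> H i j) m" if "j < n" for s j
    using assms(2) that by (intro msum_cong) auto
  ultimately show ?thesis using assms unfolding presents_def mat_def by simp
qed

text \<open>The quotient is carried by chosen representatives instead of cosets: it stays in the
  type of \<open>F\<close>, and the inclusion of carriers bounds its size.\<close>

lemma quotient_module:
  assumes F: "left_module R F" and B: "B \<subseteq> carrier F" "\<zero>\<^bsub>F\<^esub> \<in> B"
    "\<And>x y. x \<in> B \<Longrightarrow> y \<in> B \<Longrightarrow> x \<oplus>\<^bsub>F\<^esub> y \<in> B" "\<And>r x. r \<in> carrier R \<Longrightarrow> x \<in> B \<Longrightarrow> r \<odot>\<^bsub>F\<^esub> x \<in> B"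
  shows "\<exists>(Q :: ('r, 'a) module) p. left_module R Q \<and> p \<in> mhom R F Q \<and> p ` carrier F = carrier Q \<and>
    carrier Q \<subseteq> carrier F \<and> (\<forall>x\<in>carrier F. p x = \<zero>\<^bsub>Q\<^esub> \<longleftrightarrow> x \<in> B)"
proof -
  interpret F: left_module R F by fact
  have neg: "\<ominus>\<^bsub>F\<^esub> x \<in> B" if "x \<in> B" for x
  proof -
    have x: "x \<in> carrier F" using that B(1) by blast
    have "(\<ominus>\<^bsub>R\<^esub> \<one>\<^bsub>R\<^esub>) \<odot>\<^bsub>F\<^esub> x \<in> B" using that B(4) by simp
    then show ?thesis using x by (simp add: F.uminus_smult F.smult_one)
  qed
  define E where "E x y \<longleftrightarrow> x \<oplus>\<^bsub>F\<^esub> \<ominus>\<^bsub>F\<^esub> y \<in> B" for x y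
  have Erefl: "E x x" if "x \<in> carrier F" for x using that B(2) by (simp add: E_def F.M.r_neg)
  have Esym: "E y x" if "E x y" "x \<in> carrier F" "y \<in> carrier F" for x y
    using neg[of "x \<oplus>\<^bsub>F\<^esub> \<ominus>\<^bsub>F\<^esub> y"] that by (simp add: E_def F.M.minus_add F.M.a_comm)
  have Etrans: "E x z" if "E x y" "E y z" "x \<in> carrier F" "y \<in> carrier F" "z \<in> carrier F" for x y z
  proof -
    have "(x \<oplus>\<^bsub>F\<^esub> \<ominus>\<^bsub>F\<^esub> y) \<oplus>\<^bsub>F\<^esub> (y \<oplus>\<^bsub>F\<^esub> \<ominus>\<^bsub>F\<^esub> z) \<in> B" using that B(3) by (simp add: E_def)
    moreover have "(x \<oplus>\<^bsub>F\<^esub> \<ominus>\<^bsub>F\<^esub> y) \<oplus>\<^bsub>F\<^esub> (y \<oplus>\<^bsub>F\<^esub> \<ominus>\<^bsub>F\<^esub> z) = x \<oplus>\<^bsub>F\<^esub> \<ominus>\<^bsub>F\<^esub> z"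
      using that by (simp add: F.M.a_assoc F.M.r_neg1)
    ultimately show ?thesis by (simp add: E_def)
  qed
  have Eadd: "E (x \<oplus>\<^bsub>F\<^esub> x') (y \<oplus>\<^bsub>F\<^esub> y')"
    if "E x y" "E x' y'" "x \<in> carrier F" "y \<in> carrier F" "x' \<in> carrier F" "y' \<in> carrier F" for x y x' y'
  proof -
    have "(x \<oplus>\<^bsub>F\<^esub> \<ominus>\<^bsub>F\<^esub> y) \<oplus>\<^bsub>F\<^esub> (x' \<oplus>\<^bsub>F\<^esub> \<ominus>\<^bsub>F\<^esub> y') \<in> B" using that B(3) by (simp add: E_def)
    moreover have "(x \<oplus>\<^bsub>F\<^esub> \<ominus>\<^bsub>F\<^esub> y) \<oplus>\<^bsub>F\<^esub> (x' \<oplus>\<^bsub>F\<^esub> \<ominus>\<^bsub>F\<^esub> y') = (x \<oplus>\<^bsub>F\<^esub> x') \<oplus>\<^bsub>F\<^esub> \<ominus>\<^bsub>F\<^esub> (y \<oplus>\<^bsub>F\<^esub> y')"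
      using that by (simp add: F.M.minus_add F.M.a_ac)
    ultimately show ?thesis by (simp add: E_def)
  qed
  have Esm: "E (r \<odot>\<^bsub>F\<^esub> x) (r \<odot>\<^bsub>F\<^esub> y)" if "E x y" "r \<in> carrier R" "x \<in> carrier F" "y \<in> carrier F" for r x y
    using B(4)[of r "x \<oplus>\<^bsub>F\<^esub> \<ominus>\<^bsub>F\<^esub> y"] that by (simp add: E_def F.smult_r_distr F.smult_uminus)
  define rep where "rep x = (SOME y. y \<in> carrier F \<and> E x y)" for x
  have rep: "rep x \<in> carrier F" "E x (rep x)" if "x \<in> carrier F" for x
    using someI_ex[of "\<lambda>y. y \<in> carrier F \<and> E x y"] Erefl[OF that] that unfolding rep_def by blast+
  have rep_eq: "rep x = rep y" if "E x y" "x \<in> carrier F" "y \<in> carrier F" for x y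
  proof -
    \<comment> \<open>Equivalent elements give the same predicate, hence the choice operator returns
      the same representative for both.\<close>
    have "(\<lambda>z. z \<in> carrier F \<and> E x z) = (\<lambda>z. z \<in> carrier F \<and> E y z)"
      using Etrans Esym that by blast
    then show ?thesis by (simp add: rep_def)
  qed
  have rep_iff: "rep x = rep y \<longleftrightarrow> E x y" if "x \<in> carrier F" "y \<in> carrier F" for x y
    using rep_eq[of x y] rep[OF that(1)] rep[OF that(2)] Etrans Esym that by metis
  have rep_rep [simp]: "rep (rep x) = rep x" if "x \<in> carrier F" for x
    using rep_eq[OF Esym[OF rep(2)]] rep that by auto
  note Er = Esym[OF rep(2) _ rep(1)]
  have radd: "rep (rep x \<oplus>\<^bsub>F\<^esub> rep y) = rep (x \<oplus>\<^bsub>F\<^esub> y)" if "x \<in> carrier F" "y \<in> carrier F" for x y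
    by (rule rep_eq[OF Eadd[OF Er Er]]) (use that rep in auto)
  have radd1: "rep (rep x \<oplus>\<^bsub>F\<^esub> y) = rep (x \<oplus>\<^bsub>F\<^esub> y)" if "x \<in> carrier F" "y \<in> carrier F" for x y
    by (rule rep_eq[OF Eadd[OF Er Erefl]]) (use that rep in auto)
  have radd2: "rep (x \<oplus>\<^bsub>F\<^esub> rep y) = rep (x \<oplus>\<^bsub>F\<^esub> y)" if "x \<in> carrier F" "y \<in> carrier F" for x y
    by (rule rep_eq[OF Eadd[OF Erefl Er]]) (use that rep in auto)
  have rsm: "rep (r \<odot>\<^bsub>F\<^esub> rep x) = rep (r \<odot>\<^bsub>F\<^esub> x)" if "r \<in> carrier R" "x \<in> carrier F" for r x
    by (rule rep_eq[OF Esm[OF Er]]) (use that rep in auto)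
  let ?Q = "mk_module (rep ` carrier F) (rep \<zero>\<^bsub>F\<^esub>) (\<lambda>x y. rep (x \<oplus>\<^bsub>F\<^esub> y)) (\<lambda>r x. rep (r \<odot>\<^bsub>F\<^esub> x))"
  have "left_module R ?Q"
  proof (rule left_module_mk)
    show "ring R" by (rule F.ring_R)
    show "\<exists>y\<in>rep ` carrier F. rep (y \<oplus>\<^bsub>F\<^esub> x) = rep \<zero>\<^bsub>F\<^esub>" if "x \<in> rep ` carrier F" for x
      using that rep by (auto simp: radd F.M.l_neg intro!: bexI[of _ "\<ominus>\<^bsub>F\<^esub> x" for x])
    show "rep (x \<oplus>\<^bsub>F\<^esub> y) = rep (y \<oplus>\<^bsub>F\<^esub> x)" if "x \<in> rep ` carrier F" "y \<in> rep ` carrier F" for x y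
      using that rep by (auto simp: F.M.a_comm)
  qed (auto simp: rep radd rsm F.M.a_assoc F.smult_one simp flip: F.smult_l_distr F.smult_r_distr F.smult_assoc)
  moreover have "restrict rep (carrier F) \<in> mhom R F ?Q"
    by (rule mhomI) (auto simp: radd rsm)
  moreover have "rep x = rep \<zero>\<^bsub>F\<^esub> \<longleftrightarrow> x \<in> B" if "x \<in> carrier F" for x
    using rep_iff[OF that F.M.zero_closed] that by (simp add: E_def)
  ultimately show ?thesis using rep by (intro exI[of _ ?Q] exI[of _ "restrict rep (carrier F)"]) auto
qed

text \<open>The cokernel of the map of free modules that has the rows of \<open>H\<close> as values,
  copied into the universe; smallness of the ring bounds its size.\<close>

lemma fp_module_exists:
  assumes U: "inaccessible TYPE('u)" and R: "ring R" "tiny TYPE('u) (carrier R)" and H: "mat R m n H"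
  shows "\<exists>(A :: ('r, 'u) module) \<alpha>. A \<in> fp_modules R \<and> presents R A n \<alpha> m H"
proof -
  let ?F = "free_module R"
  note F = left_module_free[OF R(1)]
  interpret Fn: left_module R "?F n" by (rule F)
  interpret Fm: left_module R "?F m" by (rule F)
  have "vec (?F n) m (\<lambda>i. restrict (H i) {..<n})"
    using H by (auto simp: vec_def free_carrier mat_def coeffs_def)
  from presents_hom[OF presents_free[OF R(1), of m] F this] obtain g where
    g: "g \<in> mhom R (?F m) (?F n)" "\<And>i. i < m \<Longrightarrow> g (unit_row R m i) = restrict (H i) {..<n}" by auto
  let ?B = "g ` carrier (?F m)"
  have "\<exists>(Q :: ('r, nat \<Rightarrow> 'r) module) p. left_module R Q \<and> p \<in> mhom R (?F n) Q \<and> p ` carrier (?F n) = carrier Q \<and>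
    carrier Q \<subseteq> carrier (?F n) \<and> (\<forall>x\<in>carrier (?F n). p x = \<zero>\<^bsub>Q\<^esub> \<longleftrightarrow> x \<in> ?B)"
  proof (rule quotient_module[OF F])
    show "?B \<subseteq> carrier (?F n)" using mhom_closed[OF g(1)] by blast
    show "\<zero>\<^bsub>?F n\<^esub> \<in> ?B" using mhom_zero[OF Fm.abelian_group_M Fn.abelian_group_M g(1)] by (metis Fm.M.zero_closed imageI)
    show "x \<oplus>\<^bsub>?F n\<^esub> y \<in> ?B" if "x \<in> ?B" "y \<in> ?B" for x y
      using that by (auto simp: mhom_add[OF g(1), symmetric])
    show "r \<odot>\<^bsub>?F n\<^esub> x \<in> ?B" if "r \<in> carrier R" "x \<in> ?B" for r x
      using that by (auto simp: mhom_smult[OF g(1), symmetric])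
  qed
  then obtain Q :: "('r, nat \<Rightarrow> 'r) module" and p where Q: "left_module R Q" "p \<in> mhom R (?F n) Q"
    "p ` carrier (?F n) = carrier Q" "carrier Q \<subseteq> carrier (?F n)" "\<forall>x\<in>carrier (?F n). p x = \<zero>\<^bsub>Q\<^esub> \<longleftrightarrow> x \<in> ?B" by blast
  interpret Q: left_module R Q by (rule Q(1))
  have "tiny TYPE('u) (carrier (?F n))"
    unfolding free_module_eq using U R(2) by (auto intro!: tiny_PiE tiny_nat)
  then have "tiny TYPE('u) (carrier Q)" using Q(4) by (rule tiny_subset)
  from tiny_copy[OF Q(1) this] obtain A :: "('r, 'u) module" where A: "A \<in> Modules R" "mod_iso R Q A" by blast
  then interpret A: left_module R A by (simp add: Modules_def)
  obtain h where h: "h \<in> mhom R Q A" "bij_betw h (carrier Q) (carrier A)" using A(2) unfolding mod_iso_def by blast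
  let ?p = "compose (carrier (?F n)) h p"
  have p: "?p \<in> mhom R (?F n) A" by (rule mhom_compose[OF F Q(2) h(1)])
  have surj: "?p ` carrier (?F n) = carrier A"
  proof -
    have "?p ` carrier (?F n) = h ` (p ` carrier (?F n))" by (auto simp: compose_def)
    then show ?thesis using Q(3) h(2) by (simp add: bij_betw_def)
  qed
  have ker: "?B = {x \<in> carrier (?F n). ?p x = \<zero>\<^bsub>A\<^esub>}"
  proof -
    have "?p x = \<zero>\<^bsub>A\<^esub> \<longleftrightarrow> x \<in> ?B" if x: "x \<in> carrier (?F n)" for x
    proof -
      have "?p x = \<zero>\<^bsub>A\<^esub> \<longleftrightarrow> h (p x) = h \<zero>\<^bsub>Q\<^esub>"
        using x mhom_zero[OF Q.abelian_group_M A.abelian_group_M h(1)] by (simp add: compose_def)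
      also have "\<dots> \<longleftrightarrow> p x = \<zero>\<^bsub>Q\<^esub>"
        using h(2) mhom_closed[OF Q(2) x] by (auto simp: bij_betw_def inj_on_def)
      finally show ?thesis using Q(5) x by blast
    qed
    moreover have "?B \<subseteq> carrier (?F n)" using mhom_closed[OF g(1)] by blast
    ultimately show ?thesis by blast
  qed
  have "presents R A n (\<lambda>j. ?p (unit_row R n j)) m (\<lambda>i. g (unit_row R m i))"
    by (rule presents_of_maps[OF R(1) A.left_module_axioms g(1) p surj ker])
  then have "presents R A n (\<lambda>j. ?p (unit_row R n j)) m H"
    by (rule presents_cong) (simp add: g(2))
  moreover have "A \<in> fp_modules R"
    unfolding fp_modules_def finitely_presented_def using A(1) g(1) p surj ker by blast
  ultimately show ?thesis by blast
qed

text \<open>The vanishing at \<open>M\<close> of the cokernel of \<open>Hom(f, -)\<close>, expressed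
  without cosets; \<open>trivial_coker_iff\<close> is the translation.\<close>

definition factors :: "'r ring \<Rightarrow> ('r, 'u) module \<times> ('r, 'u) module \<times> ('u \<Rightarrow> 'u) \<Rightarrow> ('r, 'u) module \<Rightarrow> bool" where
  "factors R p M \<longleftrightarrow> mhom R (fst p) M \<subseteq> hom_image R p M"

lemma hom_image_iff:
  "g \<in> hom_image R (A, B, f) M \<longleftrightarrow> (\<exists>h\<in>mhom R B M. g = compose (carrier A) h f)"
  by (auto simp: hom_image_def)

lemma fp_modules_left_module: "A \<in> fp_modules R \<Longrightarrow> left_module R A"
  by (simp add: fp_modules_def Modules_def)

lemma fp_modules_presents: "A \<in> fp_modules R \<Longrightarrow> \<exists>n \<alpha> m H. presents R A n \<alpha> m H"
  using finitely_presented_presents[of R A] by (simp add: fp_modules_def Modules_def)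

text \<open>\<open>B\<close> has the generators of \<open>A\<close> and \<open>d\<close> further
  ones, and \<open>f\<close> maps generators to generators. A map from \<open>A\<close> therefore
  extends along \<open>f\<close> iff the solution it represents can be completed by \<open>d\<close>
  unknowns to a solution of \<open>K\<close>.\<close>

lemma fp_morphism_extending:
  assumes U: "inaccessible TYPE('u)" and R: "ring R" "tiny TYPE('u) (carrier R)"
    and H: "mat R m n H" and K: "mat R k (n + d) K"
  shows "\<exists>(A :: ('r, 'u) module) B f \<alpha>. (A, B, f) \<in> fp_morphisms R \<and> presents R A n \<alpha> m H \<and>
    (\<forall>M\<in>Modules R. \<forall>g\<in>mhom R A M. g \<in> hom_image R (A, B, f) M \<longleftrightarrow>
       (\<exists>y. vec M (n + d) y \<and> (\<forall>i<n. y i = g (\<alpha> i)) \<and> (\<forall>i<k. act M (n + d) K y i = \<zero>\<^bsub>M\<^esub>)))"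
proof -
  \<comment> \<open>The rows of \<open>H\<close>, padded by zeros in the new columns, come before
    those of \<open>K\<close>: they make the relations of \<open>A\<close> hold in \<open>B\<close>,
    so that \<open>f\<close> is defined.\<close>
  let ?c = "\<lambda>i j. if i < m then (if j < n then H i j else \<zero>\<^bsub>R\<^esub>) else K (i - m) j"
  interpret ring R by (rule R(1))
  have c: "mat R (m + k) (n + d) ?c" using H K by (auto simp: mat_def)
  obtain A :: "('r, 'u) module" and \<alpha> where A: "A \<in> fp_modules R" "presents R A n \<alpha> m H"
    using fp_module_exists[OF U R H] by blast
  obtain B :: "('r, 'u) module" and \<beta> where B: "B \<in> fp_modules R" "presents R B (n + d) \<beta> (m + k) ?c"
    using fp_module_exists[OF U R c] by blast
  interpret A: left_module R A by (rule fp_modules_left_module[OF A(1)])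
  interpret B: left_module R B by (rule fp_modules_left_module[OF B(1)])
  have upper: "act M (n + d) ?c y i = act M n H y i" if M: "left_module R M" and "vec M (n + d) y" "i < m" for M :: "('r, 'u) module" and y i
  proof -
    interpret M: left_module R M by (rule M)
    have "act M (n + d) ?c y i = act M n ?c y i \<oplus>\<^bsub>M\<^esub> act M d (\<lambda>i j. ?c i (n + j)) (\<lambda>j. y (n + j)) i"
      using c that by (intro M.act_append[of "m + k"]) auto
    also have "act M d (\<lambda>i j. ?c i (n + j)) (\<lambda>j. y (n + j)) i = \<zero>\<^bsub>M\<^esub>"
      using that by (intro M.act_coeff_zero vec_drop) auto
    also have "act M n ?c y i = act M n H y i" using that by (intro act_coeff_cong) auto
    finally show ?thesis using M.act_closed[OF H vec_take[OF that(2)] that(3)] by simp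
  qed
  have lower: "act M (n + d) ?c y (m + i) = act M (n + d) K y i" for M :: "('r, 'u) module" and y i
    by (rule act_coeff_cong) auto
  have \<beta>: "vec B (n + d) \<beta>" and \<beta>rel: "\<And>i. i < m + k \<Longrightarrow> act B (n + d) ?c \<beta> i = \<zero>\<^bsub>B\<^esub>"
    using B(2) by (auto simp: presents_def act_eq_lin)
  have "act B n H \<beta> i = \<zero>\<^bsub>B\<^esub>" if "i < m" for i
    using upper[OF B.left_module_axioms \<beta> that] \<beta>rel[of i] that by simp
  from presents_hom[OF A(2) B.left_module_axioms vec_take[OF \<beta>] this]
  obtain f where f: "f \<in> mhom R A B" "\<And>j. j < n \<Longrightarrow> f (\<alpha> j) = \<beta> j" by blast
  have \<alpha>c: "\<alpha> i \<in> carrier A" if "i < n" for i using A(2) that by (simp add: presents_def vec_def)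
  have "g \<in> hom_image R (A, B, f) M \<longleftrightarrow>
       (\<exists>y. vec M (n + d) y \<and> (\<forall>i<n. y i = g (\<alpha> i)) \<and> (\<forall>i<k. act M (n + d) K y i = \<zero>\<^bsub>M\<^esub>))"
    if "M \<in> Modules R" and g: "g \<in> mhom R A M" for M g
  proof
    have M: "left_module R M" using that(1) by (simp add: Modules_def)
    {
      assume "g \<in> hom_image R (A, B, f) M"
      then obtain h where h: "h \<in> mhom R B M" "g = compose (carrier A) h f" unfolding hom_image_iff by blast
      have "act M (n + d) K (\<lambda>j. h (\<beta> j)) i = \<zero>\<^bsub>M\<^esub>" if "i < k" for i
        using presents_solution(2)[OF B(2) M h(1), of "m + i"] that lower[of M "\<lambda>j. h (\<beta> j)" i] by simp
      then show "\<exists>y. vec M (n + d) y \<and> (\<forall>i<n. y i = g (\<alpha> i)) \<and> (\<forall>i<k. act M (n + d) K y i = \<zero>\<^bsub>M\<^esub>)"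
        using presents_solution(1)[OF B(2) M h(1)] f(2) h(2) \<alpha>c
        by (intro exI[of _ "\<lambda>j. h (\<beta> j)"]) (auto simp: compose_def)
    }
    assume "\<exists>y. vec M (n + d) y \<and> (\<forall>i<n. y i = g (\<alpha> i)) \<and> (\<forall>i<k. act M (n + d) K y i = \<zero>\<^bsub>M\<^esub>)"
    then obtain y where y: "vec M (n + d) y" "\<And>i. i < n \<Longrightarrow> y i = g (\<alpha> i)" "\<And>i. i < k \<Longrightarrow> act M (n + d) K y i = \<zero>\<^bsub>M\<^esub>"
      by blast
    have "act M (n + d) ?c y i = \<zero>\<^bsub>M\<^esub>" if i: "i < m + k" for i
    proof (cases "i < m")
      case True
      have "act M n H y i = act M n H (\<lambda>j. g (\<alpha> j)) i" by (rule act_cong) (simp add: y(2))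
      then show ?thesis using upper[OF M y(1) True] presents_solution(2)[OF A(2) M g True] by simp
    next
      case False
      then show ?thesis using y(3)[of "i - m"] lower[of M y "i - m"] i by simp
    qed
    from presents_hom[OF B(2) M y(1) this] obtain h where h: "h \<in> mhom R B M" "\<forall>j<n + d. h (\<beta> j) = y j" by blast
    have "g = compose (carrier A) h f"
      by (rule presents_unique[OF A(2) M g mhom_compose[OF A.left_module_axioms f(1) h(1)]])
        (use h(2) y(2) f(2) \<alpha>c in \<open>auto simp: compose_def\<close>)
    then show "g \<in> hom_image R (A, B, f) M" using h(1) unfolding hom_image_iff by blast
  qed
  moreover have "(A, B, f) \<in> fp_morphisms R" using A(1) B(1) f(1) by (simp add: fp_morphisms_def)
  ultimately show ?thesis using A(2) by blast
qed

text \<open>\<open>F\<close> expresses the images under \<open>f\<close> of the generators of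
  \<open>A\<close> in the generators of \<open>B\<close>; such coefficients exist but are a
  choice.\<close>

lemma fp_morphism_system:
  assumes "(A, B, f) \<in> fp_morphisms R"
  shows "\<exists>n m l k H F K \<alpha> \<beta>. system_pair R n m l k H F K \<and> presents R A n \<alpha> m H \<and> presents R B l \<beta> k K \<and>
    (\<forall>i<n. f (\<alpha> i) = lin B l (F i) \<beta>)"
proof -
  have A: "A \<in> fp_modules R" and B: "B \<in> fp_modules R" and f: "f \<in> mhom R A B"
    using assms by (auto simp: fp_morphisms_def)
  obtain n \<alpha> m H where a: "presents R A n \<alpha> m H" using fp_modules_presents[OF A] by blast
  obtain l \<beta> k K where b: "presents R B l \<beta> k K" using fp_modules_presents[OF B] by blast
  have "\<forall>i. \<exists>r. i < n \<longrightarrow> coeffs R l r \<and> f (\<alpha> i) = lin B l r \<beta>"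
    using a b mhom_closed[OF f] unfolding presents_def vec_def by blast
  then obtain F where F: "\<And>i. i < n \<Longrightarrow> coeffs R l (F i) \<and> f (\<alpha> i) = lin B l (F i) \<beta>" by metis
  have "system_pair R n m l k H F K"
    using a b F left_module.ring_R[OF fp_modules_left_module[OF A]]
    unfolding system_pair_def presents_def by (auto simp: mat_def coeffs_def)
  then show ?thesis using a b F by blast
qed

text \<open>Maps from \<open>A\<close> and \<open>B\<close> into \<open>M\<close> are the solutions
  of \<open>H\<close> and \<open>K\<close>, and composing with \<open>f\<close> sends a solution
  \<open>y\<close> to \<open>F y\<close>.\<close>

lemma factors_iff_cond:
  assumes "system_pair R n m l k H F K" "presents R A n \<alpha> m H" "presents R B l \<beta> k K"
    "\<forall>i<n. f (\<alpha> i) = lin B l (F i) \<beta>" "f \<in> mhom R A B" "left_module R M"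
  shows "factors R (A, B, f) M \<longleftrightarrow> pp_cond M n m l k H F K"
proof -
  interpret system_pair R n m l k H F K by fact
  interpret M: left_module R M by fact
  have A: "left_module R A" and B: "left_module R B" and \<beta>: "vec B l \<beta>" and \<alpha>c: "\<And>i. i < n \<Longrightarrow> \<alpha> i \<in> carrier A"
    using assms(2,3) by (auto simp: presents_def vec_def)
  have f\<alpha>: "h (f (\<alpha> i)) = act M l F (\<lambda>j. h (\<beta> j)) i" if "h \<in> mhom R B M" "i < n" for h i
    using assms(4) that lin_hom[OF B assms(6) that(1) mat_coeffs[OF F that(2)] \<beta>] by (simp add: act_eq_lin)
  show ?thesis
  proof
    assume fac: "factors R (A, B, f) M"
    show "pp_cond M n m l k H F K" unfolding pp_cond_def
    proof (intro allI impI)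
      fix x assume "vec M n x" "\<forall>i<m. act M n H x i = \<zero>\<^bsub>M\<^esub>"
      then obtain g where g: "g \<in> mhom R A M" "\<forall>j<n. g (\<alpha> j) = x j" using presents_hom[OF assms(2,6)] by blast
      have "g \<in> hom_image R (A, B, f) M" using fac g(1) by (auto simp: factors_def)
      then obtain h where h: "h \<in> mhom R B M" "g = compose (carrier A) h f" unfolding hom_image_iff by blast
      have "x i = act M l F (\<lambda>j. h (\<beta> j)) i" if "i < n" for i
        using f\<alpha>[OF h(1) that] g(2) h(2) \<alpha>c that by (auto simp: compose_def)
      then show "\<exists>y. vec M l y \<and> (\<forall>i<k. act M l K y i = \<zero>\<^bsub>M\<^esub>) \<and> (\<forall>i<n. x i = act M l F y i)"
        using presents_solution[OF assms(3,6) h(1)] by blast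
    qed
  next
    assume c: "pp_cond M n m l k H F K"
    show "factors R (A, B, f) M" unfolding factors_def
    proof
      fix g assume "g \<in> mhom R (fst (A, B, f)) M"
      then have g: "g \<in> mhom R A M" by simp
      obtain y where y: "vec M l y" "\<forall>i<k. act M l K y i = \<zero>\<^bsub>M\<^esub>" "\<forall>i<n. g (\<alpha> i) = act M l F y i"
        using c presents_solution[OF assms(2,6) g] unfolding pp_cond_def by blast
      obtain h where h: "h \<in> mhom R B M" "\<forall>j<l. h (\<beta> j) = y j" using presents_hom[OF assms(3,6) y(1)] y(2) by blast
      have eq: "act M l F (\<lambda>j. h (\<beta> j)) i = act M l F y i" for i using h(2) by (intro act_cong) auto
      have "g = compose (carrier A) h f"
        by (rule presents_unique[OF assms(2,6) g mhom_compose[OF A assms(5) h(1)]])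
          (use f\<alpha>[OF h(1)] eq y(3) \<alpha>c in \<open>auto simp: compose_def\<close>)
      then show "g \<in> hom_image R (A, B, f) M" using h(1) unfolding hom_image_iff by blast
    qed
  qed
qed

section \<open>The morphism that will present the dual functor\<close>

context system_pair
begin

text \<open>The matrix of \<open>tr F\<close> next to minus \<open>tr K\<close>. Its solutions in a
  right module are the pairs \<open>(x, z)\<close> of the hypothesis of \<open>dual\<close>, so the
  module it presents represents these pairs.\<close>

definition H' :: "nat \<Rightarrow> nat \<Rightarrow> 'r" where
  "H' j i = (if i < n then F i j else \<ominus>\<^bsub>R\<^esub> K (i - n) j)"

lemma mat_H': "mat (opp R) l (n + k) H'"
proof -
  interpret ring R by (rule ring_R)
  show ?thesis using F K by (auto simp: mat_def H'_def)
qed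

lemma solution_H':
  assumes N: "left_module (opp R) N" and y: "vec N (n + k) y" and j: "j < l"
  shows "act N (n + k) H' y j = \<zero>\<^bsub>N\<^esub> \<longleftrightarrow> act N n (tr F) y j = act N k (tr K) (\<lambda>i. y (n + i)) j"
proof -
  interpret N: left_module "opp R" N by fact
  have FT: "mat (opp R) l n (tr F)" and KT: "mat (opp R) l k (tr K)" using mat_tr F K by auto
  note y1 = vec_take[OF y] and y2 = vec_drop[OF y]
  have "act N (n + k) H' y j = act N n H' y j \<oplus>\<^bsub>N\<^esub> act N k (\<lambda>j i. H' j (n + i)) (\<lambda>i. y (n + i)) j"
    by (rule N.act_append[OF mat_H' y j])
  also have "act N n H' y j = act N n (tr F) y j" by (rule act_coeff_cong) (auto simp: H'_def tr_def)
  also have "act N k (\<lambda>j i. H' j (n + i)) (\<lambda>i. y (n + i)) j = act N k (\<lambda>i j. \<ominus>\<^bsub>opp R\<^esub> tr K i j) (\<lambda>i. y (n + i)) j"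
    by (rule act_coeff_cong) (auto simp: H'_def tr_def)
  also have "\<dots> = \<ominus>\<^bsub>N\<^esub> act N k (tr K) (\<lambda>i. y (n + i)) j" by (rule N.act_coeff_uminus[OF KT y2 j])
  finally show ?thesis using N.eq_of_add_uminus[OF N.act_closed[OF FT y1 j] N.act_closed[OF KT y2 j]] by simp
qed

text \<open>\<open>A\<close> represents the pairs \<open>(x, z)\<close> solving \<open>H'\<close>;
  its target adjoins unknowns \<open>w\<close> with \<open>x\<close> equal to \<open>tr H\<close>
  applied to \<open>w\<close>. A map from \<open>A\<close> thus extends iff its \<open>x\<close>
  satisfies the conclusion of \<open>dual\<close>.\<close>

lemma dual_morphism:
  assumes U: "inaccessible TYPE('u)" and R: "tiny TYPE('u) (carrier R)"
  shows "\<exists>(A :: ('r, 'u) module) B f \<alpha>. (A, B, f) \<in> fp_morphisms (opp R) \<and> presents (opp R) A (n + k) \<alpha> l H' \<and>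
    (\<forall>N\<in>Modules (opp R). \<forall>g\<in>mhom (opp R) A N. g \<in> hom_image (opp R) (A, B, f) N \<longleftrightarrow>
       (\<exists>w. vec N m w \<and> (\<forall>i<n. g (\<alpha> i) = act N m (tr H) w i)))"
proof -
  interpret RR: ring R by (rule ring_R)
  \<comment> \<open>The columns are ordered as \<open>x\<close>, \<open>z\<close>, \<open>w\<close>.
    Row \<open>i\<close> reads \<open>x i\<close> minus entry \<open>i\<close> of
    \<open>tr H\<close> applied to \<open>w\<close>; the columns of \<open>z\<close> are zero
    because \<open>i < n\<close>.\<close>
  let ?K = "\<lambda>i j. if j < n + k then (if j = i then \<one>\<^bsub>R\<^esub> else \<zero>\<^bsub>R\<^esub>) else \<ominus>\<^bsub>R\<^esub> H (j - (n + k)) i"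
  have K': "mat (opp R) n (n + k + m) ?K" using H by (auto simp: mat_def)
  have HT: "mat (opp R) n m (tr H)" using mat_tr[OF H] by simp
  obtain A :: "('r, 'u) module" and B f \<alpha> where A: "(A, B, f) \<in> fp_morphisms (opp R)" "presents (opp R) A (n + k) \<alpha> l H'"
    "\<And>N g. N \<in> Modules (opp R) \<Longrightarrow> g \<in> mhom (opp R) A N \<Longrightarrow> g \<in> hom_image (opp R) (A, B, f) N \<longleftrightarrow>
       (\<exists>y. vec N (n + k + m) y \<and> (\<forall>i<n + k. y i = g (\<alpha> i)) \<and> (\<forall>i<n. act N (n + k + m) ?K y i = \<zero>\<^bsub>N\<^esub>))"
    using fp_morphism_extending[OF U _ _ mat_H' K'] ring_R R by auto
  have "(\<exists>y. vec N (n + k + m) y \<and> (\<forall>i<n + k. y i = g (\<alpha> i)) \<and> (\<forall>i<n. act N (n + k + m) ?K y i = \<zero>\<^bsub>N\<^esub>)) \<longleftrightarrow>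
       (\<exists>w. vec N m w \<and> (\<forall>i<n. g (\<alpha> i) = act N m (tr H) w i))"
    if "N \<in> Modules (opp R)" and g: "g \<in> mhom (opp R) A N" for N g
  proof -
    interpret N: left_module "opp R" N using that(1) by (simp add: Modules_def)
    have calc: "act N (n + k + m) ?K y i = \<zero>\<^bsub>N\<^esub> \<longleftrightarrow> y i = act N m (tr H) (\<lambda>j. y (n + k + j)) i"
      if y: "vec N (n + k + m) y" and i: "i < n" for y i
    proof -
      have "act N (n + k + m) ?K y i = act N (n + k) ?K y i \<oplus>\<^bsub>N\<^esub> act N m (\<lambda>i j. ?K i (n + k + j)) (\<lambda>j. y (n + k + j)) i"
        by (rule N.act_append[OF K' y i])
      also have "act N (n + k) ?K y i = act N (n + k) (\<lambda>i j. if j = i then \<one>\<^bsub>opp R\<^esub> else \<zero>\<^bsub>opp R\<^esub>) y i"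
        by (rule act_coeff_cong) auto
      also have "\<dots> = y i" using vec_take[OF y] i by (intro N.act_delta) auto
      also have "act N m (\<lambda>i j. ?K i (n + k + j)) (\<lambda>j. y (n + k + j)) i = act N m (\<lambda>i j. \<ominus>\<^bsub>opp R\<^esub> tr H i j) (\<lambda>j. y (n + k + j)) i"
        by (rule act_coeff_cong) (auto simp: tr_def)
      also have "\<dots> = \<ominus>\<^bsub>N\<^esub> act N m (tr H) (\<lambda>j. y (n + k + j)) i" by (rule N.act_coeff_uminus[OF HT vec_drop[OF y] i])
      finally show ?thesis
        using N.eq_of_add_uminus[OF _ N.act_closed[OF HT vec_drop[OF y] i], of "y i"] y i by (simp add: vec_def)
    qed
    show ?thesis
    proof
      assume "\<exists>y. vec N (n + k + m) y \<and> (\<forall>i<n + k. y i = g (\<alpha> i)) \<and> (\<forall>i<n. act N (n + k + m) ?K y i = \<zero>\<^bsub>N\<^esub>)"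
      then obtain y where y: "vec N (n + k + m) y" "\<forall>i<n + k. y i = g (\<alpha> i)" "\<forall>i<n. act N (n + k + m) ?K y i = \<zero>\<^bsub>N\<^esub>" by blast
      then show "\<exists>w. vec N m w \<and> (\<forall>i<n. g (\<alpha> i) = act N m (tr H) w i)"
        using calc[OF y(1)] vec_drop[OF y(1)] by (intro exI[of _ "\<lambda>j. y (n + k + j)"]) auto
    next
      assume "\<exists>w. vec N m w \<and> (\<forall>i<n. g (\<alpha> i) = act N m (tr H) w i)"
      then obtain w where w: "vec N m w" "\<forall>i<n. g (\<alpha> i) = act N m (tr H) w i" by blast
      let ?y = "append_vec (n + k) (\<lambda>i. g (\<alpha> i)) w"
      have y: "vec N (n + k + m) ?y"
        using presents_solution(1)[OF A(2) N.left_module_axioms g] w(1) by (rule vec_append)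
      have "act N (n + k + m) ?K ?y i = \<zero>\<^bsub>N\<^esub>" if "i < n" for i
        unfolding calc[OF y that] using w(2) that by simp
      then show "\<exists>y. vec N (n + k + m) y \<and> (\<forall>i<n + k. y i = g (\<alpha> i)) \<and> (\<forall>i<n. act N (n + k + m) ?K y i = \<zero>\<^bsub>N\<^esub>)"
        using y by (intro exI[of _ ?y]) auto
    qed
  qed
  then show ?thesis using A by (intro exI[of _ A] exI[of _ B] exI[of _ f] exI[of _ \<alpha>]) auto
qed

lemma factors_iff_dual:
  assumes p: "presents (opp R) A (n + k) \<alpha> l H'" and N: "left_module (opp R) N"
    and im: "\<And>g. g \<in> mhom (opp R) A N \<Longrightarrow> g \<in> hom_image (opp R) (A, B, f) N \<longleftrightarrow>
       (\<exists>w. vec N m w \<and> (\<forall>i<n. g (\<alpha> i) = act N m (tr H) w i))"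
  shows "factors (opp R) (A, B, f) N \<longleftrightarrow> dual N"
proof
  assume fac: "factors (opp R) (A, B, f) N"
  show "dual N" unfolding pp_dual_def
  proof (intro allI impI)
    fix x z assume x: "vec N n x" and z: "vec N k z" and eq: "\<forall>j<l. act N n (tr F) x j = act N k (tr K) z j"
    let ?y = "append_vec n x z"
    have y: "vec N (n + k) ?y" using vec_append[OF x z] .
    have "act N (n + k) H' ?y j = \<zero>\<^bsub>N\<^esub>" if "j < l" for j
    proof -
      have "act N n (tr F) ?y j = act N n (tr F) x j" "act N k (tr K) (\<lambda>i. ?y (n + i)) j = act N k (tr K) z j"
        by (rule act_cong; simp)+
      then show ?thesis using solution_H'[OF N y that] eq that by simp
    qed
    from presents_hom[OF p N y this] obtain g where g: "g \<in> mhom (opp R) A N" "\<forall>j<n + k. g (\<alpha> j) = ?y j" by blast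
    then obtain w where "vec N m w" "\<forall>i<n. g (\<alpha> i) = act N m (tr H) w i"
      using fac im[OF g(1)] unfolding factors_def by auto
    then show "\<exists>w. vec N m w \<and> (\<forall>i<n. x i = act N m (tr H) w i)" using g(2) by auto
  qed
next
  assume d: "dual N"
  show "factors (opp R) (A, B, f) N" unfolding factors_def
  proof
    fix g assume "g \<in> mhom (opp R) (fst (A, B, f)) N"
    then have g: "g \<in> mhom (opp R) A N" by simp
    note y = presents_solution(1)[OF p N g]
    have "act N n (tr F) (\<lambda>i. g (\<alpha> i)) j = act N k (tr K) (\<lambda>i. g (\<alpha> (n + i))) j" if "j < l" for j
      using solution_H'[OF N y that] presents_solution(2)[OF p N g that] by simp
    then have "\<exists>w. vec N m w \<and> (\<forall>i<n. g (\<alpha> i) = act N m (tr H) w i)"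
      using d vec_take[OF y] vec_drop[OF y] unfolding pp_dual_def by blast
    then show "g \<in> hom_image (opp R) (A, B, f) N" using im[OF g] by simp
  qed
qed

end

subsection \<open>Quotients of abelian groups\<close>

context comm_group
begin

lemma rcos_eq_iff:
  assumes "subgroup S G" "x \<in> carrier G" "y \<in> carrier G"
  shows "S #> x = S #> y \<longleftrightarrow> x \<otimes> inv y \<in> S"
proof -
  interpret S: subgroup S G by fact
  have "S #> x = S #> y \<longleftrightarrow> x \<in> S #> y"
    using assms rcos_self repr_independence by metis
  also have "\<dots> \<longleftrightarrow> x \<otimes> inv y \<in> S" by (rule S.rcos_module[OF is_group assms(3,2)])
  finally show ?thesis .
qed

lemma rcos_mult:
  assumes "subgroup S G" "x \<in> carrier G" "y \<in> carrier G"
  shows "(S #> x) <#> (S #> y) = S #> (x \<otimes> y)"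
  using normal.rcos_sum[OF subgroup_imp_normal[OF assms(1)] assms(2,3)] .

text \<open>The functors are defined on a coset by a union over all its representatives. The members
  of this union coincide, because representatives differ by elements of \<open>S\<close>, which
  \<open>\<phi>\<close> sends into \<open>S'\<close>.\<close>

lemma quotient_map_eval:
  assumes S: "subgroup S G" and x: "x \<in> carrier G"
    and G': "comm_group G'" and S': "subgroup S' G'"
    and \<phi>: "\<And>u. u \<in> carrier G \<Longrightarrow> \<phi> u \<in> carrier G'"
      "\<And>u v. u \<in> carrier G \<Longrightarrow> v \<in> carrier G \<Longrightarrow> \<phi> (u \<otimes> v) = \<phi> u \<otimes>\<^bsub>G'\<^esub> \<phi> v"
      "\<And>u. u \<in> S \<Longrightarrow> \<phi> u \<in> S'"
  shows "(\<Union>u\<in>S #> x. S' #>\<^bsub>G'\<^esub> \<phi> u) = S' #>\<^bsub>G'\<^esub> \<phi> x"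
proof -
  interpret G': comm_group G' by fact
  interpret S: subgroup S G by fact
  interpret S': subgroup S' G' by fact
  have "S' #>\<^bsub>G'\<^esub> \<phi> u = S' #>\<^bsub>G'\<^esub> \<phi> x" if u: "u \<in> S #> x" for u
  proof -
    obtain s where s: "s \<in> S" "u = s \<otimes> x" using u unfolding r_coset_def by blast
    then have "\<phi> u \<otimes>\<^bsub>G'\<^esub> inv\<^bsub>G'\<^esub> \<phi> x = \<phi> s"
      using x \<phi>(1)[OF x] \<phi>(1)[of s] by (simp add: \<phi>(2) G'.m_assoc)
    then show ?thesis
      using G'.rcos_eq_iff[OF S' \<phi>(1) \<phi>(1)[OF x], of u] \<phi>(3)[OF s(1)] s x by simp
  qed
  moreover have "x \<in> S #> x" using rcos_self[OF x S] .
  ultimately show ?thesis by blast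
qed

end

subsection \<open>Cokernel functors\<close>

lemma hom_group_simps [simp]:
  "carrier (hom_group R M N) = mhom R M N" "\<one>\<^bsub>hom_group R M N\<^esub> = (\<lambda>x\<in>carrier M. \<zero>\<^bsub>N\<^esub>)"
  "g \<otimes>\<^bsub>hom_group R M N\<^esub> h = (\<lambda>x\<in>carrier M. g x \<oplus>\<^bsub>N\<^esub> h x)"
  by (simp_all add: hom_group_def)

context
  fixes R :: "'r ring" and M :: "('r, 'a) module" and N :: "('r, 'b) module"
  assumes M: "left_module R M" and N: "left_module R N"
begin

interpretation M: left_module R M by (rule M)
interpretation N: left_module R N by (rule N)

lemma mhom_sum: "g \<in> mhom R M N \<Longrightarrow> h \<in> mhom R M N \<Longrightarrow> (\<lambda>x\<in>carrier M. g x \<oplus>\<^bsub>N\<^esub> h x) \<in> mhom R M N"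
  by (rule mhomI) (auto simp: mhom_closed mhom_add mhom_smult N.M.a_ac N.smult_r_distr)

lemma mhom_zero_map: "(\<lambda>x\<in>carrier M. \<zero>\<^bsub>N\<^esub>) \<in> mhom R M N"
  by (rule mhomI) auto

lemma mhom_neg: "g \<in> mhom R M N \<Longrightarrow> (\<lambda>x\<in>carrier M. \<ominus>\<^bsub>N\<^esub> g x) \<in> mhom R M N"
  by (rule mhomI) (auto simp: mhom_closed mhom_add mhom_smult N.M.minus_add N.smult_uminus)

lemma comm_group_hom_group: "comm_group (hom_group R M N)"
proof (rule comm_groupI)
  fix f g h assume fgh: "f \<in> carrier (hom_group R M N)" "g \<in> carrier (hom_group R M N)" "h \<in> carrier (hom_group R M N)"
  show "f \<otimes>\<^bsub>hom_group R M N\<^esub> g \<in> carrier (hom_group R M N)" using fgh mhom_sum by simp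
  show "f \<otimes>\<^bsub>hom_group R M N\<^esub> g \<otimes>\<^bsub>hom_group R M N\<^esub> h = f \<otimes>\<^bsub>hom_group R M N\<^esub> (g \<otimes>\<^bsub>hom_group R M N\<^esub> h)"
    using fgh by (auto simp: fun_eq_iff mhom_closed N.M.a_assoc)
  show "f \<otimes>\<^bsub>hom_group R M N\<^esub> g = g \<otimes>\<^bsub>hom_group R M N\<^esub> f"
    using fgh by (auto simp: fun_eq_iff mhom_closed N.M.a_comm)
  show "\<exists>k\<in>carrier (hom_group R M N). k \<otimes>\<^bsub>hom_group R M N\<^esub> f = \<one>\<^bsub>hom_group R M N\<^esub>"
    using fgh mhom_neg by (intro bexI[of _ "\<lambda>x\<in>carrier M. \<ominus>\<^bsub>N\<^esub> f x"]) (auto simp: fun_eq_iff mhom_closed N.M.l_neg)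
  show "\<one>\<^bsub>hom_group R M N\<^esub> \<otimes>\<^bsub>hom_group R M N\<^esub> f = f"
    using fgh mhom_ext[of f R M N] by (auto simp: fun_eq_iff mhom_closed extensional_def)
qed (use mhom_zero_map in auto)

lemma inv_hom_group: "g \<in> mhom R M N \<Longrightarrow> inv\<^bsub>hom_group R M N\<^esub> g = (\<lambda>x\<in>carrier M. \<ominus>\<^bsub>N\<^esub> g x)"
  using mhom_neg by (intro group.inv_equality[OF comm_group.axioms(2)[OF comm_group_hom_group]])
    (auto simp: mhom_closed N.M.l_neg fun_eq_iff)

end

context
  fixes R :: "'r ring" and A B :: "('r, 'u) module" and f
  assumes p: "(A, B, f) \<in> fp_morphisms R"
begin

interpretation A: left_module R A using p by (auto simp: fp_morphisms_def fp_modules_left_module)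
interpretation B: left_module R B using p by (auto simp: fp_morphisms_def fp_modules_left_module)

lemma fp_f: "f \<in> mhom R A B" using p by (simp add: fp_morphisms_def)

lemma hom_image_subgroup:
  assumes "left_module R M"
  shows "subgroup (hom_image R (A, B, f) M) (hom_group R A M)"
proof -
  interpret M: left_module R M by fact
  note cg = comm_group_hom_group[OF A.left_module_axioms assms]
  show ?thesis
  proof (rule group.subgroupI[OF comm_group.axioms(2)[OF cg]])
    show "hom_image R (A, B, f) M \<subseteq> carrier (hom_group R A M)"
      using mhom_compose[OF A.left_module_axioms fp_f] by (auto simp: hom_image_iff)
    show "hom_image R (A, B, f) M \<noteq> {}"
      using mhom_zero_map[OF B.left_module_axioms assms] by (auto simp: hom_image_def)
  next
    fix g assume "g \<in> hom_image R (A, B, f) M"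
    then obtain h where h: "h \<in> mhom R B M" "g = compose (carrier A) h f" by (auto simp: hom_image_iff)
    have "inv\<^bsub>hom_group R A M\<^esub> g = compose (carrier A) (\<lambda>x\<in>carrier B. \<ominus>\<^bsub>M\<^esub> h x) f"
      unfolding h(2) inv_hom_group[OF A.left_module_axioms assms mhom_compose[OF A.left_module_axioms fp_f h(1)]]
      by (auto simp: compose_def fun_eq_iff mhom_closed[OF fp_f])
    then show "inv\<^bsub>hom_group R A M\<^esub> g \<in> hom_image R (A, B, f) M"
      using mhom_neg[OF B.left_module_axioms assms h(1)] by (auto simp: hom_image_iff)
  next
    fix g g' assume "g \<in> hom_image R (A, B, f) M" "g' \<in> hom_image R (A, B, f) M"
    then obtain h h' where h: "h \<in> mhom R B M" "g = compose (carrier A) h f"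
      "h' \<in> mhom R B M" "g' = compose (carrier A) h' f" by (auto simp: hom_image_iff)
    have "g \<otimes>\<^bsub>hom_group R A M\<^esub> g' = compose (carrier A) (\<lambda>x\<in>carrier B. h x \<oplus>\<^bsub>M\<^esub> h' x) f"
      using h by (auto simp: compose_def fun_eq_iff mhom_closed[OF fp_f])
    then show "g \<otimes>\<^bsub>hom_group R A M\<^esub> g' \<in> hom_image R (A, B, f) M"
      using mhom_sum[OF B.left_module_axioms assms h(1,3)] by (auto simp: hom_image_iff)
  qed
qed

end

definition cls ::
    "'r ring \<Rightarrow> ('r, 'u) module \<times> ('r, 'u) module \<times> ('u \<Rightarrow> 'u) \<Rightarrow> ('r, 'u) module \<Rightarrow> ('u \<Rightarrow> 'u) \<Rightarrow> ('u \<Rightarrow> 'u) set" where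
  "cls R p M g = hom_image R p M #>\<^bsub>hom_group R (fst p) M\<^esub> g"

context
  fixes R :: "'r ring" and A B :: "('r, 'u) module" and f
  assumes p: "(A, B, f) \<in> fp_morphisms R"
begin

interpretation A: left_module R A using p by (auto simp: fp_morphisms_def fp_modules_left_module)
interpretation B: left_module R B using p by (auto simp: fp_morphisms_def fp_modules_left_module)

lemma coker_comm_group: "left_module R M \<Longrightarrow> comm_group (fob (coker_functor R (A, B, f)) M)"
  unfolding coker_functor_def
  using comm_group.abelian_FactGroup[OF comm_group_hom_group[OF A.left_module_axioms] hom_image_subgroup[OF p]] by simp

lemma coker_carrier: "carrier (fob (coker_functor R (A, B, f)) M) = cls R (A, B, f) M ` mhom R A M"
  by (simp add: coker_functor_def carrier_FactGroup cls_def)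

lemma coker_mult:
  assumes "left_module R M" "g \<in> mhom R A M" "h \<in> mhom R A M"
  shows "cls R (A, B, f) M g \<otimes>\<^bsub>fob (coker_functor R (A, B, f)) M\<^esub> cls R (A, B, f) M h = cls R (A, B, f) M (\<lambda>x\<in>carrier A. g x \<oplus>\<^bsub>M\<^esub> h x)"
  using comm_group.rcos_mult[OF comm_group_hom_group[OF A.left_module_axioms assms(1)] hom_image_subgroup[OF p assms(1)], of g h]
    assms(2,3) by (simp add: coker_functor_def cls_def)

lemma cls_eq_iff:
  assumes "left_module R M" "g \<in> mhom R A M" "h \<in> mhom R A M"
  shows "cls R (A, B, f) M g = cls R (A, B, f) M h \<longleftrightarrow> (\<lambda>x\<in>carrier A. g x \<oplus>\<^bsub>M\<^esub> \<ominus>\<^bsub>M\<^esub> h x) \<in> hom_image R (A, B, f) M"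
proof -
  have "(\<lambda>x\<in>carrier A. g x \<oplus>\<^bsub>M\<^esub> (inv\<^bsub>hom_group R A M\<^esub> h) x) = (\<lambda>x\<in>carrier A. g x \<oplus>\<^bsub>M\<^esub> \<ominus>\<^bsub>M\<^esub> h x)"
    unfolding inv_hom_group[OF A.left_module_axioms assms(1,3)] by (auto simp: fun_eq_iff)
  then show ?thesis
    using comm_group.rcos_eq_iff[OF comm_group_hom_group[OF A.left_module_axioms assms(1)] hom_image_subgroup[OF p assms(1)], of g h]
      assms(2,3) by (simp add: cls_def)
qed

lemma cls_zero_iff:
  assumes "left_module R M" "g \<in> mhom R A M"
  shows "cls R (A, B, f) M g = cls R (A, B, f) M (\<lambda>x\<in>carrier A. \<zero>\<^bsub>M\<^esub>) \<longleftrightarrow> g \<in> hom_image R (A, B, f) M"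
proof -
  interpret M: left_module R M by fact
  have "(\<lambda>x\<in>carrier A. g x \<oplus>\<^bsub>M\<^esub> \<ominus>\<^bsub>M\<^esub> (\<lambda>x\<in>carrier A. \<zero>\<^bsub>M\<^esub>) x) = g"
    using mhom_ext[OF assms(2)] mhom_closed[OF assms(2)] by (auto simp: fun_eq_iff extensional_def)
  then show ?thesis using cls_eq_iff[OF assms mhom_zero_map[OF A.left_module_axioms assms(1)]] by simp
qed

lemma coker_fmor:
  assumes M: "left_module R M" and N: "left_module R N" and h: "h \<in> mhom R M N" and g: "g \<in> mhom R A M"
  shows "fmor (coker_functor R (A, B, f)) M N h (cls R (A, B, f) M g) = cls R (A, B, f) N (compose (carrier A) h g)"
proof -
  interpret HM: comm_group "hom_group R A M" by (rule comm_group_hom_group[OF A.left_module_axioms M])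
  have "(\<Union>u\<in>hom_image R (A, B, f) M #>\<^bsub>hom_group R A M\<^esub> g. hom_image R (A, B, f) N #>\<^bsub>hom_group R A N\<^esub> compose (carrier A) h u)
    = hom_image R (A, B, f) N #>\<^bsub>hom_group R A N\<^esub> compose (carrier A) h g"
  proof (rule HM.quotient_map_eval)
    show "subgroup (hom_image R (A, B, f) M) (hom_group R A M)" by (rule hom_image_subgroup[OF p M])
    show "subgroup (hom_image R (A, B, f) N) (hom_group R A N)" by (rule hom_image_subgroup[OF p N])
    show "comm_group (hom_group R A N)" by (rule comm_group_hom_group[OF A.left_module_axioms N])
    show "g \<in> carrier (hom_group R A M)" using g by simp
    show "compose (carrier A) h u \<in> carrier (hom_group R A N)" if "u \<in> carrier (hom_group R A M)" for u
      using mhom_compose[OF A.left_module_axioms _ h] that by simp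
    show "compose (carrier A) h (u \<otimes>\<^bsub>hom_group R A M\<^esub> v) = compose (carrier A) h u \<otimes>\<^bsub>hom_group R A N\<^esub> compose (carrier A) h v"
      if "u \<in> carrier (hom_group R A M)" "v \<in> carrier (hom_group R A M)" for u v
      using that by (auto simp: compose_def fun_eq_iff mhom_closed mhom_add[OF h])
    show "compose (carrier A) h u \<in> hom_image R (A, B, f) N" if "u \<in> hom_image R (A, B, f) M" for u
    proof -
      obtain k where k: "k \<in> mhom R B M" "u = compose (carrier A) k f" using \<open>u \<in> hom_image R (A, B, f) M\<close> by (auto simp: hom_image_iff)
      have "compose (carrier A) h u = compose (carrier A) (compose (carrier B) h k) f"
        unfolding k(2) by (auto simp: compose_def fun_eq_iff mhom_closed[OF fp_f[OF p]])
      then show ?thesis using mhom_compose[OF B.left_module_axioms k(1) h] by (auto simp: hom_image_iff)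
    qed
  qed
  then show ?thesis by (simp add: coker_functor_def cls_def)
qed

lemma trivial_coker_iff:
  assumes "left_module R M"
  shows "trivial_group (fob (coker_functor R (A, B, f)) M) \<longleftrightarrow> factors R (A, B, f) M"
proof -
  interpret C: comm_group "fob (coker_functor R (A, B, f)) M" by (rule coker_comm_group[OF assms])
  note z = mhom_zero_map[OF A.left_module_axioms assms]
  have "trivial_group (fob (coker_functor R (A, B, f)) M) \<longleftrightarrow> (\<exists>c. cls R (A, B, f) M ` mhom R A M \<subseteq> {c})"
    unfolding C.trivial_group_alt coker_carrier ..
  also have "\<dots> \<longleftrightarrow> (\<forall>g\<in>mhom R A M. cls R (A, B, f) M g = cls R (A, B, f) M (\<lambda>x\<in>carrier A. \<zero>\<^bsub>M\<^esub>))"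
    using z by blast
  also have "\<dots> \<longleftrightarrow> factors R (A, B, f) M"
    using cls_zero_iff[OF assms] by (auto simp: factors_def)
  finally show ?thesis .
qed

lemma additive_coker: "additive_functor R (coker_functor R (A, B, f))"
  unfolding additive_functor_def
proof (intro conjI ballI)
  fix X :: "('r, 'u) module" assume X: "X \<in> fp_modules R"
  show "comm_group (fob (coker_functor R (A, B, f)) X)" by (rule coker_comm_group[OF fp_modules_left_module[OF X]])
next
  fix X Y :: "('r, 'u) module" and h assume XY: "X \<in> fp_modules R" "Y \<in> fp_modules R" and h: "h \<in> mhom R X Y"
  note X = fp_modules_left_module[OF XY(1)] and Y = fp_modules_left_module[OF XY(2)]
  show "fmor (coker_functor R (A, B, f)) X Y h \<in> hom (fob (coker_functor R (A, B, f)) X) (fob (coker_functor R (A, B, f)) Y)"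
  proof (rule homI)
    show "fmor (coker_functor R (A, B, f)) X Y h c \<in> carrier (fob (coker_functor R (A, B, f)) Y)"
      if "c \<in> carrier (fob (coker_functor R (A, B, f)) X)" for c
      using that unfolding coker_carrier by (auto simp: coker_fmor[OF X Y h] intro: mhom_compose[OF A.left_module_axioms _ h])
    show "fmor (coker_functor R (A, B, f)) X Y h (c \<otimes>\<^bsub>fob (coker_functor R (A, B, f)) X\<^esub> d) =
      fmor (coker_functor R (A, B, f)) X Y h c \<otimes>\<^bsub>fob (coker_functor R (A, B, f)) Y\<^esub> fmor (coker_functor R (A, B, f)) X Y h d"
      if cd: "c \<in> carrier (fob (coker_functor R (A, B, f)) X)" "d \<in> carrier (fob (coker_functor R (A, B, f)) X)" for c d
    proof -
      obtain g k where g: "g \<in> mhom R A X" "c = cls R (A, B, f) X g" and k: "k \<in> mhom R A X" "d = cls R (A, B, f) X k"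
        using cd unfolding coker_carrier by blast
      have "compose (carrier A) h (\<lambda>x\<in>carrier A. g x \<oplus>\<^bsub>X\<^esub> k x) =
        (\<lambda>x\<in>carrier A. compose (carrier A) h g x \<oplus>\<^bsub>Y\<^esub> compose (carrier A) h k x)"
        using g k by (auto simp: compose_def fun_eq_iff mhom_closed mhom_add[OF h])
      then show ?thesis
        unfolding g(2) k(2) coker_mult[OF X g(1) k(1)] coker_fmor[OF X Y h g(1)] coker_fmor[OF X Y h k(1)]
          coker_mult[OF Y mhom_compose[OF A.left_module_axioms g(1) h] mhom_compose[OF A.left_module_axioms k(1) h]]
          coker_fmor[OF X Y h mhom_sum[OF A.left_module_axioms X g(1) k(1)]] by simp
    qed
  qed
next
  fix X :: "('r, 'u) module" and c assume X': "X \<in> fp_modules R" and c: "c \<in> carrier (fob (coker_functor R (A, B, f)) X)"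
  note X = fp_modules_left_module[OF X']
  obtain g where g: "g \<in> mhom R A X" "c = cls R (A, B, f) X g" using c unfolding coker_carrier by blast
  have "compose (carrier A) (\<lambda>u\<in>carrier X. u) g = g"
    using mhom_closed[OF g(1)] mhom_ext[OF g(1)] by (auto simp: compose_def fun_eq_iff extensional_def)
  then show "fmor (coker_functor R (A, B, f)) X X (\<lambda>u\<in>carrier X. u) c = c"
    unfolding g(2) coker_fmor[OF X X mhom_id[OF X] g(1)] by simp
next
  fix X Y Z :: "('r, 'u) module" and h k c assume XYZ: "X \<in> fp_modules R" "Y \<in> fp_modules R" "Z \<in> fp_modules R"
    and h: "h \<in> mhom R X Y" and k: "k \<in> mhom R Y Z" and c: "c \<in> carrier (fob (coker_functor R (A, B, f)) X)"
  note X = fp_modules_left_module[OF XYZ(1)] and Y = fp_modules_left_module[OF XYZ(2)]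
    and Z = fp_modules_left_module[OF XYZ(3)]
  obtain g where g: "g \<in> mhom R A X" "c = cls R (A, B, f) X g" using c unfolding coker_carrier by blast
  have "compose (carrier A) (compose (carrier X) k h) g = compose (carrier A) k (compose (carrier A) h g)"
    using mhom_closed[OF g(1)] by (auto simp: compose_def fun_eq_iff)
  then show "fmor (coker_functor R (A, B, f)) X Z (compose (carrier X) k h) c =
      fmor (coker_functor R (A, B, f)) Y Z k (fmor (coker_functor R (A, B, f)) X Y h c)"
    unfolding g(2) coker_fmor[OF X Y h g(1)] coker_fmor[OF Y Z k mhom_compose[OF A.left_module_axioms g(1) h]]
      coker_fmor[OF X Z mhom_compose[OF X h k] g(1)] by simp
next
  fix X Y :: "('r, 'u) module" and h k c assume XY: "X \<in> fp_modules R" "Y \<in> fp_modules R"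
    and h: "h \<in> mhom R X Y" and k: "k \<in> mhom R X Y" and c: "c \<in> carrier (fob (coker_functor R (A, B, f)) X)"
  note X = fp_modules_left_module[OF XY(1)] and Y = fp_modules_left_module[OF XY(2)]
  obtain g where g: "g \<in> mhom R A X" "c = cls R (A, B, f) X g" using c unfolding coker_carrier by blast
  have "compose (carrier A) (\<lambda>x\<in>carrier X. h x \<oplus>\<^bsub>Y\<^esub> k x) g =
      (\<lambda>x\<in>carrier A. compose (carrier A) h g x \<oplus>\<^bsub>Y\<^esub> compose (carrier A) k g x)"
    using mhom_closed[OF g(1)] by (auto simp: compose_def fun_eq_iff)
  then show "fmor (coker_functor R (A, B, f)) X Y (h \<otimes>\<^bsub>hom_group R X Y\<^esub> k) c =
      fmor (coker_functor R (A, B, f)) X Y h c \<otimes>\<^bsub>fob (coker_functor R (A, B, f)) Y\<^esub> fmor (coker_functor R (A, B, f)) X Y k c"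
    unfolding g(2) hom_group_simps coker_fmor[OF X Y h g(1)] coker_fmor[OF X Y k g(1)]
      coker_fmor[OF X Y mhom_sum[OF X Y h k] g(1)]
      coker_mult[OF Y mhom_compose[OF A.left_module_axioms g(1) h] mhom_compose[OF A.left_module_axioms g(1) k]] by simp
qed

lemma functor_iso_coker_refl: "functor_iso R (coker_functor R (A, B, f)) (coker_functor R (A, B, f))"
  unfolding functor_iso_def
proof (rule bexI)
    let ?\<eta> = "\<lambda>X\<in>fp_modules R. \<lambda>c\<in>carrier (fob (coker_functor R (A, B, f)) X). c"
    have fm: "fmor (coker_functor R (A, B, f)) X Y h c \<in> carrier (fob (coker_functor R (A, B, f)) Y)"
      if "X \<in> fp_modules R" "Y \<in> fp_modules R" "h \<in> mhom R X Y" "c \<in> carrier (fob (coker_functor R (A, B, f)) X)" for X Y h c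
      using additive_coker that unfolding additive_functor_def hom_def by blast
    have mc: "c \<otimes>\<^bsub>fob (coker_functor R (A, B, f)) X\<^esub> d \<in> carrier (fob (coker_functor R (A, B, f)) X)"
      if "X \<in> fp_modules R" "c \<in> carrier (fob (coker_functor R (A, B, f)) X)" "d \<in> carrier (fob (coker_functor R (A, B, f)) X)" for X c d
      using coker_comm_group[OF fp_modules_left_module[OF that(1)]] that
      by (meson comm_group.axioms(2) group.is_monoid monoid.m_closed)
    show "?\<eta> \<in> nat_trans R (coker_functor R (A, B, f)) (coker_functor R (A, B, f))"
      unfolding nat_trans_def by (auto simp: hom_def fm mc)
    show "\<forall>X\<in>fp_modules R. bij_betw (?\<eta> X) (carrier (fob (coker_functor R (A, B, f)) X)) (carrier (fob (coker_functor R (A, B, f)) X))"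
      by (auto simp: bij_betw_def inj_on_def)
qed

lemma fp_functor_coker: "fp_functor R (coker_functor R (A, B, f))"
  unfolding fp_functor_def using additive_coker functor_iso_coker_refl p by blast

end

section \<open>Independence of the presentation\<close>

text \<open>Only this much of functoriality is needed to compare two presentations of one functor.\<close>

definition fmor_closed :: "'r ring \<Rightarrow> ('r, 'u, 'x) mod_functor \<Rightarrow> bool" where
  "fmor_closed R G \<longleftrightarrow> (\<forall>X\<in>fp_modules R. \<forall>Y\<in>fp_modules R. \<forall>h\<in>mhom R X Y. \<forall>c\<in>carrier (fob G X).
     fmor G X Y h c \<in> carrier (fob G Y))"

lemma fp_functor_fmor_closed: "fp_functor R G \<Longrightarrow> fmor_closed R G"
  unfolding fp_functor_def additive_functor_def fmor_closed_def hom_def by blast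

lemma nat_transD:
  assumes "\<eta> \<in> nat_trans R F G" "X \<in> fp_modules R"
  shows "\<eta> X \<in> hom (fob F X) (fob G X)" "\<eta> X \<in> extensional (carrier (fob F X))"
    "c \<in> carrier (fob F X) \<Longrightarrow> \<eta> X c \<in> carrier (fob G X)"
    "Y \<in> fp_modules R \<Longrightarrow> h \<in> mhom R X Y \<Longrightarrow> c \<in> carrier (fob F X) \<Longrightarrow> \<eta> Y (fmor F X Y h c) = fmor G X Y h (\<eta> X c)"
  using assms unfolding nat_trans_def hom_def by (auto simp: PiE_iff)

text \<open>Lift the comparison isomorphism to maps between the presentations, by evaluating it at the
  classes of the identity maps.\<close>

lemma factors_transfer:
  assumes G: "fmor_closed R G"
    and p: "(A, B, f) \<in> fp_morphisms R" and q: "(A', B', f') \<in> fp_morphisms R"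
    and \<eta>: "functor_iso R G (coker_functor R (A, B, f))" and \<theta>: "functor_iso R G (coker_functor R (A', B', f'))"
    and M: "left_module R M" and fac: "factors R (A', B', f') M"
  shows "factors R (A, B, f) M"
proof -
  let ?p = "(A, B, f)" and ?q = "(A', B', f')"
  have mem: "A \<in> fp_modules R" "B \<in> fp_modules R" "A' \<in> fp_modules R" "B' \<in> fp_modules R"
    and f: "f \<in> mhom R A B" and f': "f' \<in> mhom R A' B'" using p q by (auto simp: fp_morphisms_def)
  note lm = mem[THEN fp_modules_left_module]
  interpret M: left_module R M by fact
  interpret A: left_module R A by (rule lm(1))
  obtain e where e: "e \<in> nat_trans R G (coker_functor R ?p)"
    "\<And>X. X \<in> fp_modules R \<Longrightarrow> bij_betw (e X) (carrier (fob G X)) (carrier (fob (coker_functor R ?p) X))"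
    using \<eta> unfolding functor_iso_def by blast
  obtain t where t: "t \<in> nat_trans R G (coker_functor R ?q)"
    "\<And>X. X \<in> fp_modules R \<Longrightarrow> bij_betw (t X) (carrier (fob G X)) (carrier (fob (coker_functor R ?q) X))"
    using \<theta> unfolding functor_iso_def by blast
  have Gc: "fmor G X Y h c \<in> carrier (fob G Y)"
    if "X \<in> fp_modules R" "Y \<in> fp_modules R" "h \<in> mhom R X Y" "c \<in> carrier (fob G X)" for X Y h c
    using G that unfolding fmor_closed_def by blast
  have tinj: "c = d" if "X \<in> fp_modules R" "c \<in> carrier (fob G X)" "d \<in> carrier (fob G X)" "t X c = t X d" for X c d
    using t(2)[OF that(1)] that unfolding bij_betw_def inj_on_def by blast
  let ?i = "\<lambda>x\<in>carrier A. x" and ?i' = "\<lambda>x\<in>carrier A'. x"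
  have i: "?i \<in> mhom R A A" and i': "?i' \<in> mhom R A' A'" using mhom_id lm by blast+
  have comp_i: "compose (carrier A) h ?i = h" if "h \<in> mhom R A X" for h X
    using mhom_ext[OF that] by (auto simp: compose_def fun_eq_iff extensional_def)
  have comp_i': "compose (carrier A') h ?i' = h" if "h \<in> mhom R A' X" for h X
    using mhom_ext[OF that] by (auto simp: compose_def fun_eq_iff extensional_def)
  \<comment> \<open>By Yoneda the comparison maps are determined by elements of \<open>G\<close>:
    \<open>u\<close> corresponds to the identity of \<open>A\<close> under \<open>e\<close>, and
    \<open>v\<close> below to the identity of \<open>A'\<close> under \<open>t\<close>.\<close>
  obtain u where u: "u \<in> carrier (fob G A)" "e A u = cls R ?p A ?i"
  proof -
    have "e A ` carrier (fob G A) = cls R ?p A ` mhom R A A"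
      using e(2)[OF mem(1)] unfolding bij_betw_def coker_carrier[OF p] by simp
    then have "cls R ?p A ?i \<in> e A ` carrier (fob G A)" using i by simp
    then show thesis using that by (auto elim!: imageE)
  qed
  obtain v where v: "v \<in> carrier (fob G A')" "t A' v = cls R ?q A' ?i'"
  proof -
    have "t A' ` carrier (fob G A') = cls R ?q A' ` mhom R A' A'"
      using t(2)[OF mem(3)] unfolding bij_betw_def coker_carrier[OF q] by simp
    then have "cls R ?q A' ?i' \<in> t A' ` carrier (fob G A')" using i' by simp
    then show thesis using that by (auto elim!: imageE)
  qed
  \<comment> \<open>Reading \<open>u\<close> in the other presentation gives \<open>g\<close> from
    \<open>A'\<close> to \<open>A\<close>, and reading \<open>v\<close> in the first one gives
    \<open>g'\<close> in the opposite direction. They represent the mutually inverse comparison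
    maps.\<close>
  obtain g where g: "g \<in> mhom R A' A" "t A u = cls R ?q A g"
    using nat_transD(3)[OF t(1) mem(1) u(1)] unfolding coker_carrier[OF q] by blast
  obtain g' where g': "g' \<in> mhom R A A'" "e A' v = cls R ?p A' g'"
    using nat_transD(3)[OF e(1) mem(3) v(1)] unfolding coker_carrier[OF p] by blast
  have "t A (fmor G A' A g v) = cls R ?q A g"
    using nat_transD(4)[OF t(1) mem(3,1) g(1) v(1)] coker_fmor[OF q lm(3,1) g(1) i'] comp_i'[OF g(1)] v(2) by simp
  then have "fmor G A' A g v = u"
    using tinj[OF mem(1) Gc[OF mem(3,1) g(1) v(1)] u(1)] g(2) by simp
  \<comment> \<open>The round trip is the identity in the cokernel, so the identity of
    \<open>A\<close> differs from \<open>g\<close> after \<open>g'\<close> by a map of the form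
    \<open>s\<close> after \<open>f\<close>.\<close>
  then have "cls R ?p A ?i = cls R ?p A (compose (carrier A) g g')"
    using nat_transD(4)[OF e(1) mem(3,1) g(1) v(1)] coker_fmor[OF p lm(3,1) g(1) g'(1)] g'(2) u(2) by simp
  then obtain s where s: "s \<in> mhom R B A" "(\<lambda>x\<in>carrier A. ?i x \<oplus>\<^bsub>A\<^esub> \<ominus>\<^bsub>A\<^esub> compose (carrier A) g g' x) = compose (carrier A) s f"
    using cls_eq_iff[OF p lm(1) i mhom_compose[OF lm(1) g'(1) g(1)]] by (auto simp: hom_image_iff)
  let ?z = "\<lambda>x\<in>carrier A'. \<zero>\<^bsub>B'\<^esub>"
  have z: "?z \<in> mhom R A' B'" by (rule mhom_zero_map[OF lm(3,4)])
  have "f' \<in> hom_image R ?q B'"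
    using mhom_id[OF lm(4)] mhom_ext[OF f'] mhom_closed[OF f'] unfolding hom_image_iff
    by (intro bexI[of _ "\<lambda>x\<in>carrier B'. x"]) (auto simp: compose_def fun_eq_iff extensional_def)
  then have "cls R ?q B' f' = cls R ?q B' ?z" using cls_zero_iff[OF q lm(4) f'] by simp
  \<comment> \<open>\<open>f'\<close> has the class of the zero map and therefore kills
    \<open>v\<close>. Carried over to the first presentation this says that \<open>f'\<close> after
    \<open>g'\<close> factors through \<open>f\<close>, by way of the map \<open>t'\<close>.\<close>
  then have "t B' (fmor G A' B' f' v) = t B' (fmor G A' B' ?z v)"
    using nat_transD(4)[OF t(1) mem(3,4) f' v(1)] nat_transD(4)[OF t(1) mem(3,4) z v(1)]
      coker_fmor[OF q lm(3,4) f' i'] coker_fmor[OF q lm(3,4) z i'] comp_i'[OF f'] comp_i'[OF z] v(2) by simp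
  then have "fmor G A' B' f' v = fmor G A' B' ?z v"
    using tinj[OF mem(4) Gc[OF mem(3,4) f' v(1)] Gc[OF mem(3,4) z v(1)]] by blast
  then have "cls R ?p B' (compose (carrier A) f' g') = cls R ?p B' (compose (carrier A) ?z g')"
    using nat_transD(4)[OF e(1) mem(3,4) f' v(1)] nat_transD(4)[OF e(1) mem(3,4) z v(1)]
      coker_fmor[OF p lm(3,4) f' g'(1)] coker_fmor[OF p lm(3,4) z g'(1)] g'(2) by simp
  moreover have "compose (carrier A) ?z g' = (\<lambda>x\<in>carrier A. \<zero>\<^bsub>B'\<^esub>)"
    using mhom_closed[OF g'(1)] by (auto simp: compose_def fun_eq_iff)
  ultimately have "compose (carrier A) f' g' \<in> hom_image R ?p B'"
    using cls_zero_iff[OF p lm(4) mhom_compose[OF lm(1) g'(1) f']] by simp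
  then obtain t' where t': "t' \<in> mhom R B B'" "compose (carrier A) f' g' = compose (carrier A) t' f"
    unfolding hom_image_iff by blast
  show ?thesis unfolding factors_def
  proof
    fix h assume "h \<in> mhom R (fst ?p) M"
    then have h: "h \<in> mhom R A M" by simp
    have "compose (carrier A') h g \<in> hom_image R ?q M"
      using fac mhom_compose[OF lm(3) g(1) h] unfolding factors_def by auto
    then obtain w where w: "w \<in> mhom R B' M" "compose (carrier A') h g = compose (carrier A') w f'"
      unfolding hom_image_iff by blast
    \<comment> \<open>Write \<open>h\<close> as \<open>h\<close> after \<open>g\<close> after
      \<open>g'\<close> plus \<open>h\<close> after \<open>s\<close> after \<open>f\<close>. The
      hypothesis replaces \<open>h\<close> after \<open>g\<close> by \<open>w\<close> after
      \<open>f'\<close>, and \<open>f'\<close> after \<open>g'\<close> is \<open>t'\<close> after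
      \<open>f\<close>, so both summands factor through \<open>f\<close>.\<close>
    let ?k = "\<lambda>b\<in>carrier B. compose (carrier B) w t' b \<oplus>\<^bsub>M\<^esub> compose (carrier B) h s b"
    have k: "?k \<in> mhom R B M"
      by (rule mhom_sum[OF lm(2) M mhom_compose[OF lm(2) t'(1) w(1)] mhom_compose[OF lm(2) s(1) h]])
    have "h a = ?k (f a)" if a: "a \<in> carrier A" for a
    proof -
      have fa: "f a \<in> carrier B" and ga: "g' a \<in> carrier A'" and gga: "g (g' a) \<in> carrier A"
        using mhom_closed[OF f a] mhom_closed[OF g'(1) a] mhom_closed[OF g(1) mhom_closed[OF g'(1) a]] .
      have "h (g (g' a)) = w (f' (g' a))" using fun_cong[OF w(2), of "g' a"] ga by (simp add: compose_def)
      also have "f' (g' a) = t' (f a)" using fun_cong[OF t'(2), of a] a by (simp add: compose_def)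
      finally have 1: "h (g (g' a)) = w (t' (f a))" .
      have "a \<oplus>\<^bsub>A\<^esub> \<ominus>\<^bsub>A\<^esub> g (g' a) = s (f a)" using fun_cong[OF s(2), of a] a by (simp add: compose_def)
      then have "h (s (f a)) = h a \<oplus>\<^bsub>M\<^esub> \<ominus>\<^bsub>M\<^esub> h (g (g' a))"
        using a gga mhom_add[OF h] mhom_uminus[OF A.abelian_group_M M.abelian_group_M h gga] by (metis A.M.a_inv_closed)
      then have "w (t' (f a)) \<oplus>\<^bsub>M\<^esub> h (s (f a)) = h a"
        using 1 mhom_closed[OF h a] mhom_closed[OF h gga] M.M.r_neg1[of "h (g (g' a))" "h a"]
        by (simp add: M.M.a_lcomm M.M.r_neg)
      then show ?thesis using fa by (simp add: compose_def)
    qed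
    then have "h = compose (carrier A) ?k f"
      using mhom_ext[OF h] by (auto simp: compose_def fun_eq_iff extensional_def)
    then show "h \<in> hom_image R ?p M" using k unfolding hom_image_iff by blast
  qed
qed

text \<open>This removes the choice operator from \<open>extension\<close>:
  \<open>factors_transfer\<close> in both directions allows any presentation to be used for deciding
  vanishing.\<close>

lemma extension_trivial_iff:
  assumes G: "fmor_closed R G" and p: "p \<in> fp_morphisms R" "functor_iso R G (coker_functor R p)" and M: "left_module R M"
  shows "trivial_group (fob (extension R G) M) \<longleftrightarrow> factors R p M"
proof -
  define q where "q = (SOME p. p \<in> fp_morphisms R \<and> functor_iso R G (coker_functor R p))"
  have q: "q \<in> fp_morphisms R" "functor_iso R G (coker_functor R q)"
    using someI[of "\<lambda>p. p \<in> fp_morphisms R \<and> functor_iso R G (coker_functor R p)" p] p unfolding q_def by auto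
  obtain A B f where pq: "p = (A, B, f)" by (cases p)
  obtain A' B' f' where qq: "q = (A', B', f')" by (cases q)
  have "trivial_group (fob (extension R G) M) \<longleftrightarrow> factors R q M"
    using trivial_coker_iff[OF q(1)[unfolded qq] M] by (simp add: extension_def q_def[symmetric] qq)
  also have "\<dots> \<longleftrightarrow> factors R p M"
    using factors_transfer[OF G p(1)[unfolded pq] q(1)[unfolded qq] p(2)[unfolded pq] q(2)[unfolded qq] M]
      factors_transfer[OF G q(1)[unfolded qq] p(1)[unfolded pq] q(2)[unfolded qq] p(2)[unfolded pq] M]
    unfolding pq qq by blast
  finally show ?thesis .
qed

subsection \<open>Tensor products\<close>

lemma keys_diff_subset: "Poly_Mapping.keys a \<subseteq> S \<Longrightarrow> Poly_Mapping.keys b \<subseteq> S \<Longrightarrow> Poly_Mapping.keys (a - b :: 'a \<Rightarrow>\<^sub>0 int) \<subseteq> S"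
  using keys_diff[of a b] by blast

lemma keys_add_subset: "Poly_Mapping.keys a \<subseteq> S \<Longrightarrow> Poly_Mapping.keys b \<subseteq> S \<Longrightarrow> Poly_Mapping.keys (a + b :: 'a \<Rightarrow>\<^sub>0 int) \<subseteq> S"
  using keys_add[of a b] by blast

lemma add_on_free_group:
  assumes "add_on (free_Abelian_group S) \<Phi>" "Poly_Mapping.keys a \<subseteq> S" "Poly_Mapping.keys b \<subseteq> S"
  shows "\<Phi> (a + b) = \<Phi> a + \<Phi> b" "\<Phi> (a - b) = \<Phi> a - \<Phi> b" "\<Phi> 0 = 0" "\<Phi> (- a) = - \<Phi> a"
proof -
  have add: "\<Phi> (x + y) = \<Phi> x + \<Phi> y" if "Poly_Mapping.keys x \<subseteq> S" "Poly_Mapping.keys y \<subseteq> S" for x y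
    using assms(1) that unfolding add_on_def by simp
  show "\<Phi> (a + b) = \<Phi> a + \<Phi> b" by (intro add assms)
  have "\<Phi> ((a - b) + b) = \<Phi> (a - b) + \<Phi> b" by (intro add keys_diff_subset assms)
  then show "\<Phi> (a - b) = \<Phi> a - \<Phi> b" by simp
  show z: "\<Phi> 0 = 0" using add[of 0 0] by simp
  have "\<Phi> (- a + a) = \<Phi> (- a) + \<Phi> a" using assms(2) by (intro add) (auto simp: keys_minus)
  then show "\<Phi> (- a) = - \<Phi> a" using z by (simp add: eq_neg_iff_add_eq_0)
qed

definition tensor_gens :: "'r ring \<Rightarrow> ('r, 'a) module \<Rightarrow> ('r, 'b) module \<Rightarrow> ('a \<times> 'b \<Rightarrow>\<^sub>0 int) set" where
  "tensor_gens R N X =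
     {frag_of (n \<oplus>\<^bsub>N\<^esub> n', x) - frag_of (n, x) - frag_of (n', x) | n n' x.
         n \<in> carrier N \<and> n' \<in> carrier N \<and> x \<in> carrier X} \<union>
      {frag_of (n, x \<oplus>\<^bsub>X\<^esub> x') - frag_of (n, x) - frag_of (n, x') | n x x'.
         n \<in> carrier N \<and> x \<in> carrier X \<and> x' \<in> carrier X} \<union>
      {frag_of (r \<odot>\<^bsub>N\<^esub> n, x) - frag_of (n, r \<odot>\<^bsub>X\<^esub> x) | r n x.
         r \<in> carrier R \<and> n \<in> carrier N \<and> x \<in> carrier X}"

lemma tensor_relations_eq:
  "tensor_relations R N X = generate (free_Abelian_group (carrier N \<times> carrier X)) (tensor_gens R N X)"
  by (simp add: tensor_relations_def tensor_gens_def)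

text \<open>Linear maps without extensionality, because \<open>tensor_functor\<close> and
  \<open>AGJ\<close> pass the unrestricted identity function to \<open>tensor_map\<close>.\<close>

definition mlin :: "'r ring \<Rightarrow> ('r, 'a) module \<Rightarrow> ('r, 'b) module \<Rightarrow> ('a \<Rightarrow> 'b) \<Rightarrow> bool" where
  "mlin R M N h \<longleftrightarrow> (\<forall>x\<in>carrier M. h x \<in> carrier N) \<and>
     (\<forall>x\<in>carrier M. \<forall>y\<in>carrier M. h (x \<oplus>\<^bsub>M\<^esub> y) = h x \<oplus>\<^bsub>N\<^esub> h y) \<and>
     (\<forall>r\<in>carrier R. \<forall>x\<in>carrier M. h (r \<odot>\<^bsub>M\<^esub> x) = r \<odot>\<^bsub>N\<^esub> h x)"

lemma mlin_mhom: "h \<in> mhom R M N \<Longrightarrow> mlin R M N h"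
  by (simp add: mlin_def mhom_closed mhom_add mhom_smult)

lemma mlin_id: "mlin R M M (\<lambda>x. x)"
  by (simp add: mlin_def)

definition tcls :: "'r ring \<Rightarrow> ('r, 'a) module \<Rightarrow> ('r, 'b) module \<Rightarrow> ('a \<times> 'b \<Rightarrow>\<^sub>0 int) \<Rightarrow> ('a \<times> 'b \<Rightarrow>\<^sub>0 int) set" where
  "tcls R N X c = tensor_relations R N X #>\<^bsub>free_Abelian_group (carrier N \<times> carrier X)\<^esub> c"

definition frag_pair :: "('a \<Rightarrow> 'c) \<Rightarrow> ('b \<Rightarrow> 'd) \<Rightarrow> ('a \<times> 'b \<Rightarrow>\<^sub>0 int) \<Rightarrow> ('c \<times> 'd \<Rightarrow>\<^sub>0 int)" where
  "frag_pair g h = frag_extend (\<lambda>(n, x). frag_of (g n, h x))"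

definition tsum :: "nat \<Rightarrow> (nat \<Rightarrow> 'a) \<Rightarrow> (nat \<Rightarrow> 'b) \<Rightarrow> ('a \<times> 'b \<Rightarrow>\<^sub>0 int)" where
  "tsum n x a = (\<Sum>i<n. frag_of (x i, a i))"

lemma keys_tsum: "vec N n x \<Longrightarrow> vec X n a \<Longrightarrow> Poly_Mapping.keys (tsum n x a) \<subseteq> carrier N \<times> carrier X"
proof (induction n)
  case (Suc n)
  then have "Poly_Mapping.keys (tsum n x a + frag_of (x n, a n)) \<subseteq> carrier N \<times> carrier X"
    by (intro keys_add_subset) (auto simp: vec_def)
  then show ?case by (simp add: tsum_def)
qed (simp add: tsum_def)

lemma frag_pair_simps [simp]:
  "frag_pair g h 0 = 0" "frag_pair g h (frag_of (n, x)) = frag_of (g n, h x)"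
  "frag_pair g h (a + b) = frag_pair g h a + frag_pair g h b" "frag_pair g h (a - b) = frag_pair g h a - frag_pair g h b"
  by (simp_all add: frag_pair_def frag_extend_add frag_extend_diff)

lemma frag_pair_tsum: "frag_pair g h (tsum n x a) = tsum n (\<lambda>i. g (x i)) (\<lambda>i. h (a i))"
  unfolding tsum_def by (induction n) auto

lemma keys_frag_pair:
  assumes "Poly_Mapping.keys c \<subseteq> carrier N \<times> carrier X" "mlin S N N' g" "mlin R X Y h"
  shows "Poly_Mapping.keys (frag_pair g h c) \<subseteq> carrier N' \<times> carrier Y"
proof (rule free_Abelian_group_induct[OF assms(1), where P = "\<lambda>c. Poly_Mapping.keys (frag_pair g h c) \<subseteq> carrier N' \<times> carrier Y"])
  show "Poly_Mapping.keys (frag_pair g h (a - b)) \<subseteq> carrier N' \<times> carrier Y"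
    if "Poly_Mapping.keys (frag_pair g h a) \<subseteq> carrier N' \<times> carrier Y"
       "Poly_Mapping.keys (frag_pair g h b) \<subseteq> carrier N' \<times> carrier Y" for a b
    using keys_diff_subset[OF that] by simp
qed (use assms in \<open>auto simp: mlin_def\<close>)

lemma frag_pair_cong:
  assumes "Poly_Mapping.keys c \<subseteq> S" "\<And>n x. (n, x) \<in> S \<Longrightarrow> g n = g' n \<and> h x = h' x"
  shows "frag_pair g h c = frag_pair g' h' c"
  by (rule free_Abelian_group_induct[OF assms(1), where P = "\<lambda>c. frag_pair g h c = frag_pair g' h' c"])
    (use assms(2) in auto)

lemma frag_pair_comp: "frag_pair g h (frag_pair g' h' c) = frag_pair (\<lambda>n. g (g' n)) (\<lambda>x. h (h' x)) c"
  by (rule free_Abelian_group_induct[of c UNIV]) auto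

context
  fixes R :: "'r ring" and N :: "('r, 'a) module" and X :: "('r, 'b) module"
  assumes N: "left_module (opp R) N" and X: "left_module R X"
begin

interpretation N: left_module "opp R" N by (rule N)
interpretation X: left_module R X by (rule X)

abbreviation (input) "tensor_FG \<equiv> free_Abelian_group (carrier N \<times> carrier X)"
abbreviation (input) "tensor_T \<equiv> tensor_relations R N X"

lemma tensor_gens_carrier: "tensor_gens R N X \<subseteq> carrier tensor_FG"
proof
  fix g assume "g \<in> tensor_gens R N X"
  then show "g \<in> carrier tensor_FG"
    unfolding tensor_gens_def by (elim UnE CollectE exE conjE) (simp_all add: keys_diff_subset)
qed

lemma keys_tensor_gens: "g \<in> tensor_gens R N X \<Longrightarrow> Poly_Mapping.keys g \<subseteq> carrier N \<times> carrier X"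
  using subsetD[OF tensor_gens_carrier, of g] unfolding carrier_free_Abelian_group_iff .

lemma tensor_relations_subgroup: "subgroup tensor_T tensor_FG"
  unfolding tensor_relations_eq
  by (rule group.generate_is_subgroup[OF group_free_Abelian_group tensor_gens_carrier])

lemma tcls_eq_iff:
  assumes "Poly_Mapping.keys c \<subseteq> carrier N \<times> carrier X" "Poly_Mapping.keys d \<subseteq> carrier N \<times> carrier X"
  shows "tcls R N X c = tcls R N X d \<longleftrightarrow> c - d \<in> tensor_T"
  using comm_group.rcos_eq_iff[OF abelian_free_Abelian_group tensor_relations_subgroup, of c d] assms
  by (simp add: tcls_def)

text \<open>The additive extension of \<open>\<theta>\<close> to the free abelian group. For a
  homomorphism \<open>\<theta>\<close> from \<open>X\<close> to \<open>cm N\<close> it induces the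
  corresponding character of the tensor product.\<close>

definition rep_char :: "('b \<Rightarrow> 'a \<Rightarrow> qz) \<Rightarrow> ('a \<times> 'b \<Rightarrow>\<^sub>0 int) \<Rightarrow> qz" where
  "rep_char \<theta> = (SOME \<Phi>. add_on tensor_FG \<Phi> \<and> (\<forall>n\<in>carrier N. \<forall>x\<in>carrier X. \<Phi> (frag_of (n, x)) = \<theta> x n))"

lemma rep_char: "add_on tensor_FG (rep_char \<theta>)"
  "n \<in> carrier N \<Longrightarrow> x \<in> carrier X \<Longrightarrow> rep_char \<theta> (frag_of (n, x)) = \<theta> x n"
proof -
  have "\<exists>\<Phi>. add_on tensor_FG \<Phi> \<and> (\<forall>n\<in>carrier N. \<forall>x\<in>carrier X. \<Phi> (frag_of (n, x)) = \<theta> x n)"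
    using free_char[of "carrier N \<times> carrier X" "\<lambda>(n, x). \<theta> x n"] by force
  from someI_ex[OF this] show "add_on tensor_FG (rep_char \<theta>)"
    "n \<in> carrier N \<Longrightarrow> x \<in> carrier X \<Longrightarrow> rep_char \<theta> (frag_of (n, x)) = \<theta> x n"
    unfolding rep_char_def by blast+
qed

lemma rep_char_tsum:
  assumes "vec N n x" "vec X n a"
  shows "rep_char \<theta> (tsum n x a) = (\<Sum>i<n. \<theta> (a i) (x i))"
  using assms
proof (induction n)
  case 0 then show ?case using add_on_free_group(3)[OF rep_char(1), of 0 0] by (simp add: tsum_def)
next
  case (Suc n)
  then have v: "vec N n x" "vec X n a" "x n \<in> carrier N" "a n \<in> carrier X" by (auto simp: vec_def)
  have "rep_char \<theta> (tsum (Suc n) x a) = rep_char \<theta> (tsum n x a) + rep_char \<theta> (frag_of (x n, a n))"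
    unfolding tsum_def sum.lessThan_Suc
    by (rule add_on_free_group(1)[OF rep_char(1)]) (use keys_tsum[OF v(1,2)] v in \<open>auto simp: tsum_def\<close>)
  then show ?case using Suc.IH[OF v(1,2)] rep_char(2)[OF v(3,4)] by simp
qed

text \<open>The characters of \<open>N \<otimes> X\<close> are the homomorphisms from \<open>X\<close> to the character module of \<open>N\<close>; they detect
  equality in \<open>N \<otimes> X\<close>.\<close>

lemma tensor_relations_iff:
  assumes c: "Poly_Mapping.keys c \<subseteq> carrier N \<times> carrier X"
  shows "c \<in> tensor_T \<longleftrightarrow> (\<forall>\<theta>\<in>mhom R X (cm N). rep_char \<theta> c = 0)"
proof
  assume "c \<in> tensor_T"
  show "\<forall>\<theta>\<in>mhom R X (cm N). rep_char \<theta> c = 0"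
  proof
    fix \<theta> assume \<theta>: "\<theta> \<in> mhom R X (cm N)"
    note \<Phi> = rep_char(1)[of \<theta>]
    have gens: "rep_char \<theta> g = 0" if "g \<in> tensor_gens R N X" for g
    proof -
      show ?thesis using that unfolding tensor_gens_def
      proof (elim UnE CollectE exE conjE)
        fix n n' x assume a: "g = frag_of (n \<oplus>\<^bsub>N\<^esub> n', x) - frag_of (n, x) - frag_of (n', x)"
          "n \<in> carrier N" "n' \<in> carrier N" "x \<in> carrier X"
        then have "rep_char \<theta> g = \<theta> x (n \<oplus>\<^bsub>N\<^esub> n') - \<theta> x n - \<theta> x n'"
          by (simp add: add_on_free_group(2)[OF \<Phi>] keys_diff_subset rep_char(2))
        then show ?thesis using cm_add[OF mhom_closed[OF \<theta> a(4)] a(2,3)] by simp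
      next
        fix n x x' assume b: "g = frag_of (n, x \<oplus>\<^bsub>X\<^esub> x') - frag_of (n, x) - frag_of (n, x')"
          "n \<in> carrier N" "x \<in> carrier X" "x' \<in> carrier X"
        then have "rep_char \<theta> g = \<theta> (x \<oplus>\<^bsub>X\<^esub> x') n - \<theta> x n - \<theta> x' n"
          by (simp add: add_on_free_group(2)[OF \<Phi>] keys_diff_subset rep_char(2))
        then show ?thesis using mhom_add[OF \<theta> b(3,4)] b(2) by simp
      next
        fix r n x assume c: "g = frag_of (r \<odot>\<^bsub>N\<^esub> n, x) - frag_of (n, r \<odot>\<^bsub>X\<^esub> x)"
          "r \<in> carrier R" "n \<in> carrier N" "x \<in> carrier X"
        then have "rep_char \<theta> g = \<theta> x (r \<odot>\<^bsub>N\<^esub> n) - \<theta> (r \<odot>\<^bsub>X\<^esub> x) n"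
          by (simp add: add_on_free_group(2)[OF \<Phi>] rep_char(2))
        then show ?thesis using mhom_smult[OF \<theta> c(2,4)] c(3) by simp
      qed
    qed
    have "c \<in> generate tensor_FG (tensor_gens R N X)" using \<open>c \<in> tensor_T\<close> by (simp add: tensor_relations_eq)
    then have "Poly_Mapping.keys c \<subseteq> carrier N \<times> carrier X \<and> rep_char \<theta> c = 0"
    proof (induction c rule: generate.induct)
      case one
      then show ?case using add_on_free_group(3)[OF \<Phi>, of 0 0] by simp
    next
      case (incl h)
      then show ?case using gens keys_tensor_gens by blast
    next
      case (inv h)
      then have "Poly_Mapping.keys h \<subseteq> carrier N \<times> carrier X" by (rule keys_tensor_gens)
      then show ?case using add_on_free_group(4)[OF \<Phi>, of h h] gens[OF inv] by (simp add: keys_minus)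
    next
      case (eng g h)
      then show ?case using add_on_free_group(1)[OF \<Phi>, of g h] by (simp add: keys_add_subset)
    qed
    then show "rep_char \<theta> c = 0" ..
  qed
next
  assume z: "\<forall>\<theta>\<in>mhom R X (cm N). rep_char \<theta> c = 0"
  show "c \<in> tensor_T"
  proof (rule ccontr)
    assume "c \<notin> tensor_T"
    then obtain \<psi> where \<psi>: "add_on tensor_FG \<psi>" "\<forall>y\<in>tensor_T. \<psi> y = 0" "\<psi> c \<noteq> 0"
      using comm_group.char_separates[OF abelian_free_Abelian_group tensor_relations_subgroup, of c] c by auto
    have g: "\<psi> g = 0" if "g \<in> tensor_gens R N X" for g
      using \<psi>(2) generate.incl[OF that, of tensor_FG] by (simp add: tensor_relations_eq)
    \<comment> \<open>The function of two arguments underlying \<open>\<psi>\<close>, read as a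
      homomorphism: the vanishing of \<open>\<psi>\<close> on the generating relations says that it
      is bilinear and balanced.\<close>
    define \<theta> where "\<theta> = (\<lambda>x\<in>carrier X. \<lambda>n\<in>carrier N. \<psi> (frag_of (n, x)))"
    have b1: "\<psi> (frag_of (n \<oplus>\<^bsub>N\<^esub> n', x)) = \<psi> (frag_of (n, x)) + \<psi> (frag_of (n', x))"
      if "n \<in> carrier N" "n' \<in> carrier N" "x \<in> carrier X" for n n' x
    proof -
      have "\<psi> (frag_of (n \<oplus>\<^bsub>N\<^esub> n', x) - frag_of (n, x) - frag_of (n', x)) = 0"
        by (rule g) (use that in \<open>unfold tensor_gens_def, blast\<close>)
      then show ?thesis using that
        by (simp add: add_on_free_group(2)[OF \<psi>(1)] keys_diff_subset diff_eq_eq add.commute)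
    qed
    have b2: "\<psi> (frag_of (n, x \<oplus>\<^bsub>X\<^esub> x')) = \<psi> (frag_of (n, x)) + \<psi> (frag_of (n, x'))"
      if "n \<in> carrier N" "x \<in> carrier X" "x' \<in> carrier X" for n x x'
    proof -
      have "\<psi> (frag_of (n, x \<oplus>\<^bsub>X\<^esub> x') - frag_of (n, x) - frag_of (n, x')) = 0"
        by (rule g) (use that in \<open>unfold tensor_gens_def, blast\<close>)
      then show ?thesis using that
        by (simp add: add_on_free_group(2)[OF \<psi>(1)] keys_diff_subset diff_eq_eq add.commute)
    qed
    have b3: "\<psi> (frag_of (r \<odot>\<^bsub>N\<^esub> n, x)) = \<psi> (frag_of (n, r \<odot>\<^bsub>X\<^esub> x))"
      if "r \<in> carrier R" "n \<in> carrier N" "x \<in> carrier X" for r n x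
    proof -
      have "\<psi> (frag_of (r \<odot>\<^bsub>N\<^esub> n, x) - frag_of (n, r \<odot>\<^bsub>X\<^esub> x)) = 0"
        by (rule g) (use that in \<open>unfold tensor_gens_def, blast\<close>)
      then show ?thesis using that by (simp add: add_on_free_group(2)[OF \<psi>(1)])
    qed
    have "\<theta> \<in> mhom R X (cm N)"
      by (rule mhomI) (auto simp: \<theta>_def cm_carrier b1 b2 b3 fun_eq_iff)
    then have "rep_char \<theta> c = 0" using z by blast
    moreover have "rep_char \<theta> c = \<psi> c"
    proof (rule free_Abelian_group_induct[OF c, where P = "\<lambda>c. rep_char \<theta> c = \<psi> c"])
      show "rep_char \<theta> 0 = \<psi> 0"
        using add_on_free_group(3)[OF rep_char(1), of 0 0] add_on_free_group(3)[OF \<psi>(1), of 0 0] by simp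
      show "rep_char \<theta> (a - b) = \<psi> (a - b)"
        if "Poly_Mapping.keys a \<subseteq> carrier N \<times> carrier X" "Poly_Mapping.keys b \<subseteq> carrier N \<times> carrier X"
          "rep_char \<theta> a = \<psi> a" "rep_char \<theta> b = \<psi> b" for a b
        using add_on_free_group(2)[OF rep_char(1) that(1,2)] add_on_free_group(2)[OF \<psi>(1) that(1,2)] that by simp
      show "rep_char \<theta> (frag_of a) = \<psi> (frag_of a)" if "a \<in> carrier N \<times> carrier X" for a
        using that rep_char(2) by (auto simp: \<theta>_def)
    qed
    ultimately show False using \<psi>(3) by simp
  qed
qed

text \<open>Identities in a tensor product are verified by evaluating characters, so that no
  explicit combination of defining relations has to be written down.\<close>

lemma tcls_eqI:
  assumes "Poly_Mapping.keys c \<subseteq> carrier N \<times> carrier X" "Poly_Mapping.keys d \<subseteq> carrier N \<times> carrier X"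
    "\<And>\<theta>. \<theta> \<in> mhom R X (cm N) \<Longrightarrow> rep_char \<theta> c = rep_char \<theta> d"
  shows "tcls R N X c = tcls R N X d"
  unfolding tcls_eq_iff[OF assms(1,2)] tensor_relations_iff[OF keys_diff_subset[OF assms(1,2)]]
  using assms(3) by (simp add: add_on_free_group(2)[OF rep_char(1) assms(1,2)])

lemma tcls_eqD:
  assumes "Poly_Mapping.keys c \<subseteq> carrier N \<times> carrier X" "Poly_Mapping.keys d \<subseteq> carrier N \<times> carrier X"
    "tcls R N X c = tcls R N X d" "\<theta> \<in> mhom R X (cm N)"
  shows "rep_char \<theta> c = rep_char \<theta> d"
  using assms(3,4) unfolding tcls_eq_iff[OF assms(1,2)] tensor_relations_iff[OF keys_diff_subset[OF assms(1,2)]]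
  by (simp add: add_on_free_group(2)[OF rep_char(1) assms(1,2)])

lemma tensor_comm_group: "comm_group (tensor R N X)"
  unfolding tensor_def by (rule comm_group.abelian_FactGroup[OF abelian_free_Abelian_group tensor_relations_subgroup])

lemma tensor_carrier: "carrier (tensor R N X) = tcls R N X ` {c. Poly_Mapping.keys c \<subseteq> carrier N \<times> carrier X}"
  unfolding tensor_def carrier_FactGroup tcls_def by (auto simp: free_Abelian_group_def)

lemma tensor_mult:
  assumes "Poly_Mapping.keys c \<subseteq> carrier N \<times> carrier X" "Poly_Mapping.keys d \<subseteq> carrier N \<times> carrier X"
  shows "tcls R N X c \<otimes>\<^bsub>tensor R N X\<^esub> tcls R N X d = tcls R N X (c + d)"
  unfolding tensor_def tcls_def mult_FactGroup
  using comm_group.rcos_mult[OF abelian_free_Abelian_group tensor_relations_subgroup, of c d] assms by simp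

lemma tsum_add_right:
  assumes "vec N n x" "vec X n a" "vec X n b"
  shows "tcls R N X (tsum n x (\<lambda>i. a i \<oplus>\<^bsub>X\<^esub> b i)) = tcls R N X (tsum n x a + tsum n x b)"
proof -
  have ab: "vec X n (\<lambda>i. a i \<oplus>\<^bsub>X\<^esub> b i)" using assms by (simp add: vec_def)
  show ?thesis
  proof (rule tcls_eqI)
    fix \<theta> assume \<theta>: "\<theta> \<in> mhom R X (cm N)"
    show "rep_char \<theta> (tsum n x (\<lambda>i. a i \<oplus>\<^bsub>X\<^esub> b i)) = rep_char \<theta> (tsum n x a + tsum n x b)"
      unfolding add_on_free_group(1)[OF rep_char(1) keys_tsum[OF assms(1,2)] keys_tsum[OF assms(1,3)]]
        rep_char_tsum[OF assms(1) ab] rep_char_tsum[OF assms(1,2)] rep_char_tsum[OF assms(1,3)] sum.distrib[symmetric]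
      using assms by (intro sum.cong) (auto simp: vec_def mhom_add[OF \<theta>])
  qed (use keys_tsum[OF assms(1) ab] keys_add_subset[OF keys_tsum[OF assms(1,2)] keys_tsum[OF assms(1,3)]] in auto)
qed

lemma tsum_add_left:
  assumes "vec N n x" "vec N n y" "vec X n a"
  shows "tcls R N X (tsum n (\<lambda>i. x i \<oplus>\<^bsub>N\<^esub> y i) a) = tcls R N X (tsum n x a + tsum n y a)"
proof -
  have xy: "vec N n (\<lambda>i. x i \<oplus>\<^bsub>N\<^esub> y i)" using assms by (simp add: vec_def)
  show ?thesis
  proof (rule tcls_eqI)
    fix \<theta> assume \<theta>: "\<theta> \<in> mhom R X (cm N)"
    show "rep_char \<theta> (tsum n (\<lambda>i. x i \<oplus>\<^bsub>N\<^esub> y i) a) = rep_char \<theta> (tsum n x a + tsum n y a)"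
      unfolding add_on_free_group(1)[OF rep_char(1) keys_tsum[OF assms(1,3)] keys_tsum[OF assms(2,3)]]
        rep_char_tsum[OF xy assms(3)] rep_char_tsum[OF assms(1,3)] rep_char_tsum[OF assms(2,3)] sum.distrib[symmetric]
      using assms by (intro sum.cong) (auto simp: vec_def cm_add[OF mhom_closed[OF \<theta>]])
  qed (use keys_tsum[OF xy assms(3)] keys_add_subset[OF keys_tsum[OF assms(1,3)] keys_tsum[OF assms(2,3)]] in auto)
qed

lemma tsum_zero_right:
  assumes "vec N n x"
  shows "tcls R N X (tsum n x (\<lambda>i. \<zero>\<^bsub>X\<^esub>)) = tcls R N X 0"
proof -
  have z: "vec X n (\<lambda>i. \<zero>\<^bsub>X\<^esub>)" by (simp add: vec_def)
  interpret C: left_module R "cm N" using left_module_cm[OF N] by simp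
  show ?thesis
  proof (rule tcls_eqI)
    fix \<theta> assume \<theta>: "\<theta> \<in> mhom R X (cm N)"
    have "(\<Sum>i<n. \<theta> \<zero>\<^bsub>X\<^esub> (x i)) = 0"
      using assms mhom_zero[OF X.abelian_group_M C.abelian_group_M \<theta>] by (intro sum.neutral) (auto simp: vec_def)
    then show "rep_char \<theta> (tsum n x (\<lambda>i. \<zero>\<^bsub>X\<^esub>)) = rep_char \<theta> 0"
      using rep_char_tsum[OF assms z] add_on_free_group(3)[OF rep_char(1), of 0 0] by simp
  qed (use keys_tsum[OF assms z] in auto)
qed

lemma tsum_diff_left:
  assumes "vec N n x" "vec N n y" "vec X n a"
  shows "tcls R N X (tsum n x a) = tcls R N X (tsum n y a) \<longleftrightarrow>
    tcls R N X (tsum n (\<lambda>i. x i \<oplus>\<^bsub>N\<^esub> \<ominus>\<^bsub>N\<^esub> y i) a) = tcls R N X 0"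
proof -
  have y': "vec N n (\<lambda>i. \<ominus>\<^bsub>N\<^esub> y i)" using assms by (simp add: vec_def)
  have d: "vec N n (\<lambda>i. x i \<oplus>\<^bsub>N\<^esub> \<ominus>\<^bsub>N\<^esub> y i)" using assms by (simp add: vec_def)
  have "x i \<oplus>\<^bsub>N\<^esub> \<ominus>\<^bsub>N\<^esub> y i \<oplus>\<^bsub>N\<^esub> y i = x i" if "i < n" for i
    using assms that by (simp add: vec_def N.M.a_assoc N.M.l_neg)
  then have "tsum n (\<lambda>i. x i \<oplus>\<^bsub>N\<^esub> \<ominus>\<^bsub>N\<^esub> y i \<oplus>\<^bsub>N\<^esub> y i) a = tsum n x a" by (simp add: tsum_def)
  then have "tcls R N X (tsum n x a) = tcls R N X (tsum n (\<lambda>i. x i \<oplus>\<^bsub>N\<^esub> \<ominus>\<^bsub>N\<^esub> y i) a + tsum n y a)"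
    using tsum_add_left[OF d assms(2,3)] by simp
  then show ?thesis
    using keys_tsum[OF d assms(3)] keys_tsum[OF assms(2,3)]
    by (simp add: tcls_eq_iff keys_add_subset)
qed

text \<open>Coefficients move across the tensor sign: an element tensored with a combination of the
  generators becomes a sum with one term for each generator.\<close>

lemma tensor_spanned:
  assumes \<alpha>: "vec X n \<alpha>" and gen: "\<And>a. a \<in> carrier X \<Longrightarrow> \<exists>r. coeffs R n r \<and> a = lin X n r \<alpha>"
    and c: "Poly_Mapping.keys c \<subseteq> carrier N \<times> carrier X"
  shows "\<exists>x. vec N n x \<and> tcls R N X c = tcls R N X (tsum n x \<alpha>)"
proof -
  interpret C: left_module R "cm N" using left_module_cm[OF N] by simp
  \<comment> \<open>The claim is phrased with values of characters instead of cosets; in this form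
    it passes through the induction over formal combinations by subtracting the vectors.\<close>
  have "\<exists>x. vec N n x \<and> (\<forall>\<theta>\<in>mhom R X (cm N). rep_char \<theta> c = (\<Sum>i<n. \<theta> (\<alpha> i) (x i)))"
  proof (rule free_Abelian_group_induct[OF c,
      where P = "\<lambda>c. \<exists>x. vec N n x \<and> (\<forall>\<theta>\<in>mhom R X (cm N). rep_char \<theta> c = (\<Sum>i<n. \<theta> (\<alpha> i) (x i)))"])
    have "(\<Sum>i<n. \<theta> (\<alpha> i) \<zero>\<^bsub>N\<^esub>) = 0" if "\<theta> \<in> mhom R X (cm N)" for \<theta>
      using \<alpha> by (intro sum.neutral) (auto simp: vec_def intro!: cm_zero[OF N.abelian_group_M] mhom_closed[OF that])
    then show "\<exists>x. vec N n x \<and> (\<forall>\<theta>\<in>mhom R X (cm N). rep_char \<theta> 0 = (\<Sum>i<n. \<theta> (\<alpha> i) (x i)))"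
      using add_on_free_group(3)[OF rep_char(1), of 0 0] by (intro exI[of _ "\<lambda>i. \<zero>\<^bsub>N\<^esub>"]) (auto simp: vec_def)
  next
    fix a b assume ab: "Poly_Mapping.keys a \<subseteq> carrier N \<times> carrier X" "Poly_Mapping.keys b \<subseteq> carrier N \<times> carrier X"
      "\<exists>x. vec N n x \<and> (\<forall>\<theta>\<in>mhom R X (cm N). rep_char \<theta> a = (\<Sum>i<n. \<theta> (\<alpha> i) (x i)))"
      "\<exists>x. vec N n x \<and> (\<forall>\<theta>\<in>mhom R X (cm N). rep_char \<theta> b = (\<Sum>i<n. \<theta> (\<alpha> i) (x i)))"
    then obtain x y where x: "vec N n x" "\<forall>\<theta>\<in>mhom R X (cm N). rep_char \<theta> a = (\<Sum>i<n. \<theta> (\<alpha> i) (x i))"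
      and y: "vec N n y" "\<forall>\<theta>\<in>mhom R X (cm N). rep_char \<theta> b = (\<Sum>i<n. \<theta> (\<alpha> i) (y i))" by blast
    have "rep_char \<theta> (a - b) = (\<Sum>i<n. \<theta> (\<alpha> i) (x i \<oplus>\<^bsub>N\<^esub> \<ominus>\<^bsub>N\<^esub> y i))" if \<theta>: "\<theta> \<in> mhom R X (cm N)" for \<theta>
    proof -
      have "\<theta> (\<alpha> i) (x i \<oplus>\<^bsub>N\<^esub> \<ominus>\<^bsub>N\<^esub> y i) = \<theta> (\<alpha> i) (x i) - \<theta> (\<alpha> i) (y i)" if i: "i < n" for i
      proof -
        have m: "\<theta> (\<alpha> i) \<in> carrier (cm N)" "x i \<in> carrier N" "y i \<in> carrier N"
          using mhom_closed[OF \<theta>] \<alpha> x y i by (auto simp: vec_def)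
        have "\<theta> (\<alpha> i) (x i \<oplus>\<^bsub>N\<^esub> \<ominus>\<^bsub>N\<^esub> y i) + \<theta> (\<alpha> i) (y i) = \<theta> (\<alpha> i) (x i)"
          using m by (simp flip: cm_add[OF m(1)] add: N.M.a_assoc N.M.l_neg)
        then show ?thesis by (simp add: algebra_simps)
      qed
      then show ?thesis using x y \<theta> by (simp add: add_on_free_group(2)[OF rep_char(1) ab(1,2)] sum_subtractf)
    qed
    then show "\<exists>x. vec N n x \<and> (\<forall>\<theta>\<in>mhom R X (cm N). rep_char \<theta> (a - b) = (\<Sum>i<n. \<theta> (\<alpha> i) (x i)))"
      using x y by (intro exI[of _ "\<lambda>i. x i \<oplus>\<^bsub>N\<^esub> \<ominus>\<^bsub>N\<^esub> y i"]) (auto simp: vec_def)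
  next
    fix a assume "a \<in> carrier N \<times> carrier X"
    then obtain \<nu> b where a: "a = (\<nu>, b)" "\<nu> \<in> carrier N" "b \<in> carrier X" by blast
    obtain r where r: "coeffs R n r" "b = lin X n r \<alpha>" using gen[OF a(3)] by blast
    have "rep_char \<theta> (frag_of a) = (\<Sum>i<n. \<theta> (\<alpha> i) (r i \<odot>\<^bsub>N\<^esub> \<nu>))" if \<theta>: "\<theta> \<in> mhom R X (cm N)" for \<theta>
    proof -
      have "rep_char \<theta> (frag_of a) = \<theta> b \<nu>" using a rep_char(2) by simp
      also have "\<theta> b = lin (cm N) n r (\<lambda>i. \<theta> (\<alpha> i))"
        unfolding r(2) by (rule lin_hom[OF X C.left_module_axioms \<theta> r(1) \<alpha>])
      also have "lin (cm N) n r (\<lambda>i. \<theta> (\<alpha> i)) \<nu> = (\<Sum>i<n. \<theta> (\<alpha> i) (r i \<odot>\<^bsub>N\<^esub> \<nu>))"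
        unfolding lin_def cm_msum[OF a(2)] using a(2) by simp
      finally show ?thesis .
    qed
    then show "\<exists>x. vec N n x \<and> (\<forall>\<theta>\<in>mhom R X (cm N). rep_char \<theta> (frag_of a) = (\<Sum>i<n. \<theta> (\<alpha> i) (x i)))"
      using r a by (intro exI[of _ "\<lambda>i. r i \<odot>\<^bsub>N\<^esub> \<nu>"]) (auto simp: vec_def coeffs_def)
  qed
  then obtain x where x: "vec N n x" "\<forall>\<theta>\<in>mhom R X (cm N). rep_char \<theta> c = (\<Sum>i<n. \<theta> (\<alpha> i) (x i))" by blast
  have "tcls R N X c = tcls R N X (tsum n x \<alpha>)"
    by (rule tcls_eqI[OF c keys_tsum[OF x(1) \<alpha>]]) (simp add: x(2) rep_char_tsum[OF x(1) \<alpha>])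
  then show ?thesis using x(1) by blast
qed

text \<open>Right exactness of the tensor product. A functional annihilated by \<open>H\<close> is a
  homomorphism from \<open>X\<close> to \<open>cm N\<close>, that is, a character of the tensor
  product; if the given element is zero, every such functional vanishes at \<open>x\<close>, and
  \<open>image_detected\<close> applies.\<close>

lemma tsum_presents_zero_iff:
  assumes p: "presents R X n \<alpha> m H" and x: "vec N n x"
  shows "tcls R N X (tsum n x \<alpha>) = tcls R N X 0 \<longleftrightarrow> (\<exists>w. vec N m w \<and> (\<forall>i<n. x i = act N m (tr H) w i))"
proof -
  interpret C: left_module R "cm N" using left_module_cm[OF N] by simp
  have \<alpha>: "vec X n \<alpha>" and H: "mat R m n H" using p by (auto simp: presents_def)
  have HT: "mat (opp R) n m (tr H)" using mat_tr[OF H] by simp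
  have k0: "Poly_Mapping.keys (0 :: 'a \<times> 'b \<Rightarrow>\<^sub>0 int) \<subseteq> carrier N \<times> carrier X" by simp
  note z = add_on_free_group(3)[OF rep_char(1), of 0 0, simplified]
  show ?thesis
  proof
    assume eq: "tcls R N X (tsum n x \<alpha>) = tcls R N X 0"
    show "\<exists>w. vec N m w \<and> (\<forall>i<n. x i = act N m (tr H) w i)"
    proof (rule image_detected[OF N HT x])
      fix Y assume Y: "vec (cm N) n Y" "\<And>j. j < m \<Longrightarrow> act (cm N) n (tr (tr H)) Y j = \<zero>\<^bsub>cm N\<^esub>"
      obtain \<theta> where \<theta>: "\<theta> \<in> mhom R X (cm N)" "\<forall>j<n. \<theta> (\<alpha> j) = Y j"
        using presents_hom[OF p C.left_module_axioms Y(1)] Y(2) by auto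
      have "rep_char \<theta> (tsum n x \<alpha>) = 0"
        using tcls_eqD[OF keys_tsum[OF x \<alpha>] k0 eq \<theta>(1)] z by simp
      then show "(\<Sum>i<n. Y i (x i)) = 0" using \<theta>(2) by (simp add: rep_char_tsum[OF x \<alpha>])
    qed
  next
    assume "\<exists>w. vec N m w \<and> (\<forall>i<n. x i = act N m (tr H) w i)"
    then obtain w where w: "vec N m w" "\<forall>i<n. x i = act N m (tr H) w i" by blast
    show "tcls R N X (tsum n x \<alpha>) = tcls R N X 0"
    proof (rule tcls_eqI[OF keys_tsum[OF x \<alpha>] k0])
      fix \<theta> assume \<theta>: "\<theta> \<in> mhom R X (cm N)"
      note sol = presents_solution[OF p C.left_module_axioms \<theta>]
      have "(\<Sum>i<n. \<theta> (\<alpha> i) (x i)) = (\<Sum>i<n. \<theta> (\<alpha> i) (act N m (tr H) w i))" using w(2) by simp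
      also have "\<dots> = (\<Sum>j<m. act (cm N) n H (\<lambda>i. \<theta> (\<alpha> i)) j (w j))"
        using act_adjoint[OF N HT sol(1) w(1)] by simp
      also have "\<dots> = 0" using sol(2) w(1) by (intro sum.neutral) (auto simp: vec_def)
      finally show "rep_char \<theta> (tsum n x \<alpha>) = rep_char \<theta> 0" using z by (simp add: rep_char_tsum[OF x \<alpha>])
    qed
  qed
qed

text \<open>The matrix \<open>F\<close> crosses the tensor sign and becomes its transpose; on
  characters this is \<open>act_adjoint\<close>.\<close>

lemma tsum_lin:
  assumes F: "mat R n l F" and x: "vec N n x" and \<beta>: "vec X l \<beta>"
  shows "tcls R N X (tsum n x (\<lambda>i. lin X l (F i) \<beta>)) = tcls R N X (tsum l (act N n (tr F) x) \<beta>)"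
proof -
  interpret C: left_module R "cm N" using left_module_cm[OF N] by simp
  have FT: "mat (opp R) l n (tr F)" using mat_tr[OF F] by simp
  have y: "vec N l (act N n (tr F) x)" using N.act_closed[OF FT x] by (simp add: vec_def)
  have b: "vec X n (\<lambda>i. lin X l (F i) \<beta>)" using X.lin_closed[OF mat_coeffs[OF F] \<beta>] by (simp add: vec_def)
  show ?thesis
  proof (rule tcls_eqI[OF keys_tsum[OF x b] keys_tsum[OF y \<beta>]])
    fix \<theta> assume \<theta>: "\<theta> \<in> mhom R X (cm N)"
    have \<theta>\<beta>: "vec (cm N) l (\<lambda>j. \<theta> (\<beta> j))" using mhom_closed[OF \<theta>] \<beta> by (simp add: vec_def)
    have "(\<Sum>i<n. \<theta> (lin X l (F i) \<beta>) (x i)) = (\<Sum>i<n. act (cm N) l F (\<lambda>j. \<theta> (\<beta> j)) i (x i))"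
      using lin_hom[OF X C.left_module_axioms \<theta> mat_coeffs[OF F] \<beta>] by (intro sum.cong) (auto simp: act_eq_lin)
    also have "\<dots> = (\<Sum>j<l. \<theta> (\<beta> j) (act N n (tr F) x j))"
      using act_adjoint[OF N FT \<theta>\<beta> x] by simp
    finally show "rep_char \<theta> (tsum n x (\<lambda>i. lin X l (F i) \<beta>)) = rep_char \<theta> (tsum l (act N n (tr F) x) \<beta>)"
      by (simp add: rep_char_tsum[OF x b] rep_char_tsum[OF y \<beta>])
  qed
qed

end

text \<open>The induced map on formal combinations carries generating relations to generating
  relations, hence cosets to cosets.\<close>

lemma tensor_map_tcls:
  assumes N: "left_module (opp R) N" and X: "left_module R X" and N': "left_module (opp R) N'" and Y: "left_module R Y"
    and g: "mlin (opp R) N N' g" and h: "mlin R X Y h" and c: "Poly_Mapping.keys c \<subseteq> carrier N \<times> carrier X"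
  shows "tensor_map R N' Y g h (tcls R N X c) = tcls R N' Y (frag_pair g h c)"
proof -
  let ?G = "free_Abelian_group (carrier N \<times> carrier X)" and ?G' = "free_Abelian_group (carrier N' \<times> carrier Y)"
  have rel: "frag_pair g h u \<in> tensor_relations R N' Y" if "u \<in> tensor_relations R N X" for u
  proof -
    have gens: "frag_pair g h v \<in> tensor_gens R N' Y" if "v \<in> tensor_gens R N X" for v
      using that g h unfolding tensor_gens_def mlin_def
      by (elim UnE CollectE exE conjE) (simp_all, blast+)
    have "u \<in> generate ?G (tensor_gens R N X)" using that by (simp add: tensor_relations_eq)
    then have "frag_pair g h u \<in> generate ?G' (tensor_gens R N' Y)"
    proof (induction u rule: generate.induct)
      case one
      then show ?case using generate.one[of ?G'] by simp
    next
      case (incl v)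
      then show ?case using gens by (intro generate.incl)
    next
      case (inv v)
      have "Poly_Mapping.keys v \<subseteq> carrier N \<times> carrier X" by (rule keys_tensor_gens[OF N X inv])
      moreover have "Poly_Mapping.keys (frag_pair g h v) \<subseteq> carrier N' \<times> carrier Y"
        by (rule keys_tensor_gens[OF N' Y gens[OF inv]])
      ultimately have "frag_pair g h (inv\<^bsub>?G\<^esub> v) = inv\<^bsub>?G'\<^esub> (frag_pair g h v)"
        using frag_pair_simps(4)[of g h 0 v] by simp
      then show ?case using generate.inv[OF gens[OF inv], of ?G'] by simp
    next
      case (eng u v)
      then show ?case using generate.eng[of _ ?G'] by simp
    qed
    then show ?thesis by (simp add: tensor_relations_eq)
  qed
  have "(\<Union>u\<in>tensor_relations R N X #>\<^bsub>?G\<^esub> c. tensor_relations R N' Y #>\<^bsub>?G'\<^esub> frag_pair g h u)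
    = tensor_relations R N' Y #>\<^bsub>?G'\<^esub> frag_pair g h c"
  proof (rule comm_group.quotient_map_eval[OF abelian_free_Abelian_group tensor_relations_subgroup[OF N X] _ abelian_free_Abelian_group tensor_relations_subgroup[OF N' Y]])
    show "frag_pair g h u \<in> carrier ?G'" if "u \<in> carrier ?G" for u
      using keys_frag_pair[OF _ g h, of u] that by simp
  qed (use c rel in auto)
  then show ?thesis by (simp add: tensor_map_def tcls_def frag_pair_def)
qed

subsection \<open>The dual of a finitely presented functor\<close>

lemma tensor_map_carrier:
  assumes "left_module (opp R) N" "left_module R X" "left_module (opp R) N'" "left_module R Y"
    "mlin (opp R) N N' g" "mlin R X Y h" "t \<in> carrier (tensor R N X)"
  shows "tensor_map R N' Y g h t \<in> carrier (tensor R N' Y)"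
  using assms(7) unfolding tensor_carrier[OF assms(1,2)] tensor_carrier[OF assms(3,4)]
  by (auto simp: tensor_map_tcls[OF assms(1-6)] intro!: imageI keys_frag_pair[OF _ assms(5,6)])

lemma tensor_map_mult:
  assumes "left_module (opp R) N" "left_module R X" "left_module (opp R) N'" "left_module R Y"
    "mlin (opp R) N N' g" "mlin R X Y h" "t \<in> carrier (tensor R N X)" "t' \<in> carrier (tensor R N X)"
  shows "tensor_map R N' Y g h (t \<otimes>\<^bsub>tensor R N X\<^esub> t') = tensor_map R N' Y g h t \<otimes>\<^bsub>tensor R N' Y\<^esub> tensor_map R N' Y g h t'"
proof -
  obtain c d where c: "Poly_Mapping.keys c \<subseteq> carrier N \<times> carrier X" "t = tcls R N X c"
    and d: "Poly_Mapping.keys d \<subseteq> carrier N \<times> carrier X" "t' = tcls R N X d"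
    using assms(7,8) unfolding tensor_carrier[OF assms(1,2)] by blast
  note kf = keys_frag_pair[OF _ assms(5,6)]
  show ?thesis
    unfolding c(2) d(2) tensor_mult[OF assms(1,2) c(1) d(1)] tensor_map_tcls[OF assms(1-6) c(1)]
      tensor_map_tcls[OF assms(1-6) d(1)] tensor_map_tcls[OF assms(1-6) keys_add_subset[OF c(1) d(1)]]
      tensor_mult[OF assms(3,4) kf[OF c(1)] kf[OF d(1)]] by simp
qed

text \<open>The composites are supplied as separate maps that agree on the carriers, since
  restricted homomorphisms and unrestricted identities are mixed in the applications.\<close>

lemma tensor_map_comp:
  assumes "left_module (opp R) N" "left_module R X" "left_module (opp R) N'" "left_module R Y" "left_module (opp R) N''" "left_module R Z"
    "mlin (opp R) N N' g" "mlin R X Y h" "mlin (opp R) N' N'' g'" "mlin R Y Z h'"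
    "mlin (opp R) N N'' g''" "mlin R X Z h''"
    "\<And>n. n \<in> carrier N \<Longrightarrow> g'' n = g' (g n)" "\<And>x. x \<in> carrier X \<Longrightarrow> h'' x = h' (h x)" "t \<in> carrier (tensor R N X)"
  shows "tensor_map R N'' Z g' h' (tensor_map R N' Y g h t) = tensor_map R N'' Z g'' h'' t"
proof -
  obtain c where c: "Poly_Mapping.keys c \<subseteq> carrier N \<times> carrier X" "t = tcls R N X c"
    using assms(15) unfolding tensor_carrier[OF assms(1,2)] by blast
  have "frag_pair g' h' (frag_pair g h c) = frag_pair g'' h'' c"
    unfolding frag_pair_comp using assms(13,14) by (intro frag_pair_cong[OF c(1)]) auto
  then show ?thesis
    unfolding c(2) tensor_map_tcls[OF assms(1-4,7,8) c(1)]
      tensor_map_tcls[OF assms(3-6,9,10) keys_frag_pair[OF c(1) assms(7,8)]]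
      tensor_map_tcls[OF assms(1,2,5,6,11,12) c(1)] by simp
qed

lemma tensor_functor_simps [simp]:
  "fob (tensor_functor R N) X = tensor R N X" "fmor (tensor_functor R N) X Y h = tensor_map R N Y (\<lambda>n. n) h"
  by (simp_all add: tensor_functor_def)

lemma AGJ_simps [simp]:
  "fob (AGJ R G) N = nat_trans_group R G (tensor_functor R N)"
  "fmor (AGJ R G) N N' g = (\<lambda>\<eta>. \<lambda>X\<in>fp_modules R. \<lambda>x\<in>carrier (fob G X). tensor_map R N' X g (\<lambda>y. y) (\<eta> X x))"
  by (simp_all add: AGJ_def)

lemma nat_trans_group_simps [simp]:
  "carrier (nat_trans_group R F G) = nat_trans R F G"
  "\<eta> \<otimes>\<^bsub>nat_trans_group R F G\<^esub> \<theta> = (\<lambda>X\<in>fp_modules R. \<lambda>x\<in>carrier (fob F X). \<eta> X x \<otimes>\<^bsub>fob G X\<^esub> \<theta> X x)"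
  by (simp_all add: nat_trans_group_def)

lemma nat_transI:
  assumes "\<eta> \<in> extensional (fp_modules R)"
    "\<And>X. X \<in> fp_modules R \<Longrightarrow> \<eta> X \<in> extensional (carrier (fob F X))"
    "\<And>X c. X \<in> fp_modules R \<Longrightarrow> c \<in> carrier (fob F X) \<Longrightarrow> \<eta> X c \<in> carrier (fob G X)"
    "\<And>X c d. X \<in> fp_modules R \<Longrightarrow> c \<in> carrier (fob F X) \<Longrightarrow> d \<in> carrier (fob F X) \<Longrightarrow>
       \<eta> X (c \<otimes>\<^bsub>fob F X\<^esub> d) = \<eta> X c \<otimes>\<^bsub>fob G X\<^esub> \<eta> X d"
    "\<And>X Y h c. X \<in> fp_modules R \<Longrightarrow> Y \<in> fp_modules R \<Longrightarrow> h \<in> mhom R X Y \<Longrightarrow> c \<in> carrier (fob F X) \<Longrightarrow>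
       \<eta> Y (fmor F X Y h c) = fmor G X Y h (\<eta> X c)"
  shows "\<eta> \<in> nat_trans R F G"
  using assms unfolding nat_trans_def by (auto simp: PiE_iff hom_def)

lemma AGJ_fmor_closed:
  fixes G :: "('r, 'u, 'x) mod_functor"
  assumes G: "fp_functor R G"
  shows "fmor_closed (opp R) (AGJ R G)"
  unfolding fmor_closed_def
proof (intro ballI)
  fix N N' :: "('r, 'u) module" and g \<nu> assume N': "N \<in> fp_modules (opp R)" "N' \<in> fp_modules (opp R)" and g': "g \<in> mhom (opp R) N N'"
    and "\<nu> \<in> carrier (fob (AGJ R G) N)"
  then have \<nu>: "\<nu> \<in> nat_trans R G (tensor_functor R N)" by simp
  note N = N'[THEN fp_modules_left_module] and g = mlin_mhom[OF g']
  have add: "additive_functor R G" using G by (simp add: fp_functor_def)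
  have Gm: "c \<otimes>\<^bsub>fob G X\<^esub> d \<in> carrier (fob G X)"
    if "X \<in> fp_modules R" "c \<in> carrier (fob G X)" "d \<in> carrier (fob G X)" for X c d
    using add that unfolding additive_functor_def by (meson comm_group.axioms(2) group.is_monoid monoid.m_closed)
  have Gc: "fmor G X Y h c \<in> carrier (fob G Y)"
    if "X \<in> fp_modules R" "Y \<in> fp_modules R" "h \<in> mhom R X Y" "c \<in> carrier (fob G X)" for X Y h c
    using fp_functor_fmor_closed[OF G] that unfolding fmor_closed_def by blast
  have \<nu>c: "\<nu> X c \<in> carrier (tensor R N X)" if "X \<in> fp_modules R" "c \<in> carrier (fob G X)" for X c
    using nat_transD(3)[OF \<nu> that] by simp
  have "fmor (AGJ R G) N N' g \<nu> \<in> nat_trans R G (tensor_functor R N')"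
  proof (rule nat_transI)
    fix X c assume X: "X \<in> fp_modules R" and c: "c \<in> carrier (fob G X)"
    show "fmor (AGJ R G) N N' g \<nu> X c \<in> carrier (fob (tensor_functor R N') X)"
      using X c tensor_map_carrier[OF N(1) fp_modules_left_module[OF X] N(2) fp_modules_left_module[OF X] g mlin_id \<nu>c[OF X c]] by simp
    show "fmor (AGJ R G) N N' g \<nu> X (c \<otimes>\<^bsub>fob G X\<^esub> d) =
       fmor (AGJ R G) N N' g \<nu> X c \<otimes>\<^bsub>fob (tensor_functor R N') X\<^esub> fmor (AGJ R G) N N' g \<nu> X d"
      if d: "d \<in> carrier (fob G X)" for d
    proof -
      have "\<nu> X (c \<otimes>\<^bsub>fob G X\<^esub> d) = \<nu> X c \<otimes>\<^bsub>tensor R N X\<^esub> \<nu> X d"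
        using nat_transD(1)[OF \<nu> X] c d by (simp add: hom_def)
      then show ?thesis
        using X c d Gm[OF X c d] tensor_map_mult[OF N(1) fp_modules_left_module[OF X] N(2) fp_modules_left_module[OF X] g mlin_id \<nu>c[OF X c] \<nu>c[OF X d]]
        by simp
    qed
    show "fmor (AGJ R G) N N' g \<nu> Y (fmor G X Y h c) = fmor (tensor_functor R N') X Y h (fmor (AGJ R G) N N' g \<nu> X c)"
      if Y: "Y \<in> fp_modules R" and h': "h \<in> mhom R X Y" for Y h
    proof -
      note lX = fp_modules_left_module[OF X] and lY = fp_modules_left_module[OF Y] and h = mlin_mhom[OF h']
      have 1: "\<nu> Y (fmor G X Y h c) = tensor_map R N Y (\<lambda>n. n) h (\<nu> X c)"
        using nat_transD(4)[OF \<nu> X Y h' c] by simp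
      \<comment> \<open>Both orders of applying \<open>g\<close> and \<open>h\<close> equal the
        simultaneous map, whence naturality.\<close>
      have 2: "tensor_map R N' Y g (\<lambda>y. y) (tensor_map R N Y (\<lambda>n. n) h (\<nu> X c)) = tensor_map R N' Y g h (\<nu> X c)"
        by (rule tensor_map_comp[OF N(1) lX N(1) lY N(2) lY mlin_id h g mlin_id g h _ _ \<nu>c[OF X c]]) auto
      have 3: "tensor_map R N' Y (\<lambda>n. n) h (tensor_map R N' X g (\<lambda>y. y) (\<nu> X c)) = tensor_map R N' Y g h (\<nu> X c)"
        by (rule tensor_map_comp[OF N(1) lX N(2) lX N(2) lY g mlin_id mlin_id h g h _ _ \<nu>c[OF X c]]) auto
      show ?thesis using X Y c Gc[OF X Y h' c] 1 2 3 by simp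
    qed
  qed simp_all
  then show "fmor (AGJ R G) N N' g \<nu> \<in> carrier (fob (AGJ R G) N')" by simp
qed

text \<open>\<open>f\<close> presents \<open>G\<close>, and \<open>f'\<close> is a morphism as in
  \<open>dual_morphism\<close>; the aim is that \<open>f'\<close> presents the dual functor. A
  transformation from \<open>G\<close> to \<open>N \<otimes> -\<close> amounts to a vanishing
  condition on an element of \<open>N \<otimes> A\<close>: with
  \<open>\<Sum>i. x i \<otimes> \<alpha> i\<close> for this element, \<open>x\<close> belongs to a
  pair \<open>(x, z)\<close> solving \<open>H'\<close> and matters up to the image of
  \<open>tr H\<close>. Such classes form the cokernel of \<open>Hom(f', -)\<close> at
  \<open>N\<close>.\<close>

locale agj_setup = system_pair R n m l k H F K
  for R :: "'r ring" and n m l k H F K +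
  fixes A B :: "('r, 'u) module" and f \<alpha> \<beta> and A' B' :: "('r, 'u) module" and f' \<alpha>'
    and G :: "('r, 'u, 'x) mod_functor" and \<eta>
  assumes p: "(A, B, f) \<in> fp_morphisms R" and presA: "presents R A n \<alpha> m H" and presB: "presents R B l \<beta> k K"
    and f\<alpha>: "\<And>i. i < n \<Longrightarrow> f (\<alpha> i) = lin B l (F i) \<beta>"
    and G: "fp_functor R G" and \<eta>: "\<eta> \<in> nat_trans R G (coker_functor R (A, B, f))"
    and \<eta>_bij: "\<And>X. X \<in> fp_modules R \<Longrightarrow> bij_betw (\<eta> X) (carrier (fob G X)) (carrier (fob (coker_functor R (A, B, f)) X))"
    and p': "(A', B', f') \<in> fp_morphisms (opp R)" and presA': "presents (opp R) A' (n + k) \<alpha>' l H'"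
    and im': "\<And>N g. N \<in> Modules (opp R) \<Longrightarrow> g \<in> mhom (opp R) A' N \<Longrightarrow>
      g \<in> hom_image (opp R) (A', B', f') N \<longleftrightarrow> (\<exists>w. vec N m w \<and> (\<forall>i<n. g (\<alpha>' i) = act N m (tr H) w i))"
begin

abbreviation "cokerA' \<equiv> coker_functor (opp R) (A', B', f')"
abbreviation "idA \<equiv> \<lambda>x\<in>carrier A. x"

lemma fpA: "A \<in> fp_modules R" and fpB: "B \<in> fp_modules R" and f: "f \<in> mhom R A B" and fpA': "A' \<in> fp_modules (opp R)"
  using p p' by (auto simp: fp_morphisms_def)

lemmas lmA = fp_modules_left_module[OF fpA]
lemmas lmB = fp_modules_left_module[OF fpB]
lemmas lmA' = fp_modules_left_module[OF fpA']

lemma vec_\<alpha>: "vec A n \<alpha>" and vec_\<beta>: "vec B l \<beta>"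
  using presA presB by (auto simp: presents_def)

lemma G_group: "X \<in> fp_modules R \<Longrightarrow> comm_group (fob G X)"
  using G by (simp add: fp_functor_def additive_functor_def)

lemma G_mult: "X \<in> fp_modules R \<Longrightarrow> c \<in> carrier (fob G X) \<Longrightarrow> d \<in> carrier (fob G X) \<Longrightarrow> c \<otimes>\<^bsub>fob G X\<^esub> d \<in> carrier (fob G X)"
  using G_group by (meson comm_group.axioms(2) group.is_monoid monoid.m_closed)

lemma G_fmor: "X \<in> fp_modules R \<Longrightarrow> Y \<in> fp_modules R \<Longrightarrow> h \<in> mhom R X Y \<Longrightarrow> c \<in> carrier (fob G X) \<Longrightarrow> fmor G X Y h c \<in> carrier (fob G Y)"
  using fp_functor_fmor_closed[OF G] unfolding fmor_closed_def by blast

lemma \<eta>_inj: "X \<in> fp_modules R \<Longrightarrow> c \<in> carrier (fob G X) \<Longrightarrow> d \<in> carrier (fob G X) \<Longrightarrow> \<eta> X c = \<eta> X d \<Longrightarrow> c = d"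
  using \<eta>_bij unfolding bij_betw_def inj_on_def by blast

lemma idA: "idA \<in> mhom R A A"
  by (rule mhom_id[OF lmA])

lemma ex_unit: "\<exists>u. u \<in> carrier (fob G A) \<and> \<eta> A u = cls R (A, B, f) A idA"
proof -
  have "\<eta> A ` carrier (fob G A) = cls R (A, B, f) A ` mhom R A A"
    using \<eta>_bij[OF fpA] unfolding bij_betw_def coker_carrier[OF p] by simp
  then have "cls R (A, B, f) A idA \<in> \<eta> A ` carrier (fob G A)" using idA by simp
  then show ?thesis by (auto elim!: imageE)
qed

text \<open>The universal element of \<open>G\<close>: by Yoneda it corresponds to the identity of
  \<open>A\<close>, and its images under maps out of \<open>A\<close> exhaust
  \<open>G\<close>.\<close>

definition u where "u = (SOME u. u \<in> carrier (fob G A) \<and> \<eta> A u = cls R (A, B, f) A idA)"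

lemma u: "u \<in> carrier (fob G A)" "\<eta> A u = cls R (A, B, f) A idA"
  using someI_ex[OF ex_unit] unfolding u_def by blast+

lemma \<eta>_fmor_u:
  assumes X: "X \<in> fp_modules R" and h: "h \<in> mhom R A X"
  shows "\<eta> X (fmor G A X h u) = cls R (A, B, f) X h"
proof -
  have "compose (carrier A) h idA = h" using mhom_ext[OF h] by (auto simp: compose_def fun_eq_iff extensional_def)
  then show ?thesis
    using nat_transD(4)[OF \<eta> fpA X h u(1)] coker_fmor[OF p lmA fp_modules_left_module[OF X] h idA] u(2) by simp
qed

lemma generated:
  assumes X: "X \<in> fp_modules R" and c: "c \<in> carrier (fob G X)"
  shows "\<exists>h\<in>mhom R A X. \<eta> X c = cls R (A, B, f) X h"
  using nat_transD(3)[OF \<eta> X c] unfolding coker_carrier[OF p] by blast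

lemma generated':
  assumes X: "X \<in> fp_modules R" and c: "c \<in> carrier (fob G X)" and h: "h \<in> mhom R A X" "\<eta> X c = cls R (A, B, f) X h"
  shows "c = fmor G A X h u"
  using \<eta>_inj[OF X c G_fmor[OF fpA X h(1) u(1)]] \<eta>_fmor_u[OF X h(1)] h(2) by simp

context
  fixes N :: "('r, 'u) module"
  assumes N: "N \<in> Modules (opp R)"
begin

interpretation N: left_module "opp R" N using N by (simp add: Modules_def)

lemma nat_trans_value:
  assumes \<nu>: "\<nu> \<in> nat_trans R G (tensor_functor R N)" and X: "X \<in> fp_modules R" and h: "h \<in> mhom R A X"
  shows "\<nu> X (fmor G A X h u) = tensor_map R N X (\<lambda>n. n) h (\<nu> A u)"
  using nat_transD(4)[OF \<nu> fpA X h u(1)] by simp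

lemma tensor_map_tsum:
  assumes X: "left_module R X" and h: "h \<in> mhom R A X" and x: "vec N n x"
  shows "tensor_map R N X (\<lambda>n. n) h (tcls R N A (tsum n x \<alpha>)) = tcls R N X (tsum n x (\<lambda>i. h (\<alpha> i)))"
  using tensor_map_tcls[OF N.left_module_axioms lmA N.left_module_axioms X mlin_id mlin_mhom[OF h] keys_tsum[OF x vec_\<alpha>]]
  by (simp add: frag_pair_tsum)

lemma vec_hom: "h \<in> mhom R A X \<Longrightarrow> vec X n (\<lambda>i. h (\<alpha> i))"
  using vec_\<alpha> by (auto simp: vec_def mhom_closed)

text \<open>Membership in the kernel of \<open>N \<otimes> f\<close>, computed by moving
  \<open>F\<close> across the tensor sign and using right exactness for \<open>B\<close>; what
  results is the hypothesis of \<open>dual\<close>.\<close>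

lemma kernel_iff:
  assumes x: "vec N n x"
  shows "tcls R N B (tsum n x (\<lambda>i. f (\<alpha> i))) = tcls R N B 0 \<longleftrightarrow>
    (\<exists>z. vec N k z \<and> (\<forall>j<l. act N n (tr F) x j = act N k (tr K) z j))"
proof -
  have FT: "mat (opp R) l n (tr F)" using mat_tr[OF F] by simp
  have y: "vec N l (act N n (tr F) x)" using N.act_closed[OF FT x] by (simp add: vec_def)
  have "tsum n x (\<lambda>i. f (\<alpha> i)) = tsum n x (\<lambda>i. lin B l (F i) \<beta>)" by (simp add: tsum_def f\<alpha>)
  then have "tcls R N B (tsum n x (\<lambda>i. f (\<alpha> i))) = tcls R N B (tsum l (act N n (tr F) x) \<beta>)"
    using tsum_lin[OF N.left_module_axioms lmB F x vec_\<beta>] by simp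
  then show ?thesis using tsum_presents_zero_iff[OF N.left_module_axioms lmB presB y] by simp
qed

text \<open>An element of the kernel comes with some \<open>z\<close> completing \<open>x\<close> to
  a solution of \<open>H'\<close>, hence with a map from \<open>A'\<close>. The values at the last
  \<open>k\<close> generators are this \<open>z\<close>.\<close>

lemma hom_of_kernel:
  assumes x: "vec N n x" and "tcls R N B (tsum n x (\<lambda>i. f (\<alpha> i))) = tcls R N B 0"
  shows "\<exists>g\<in>mhom (opp R) A' N. \<forall>i<n. g (\<alpha>' i) = x i"
proof -
  obtain z where z: "vec N k z" "\<forall>j<l. act N n (tr F) x j = act N k (tr K) z j" using assms(2) kernel_iff[OF x] by blast
  let ?y = "append_vec n x z"
  have y: "vec N (n + k) ?y" using vec_append[OF x z(1)] .
  have "act N (n + k) H' ?y j = \<zero>\<^bsub>N\<^esub>" if "j < l" for j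
  proof -
    have "act N n (tr F) ?y j = act N n (tr F) x j" "act N k (tr K) (\<lambda>i. ?y (n + i)) j = act N k (tr K) z j"
      by (rule act_cong; simp)+
    then show ?thesis using solution_H'[OF N.left_module_axioms y that] z(2) that by simp
  qed
  from presents_hom[OF presA' N.left_module_axioms y this]
  obtain g where "g \<in> mhom (opp R) A' N" "\<forall>j<n + k. g (\<alpha>' j) = ?y j" by blast
  then show ?thesis by (intro bexI[of _ g]) auto
qed

lemma kernel_of_hom:
  assumes g: "g \<in> mhom (opp R) A' N"
  shows "vec N n (\<lambda>i. g (\<alpha>' i))" "tcls R N B (tsum n (\<lambda>i. g (\<alpha>' i)) (\<lambda>i. f (\<alpha> i))) = tcls R N B 0"
proof -
  note y = presents_solution[OF presA' N.left_module_axioms g]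
  show v: "vec N n (\<lambda>i. g (\<alpha>' i))" by (rule vec_take[OF y(1)])
  have "act N n (tr F) (\<lambda>i. g (\<alpha>' i)) j = act N k (tr K) (\<lambda>i. g (\<alpha>' (n + i))) j" if "j < l" for j
    using solution_H'[OF N.left_module_axioms y(1) that] y(2)[OF that] by simp
  then show "tcls R N B (tsum n (\<lambda>i. g (\<alpha>' i)) (\<lambda>i. f (\<alpha> i))) = tcls R N B 0"
    using kernel_iff[OF v] vec_drop[OF y(1)] by blast
qed

text \<open>The ambiguity is the same on both sides: a difference is zero in
  \<open>N \<otimes> A\<close> iff its coordinates lie in the image of \<open>tr H\<close>, which is
  the condition for the difference of the maps to factor through \<open>f'\<close>.\<close>

lemma tsum_eq_iff_cls:
  assumes g: "g \<in> mhom (opp R) A' N" and h: "h \<in> mhom (opp R) A' N"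
  shows "tcls R N A (tsum n (\<lambda>i. g (\<alpha>' i)) \<alpha>) = tcls R N A (tsum n (\<lambda>i. h (\<alpha>' i)) \<alpha>) \<longleftrightarrow>
    cls (opp R) (A', B', f') N g = cls (opp R) (A', B', f') N h"
proof -
  let ?d = "\<lambda>x\<in>carrier A'. g x \<oplus>\<^bsub>N\<^esub> \<ominus>\<^bsub>N\<^esub> h x"
  have "(\<lambda>x\<in>carrier A'. g x \<oplus>\<^bsub>N\<^esub> (\<lambda>x\<in>carrier A'. \<ominus>\<^bsub>N\<^esub> h x) x) \<in> mhom (opp R) A' N"
    by (rule mhom_sum[OF lmA' N.left_module_axioms g mhom_neg[OF lmA' N.left_module_axioms h]])
  moreover have "(\<lambda>x\<in>carrier A'. g x \<oplus>\<^bsub>N\<^esub> (\<lambda>x\<in>carrier A'. \<ominus>\<^bsub>N\<^esub> h x) x) = ?d" by (auto simp: fun_eq_iff)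
  ultimately have d: "?d \<in> mhom (opp R) A' N" by simp
  have \<alpha>': "\<alpha>' i \<in> carrier A'" if "i < n" for i using presA' that by (simp add: presents_def vec_def)
  have td: "tsum n (\<lambda>i. ?d (\<alpha>' i)) \<alpha> = tsum n (\<lambda>i. g (\<alpha>' i) \<oplus>\<^bsub>N\<^esub> \<ominus>\<^bsub>N\<^esub> h (\<alpha>' i)) \<alpha>"
    by (simp add: tsum_def \<alpha>')
  have "tcls R N A (tsum n (\<lambda>i. g (\<alpha>' i)) \<alpha>) = tcls R N A (tsum n (\<lambda>i. h (\<alpha>' i)) \<alpha>) \<longleftrightarrow>
      tcls R N A (tsum n (\<lambda>i. ?d (\<alpha>' i)) \<alpha>) = tcls R N A 0"
    unfolding td by (rule tsum_diff_left[OF N.left_module_axioms lmA kernel_of_hom(1)[OF g] kernel_of_hom(1)[OF h] vec_\<alpha>])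
  also have "\<dots> \<longleftrightarrow> ?d \<in> hom_image (opp R) (A', B', f') N"
    unfolding tsum_presents_zero_iff[OF N.left_module_axioms lmA presA kernel_of_hom(1)[OF d]] im'[OF N d] ..
  also have "\<dots> \<longleftrightarrow> cls (opp R) (A', B', f') N g = cls (opp R) (A', B', f') N h"
    by (rule cls_eq_iff[OF p' N.left_module_axioms g h, symmetric])
  finally show ?thesis .
qed

lemma value_u:
  assumes \<nu>: "\<nu> \<in> nat_trans R G (tensor_functor R N)"
  shows "\<exists>g\<in>mhom (opp R) A' N. tcls R N A (tsum n (\<lambda>i. g (\<alpha>' i)) \<alpha>) = \<nu> A u"
proof -
  have "\<nu> A u \<in> carrier (tensor R N A)" using nat_transD(3)[OF \<nu> fpA u(1)] by simp
  then obtain c where c: "Poly_Mapping.keys c \<subseteq> carrier N \<times> carrier A" "\<nu> A u = tcls R N A c"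
    unfolding tensor_carrier[OF N.left_module_axioms lmA] by blast
  obtain x where x: "vec N n x" "\<nu> A u = tcls R N A (tsum n x \<alpha>)"
    using tensor_spanned[OF N.left_module_axioms lmA vec_\<alpha> _ c(1)] presA c(2) unfolding presents_def by metis
  let ?z = "\<lambda>x\<in>carrier A. \<zero>\<^bsub>B\<^esub>"
  have z: "?z \<in> mhom R A B" by (rule mhom_zero_map[OF lmA lmB])
  \<comment> \<open>\<open>f\<close> and the zero map have the same class, so they move
    \<open>u\<close> to the same element of \<open>G\<close>; by naturality the value of the
    transformation at \<open>u\<close> lies in the kernel of \<open>N \<otimes> f\<close>.\<close>
  have "f \<in> hom_image R (A, B, f) B"
    using mhom_id[OF lmB] mhom_ext[OF f] mhom_closed[OF f] unfolding hom_image_iff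
    by (intro bexI[of _ "\<lambda>x\<in>carrier B. x"]) (auto simp: compose_def fun_eq_iff extensional_def)
  then have "fmor G A B f u = fmor G A B ?z u"
    using \<eta>_inj[OF fpB G_fmor[OF fpA fpB f u(1)] G_fmor[OF fpA fpB z u(1)]] \<eta>_fmor_u[OF fpB f] \<eta>_fmor_u[OF fpB z]
      cls_zero_iff[OF p lmB f] by simp
  then have "tcls R N B (tsum n x (\<lambda>i. f (\<alpha> i))) = tcls R N B (tsum n x (\<lambda>i. ?z (\<alpha> i)))"
    using nat_trans_value[OF \<nu> fpB f] nat_trans_value[OF \<nu> fpB z] tensor_map_tsum[OF lmB f x(1)] tensor_map_tsum[OF lmB z x(1)] x(2)
    by simp
  also have "tsum n x (\<lambda>i. ?z (\<alpha> i)) = tsum n x (\<lambda>i. \<zero>\<^bsub>B\<^esub>)" using vec_\<alpha> by (simp add: tsum_def vec_def)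
  also have "tcls R N B (tsum n x (\<lambda>i. \<zero>\<^bsub>B\<^esub>)) = tcls R N B 0" by (rule tsum_zero_right[OF N.left_module_axioms lmB x(1)])
  finally obtain g where g: "g \<in> mhom (opp R) A' N" "\<forall>i<n. g (\<alpha>' i) = x i" using hom_of_kernel[OF x(1)] by blast
  have "tsum n (\<lambda>i. g (\<alpha>' i)) \<alpha> = tsum n x \<alpha>" using g(2) by (simp add: tsum_def)
  then show ?thesis using g(1) x(2) by (intro bexI[of _ g]) simp_all
qed

text \<open>An element of \<open>G\<close> is the class of some \<open>h\<close> out of
  \<open>A\<close>; it is sent to the image under \<open>h\<close> of the kernel element determined
  by \<open>g\<close>. Two choices of \<open>h\<close> differ by a map through \<open>f\<close>,
  which annihilates that element.\<close>

lemma trans_of_hom: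
  assumes g: "g \<in> mhom (opp R) A' N"
  shows "\<exists>\<nu>\<in>nat_trans R G (tensor_functor R N). \<nu> A u = tcls R N A (tsum n (\<lambda>i. g (\<alpha>' i)) \<alpha>)"
proof -
  define x where "x i = g (\<alpha>' i)" for i
  have x: "vec N n x" and xf: "tcls R N B (tsum n x (\<lambda>i. f (\<alpha> i))) = tcls R N B 0"
    using kernel_of_hom[OF g] by (simp_all add: x_def[abs_def])
  define v where "v X h = tcls R N X (tsum n x (\<lambda>i. h (\<alpha> i)))" for X and h :: "'u \<Rightarrow> 'u"
  have v_add: "v X (\<lambda>a\<in>carrier A. h a \<oplus>\<^bsub>X\<^esub> h' a) = v X h \<otimes>\<^bsub>tensor R N X\<^esub> v X h'"
    if X: "left_module R X" and h: "h \<in> mhom R A X" "h' \<in> mhom R A X" for X h h'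
  proof -
    have "tsum n x (\<lambda>i. (\<lambda>a\<in>carrier A. h a \<oplus>\<^bsub>X\<^esub> h' a) (\<alpha> i)) = tsum n x (\<lambda>i. h (\<alpha> i) \<oplus>\<^bsub>X\<^esub> h' (\<alpha> i))"
      using vec_\<alpha> by (simp add: tsum_def vec_def)
    then show ?thesis
      unfolding v_def tensor_mult[OF N.left_module_axioms X keys_tsum[OF x vec_hom[OF h(1)]] keys_tsum[OF x vec_hom[OF h(2)]]]
      using tsum_add_right[OF N.left_module_axioms X x vec_hom[OF h(1)] vec_hom[OF h(2)]] by simp
  qed
  have v_im: "v X h = tcls R N X 0" if X: "left_module R X" and h: "h \<in> hom_image R (A, B, f) X" for X h
  proof -
    obtain q where q: "q \<in> mhom R B X" "h = compose (carrier A) q f" using h by (auto simp: hom_image_iff)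
    have k1: "Poly_Mapping.keys (tsum n x (\<lambda>i. f (\<alpha> i))) \<subseteq> carrier N \<times> carrier B" by (rule keys_tsum[OF x vec_hom[OF f]])
    have k0: "Poly_Mapping.keys (0 :: 'u \<times> 'u \<Rightarrow>\<^sub>0 int) \<subseteq> carrier N \<times> carrier B" by simp
    note tm = tensor_map_tcls[OF N.left_module_axioms lmB N.left_module_axioms X mlin_id mlin_mhom[OF q(1)]]
    have "v X h = tcls R N X (frag_pair (\<lambda>n. n) q (tsum n x (\<lambda>i. f (\<alpha> i))))"
      unfolding v_def frag_pair_tsum using vec_\<alpha> by (simp add: q(2) compose_def tsum_def vec_def)
    also have "\<dots> = tcls R N X (frag_pair (\<lambda>n. n) q 0)"
      using tm[OF k1] tm[OF k0] xf by simp
    finally show ?thesis by simp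
  qed
  have v_cls: "v X h = v X h'" if X: "left_module R X" and h: "h \<in> mhom R A X" "h' \<in> mhom R A X"
    and eq: "cls R (A, B, f) X h = cls R (A, B, f) X h'" for X h h'
  proof -
    interpret X: left_module R X by fact
    let ?d = "\<lambda>a\<in>carrier A. h a \<oplus>\<^bsub>X\<^esub> \<ominus>\<^bsub>X\<^esub> h' a"
    have d: "?d \<in> hom_image R (A, B, f) X" using cls_eq_iff[OF p X h] eq by simp
    then have d': "?d \<in> mhom R A X" using mhom_compose[OF lmA f] by (auto simp: hom_image_iff)
    have "h a = ?d a \<oplus>\<^bsub>X\<^esub> h' a" if a: "a \<in> carrier A" for a
      using a mhom_closed[OF h(1) a] mhom_closed[OF h(2) a] by (simp add: X.M.a_assoc X.M.l_neg)
    then have h_eq: "h = (\<lambda>a\<in>carrier A. ?d a \<oplus>\<^bsub>X\<^esub> h' a)"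
      using mhom_ext[OF h(1)] by (auto simp: fun_eq_iff extensional_def)
    have "v X h = v X ?d \<otimes>\<^bsub>tensor R N X\<^esub> v X h'"
      using v_add[OF X d' h(2)] unfolding h_eq[symmetric] .
    also have "\<dots> = tcls R N X 0 \<otimes>\<^bsub>tensor R N X\<^esub> v X h'" using v_im[OF X d] by simp
    also have "\<dots> = v X h'"
      unfolding v_def using tensor_mult[OF N.left_module_axioms X _ keys_tsum[OF x vec_hom[OF h(2)]], of 0] by simp
    finally show ?thesis .
  qed
  define rep where "rep X c = (SOME h. h \<in> mhom R A X \<and> \<eta> X c = cls R (A, B, f) X h)" for X c
  have rep: "rep X c \<in> mhom R A X" "\<eta> X c = cls R (A, B, f) X (rep X c)"
    if "X \<in> fp_modules R" "c \<in> carrier (fob G X)" for X c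
    using someI_ex[of "\<lambda>h. h \<in> mhom R A X \<and> \<eta> X c = cls R (A, B, f) X h"] generated[OF that] unfolding rep_def by blast+
  define \<nu> where "\<nu> = (\<lambda>X\<in>fp_modules R. \<lambda>c\<in>carrier (fob G X). v X (rep X c))"
  have \<nu>v: "\<nu> X c = v X h" if X: "X \<in> fp_modules R" and c: "c \<in> carrier (fob G X)" and h: "h \<in> mhom R A X" "\<eta> X c = cls R (A, B, f) X h" for X c h
    using v_cls[OF fp_modules_left_module[OF X] rep(1)[OF X c] h(1)] rep(2)[OF X c] X c h(2) by (simp add: \<nu>_def)
  have "\<nu> \<in> nat_trans R G (tensor_functor R N)"
  proof (rule nat_transI)
    fix X c assume X: "X \<in> fp_modules R" and c: "c \<in> carrier (fob G X)"
    note lX = fp_modules_left_module[OF X]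
    obtain h where h: "h \<in> mhom R A X" "\<eta> X c = cls R (A, B, f) X h" using generated[OF X c] by blast
    show "\<nu> X c \<in> carrier (fob (tensor_functor R N) X)"
      unfolding \<nu>v[OF X c h] using keys_tsum[OF x vec_hom[OF h(1)]]
      by (simp add: tensor_carrier[OF N.left_module_axioms lX] v_def)
    show "\<nu> X (c \<otimes>\<^bsub>fob G X\<^esub> d) = \<nu> X c \<otimes>\<^bsub>fob (tensor_functor R N) X\<^esub> \<nu> X d" if d: "d \<in> carrier (fob G X)" for d
    proof -
      obtain h' where h': "h' \<in> mhom R A X" "\<eta> X d = cls R (A, B, f) X h'" using generated[OF X d] by blast
      have "\<eta> X (c \<otimes>\<^bsub>fob G X\<^esub> d) = cls R (A, B, f) X (\<lambda>a\<in>carrier A. h a \<oplus>\<^bsub>X\<^esub> h' a)"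
        using nat_transD(1)[OF \<eta> X] c d h(2) h'(2) coker_mult[OF p lX h(1) h'(1)] by (simp add: hom_def)
      then have "\<nu> X (c \<otimes>\<^bsub>fob G X\<^esub> d) = v X (\<lambda>a\<in>carrier A. h a \<oplus>\<^bsub>X\<^esub> h' a)"
        by (rule \<nu>v[OF X G_mult[OF X c d] mhom_sum[OF lmA lX h(1) h'(1)]])
      then show ?thesis using v_add[OF lX h(1) h'(1)] \<nu>v[OF X c h] \<nu>v[OF X d h'] by simp
    qed
    show "\<nu> Y (fmor G X Y q c) = fmor (tensor_functor R N) X Y q (\<nu> X c)"
      if Y: "Y \<in> fp_modules R" and q: "q \<in> mhom R X Y" for Y q
    proof -
      note lY = fp_modules_left_module[OF Y]
      have "\<eta> Y (fmor G X Y q c) = cls R (A, B, f) Y (compose (carrier A) q h)"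
        using nat_transD(4)[OF \<eta> X Y q c] coker_fmor[OF p lX lY q h(1)] h(2) by simp
      then have "\<nu> Y (fmor G X Y q c) = v Y (compose (carrier A) q h)"
        by (rule \<nu>v[OF Y G_fmor[OF X Y q c] mhom_compose[OF lmA h(1) q]])
      also have "\<dots> = tensor_map R N Y (\<lambda>n. n) q (v X h)"
      proof -
        have "tsum n x (\<lambda>i. compose (carrier A) q h (\<alpha> i)) = frag_pair (\<lambda>n. n) q (tsum n x (\<lambda>i. h (\<alpha> i)))"
          unfolding frag_pair_tsum using vec_\<alpha> by (simp add: tsum_def compose_def vec_def)
        then show ?thesis unfolding v_def
          using tensor_map_tcls[OF N.left_module_axioms lX N.left_module_axioms lY mlin_id mlin_mhom[OF q] keys_tsum[OF x vec_hom[OF h(1)]]]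
          by simp
      qed
      finally show ?thesis by (simp add: \<nu>v[OF X c h])
    qed
  qed (simp_all add: \<nu>_def)
  moreover have "\<nu> A u = tcls R N A (tsum n x \<alpha>)"
    unfolding \<nu>v[OF fpA u(1) idA u(2)] v_def using vec_\<alpha> by (simp add: tsum_def vec_def)
  ultimately show ?thesis unfolding x_def[abs_def] by blast
qed

text \<open>Every element of \<open>G\<close> is the image of \<open>u\<close> under some map, so
  naturality leaves no freedom beyond the value at \<open>u\<close>.\<close>

lemma nat_trans_eqI:
  assumes \<nu>: "\<nu> \<in> nat_trans R G (tensor_functor R N)" and \<mu>: "\<mu> \<in> nat_trans R G (tensor_functor R N)" and eq: "\<nu> A u = \<mu> A u"
  shows "\<nu> = \<mu>"
proof (rule extensionalityI[where A = "fp_modules R"])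
  show "\<nu> \<in> extensional (fp_modules R)" "\<mu> \<in> extensional (fp_modules R)"
    using \<nu> \<mu> unfolding nat_trans_def by (auto simp: PiE_def)
  fix X :: "('r, 'u) module" assume X: "X \<in> fp_modules R"
  show "\<nu> X = \<mu> X"
  proof (rule extensionalityI[OF nat_transD(2)[OF \<nu> X] nat_transD(2)[OF \<mu> X]])
    fix c assume c: "c \<in> carrier (fob G X)"
    obtain h where h: "h \<in> mhom R A X" "\<eta> X c = cls R (A, B, f) X h" using generated[OF X c] by blast
    show "\<nu> X c = \<mu> X c"
      unfolding generated'[OF X c h] nat_trans_value[OF \<nu> X h(1)] nat_trans_value[OF \<mu> X h(1)] eq ..
  qed
qed

end

text \<open>The class of any map from \<open>A'\<close> whose tensor sum is the value at
  \<open>u\<close>; by \<open>tsum_eq_iff_cls\<close> the choice does not affect the class.\<close>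

definition dual_map :: "('r, 'u) module \<Rightarrow> (('r, 'u) module \<Rightarrow> 'x \<Rightarrow> ('u \<times> 'u \<Rightarrow>\<^sub>0 int) set) \<Rightarrow> ('u \<Rightarrow> 'u) set" where
  "dual_map N \<nu> = cls (opp R) (A', B', f') N
     (SOME g. g \<in> mhom (opp R) A' N \<and> tcls R N A (tsum n (\<lambda>i. g (\<alpha>' i)) \<alpha>) = \<nu> A u)"

lemma dual_map_eq:
  assumes N: "N \<in> Modules (opp R)" and g: "g \<in> mhom (opp R) A' N" "tcls R N A (tsum n (\<lambda>i. g (\<alpha>' i)) \<alpha>) = \<nu> A u"
  shows "dual_map N \<nu> = cls (opp R) (A', B', f') N g"
proof -
  let ?g = "SOME g. g \<in> mhom (opp R) A' N \<and> tcls R N A (tsum n (\<lambda>i. g (\<alpha>' i)) \<alpha>) = \<nu> A u"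
  have "?g \<in> mhom (opp R) A' N \<and> tcls R N A (tsum n (\<lambda>i. ?g (\<alpha>' i)) \<alpha>) = \<nu> A u"
    by (rule someI[of _ g]) (use g in blast)
  then show ?thesis unfolding dual_map_def using tsum_eq_iff_cls[OF N _ g(1), of ?g] g(2) by simp
qed

text \<open>Both functors are compared with the kernel of \<open>N \<otimes> f\<close>:
  \<open>value_u\<close>, \<open>trans_of_hom\<close> and \<open>nat_trans_eqI\<close> identify
  transformations with its elements, and \<open>tsum_eq_iff_cls\<close> identifies these with
  classes of maps from \<open>A'\<close>.\<close>

theorem AGJ_iso: "functor_iso (opp R) (AGJ R G) cokerA'"
  unfolding functor_iso_def
proof (rule bexI)
  let ?E = "\<lambda>N\<in>fp_modules (opp R). \<lambda>\<nu>\<in>nat_trans R G (tensor_functor R N). dual_map N \<nu>"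
  have mod: "N \<in> Modules (opp R)" "left_module (opp R) N" if "N \<in> fp_modules (opp R)" for N :: "('r, 'u) module"
    using that by (auto simp: fp_modules_def Modules_def)
  show "\<forall>N\<in>fp_modules (opp R). bij_betw (?E N) (carrier (fob (AGJ R G) N)) (carrier (fob cokerA' N))"
  proof
    fix N :: "('r, 'u) module" assume N: "N \<in> fp_modules (opp R)"
    note M = mod[OF N]
    show "bij_betw (?E N) (carrier (fob (AGJ R G) N)) (carrier (fob cokerA' N))"
      unfolding bij_betw_def
    proof (intro conjI inj_onI equalityI subsetI)
      fix \<nu> \<mu> assume "\<nu> \<in> carrier (fob (AGJ R G) N)" "\<mu> \<in> carrier (fob (AGJ R G) N)" and eq: "?E N \<nu> = ?E N \<mu>"
      then have \<nu>: "\<nu> \<in> nat_trans R G (tensor_functor R N)" and \<mu>: "\<mu> \<in> nat_trans R G (tensor_functor R N)" by simp_all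
      obtain g where g: "g \<in> mhom (opp R) A' N" "tcls R N A (tsum n (\<lambda>i. g (\<alpha>' i)) \<alpha>) = \<nu> A u" using value_u[OF M(1) \<nu>] by blast
      obtain h where h: "h \<in> mhom (opp R) A' N" "tcls R N A (tsum n (\<lambda>i. h (\<alpha>' i)) \<alpha>) = \<mu> A u" using value_u[OF M(1) \<mu>] by blast
      have "cls (opp R) (A', B', f') N g = cls (opp R) (A', B', f') N h"
        using eq N \<nu> \<mu> dual_map_eq[where \<nu> = \<nu>, OF M(1) g] dual_map_eq[where \<nu> = \<mu>, OF M(1) h] by simp
      then have "\<nu> A u = \<mu> A u" using tsum_eq_iff_cls[OF M(1) g(1) h(1)] g(2) h(2) by simp
      then show "\<nu> = \<mu>" by (rule nat_trans_eqI[OF M(1) \<nu> \<mu>])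
    next
      fix c assume "c \<in> ?E N ` carrier (fob (AGJ R G) N)"
      then obtain \<nu> where \<nu>: "\<nu> \<in> nat_trans R G (tensor_functor R N)" "c = dual_map N \<nu>" using N by auto
      obtain g where g: "g \<in> mhom (opp R) A' N" "tcls R N A (tsum n (\<lambda>i. g (\<alpha>' i)) \<alpha>) = \<nu> A u" using value_u[OF M(1) \<nu>(1)] by blast
      then show "c \<in> carrier (fob cokerA' N)" using \<nu>(2) dual_map_eq[where \<nu> = \<nu>, OF M(1) g] by (simp add: coker_carrier[OF p'])
    next
      fix c assume "c \<in> carrier (fob cokerA' N)"
      then obtain g where g: "g \<in> mhom (opp R) A' N" "c = cls (opp R) (A', B', f') N g" by (auto simp: coker_carrier[OF p'])
      obtain \<nu> where \<nu>: "\<nu> \<in> nat_trans R G (tensor_functor R N)" "\<nu> A u = tcls R N A (tsum n (\<lambda>i. g (\<alpha>' i)) \<alpha>)"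
        using trans_of_hom[OF M(1) g(1)] by blast
      have "?E N \<nu> = c" using N \<nu>(1) dual_map_eq[where \<nu> = \<nu>, OF M(1) g(1) \<nu>(2)[symmetric]] g(2) by simp
      then show "c \<in> ?E N ` carrier (fob (AGJ R G) N)" using \<nu>(1) by force
    qed
  qed
  show "?E \<in> nat_trans (opp R) (AGJ R G) cokerA'"
  proof (rule nat_transI)
    fix N :: "('r, 'u) module" and \<nu> assume N: "N \<in> fp_modules (opp R)" and \<nu>': "\<nu> \<in> carrier (fob (AGJ R G) N)"
    note M = mod[OF N]
    have \<nu>: "\<nu> \<in> nat_trans R G (tensor_functor R N)" using \<nu>' by simp
    obtain g where g: "g \<in> mhom (opp R) A' N" "tcls R N A (tsum n (\<lambda>i. g (\<alpha>' i)) \<alpha>) = \<nu> A u" using value_u[OF M(1) \<nu>] by blast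
    show "?E N \<nu> \<in> carrier (fob cokerA' N)"
      using N \<nu> dual_map_eq[where \<nu> = \<nu>, OF M(1) g] g(1) by (simp add: coker_carrier[OF p'])
    have \<alpha>': "\<alpha>' i \<in> carrier A'" if "i < n" for i using presA' that by (simp add: presents_def vec_def)
    show "?E N (\<nu> \<otimes>\<^bsub>fob (AGJ R G) N\<^esub> \<mu>) = ?E N \<nu> \<otimes>\<^bsub>fob cokerA' N\<^esub> ?E N \<mu>" if "\<mu> \<in> carrier (fob (AGJ R G) N)" for \<mu>
    proof -
      have \<mu>: "\<mu> \<in> nat_trans R G (tensor_functor R N)" using that by simp
      obtain h where h: "h \<in> mhom (opp R) A' N" "tcls R N A (tsum n (\<lambda>i. h (\<alpha>' i)) \<alpha>) = \<mu> A u" using value_u[OF M(1) \<mu>] by blast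
      let ?s = "\<lambda>x\<in>carrier A'. g x \<oplus>\<^bsub>N\<^esub> h x"
      let ?\<nu>\<mu> = "\<nu> \<otimes>\<^bsub>nat_trans_group R G (tensor_functor R N)\<^esub> \<mu>"
      have s: "?s \<in> mhom (opp R) A' N" by (rule mhom_sum[OF lmA' M(2) g(1) h(1)])
      note vg = kernel_of_hom(1)[OF M(1) g(1)] and vh = kernel_of_hom(1)[OF M(1) h(1)]
      have "tsum n (\<lambda>i. ?s (\<alpha>' i)) \<alpha> = tsum n (\<lambda>i. g (\<alpha>' i) \<oplus>\<^bsub>N\<^esub> h (\<alpha>' i)) \<alpha>" by (simp add: tsum_def \<alpha>')
      then have "tcls R N A (tsum n (\<lambda>i. ?s (\<alpha>' i)) \<alpha>) = \<nu> A u \<otimes>\<^bsub>tensor R N A\<^esub> \<mu> A u"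
        unfolding g(2)[symmetric] h(2)[symmetric] tensor_mult[OF M(2) lmA keys_tsum[OF vg vec_\<alpha>] keys_tsum[OF vh vec_\<alpha>]]
        using tsum_add_left[OF M(2) lmA vg vh vec_\<alpha>] by simp
      also have "\<dots> = ?\<nu>\<mu> A u" using fpA u(1) by simp
      finally have E: "dual_map N ?\<nu>\<mu> = cls (opp R) (A', B', f') N ?s" by (rule dual_map_eq[OF M(1) s])
      have "?\<nu>\<mu> \<in> nat_trans R G (tensor_functor R N)"
      proof (rule nat_transI)
        fix X :: "('r, 'u) module" and c assume X: "X \<in> fp_modules R" and c: "c \<in> carrier (fob G X)"
        interpret T: comm_group "tensor R N X" by (rule tensor_comm_group[OF M(2) fp_modules_left_module[OF X]])
        have \<nu>c: "\<nu> X c \<in> carrier (tensor R N X)" "\<mu> X c \<in> carrier (tensor R N X)"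
          if "c \<in> carrier (fob G X)" for c
          using nat_transD(3)[OF \<nu> X that] nat_transD(3)[OF \<mu> X that] by simp_all
        show "?\<nu>\<mu> X c \<in> carrier (fob (tensor_functor R N) X)" using X c \<nu>c[OF c] by simp
        show "?\<nu>\<mu> X (c \<otimes>\<^bsub>fob G X\<^esub> d) = ?\<nu>\<mu> X c \<otimes>\<^bsub>fob (tensor_functor R N) X\<^esub> ?\<nu>\<mu> X d" if d: "d \<in> carrier (fob G X)" for d
          using X c d \<nu>c[OF c] \<nu>c[OF d] G_mult[OF X c d] nat_transD(1)[OF \<nu> X] nat_transD(1)[OF \<mu> X]
          by (simp add: hom_def T.m_ac)
        show "?\<nu>\<mu> Y (fmor G X Y q c) = fmor (tensor_functor R N) X Y q (?\<nu>\<mu> X c)"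
          if Y: "Y \<in> fp_modules R" and q: "q \<in> mhom R X Y" for Y q
          using X Y c G_fmor[OF X Y q c] nat_transD(4)[OF \<nu> X Y q c] nat_transD(4)[OF \<mu> X Y q c]
            tensor_map_mult[OF M(2) fp_modules_left_module[OF X] M(2) fp_modules_left_module[OF Y] mlin_id mlin_mhom[OF q] \<nu>c[OF c]]
          by simp
      qed simp_all
      then show ?thesis
        using N \<nu> \<mu> E dual_map_eq[where \<nu> = \<nu>, OF M(1) g] dual_map_eq[where \<nu> = \<mu>, OF M(1) h] coker_mult[OF p' M(2) g(1) h(1)]
        by (simp del: nat_trans_group_simps(2))
    qed
    show "?E N' (fmor (AGJ R G) N N' q \<nu>) = fmor cokerA' N N' q (?E N \<nu>)"
      if N': "N' \<in> fp_modules (opp R)" and q: "q \<in> mhom (opp R) N N'" for N' q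
    proof -
      note M' = mod[OF N']
      let ?c = "compose (carrier A') q g"
      have c: "?c \<in> mhom (opp R) A' N'" by (rule mhom_compose[OF lmA' g(1) q])
      have "tsum n (\<lambda>i. ?c (\<alpha>' i)) \<alpha> = frag_pair q (\<lambda>y. y) (tsum n (\<lambda>i. g (\<alpha>' i)) \<alpha>)"
        unfolding frag_pair_tsum by (simp add: tsum_def compose_def \<alpha>')
      then have "tcls R N' A (tsum n (\<lambda>i. ?c (\<alpha>' i)) \<alpha>) = tensor_map R N' A q (\<lambda>y. y) (\<nu> A u)"
        unfolding g(2)[symmetric]
        using tensor_map_tcls[OF M(2) lmA M'(2) lmA mlin_mhom[OF q] mlin_id keys_tsum[OF kernel_of_hom(1)[OF M(1) g(1)] vec_\<alpha>]] by simp
      also have "\<dots> = fmor (AGJ R G) N N' q \<nu> A u" using fpA u(1) by simp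
      finally have "dual_map N' (fmor (AGJ R G) N N' q \<nu>) = cls (opp R) (A', B', f') N' ?c" by (rule dual_map_eq[OF M'(1) c])
      moreover have "fmor (AGJ R G) N N' q \<nu> \<in> nat_trans R G (tensor_functor R N')"
        using AGJ_fmor_closed[OF G] N N' q \<nu>' unfolding fmor_closed_def by fastforce
      ultimately show ?thesis
        using N N' \<nu> dual_map_eq[where \<nu> = \<nu>, OF M(1) g] coker_fmor[OF p' M(2) M'(2) q g(1)] by (simp del: AGJ_simps(2))
    qed
  qed (simp_all add: extensional_def)
qed

end

subsection \<open>Closure properties of definable classes\<close>

lemma vec_hom_image: "h \<in> mhom R X Y \<Longrightarrow> vec X n x \<Longrightarrow> vec Y n (\<lambda>i. h (x i))"
  by (simp add: vec_def mhom_closed)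

context system_pair
begin

text \<open>A solution is pushed into \<open>Y\<close> by the section, completed there, and the
  completion is brought back by the retraction; homomorphisms commute with matrices.\<close>

lemma cond_retract:
  assumes X: "left_module R X" and Y: "left_module R Y" and r: "retract R X Y" and c: "cond Y"
  shows "cond X"
  unfolding pp_cond_def
proof (intro allI impI)
  obtain s p where s: "s \<in> mhom R X Y" and p: "p \<in> mhom R Y X" and ps: "\<And>x. x \<in> carrier X \<Longrightarrow> p (s x) = x"
    using r unfolding retract_def by blast
  note ab = left_module.abelian_group_M[OF X] left_module.abelian_group_M[OF Y]
  fix x assume x: "vec X n x" "\<forall>i<m. act X n H x i = \<zero>\<^bsub>X\<^esub>"
  have "act Y n H (\<lambda>j. s (x j)) i = \<zero>\<^bsub>Y\<^esub>" if "i < m" for i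
    using act_hom[OF X Y s H x(1) that] x(2) that mhom_zero[OF ab s] by simp
  then obtain y where y: "vec Y l y" "\<forall>i<k. act Y l K y i = \<zero>\<^bsub>Y\<^esub>" "\<forall>i<n. s (x i) = act Y l F y i"
    using c vec_hom_image[OF s x(1)] unfolding pp_cond_def by blast
  have "act X l K (\<lambda>j. p (y j)) i = \<zero>\<^bsub>X\<^esub>" if "i < k" for i
    using act_hom[OF Y X p K y(1) that] y(2) that mhom_zero[OF ab(2,1) p] by simp
  moreover have "x i = act X l F (\<lambda>j. p (y j)) i" if "i < n" for i
    using act_hom[OF Y X p F y(1) that] y(3) that ps[of "x i"] x(1) by (simp add: vec_def)
  ultimately show "\<exists>y. vec X l y \<and> (\<forall>i<k. act X l K y i = \<zero>\<^bsub>X\<^esub>) \<and> (\<forall>i<n. x i = act X l F y i)"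
    using vec_hom_image[OF p y(1)] by blast
qed

lemma dual_retract:
  assumes X: "left_module (opp R) X" and Y: "left_module (opp R) Y" and r: "retract (opp R) X Y" and c: "dual Y"
  shows "dual X"
  unfolding pp_dual_def
proof (intro allI impI)
  obtain s p where s: "s \<in> mhom (opp R) X Y" and p: "p \<in> mhom (opp R) Y X" and ps: "\<And>x. x \<in> carrier X \<Longrightarrow> p (s x) = x"
    using r unfolding retract_def by blast
  have FT: "mat (opp R) l n (tr F)" and KT: "mat (opp R) l k (tr K)" and HT: "mat (opp R) n m (tr H)"
    using mat_tr F K H by auto
  fix x z assume x: "vec X n x" and z: "vec X k z" and eq: "\<forall>j<l. act X n (tr F) x j = act X k (tr K) z j"
  have "act Y n (tr F) (\<lambda>i. s (x i)) j = act Y k (tr K) (\<lambda>i. s (z i)) j" if "j < l" for j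
    using act_hom[OF X Y s FT x that] act_hom[OF X Y s KT z that] eq that by simp
  then obtain w where w: "vec Y m w" "\<forall>i<n. s (x i) = act Y m (tr H) w i"
    using c vec_hom_image[OF s x] vec_hom_image[OF s z] unfolding pp_dual_def by blast
  have "x i = act X m (tr H) (\<lambda>j. p (w j)) i" if "i < n" for i
    using act_hom[OF Y X p HT w(1) that] w(2) that ps[of "x i"] x by (simp add: vec_def)
  then show "\<exists>w. vec X m w \<and> (\<forall>i<n. x i = act X m (tr H) w i)" using vec_hom_image[OF p w(1)] by blast
qed

end

section \<open>Linear conditions in products, coproducts and direct sums\<close>

lemma msum_same_ops:
  "\<zero>\<^bsub>Q\<^esub> = \<zero>\<^bsub>P\<^esub> \<Longrightarrow> (\<And>x y. x \<oplus>\<^bsub>Q\<^esub> y = x \<oplus>\<^bsub>P\<^esub> y) \<Longrightarrow> msum Q f n = msum P f n"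
  by (induction n) auto

text \<open>Products and coproducts at once: the supports of the elements are restricted to a family \<open>\<Phi>\<close> of sets.
  In each coordinate where the given tuple vanishes, the zero solution is chosen.\<close>

lemma (in system_pair) cond_restricted_product:
  assumes F': "\<And>i. i \<in> I \<Longrightarrow> left_module R (X i)" "\<And>i. i \<in> I \<Longrightarrow> cond (X i)"
    and Q: "carrier Q = {x \<in> \<Pi>\<^sub>E i\<in>I. carrier (X i). \<Phi> {i \<in> I. x i \<noteq> \<zero>\<^bsub>X i\<^esub>}}"
      "\<zero>\<^bsub>Q\<^esub> = \<zero>\<^bsub>prod_module I X\<^esub>" "\<And>x y. x \<oplus>\<^bsub>Q\<^esub> y = x \<oplus>\<^bsub>prod_module I X\<^esub> y"
      "\<And>r x. r \<odot>\<^bsub>Q\<^esub> x = r \<odot>\<^bsub>prod_module I X\<^esub> x"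
    and \<Phi>: "\<Phi> {}" "\<And>S T. \<Phi> S \<Longrightarrow> \<Phi> T \<Longrightarrow> \<Phi> (S \<union> T)" "\<And>S T. \<Phi> S \<Longrightarrow> T \<subseteq> S \<Longrightarrow> \<Phi> T"
  shows "cond Q"
  unfolding pp_cond_def
proof (intro allI impI)
  let ?P = "prod_module I X"
  have act_Q: "act Q N c x i = act ?P N c x i" for N c x i
    unfolding act_def using Q(4) msum_same_ops[of Q ?P] Q(2,3) by simp
  interpret P: left_module R ?P by (rule left_module_prod[OF ring_R F'(1)])
  have vecP: "vec ?P N x" if "vec Q N x" for N x using that Q(1) by (auto simp: vec_def)
  have coord: "act Q N c x k' i = act (X i) N c (\<lambda>j. x j i) k'" if "i \<in> I" for N c x k' i
    unfolding act_Q using that by (rule act_prod)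
  fix x assume x: "vec Q n x" "\<forall>i<m. act Q n H x i = \<zero>\<^bsub>Q\<^esub>"
  let ?S = "\<Union>j<n. {i \<in> I. x j i \<noteq> \<zero>\<^bsub>X i\<^esub>}"
  have \<Phi>S: "\<Phi> ?S"
  proof -
    have "k' \<le> n \<Longrightarrow> \<Phi> (\<Union>j<k'. {i \<in> I. x j i \<noteq> \<zero>\<^bsub>X i\<^esub>})" for k'
    proof (induction k')
      case 0 then show ?case using \<Phi>(1) by simp
    next
      case (Suc k')
      have "\<Phi> {i \<in> I. x k' i \<noteq> \<zero>\<^bsub>X i\<^esub>}" using x(1) Suc.prems Q(1) by (auto simp: vec_def)
      then show ?case using Suc \<Phi>(2) by (simp add: lessThan_Suc Un_commute)
    qed
    then show ?thesis by simp
  qed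
  have xi: "vec (X i) n (\<lambda>j. x j i)" if "i \<in> I" for i using vecP[OF x(1)] that by (auto simp: vec_def PiE_iff)
  have ex: "\<exists>y. vec (X i) l y \<and> (\<forall>r<k. act (X i) l K y r = \<zero>\<^bsub>X i\<^esub>) \<and> (\<forall>r<n. x r i = act (X i) l F y r) \<and>
    (i \<notin> ?S \<longrightarrow> (\<forall>j. y j = \<zero>\<^bsub>X i\<^esub>))" if i: "i \<in> I" for i
  proof (cases "i \<in> ?S")
    case True
    have "act (X i) n H (\<lambda>j. x j i) r = \<zero>\<^bsub>X i\<^esub>" if "r < m" for r
      using coord[OF i, of n H x r] x(2) that i Q(2) by simp
    then show ?thesis using F'(2)[OF i] xi[OF i] True unfolding pp_cond_def by blast
  next
    case False
    interpret Xi: left_module R "X i" by (rule F'(1)[OF i])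
    have "vec (X i) l (\<lambda>_. \<zero>\<^bsub>X i\<^esub>)" by (simp add: vec_def)
    moreover have "x r i = \<zero>\<^bsub>X i\<^esub>" if "r < n" for r using False i that by auto
    ultimately show ?thesis using Xi.act_zero[OF K] Xi.act_zero[OF F] by (intro exI[of _ "\<lambda>_. \<zero>\<^bsub>X i\<^esub>"]) auto
  qed
  have "\<exists>Y. \<forall>i\<in>I. vec (X i) l (Y i) \<and> (\<forall>r<k. act (X i) l K (Y i) r = \<zero>\<^bsub>X i\<^esub>) \<and>
    (\<forall>r<n. x r i = act (X i) l F (Y i) r) \<and> (i \<notin> ?S \<longrightarrow> (\<forall>j. Y i j = \<zero>\<^bsub>X i\<^esub>))"
    by (intro bchoice ballI ex)
  then obtain Y where "\<forall>i\<in>I. vec (X i) l (Y i) \<and> (\<forall>r<k. act (X i) l K (Y i) r = \<zero>\<^bsub>X i\<^esub>) \<and>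
    (\<forall>r<n. x r i = act (X i) l F (Y i) r) \<and> (i \<notin> ?S \<longrightarrow> (\<forall>j. Y i j = \<zero>\<^bsub>X i\<^esub>))" by (rule exE)
  then have Y: "\<And>i. i \<in> I \<Longrightarrow> vec (X i) l (Y i)"
    "\<And>i r. i \<in> I \<Longrightarrow> r < k \<Longrightarrow> act (X i) l K (Y i) r = \<zero>\<^bsub>X i\<^esub>"
    "\<And>i r. i \<in> I \<Longrightarrow> r < n \<Longrightarrow> x r i = act (X i) l F (Y i) r"
    "\<And>i j. i \<in> I \<Longrightarrow> i \<notin> ?S \<Longrightarrow> Y i j = \<zero>\<^bsub>X i\<^esub>" by simp_all
  define y where "y j = (\<lambda>i\<in>I. Y i j)" for j
  have yQ: "vec Q l y"
    unfolding vec_def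
  proof (intro allI impI)
    fix j assume j: "j < l"
    have "{i \<in> I. y j i \<noteq> \<zero>\<^bsub>X i\<^esub>} \<subseteq> ?S" using Y(4) unfolding y_def by (auto simp del: UN_iff)
    then have "\<Phi> {i \<in> I. y j i \<noteq> \<zero>\<^bsub>X i\<^esub>}" by (rule \<Phi>(3)[OF \<Phi>S])
    then show "y j \<in> carrier Q" using Y(1) j unfolding Q(1) by (auto simp: y_def vec_def)
  qed
  have yY: "act (X i) l c (\<lambda>j. y j i) r = act (X i) l c (Y i) r" if "i \<in> I" for i c r
    using that by (intro act_cong) (simp add: y_def)
  have "act Q l K y r = \<zero>\<^bsub>Q\<^esub>" if r: "r < k" for r
  proof (rule PiE_ext)
    show "act Q l K y r \<in> (\<Pi>\<^sub>E i\<in>I. carrier (X i))" using P.act_closed[OF K vecP[OF yQ] r] by (simp add: act_Q)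
    show "\<zero>\<^bsub>Q\<^esub> \<in> (\<Pi>\<^sub>E i\<in>I. carrier (X i))" using P.M.zero_closed by (simp add: Q(2))
    show "act Q l K y r i = \<zero>\<^bsub>Q\<^esub> i" if "i \<in> I" for i using coord[OF that] yY[OF that] Y(2)[OF that r] that by (simp add: Q(2))
  qed
  moreover have "x r = act Q l F y r" if r: "r < n" for r
  proof (rule PiE_ext)
    show "x r \<in> (\<Pi>\<^sub>E i\<in>I. carrier (X i))" using vecP[OF x(1)] r by (simp add: vec_def)
    show "act Q l F y r \<in> (\<Pi>\<^sub>E i\<in>I. carrier (X i))" using P.act_closed[OF F vecP[OF yQ] r] by (simp add: act_Q)
    show "x r i = act Q l F y r i" if "i \<in> I" for i using coord[OF that] yY[OF that] Y(3)[OF that r] by simp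
  qed
  ultimately show "\<exists>y. vec Q l y \<and> (\<forall>i<k. act Q l K y i = \<zero>\<^bsub>Q\<^esub>) \<and> (\<forall>i<n. x i = act Q l F y i)"
    using yQ by blast
qed

lemma left_module_sub:
  assumes M: "left_module R M" and C: "C \<subseteq> carrier M" "\<zero>\<^bsub>M\<^esub> \<in> C" "\<And>x y. x \<in> C \<Longrightarrow> y \<in> C \<Longrightarrow> x \<oplus>\<^bsub>M\<^esub> y \<in> C"
    "\<And>r x. r \<in> carrier R \<Longrightarrow> x \<in> C \<Longrightarrow> r \<odot>\<^bsub>M\<^esub> x \<in> C"
  shows "left_module R (M\<lparr>carrier := C\<rparr>)"
proof -
  interpret M: left_module R M by fact
  have mem: "x \<in> carrier M" if "x \<in> C" for x using that C(1) by blast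
  have "abelian_group (M\<lparr>carrier := C\<rparr>)"
  proof (rule abelian_groupI)
    fix x assume x: "x \<in> carrier (M\<lparr>carrier := C\<rparr>)"
    have "(\<ominus>\<^bsub>R\<^esub> \<one>\<^bsub>R\<^esub>) \<odot>\<^bsub>M\<^esub> x \<in> C" using x C(4) by simp
    then show "\<exists>y\<in>carrier (M\<lparr>carrier := C\<rparr>). y \<oplus>\<^bsub>M\<lparr>carrier := C\<rparr>\<^esub> x = \<zero>\<^bsub>M\<lparr>carrier := C\<rparr>\<^esub>"
      using x mem by (intro bexI[of _ "(\<ominus>\<^bsub>R\<^esub> \<one>\<^bsub>R\<^esub>) \<odot>\<^bsub>M\<^esub> x"]) (auto simp: M.uminus_smult M.smult_one M.M.l_neg)
  qed (use C mem in \<open>auto simp: M.M.a_assoc intro: M.M.a_comm\<close>)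
  moreover have "left_module_axioms R (M\<lparr>carrier := C\<rparr>)"
    unfolding left_module_axioms_def using C mem by (auto simp: M.smult_l_distr M.smult_r_distr M.smult_assoc M.smult_one)
  ultimately show ?thesis using M.ring_R unfolding left_module_def by simp
qed

lemma coprod_carrier: "carrier (coprod_module I F) = {x \<in> \<Pi>\<^sub>E i\<in>I. carrier (F i). finite {i \<in> I. x i \<noteq> \<zero>\<^bsub>F i\<^esub>}}"
  by (simp add: coprod_module_def)

lemma coprod_module_simps [simp]:
  "\<zero>\<^bsub>coprod_module I F\<^esub> = (\<lambda>i\<in>I. \<zero>\<^bsub>F i\<^esub>)" "x \<oplus>\<^bsub>coprod_module I F\<^esub> y = (\<lambda>i\<in>I. x i \<oplus>\<^bsub>F i\<^esub> y i)"
  "r \<odot>\<^bsub>coprod_module I F\<^esub> x = (\<lambda>i\<in>I. r \<odot>\<^bsub>F i\<^esub> x i)"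
  by (simp_all add: coprod_module_def)

lemma left_module_coprod:
  assumes R: "ring R" and F: "\<And>i. i \<in> I \<Longrightarrow> left_module R (F i)"
  shows "left_module R (coprod_module I F)"
  unfolding coprod_module_def
proof (rule left_module_sub[OF left_module_prod[OF R F]])
  interpret P: left_module R "prod_module I F" by (rule left_module_prod[OF R F])
  let ?C = "{x \<in> \<Pi>\<^sub>E i\<in>I. carrier (F i). finite {i \<in> I. x i \<noteq> \<zero>\<^bsub>F i\<^esub>}}"
  show "\<zero>\<^bsub>prod_module I F\<^esub> \<in> ?C" using P.M.zero_closed by simp
  show "x \<oplus>\<^bsub>prod_module I F\<^esub> y \<in> ?C" if "x \<in> ?C" "y \<in> ?C" for x y
  proof -
    have "(x i \<oplus>\<^bsub>F i\<^esub> y i) = \<zero>\<^bsub>F i\<^esub>" if "i \<in> I" "x i = \<zero>\<^bsub>F i\<^esub>" "y i = \<zero>\<^bsub>F i\<^esub>" for i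
    proof -
      interpret left_module R "F i" by (rule F[OF that(1)])
      show ?thesis using that by simp
    qed
    then have "{i \<in> I. (x i \<oplus>\<^bsub>F i\<^esub> y i) \<noteq> \<zero>\<^bsub>F i\<^esub>} \<subseteq> {i \<in> I. x i \<noteq> \<zero>\<^bsub>F i\<^esub>} \<union> {i \<in> I. y i \<noteq> \<zero>\<^bsub>F i\<^esub>}" by blast
    then have "finite {i \<in> I. (x i \<oplus>\<^bsub>F i\<^esub> y i) \<noteq> \<zero>\<^bsub>F i\<^esub>}"
      by (rule finite_subset) (use that in simp)
    then have "finite {i \<in> I. (x \<oplus>\<^bsub>prod_module I F\<^esub> y) i \<noteq> \<zero>\<^bsub>F i\<^esub>}" by (simp cong: conj_cong)
    moreover have "x \<oplus>\<^bsub>prod_module I F\<^esub> y \<in> (\<Pi>\<^sub>E i\<in>I. carrier (F i))" using P.M.a_closed[of x y] that by simp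
    ultimately show ?thesis by blast
  qed
  show "r \<odot>\<^bsub>prod_module I F\<^esub> x \<in> ?C" if "r \<in> carrier R" "x \<in> ?C" for r x
  proof -
    have "r \<odot>\<^bsub>F i\<^esub> x i = \<zero>\<^bsub>F i\<^esub>" if "i \<in> I" "x i = \<zero>\<^bsub>F i\<^esub>" for i
      using that \<open>r \<in> carrier R\<close> left_module.smult_zero[OF F[OF that(1)]] by simp
    then have "{i \<in> I. r \<odot>\<^bsub>F i\<^esub> x i \<noteq> \<zero>\<^bsub>F i\<^esub>} \<subseteq> {i \<in> I. x i \<noteq> \<zero>\<^bsub>F i\<^esub>}" by blast
    then have "finite {i \<in> I. r \<odot>\<^bsub>F i\<^esub> x i \<noteq> \<zero>\<^bsub>F i\<^esub>}" by (rule finite_subset) (use that in simp)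
    then have "finite {i \<in> I. (r \<odot>\<^bsub>prod_module I F\<^esub> x) i \<noteq> \<zero>\<^bsub>F i\<^esub>}" by (simp cong: conj_cong)
    moreover have "r \<odot>\<^bsub>prod_module I F\<^esub> x \<in> (\<Pi>\<^sub>E i\<in>I. carrier (F i))" using P.smult_closed[of r x] that by simp
    ultimately show ?thesis by blast
  qed
qed auto

lemma (in system_pair) cond_prod:
  assumes "\<And>i. i \<in> I \<Longrightarrow> left_module R (X i)" "\<And>i. i \<in> I \<Longrightarrow> cond (X i)"
  shows "cond (prod_module I X)"
  by (rule cond_restricted_product[OF assms, where \<Phi> = "\<lambda>_. True"]) auto

lemma (in system_pair) cond_coprod:
  assumes "\<And>i. i \<in> I \<Longrightarrow> left_module R (X i)" "\<And>i. i \<in> I \<Longrightarrow> cond (X i)"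
  shows "cond (coprod_module I X)"
  by (rule cond_restricted_product[OF assms, where \<Phi> = finite]) (auto simp: coprod_carrier finite_subset)

lemma sum_module_simps [simp]:
  "carrier (sum_module M N) = carrier M \<times> carrier N" "\<zero>\<^bsub>sum_module M N\<^esub> = (\<zero>\<^bsub>M\<^esub>, \<zero>\<^bsub>N\<^esub>)"
  "(x, y) \<oplus>\<^bsub>sum_module M N\<^esub> (x', y') = (x \<oplus>\<^bsub>M\<^esub> x', y \<oplus>\<^bsub>N\<^esub> y')" "r \<odot>\<^bsub>sum_module M N\<^esub> (x, y) = (r \<odot>\<^bsub>M\<^esub> x, r \<odot>\<^bsub>N\<^esub> y)"
  by (simp_all add: sum_module_def)

lemma left_module_sum:
  assumes "left_module R M" "left_module R N"
  shows "left_module R (sum_module M N)"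
proof -
  interpret M: left_module R M by fact
  interpret N: left_module R N by fact
  show ?thesis unfolding sum_module_def
  proof (rule left_module_mk)
    show "\<exists>y\<in>carrier M \<times> carrier N. (case y of (x, y) \<Rightarrow> \<lambda>(x', y'). (x \<oplus>\<^bsub>M\<^esub> x', y \<oplus>\<^bsub>N\<^esub> y')) x = (\<zero>\<^bsub>M\<^esub>, \<zero>\<^bsub>N\<^esub>)"
      if "x \<in> carrier M \<times> carrier N" for x
      using that by (intro bexI[of _ "(\<ominus>\<^bsub>M\<^esub> fst x, \<ominus>\<^bsub>N\<^esub> snd x)"]) (auto simp: M.M.l_neg N.M.l_neg)
  qed (auto simp: M.ring_R M.M.a_ac N.M.a_ac M.smult_l_distr M.smult_r_distr M.smult_assoc M.smult_one
      N.smult_l_distr N.smult_r_distr N.smult_assoc N.smult_one)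
qed

lemma retract_sum:
  assumes "left_module R M" "left_module R N"
  shows "retract R M (sum_module M N)"
proof -
  interpret M: left_module R M by fact
  interpret N: left_module R N by fact
  show ?thesis unfolding retract_def
  proof (intro bexI ballI)
    show "(\<lambda>x\<in>carrier M. (x, \<zero>\<^bsub>N\<^esub>)) \<in> mhom R M (sum_module M N)" by (rule mhomI) auto
    show "(\<lambda>z\<in>carrier (sum_module M N). fst z) \<in> mhom R (sum_module M N) M" by (rule mhomI) auto
  qed auto
qed

text \<open>A retract of \<open>N\<close> is a direct summand, the complement being the kernel of the projection.\<close>

lemma closed_summands_retract:
  assumes B: "closed_summands S B" and M: "M \<in> Modules S" and N: "N \<in> Modules S" "N \<in> B" and r: "retract S M N"
  shows "M \<in> B"
proof -
  interpret M: left_module S M using M by (simp add: Modules_def)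
  interpret N: left_module S N using N by (simp add: Modules_def)
  obtain s p where s: "s \<in> mhom S M N" and p: "p \<in> mhom S N M" and ps: "\<And>x. x \<in> carrier M \<Longrightarrow> p (s x) = x"
    using r unfolding retract_def by blast
  let ?C = "{y \<in> carrier N. p y = \<zero>\<^bsub>M\<^esub>}"
  let ?Y = "N\<lparr>carrier := ?C\<rparr>"
  have Y: "left_module S ?Y"
    by (rule left_module_sub[OF N.left_module_axioms])
      (auto simp: mhom_add[OF p] mhom_smult[OF p] mhom_zero[OF N.abelian_group_M M.abelian_group_M p])
  have "small ?C" using N(1) tiny_subset[of "carrier N" ?C] by (auto simp: Modules_def small_iff_tiny)
  then have YM: "?Y \<in> Modules S" using Y by (simp add: Modules_def)
  let ?h = "\<lambda>z\<in>carrier (sum_module M ?Y). s (fst z) \<oplus>\<^bsub>N\<^esub> snd z"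
  note sc = mhom_closed[OF s] and pc = mhom_closed[OF p]
  interpret Q: left_module S "sum_module M ?Y" by (rule left_module_sum[OF M.left_module_axioms Y])
  have "?h \<in> mhom S (sum_module M ?Y) N"
  proof (rule mhomI)
    show "?h (x \<oplus>\<^bsub>sum_module M ?Y\<^esub> y) = ?h x \<oplus>\<^bsub>N\<^esub> ?h y"
      if "x \<in> carrier (sum_module M ?Y)" "y \<in> carrier (sum_module M ?Y)" for x y
      using that Q.M.a_closed[OF that] sc by (auto simp: mhom_add[OF s] N.M.a_ac)
    show "?h (r \<odot>\<^bsub>sum_module M ?Y\<^esub> x) = r \<odot>\<^bsub>N\<^esub> ?h x" if "r \<in> carrier S" "x \<in> carrier (sum_module M ?Y)" for r x
      using that Q.smult_closed[OF that] sc by (auto simp: mhom_smult[OF s] N.smult_r_distr)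
  qed (use sc in auto)
  moreover have "bij_betw ?h (carrier (sum_module M ?Y)) (carrier N)"
    unfolding bij_betw_def
  proof (intro conjI inj_onI equalityI subsetI)
    fix x y assume xy: "x \<in> carrier (sum_module M ?Y)" "y \<in> carrier (sum_module M ?Y)" "?h x = ?h y"
    then have c: "fst x \<in> carrier M" "fst y \<in> carrier M" "snd x \<in> carrier N" "snd y \<in> carrier N"
      "p (snd x) = \<zero>\<^bsub>M\<^esub>" "p (snd y) = \<zero>\<^bsub>M\<^esub>" by auto
    have eq: "s (fst x) \<oplus>\<^bsub>N\<^esub> snd x = s (fst y) \<oplus>\<^bsub>N\<^esub> snd y" using xy by simp
    then have "p (s (fst x) \<oplus>\<^bsub>N\<^esub> snd x) = p (s (fst y) \<oplus>\<^bsub>N\<^esub> snd y)" by simp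
    then have f: "fst x = fst y" using c sc ps by (simp add: mhom_add[OF p])
    then have "snd x = snd y" using eq c sc[of "fst y"] by (metis N.M.r_neg1)
    then show "x = y" using f by (simp add: prod_eq_iff)
  next
    fix y assume "y \<in> ?h ` carrier (sum_module M ?Y)"
    then show "y \<in> carrier N" using sc by auto
  next
    fix y assume y: "y \<in> carrier N"
    \<comment> \<open>The preimage of \<open>y\<close> is the pair of \<open>p y\<close> and the
      component of \<open>y\<close> in the kernel of \<open>p\<close>.\<close>
    let ?d = "y \<oplus>\<^bsub>N\<^esub> \<ominus>\<^bsub>N\<^esub> s (p y)"
    have d: "?d \<in> ?C" using y sc pc ps[OF pc[OF y]]
      by (simp add: mhom_add[OF p] mhom_uminus[OF N.abelian_group_M M.abelian_group_M p] M.M.r_neg)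
    have "s (p y) \<oplus>\<^bsub>N\<^esub> ?d = y" using y sc pc by (simp add: N.M.a_lcomm N.M.r_neg)
    then show "y \<in> ?h ` carrier (sum_module M ?Y)" using d y pc by (intro image_eqI[of _ _ "(p y, ?d)"]) auto
  qed
  ultimately have "mod_iso S (sum_module M ?Y) N" unfolding mod_iso_def by blast
  then have "belongs S (sum_module M ?Y) B" using N(2) unfolding belongs_def by blast
  then show ?thesis using B M YM unfolding closed_summands_def by blast
qed

section \<open>Definable classes in terms of linear systems\<close>

lemma factors_system:
  assumes "p \<in> fp_morphisms R"
  shows "\<exists>n m l k H F K. system_pair R n m l k H F K \<and>
    (\<forall>M. left_module R M \<longrightarrow> (factors R p M \<longleftrightarrow> pp_cond M n m l k H F K))"
proof -
  obtain A B f where p: "p = (A, B, f)" by (cases p)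
  then have "(A, B, f) \<in> fp_morphisms R" using assms by simp
  from fp_morphism_system[OF this] obtain n m l k H F K \<alpha> \<beta> where s: "system_pair R n m l k H F K"
    "presents R A n \<alpha> m H" "presents R B l \<beta> k K" "\<forall>i<n. f (\<alpha> i) = lin B l (F i) \<beta>" by blast
  have f: "f \<in> mhom R A B" using assms p by (simp add: fp_morphisms_def)
  show ?thesis using s(1) factors_iff_cond[OF s f] unfolding p by blast
qed

text \<open>From here on functors are replaced by morphisms between finitely presented modules:
  every functor in a defining set has a presentation, and conversely cokernel functors are finitely
  presented.\<close>

lemma definable_iff:
  fixes D :: "('r, 'u) module set"
  shows "definable R D \<longleftrightarrow> (\<exists>P\<subseteq>fp_morphisms R. D = {M \<in> Modules R. \<forall>p\<in>P. factors R p M})"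
proof
  assume "definable R D"
  then obtain S :: "('r, 'u, ('u \<Rightarrow> 'u) set) mod_functor set" where S: "\<forall>G\<in>S. fp_functor R G" "D = Ker R S"
    unfolding definable_def by blast
  then have "\<forall>G\<in>S. \<exists>p. p \<in> fp_morphisms R \<and> functor_iso R G (coker_functor R p)" unfolding fp_functor_def by blast
  then obtain p where p: "\<And>G. G \<in> S \<Longrightarrow> p G \<in> fp_morphisms R" "\<And>G. G \<in> S \<Longrightarrow> functor_iso R G (coker_functor R (p G))" by metis
  have "trivial_group (fob (extension R G) M) \<longleftrightarrow> factors R (p G) M" if "G \<in> S" "M \<in> Modules R" for G M
    using extension_trivial_iff[OF fp_functor_fmor_closed p(1) p(2)] S(1) that by (auto simp: Modules_def)
  then have "D = {M \<in> Modules R. \<forall>q\<in>p ` S. factors R q M}" unfolding S(2) Ker_def by auto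
  moreover have "p ` S \<subseteq> fp_morphisms R" using p(1) by blast
  ultimately show "\<exists>P\<subseteq>fp_morphisms R. D = {M \<in> Modules R. \<forall>p\<in>P. factors R p M}" by blast
next
  assume "\<exists>P\<subseteq>fp_morphisms R. D = {M \<in> Modules R. \<forall>p\<in>P. factors R p M}"
  then obtain P where P: "P \<subseteq> fp_morphisms R" "D = {M \<in> Modules R. \<forall>p\<in>P. factors R p M}" by blast
  have fp: "fp_functor R (coker_functor R p)" if "p \<in> P" for p
    using fp_functor_coker[of "fst p" "fst (snd p)" "snd (snd p)"] P(1) that by auto
  have iso: "functor_iso R (coker_functor R p) (coker_functor R p)" if "p \<in> P" for p
    using functor_iso_coker_refl[of "fst p" "fst (snd p)" "snd (snd p)"] P(1) that by auto
  have "trivial_group (fob (extension R (coker_functor R p)) M) \<longleftrightarrow> factors R p M" if "p \<in> P" "M \<in> Modules R" for p M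
    using extension_trivial_iff[OF fp_functor_fmor_closed[OF fp[OF that(1)]] _ iso[OF that(1)]] P(1) that by (auto simp: Modules_def)
  then have "D = Ker R (coker_functor R ` P)" unfolding P(2) Ker_def by auto
  then show "definable R D" unfolding definable_def using fp by blast
qed

lemma Modules_lm: "M \<in> Modules R \<Longrightarrow> left_module R M"
  and Modules_tiny: "M \<in> Modules R \<Longrightarrow> tiny TYPE('u) (carrier (M :: ('r, 'u) module))"
  by (simp_all add: Modules_def small_iff_tiny)

lemma definable_subset: "definable R D \<Longrightarrow> D \<subseteq> Modules R"
  unfolding definable_iff by blast

text \<open>A membership test for modules on any type: it suffices that \<open>X\<close> inherits
  each system condition valid on the class, since a copy of \<open>X\<close> in the universe then
  satisfies the defining ones.\<close>

lemma definable_belongs: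
  fixes D :: "('r, 'u) module set"
  assumes D: "definable R D" and X: "left_module R X" "tiny TYPE('u) (carrier X)"
    and cond: "\<And>n m l k H F K. system_pair R n m l k H F K \<Longrightarrow> (\<And>M. M \<in> D \<Longrightarrow> pp_cond M n m l k H F K) \<Longrightarrow> pp_cond X n m l k H F K"
  shows "belongs R X D"
proof -
  obtain P where P: "P \<subseteq> fp_morphisms R" "D = {M \<in> Modules R. \<forall>p\<in>P. factors R p M}" using D unfolding definable_iff by blast
  obtain M :: "('r, 'u) module" where M: "M \<in> Modules R" "mod_iso R X M" using tiny_copy[OF X] by blast
  have "factors R p M" if p: "p \<in> P" for p
  proof -
    obtain n m l k H F K where s: "system_pair R n m l k H F K"
      "\<And>M. left_module R M \<Longrightarrow> (factors R p M \<longleftrightarrow> pp_cond M n m l k H F K)"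
      using factors_system P(1) p by blast
    have "pp_cond X n m l k H F K" using cond[OF s(1)] s(2) p by (auto simp: P(2) Modules_def)
    then have "pp_cond M n m l k H F K"
      using system_pair.cond_retract[OF s(1) Modules_lm[OF M(1)] X(1) mod_iso_retract(2)[OF X(1) M(2)]] by blast
    then show ?thesis using s(2)[OF Modules_lm[OF M(1)]] by blast
  qed
  then have "M \<in> D" using M(1) by (simp add: P(2))
  then show ?thesis using M(2) unfolding belongs_def by blast
qed

lemma definable_closed:
  fixes D :: "('r, 'u) module set"
  assumes U: "inaccessible TYPE('u)" and R: "ring R" and D: "definable R D"
  shows "closed_products R D" "closed_coproducts R D" "closed_finite_sums R D" "closed_summands R D"
proof -
  note DM = definable_subset[OF D]
  have lm: "left_module R M" if "M \<in> D" for M using DM that Modules_lm by blast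
  have tp: "tiny TYPE('u) (carrier (prod_module I F))" if "small I" "\<forall>i\<in>I. F i \<in> D" for I :: "'u set" and F
  proof -
    have "tiny TYPE('u) (carrier (F i))" if "i \<in> I" for i
      using Modules_tiny subsetD[OF DM] bspec[OF \<open>\<forall>i\<in>I. F i \<in> D\<close> that] by blast
    then show ?thesis unfolding prod_module_simps using \<open>small I\<close> by (intro tiny_PiE[OF U]) (simp_all add: small_iff_tiny)
  qed
  show "closed_products R D" unfolding closed_products_def
  proof (intro allI impI, elim conjE)
    fix I :: "'u set" and F assume I: "small I" "\<forall>i\<in>I. F i \<in> D"
    show "belongs R (prod_module I F) D"
      by (rule definable_belongs[OF D left_module_prod[OF R] tp[OF I]])
        (use I lm in \<open>auto intro!: system_pair.cond_prod\<close>)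
  qed
  have cop: "belongs R (coprod_module I F) D" if I: "small I" "\<forall>i\<in>I. F i \<in> D" for I :: "'u set" and F
  proof (rule definable_belongs[OF D left_module_coprod[OF R]])
    show "tiny TYPE('u) (carrier (coprod_module I F))"
      using tp[OF I] by (rule tiny_subset) (auto simp: coprod_carrier)
  qed (use I lm in \<open>auto intro!: system_pair.cond_coprod\<close>)
  show "closed_coproducts R D" unfolding closed_coproducts_def using cop by blast
  have "small I" if "finite I" for I :: "'u set" using tiny_finite[OF U that] by (simp add: small_iff_tiny)
  then show "closed_finite_sums R D" unfolding closed_finite_sums_def using cop by blast
  show "closed_summands R D" unfolding closed_summands_def
  proof (intro ballI impI)
    fix X Y :: "('r, 'u) module" assume X: "X \<in> Modules R" and Y: "Y \<in> Modules R" and b: "belongs R (sum_module X Y) D"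
    note s = left_module_sum[OF Modules_lm[OF X] Modules_lm[OF Y]]
    obtain M where M: "M \<in> D" "mod_iso R (sum_module X Y) M" using b unfolding belongs_def by blast
    have r: "retract R X M"
      by (rule retract_trans[OF Modules_lm[OF X] lm[OF M(1)] retract_sum[OF Modules_lm[OF X] Modules_lm[OF Y]] mod_iso_retract(1)[OF s M(2)]])
    obtain P where P: "P \<subseteq> fp_morphisms R" "D = {M \<in> Modules R. \<forall>p\<in>P. factors R p M}" using D unfolding definable_iff by blast
    have "factors R p X" if p: "p \<in> P" for p
    proof -
      obtain n m l k H F K where s: "system_pair R n m l k H F K"
        "\<And>M. left_module R M \<Longrightarrow> (factors R p M \<longleftrightarrow> pp_cond M n m l k H F K)"
        using factors_system P(1) p by blast
      have "pp_cond M n m l k H F K" using s(2)[OF lm[OF M(1)]] M(1) p by (auto simp: P(2))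
      then have "pp_cond X n m l k H F K" by (rule system_pair.cond_retract[OF s(1) Modules_lm[OF X] lm[OF M(1)] r])
      then show ?thesis using s(2)[OF Modules_lm[OF X]] by blast
    qed
    then show "X \<in> D" using X by (simp add: P(2))
  qed
qed

subsection \<open>Duality pairs\<close>

text \<open>Closure of \<open>X\<close> under its operations is obtained from the bijection with
  \<open>M\<close>; in the application \<open>X\<close> is \<open>char_module M\<close>, whose
  module laws are known through its isomorphism with \<open>cm M\<close>.\<close>

lemma mod_iso_of_common_source:
  assumes M: "left_module R M" and 1: "mod_iso R M X" and 2: "mod_iso R M Y"
  shows "mod_iso R X Y"
proof -
  interpret left_module R M by fact
  obtain h where h: "h \<in> mhom R M X" "bij_betw h (carrier M) (carrier X)" using 1 unfolding mod_iso_def by blast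
  obtain k where k: "k \<in> mhom R M Y" "bij_betw k (carrier M) (carrier Y)" using 2 unfolding mod_iso_def by blast
  obtain g where g: "g \<in> mhom R X M" "bij_betw g (carrier X) (carrier M)"
    using mod_iso_sym[OF M 1] unfolding mod_iso_def by blast
  have ex: "\<exists>a\<in>carrier M. x = h a" if "x \<in> carrier X" for x using h(2) that by (auto simp: bij_betw_def)
  have cl: "x \<oplus>\<^bsub>X\<^esub> y \<in> carrier X" if "x \<in> carrier X" "y \<in> carrier X" for x y
    using ex[OF that(1)] ex[OF that(2)] mhom_closed[OF h(1)] by (auto simp flip: mhom_add[OF h(1)])
  have sm: "r \<odot>\<^bsub>X\<^esub> x \<in> carrier X" if "r \<in> carrier R" "x \<in> carrier X" for r x
    using ex[OF that(2)] that mhom_closed[OF h(1)] by (auto simp flip: mhom_smult[OF h(1)])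
  have "compose (carrier X) k g \<in> mhom R X Y"
    by (rule mhomI) (auto simp: compose_def cl sm mhom_closed[OF g(1)] mhom_closed[OF k(1)] mhom_add[OF g(1)]
        mhom_add[OF k(1)] mhom_smult[OF g(1)] mhom_smult[OF k(1)])
  moreover have "bij_betw (compose (carrier X) k g) (carrier X) (carrier Y)"
    using bij_betw_trans[OF g(2) k(2)] by (rule bij_betw_cong[THEN iffD1, rotated]) (auto simp: compose_def)
  ultimately show ?thesis unfolding mod_iso_def by blast
qed

lemma belongs_char_iff:
  assumes "left_module R M"
  shows "belongs (opp R) (char_module M) B \<longleftrightarrow> belongs (opp R) (cm M) B"
  unfolding belongs_def
  using mod_iso_of_common_source[OF left_module_cm[OF assms] char_module_iso[OF assms]]
    mod_iso_trans[OF left_module_cm[OF assms] char_module_iso[OF assms]] by blast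

text \<open>Closure of \<open>B\<close> under summands allows the isomorphism with a member to be
  weakened to a retract of a member. Membership in \<open>A\<close> then passes along retracts of
  character modules.\<close>

lemma duality_pair_iff:
  fixes A B :: "('r, 'u) module set"
  assumes U: "inaccessible TYPE('u)" and d: "duality_pair R A B" and M: "M \<in> Modules R"
  shows "M \<in> A \<longleftrightarrow> (\<exists>N\<in>B. retract (opp R) (cm M) N)"
proof -
  note lm = Modules_lm[OF M] and lc = left_module_cm[OF Modules_lm[OF M]]
  have B: "B \<subseteq> Modules (opp R)" "closed_summands (opp R) B" using d by (auto simp: duality_pair_def)
  have "M \<in> A \<longleftrightarrow> belongs (opp R) (cm M) B"
    using d M belongs_char_iff[OF lm, of B] by (simp add: duality_pair_def)
  also have "\<dots> \<longleftrightarrow> (\<exists>N\<in>B. retract (opp R) (cm M) N)"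
  proof
    assume "belongs (opp R) (cm M) B"
    then show "\<exists>N\<in>B. retract (opp R) (cm M) N" unfolding belongs_def using mod_iso_retract(1)[OF lc] by blast
  next
    assume "\<exists>N\<in>B. retract (opp R) (cm M) N"
    then obtain N where N: "N \<in> B" "retract (opp R) (cm M) N" by blast
    obtain M' :: "('r, 'u) module" where M': "M' \<in> Modules (opp R)" "mod_iso (opp R) (cm M) M'"
      using tiny_copy[OF lc tiny_cm[OF U Modules_tiny[OF M]]] by blast
    have "N \<in> Modules (opp R)" using N B by blast
    then have "retract (opp R) M' N"
      using retract_trans[OF Modules_lm[OF M'(1)] Modules_lm mod_iso_retract(2)[OF lc M'(2)] N(2)] by blast
    then have "M' \<in> B" using closed_summands_retract[OF B(2) M'(1) \<open>N \<in> Modules (opp R)\<close> N(1)] by blast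
    then show "belongs (opp R) (cm M) B" using M'(2) unfolding belongs_def by blast
  qed
  finally show ?thesis .
qed

subsection \<open>The dual of a definable class\<close>

abbreviation vanishes where "vanishes R G M \<equiv> trivial_group (fob (extension R G) M)"

text \<open>One set of matrices governs the functor, its dual and a morphism \<open>p\<close> over
  \<open>opp R\<close> that stands for the dual. With this the functors disappear from the remaining
  arguments.\<close>

lemma functor_system:
  fixes G :: "('r, 'u, 'x) mod_functor"
  assumes U: "inaccessible TYPE('u)" and R: "tiny TYPE('u) (carrier R)" "ring R" and G: "fp_functor R G"
  shows "\<exists>n m l k H F K p. system_pair R n m l k H F K \<and> p \<in> fp_morphisms (opp R) \<and>
    (\<forall>M\<in>Modules R. vanishes R G M \<longleftrightarrow> pp_cond M n m l k H F K) \<and>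
    (\<forall>N\<in>Modules (opp R). vanishes (opp R) (AGJ R G) N \<longleftrightarrow> pp_dual N n m l k H F K) \<and>
    (\<forall>N\<in>Modules (opp R). factors (opp R) (p :: ('r, 'u) module \<times> ('r, 'u) module \<times> ('u \<Rightarrow> 'u)) N \<longleftrightarrow> pp_dual N n m l k H F K)"
proof -
  obtain A B f where p: "(A, B, f) \<in> fp_morphisms R" and iso: "functor_iso R G (coker_functor R (A, B, f))"
    using G unfolding fp_functor_def by auto
  obtain \<eta> where \<eta>: "\<eta> \<in> nat_trans R G (coker_functor R (A, B, f))"
    "\<And>X. X \<in> fp_modules R \<Longrightarrow> bij_betw (\<eta> X) (carrier (fob G X)) (carrier (fob (coker_functor R (A, B, f)) X))"
    using iso unfolding functor_iso_def by blast
  have f: "f \<in> mhom R A B" using p by (simp add: fp_morphisms_def)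
  from fp_morphism_system[OF p] obtain n m l k H F K \<alpha> \<beta> where s: "system_pair R n m l k H F K"
    "presents R A n \<alpha> m H" "presents R B l \<beta> k K" "\<forall>i<n. f (\<alpha> i) = lin B l (F i) \<beta>" by blast
  interpret S: system_pair R n m l k H F K by (rule s(1))
  from S.dual_morphism[OF U R(1)] obtain A' B' :: "('r, 'u) module" and f' \<alpha>' where
    p': "(A', B', f') \<in> fp_morphisms (opp R)" "presents (opp R) A' (n + k) \<alpha>' l S.H'"
    "\<And>N g. N \<in> Modules (opp R) \<Longrightarrow> g \<in> mhom (opp R) A' N \<Longrightarrow> g \<in> hom_image (opp R) (A', B', f') N \<longleftrightarrow>
       (\<exists>w. vec N m w \<and> (\<forall>i<n. g (\<alpha>' i) = act N m (tr H) w i))" by blast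
  have "agj_setup R n m l k H F K A B f \<alpha> \<beta> A' B' f' \<alpha>' G \<eta>"
    by (intro agj_setup.intro agj_setup_axioms.intro s p G \<eta> p') (use s(4) in auto)
  then interpret D: agj_setup R n m l k H F K A B f \<alpha> \<beta> A' B' f' \<alpha>' G \<eta> .
  have 1: "vanishes R G M \<longleftrightarrow> pp_cond M n m l k H F K" if "M \<in> Modules R" for M
    using extension_trivial_iff[OF fp_functor_fmor_closed[OF G] p iso Modules_lm[OF that]]
      factors_iff_cond[OF s f Modules_lm[OF that]] by simp
  have 2: "factors (opp R) (A', B', f') N \<longleftrightarrow> pp_dual N n m l k H F K" if "N \<in> Modules (opp R)" for N
    by (rule S.factors_iff_dual[OF p'(2) Modules_lm[OF that] p'(3)[OF that]])
  have 3: "vanishes (opp R) (AGJ R G) N \<longleftrightarrow> pp_dual N n m l k H F K" if "N \<in> Modules (opp R)" for N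
    using extension_trivial_iff[OF AGJ_fmor_closed[OF G] p'(1) D.AGJ_iso Modules_lm[OF that]] 2[OF that] by simp
  show ?thesis using s(1) p'(1) 1 2 3 by (intro exI conjI ballI)
qed

lemma dual_class_eq: "dual_class R D = {N \<in> Modules (opp R). \<forall>G\<in>vanishing_functors R D. vanishes (opp R) (AGJ R G) N}"
  by (auto simp: dual_class_def Ker_def)

text \<open>A Galois correspondence: any defining set is contained in the set of all functors
  vanishing on the class, and enlarging to that set removes no module.\<close>

lemma definable_vanishing:
  fixes D :: "('r, 'u) module set"
  assumes "definable R D"
  shows "D = {M \<in> Modules R. \<forall>G\<in>vanishing_functors R D. vanishes R G M}"
proof -
  obtain S :: "('r, 'u, ('u \<Rightarrow> 'u) set) mod_functor set" where S: "\<forall>G\<in>S. fp_functor R G" "D = Ker R S"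
    using assms unfolding definable_def by blast
  have "S \<subseteq> vanishing_functors R D" using S by (auto simp: vanishing_functors_def Ker_def)
  then show ?thesis using S(2) by (auto simp: vanishing_functors_def Ker_def)
qed

context
  fixes R :: "'r ring"
  assumes univ: "inaccessible TYPE('u)" and R: "ring R" and tiny_R: "tiny TYPE('u) (carrier R)"
begin

text \<open>The dual functors take values in another type than \<open>definable\<close> asks for, so
  they are replaced by the morphisms of \<open>functor_system\<close>.\<close>

lemma definable_dual_class: "definable (opp R) (dual_class R (D :: ('r, 'u) module set))"
proof -
  have "\<forall>G\<in>vanishing_functors R D. \<exists>p\<in>fp_morphisms (opp R). \<forall>N\<in>Modules (opp R).
      vanishes (opp R) (AGJ R G) N \<longleftrightarrow> factors (opp R) p N"
  proof
    fix G assume "G \<in> vanishing_functors R D"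
    then have "fp_functor R G" by (simp add: vanishing_functors_def)
    from functor_system[OF univ tiny_R R this]
    show "\<exists>p\<in>fp_morphisms (opp R). \<forall>N\<in>Modules (opp R). vanishes (opp R) (AGJ R G) N \<longleftrightarrow> factors (opp R) p N"
      by (elim exE conjE) (rule bexI, auto)
  qed
  then obtain p where p: "\<forall>G\<in>vanishing_functors R D. p G \<in> fp_morphisms (opp R) \<and> (\<forall>N\<in>Modules (opp R).
      vanishes (opp R) (AGJ R G) N \<longleftrightarrow> factors (opp R) (p G) N)" by metis
  then have "dual_class R D = {N \<in> Modules (opp R). \<forall>q\<in>p ` vanishing_functors R D. factors (opp R) q N}"
    unfolding dual_class_eq by auto
  then show ?thesis unfolding definable_iff using p by (intro exI[of _ "p ` vanishing_functors R D"]) blast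
qed

lemma cm_copy:
  fixes M :: "('r, 'u) module"
  assumes "M \<in> Modules R"
  obtains N :: "('r, 'u) module" where "N \<in> Modules (opp R)" "mod_iso (opp R) (cm M) N"
  using tiny_copy[OF left_module_cm[OF Modules_lm[OF assms]] tiny_cm[OF univ Modules_tiny[OF assms]]] by blast

text \<open>Each functor is handled separately through its matrices; \<open>M\<close> and
  \<open>N\<close> are arbitrary copies in the universe of the respective character modules, to
  which the conditions pass along the retracts of an isomorphism.\<close>

lemma definable_duality:
  fixes D :: "('r, 'u) module set"
  assumes D: "definable R D" and M: "M \<in> Modules R" and N: "N \<in> Modules (opp R)"
  shows "mod_iso (opp R) (cm M) N \<Longrightarrow> M \<in> D \<longleftrightarrow> N \<in> dual_class R D"
    and "mod_iso R (cm N) M \<Longrightarrow> N \<in> dual_class R D \<longleftrightarrow> M \<in> D"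
proof -
  note lM = Modules_lm[OF M] and lN = Modules_lm[OF N]
  note cM = left_module_cm[OF lM] and cN = left_module_cm[OF lN, simplified]
  have sys: "(mod_iso (opp R) (cm M) N \<longrightarrow> (vanishes R G M \<longleftrightarrow> vanishes (opp R) (AGJ R G) N)) \<and>
      (mod_iso R (cm N) M \<longrightarrow> (vanishes R G M \<longleftrightarrow> vanishes (opp R) (AGJ R G) N))"
    if "G \<in> vanishing_functors R D" for G
  proof -
    have "fp_functor R G" using that by (simp add: vanishing_functors_def)
    from functor_system[OF univ tiny_R R this] obtain n m l k H F K where s: "system_pair R n m l k H F K"
      "\<And>M. M \<in> Modules R \<Longrightarrow> vanishes R G M \<longleftrightarrow> pp_cond M n m l k H F K"
      "\<And>N. N \<in> Modules (opp R) \<Longrightarrow> vanishes (opp R) (AGJ R G) N \<longleftrightarrow> pp_dual N n m l k H F K" by blast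
    interpret system_pair R n m l k H F K by (rule s(1))
    have "dual (cm M) \<longleftrightarrow> dual N" if "mod_iso (opp R) (cm M) N"
      using dual_retract[OF cM lN mod_iso_retract(1)[OF cM that]] dual_retract[OF lN cM mod_iso_retract(2)[OF cM that]] by blast
    moreover have "cond (cm N) \<longleftrightarrow> cond M" if "mod_iso R (cm N) M"
      using cond_retract[OF cN lM mod_iso_retract(1)[OF cN that]] cond_retract[OF lM cN mod_iso_retract(2)[OF cN that]] by blast
    ultimately show ?thesis
      using s(2)[OF M] s(3)[OF N] cond_iff_dual_cm[OF lM] dual_iff_cond_cm[OF lN] by blast
  qed
  have MD: "M \<in> D \<longleftrightarrow> (\<forall>G\<in>vanishing_functors R D. vanishes R G M)"
    using definable_vanishing[OF D] M by auto
  have ND: "N \<in> dual_class R D \<longleftrightarrow> (\<forall>G\<in>vanishing_functors R D. vanishes (opp R) (AGJ R G) N)"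
    using N by (simp add: dual_class_eq)
  show "mod_iso (opp R) (cm M) N \<Longrightarrow> M \<in> D \<longleftrightarrow> N \<in> dual_class R D"
    and "mod_iso R (cm N) M \<Longrightarrow> N \<in> dual_class R D \<longleftrightarrow> M \<in> D"
    unfolding MD ND using sys by blast+
qed

end

theorem definable_symmetric_duality_pair:
  fixes D :: "('r, 'u) module set"
  assumes U: "inaccessible TYPE('u)" and R: "ring R" "tiny TYPE('u) (carrier R)" and D: "definable R D"
  shows "symmetric_duality_pair R D (dual_class R D)"
proof -
  note oR = ring_opp[OF R(1)] and dD = definable_dual_class[OF U R]
  have tR: "tiny TYPE('u) (carrier (opp R))" using R(2) by simp
  note dual = definable_duality[OF U R D]
  have D': "dual_class R D \<subseteq> Modules (opp R)" by (rule definable_subset[OF dD])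
  have "M \<in> D \<longleftrightarrow> belongs (opp R) (char_module M) (dual_class R D)" if M: "M \<in> Modules R" for M
    unfolding belongs_char_iff[OF Modules_lm[OF M]]
  proof
    assume "M \<in> D"
    obtain N :: "('r, 'u) module" where N: "N \<in> Modules (opp R)" "mod_iso (opp R) (cm M) N" by (rule cm_copy[OF U R M])
    then show "belongs (opp R) (cm M) (dual_class R D)" using dual(1)[OF M N] \<open>M \<in> D\<close> unfolding belongs_def by blast
  next
    assume "belongs (opp R) (cm M) (dual_class R D)"
    then show "M \<in> D" using dual(1)[OF M] D' unfolding belongs_def by blast
  qed
  moreover have "N \<in> dual_class R D \<longleftrightarrow> belongs (opp (opp R)) (char_module N) D" if N: "N \<in> Modules (opp R)" for N
    unfolding belongs_char_iff[OF Modules_lm[OF N]]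
  proof
    assume "N \<in> dual_class R D"
    obtain M :: "('r, 'u) module" where M: "M \<in> Modules (opp (opp R))" "mod_iso (opp (opp R)) (cm N) M"
      by (rule cm_copy[OF U oR tR N])
    then show "belongs (opp (opp R)) (cm N) D" using dual(2)[OF _ N, of M] \<open>N \<in> dual_class R D\<close> unfolding belongs_def by auto
  next
    assume "belongs (opp (opp R)) (cm N) D"
    then show "N \<in> dual_class R D" using dual(2)[OF _ N] definable_subset[OF D] unfolding belongs_def by auto
  qed
  ultimately show ?thesis
    unfolding symmetric_duality_pair_def duality_pair_def
    using definable_closed[OF U R(1) D] definable_closed[OF U oR dD] definable_subset[OF D] D' by simp
qed

subsection \<open>Splitting maps of character modules\<close>

text \<open>A linear equation \<open>\<sigma> (r x + y) = r \<sigma> x + \<sigma> y\<close> is recorded by its triple \<open>(r, x, y)\<close>; a map is linear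
  if it respects all triples.\<close>

definition triples :: "'r ring \<Rightarrow> ('r, 'a) module \<Rightarrow> ('r \<times> 'a \<times> 'a) set" where
  "triples R X = carrier R \<times> carrier X \<times> carrier X"

definition respects_on :: "('r \<times> 'a \<times> 'a) set \<Rightarrow> ('r, 'a) module \<Rightarrow> ('r, 'b) module \<Rightarrow> ('a \<Rightarrow> 'b) \<Rightarrow> bool" where
  "respects_on E X Y \<sigma> \<longleftrightarrow> \<sigma> \<in> carrier X \<rightarrow> carrier Y \<and>
     (\<forall>(r, x, y)\<in>E. \<sigma> (r \<odot>\<^bsub>X\<^esub> x \<oplus>\<^bsub>X\<^esub> y) = r \<odot>\<^bsub>Y\<^esub> \<sigma> x \<oplus>\<^bsub>Y\<^esub> \<sigma> y)"

text \<open>A homomorphism from \<open>C\<close> to the characters of \<open>P\<close> is a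
  biadditive balanced function into Q/Z: a system with one unknown for every pair of elements, and
  \<open>V\<close> prescribes some of them. By compactness local solutions suffice, which have to be
  linear in \<open>P\<close> at finitely many triples.\<close>

lemma hom_to_cm_exists:
  fixes C :: "('r, 'c) module" and P :: "('r, 'p) module"
  assumes C: "left_module (opp R) C" and P: "left_module R P" and V: "V \<subseteq> carrier C \<times> carrier P \<times> UNIV"
    and local: "\<And>E V'. finite E \<Longrightarrow> E \<subseteq> triples R P \<Longrightarrow> finite V' \<Longrightarrow> V' \<subseteq> V \<Longrightarrow>
      \<exists>\<beta>. (\<forall>\<chi>\<in>carrier C. \<forall>\<chi>'\<in>carrier C. \<forall>p\<in>carrier P. \<beta> (\<chi> \<oplus>\<^bsub>C\<^esub> \<chi>') p = \<beta> \<chi> p + \<beta> \<chi>' p) \<and>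
        (\<forall>(r, p, p')\<in>E. \<forall>\<chi>\<in>carrier C. \<beta> \<chi> (r \<odot>\<^bsub>P\<^esub> p \<oplus>\<^bsub>P\<^esub> p') = \<beta> (r \<odot>\<^bsub>C\<^esub> \<chi>) p + \<beta> \<chi> p') \<and>
        (\<forall>(\<chi>, p, q)\<in>V'. \<beta> \<chi> p = (q :: qz))"
  shows "\<exists>h\<in>mhom (opp R) C (cm P). \<forall>(\<chi>, p, q)\<in>V. h \<chi> p = q"
proof -
  interpret C: left_module "opp R" C by fact
  interpret P: left_module R P by fact
  \<comment> \<open>\<open>e\<close> encodes additivity in the first argument. \<open>g\<close>
    encodes, in one equation, additivity in the second argument together with balancedness, in the
    shape of a triple.\<close>
  define e where "e = (\<lambda>(\<chi>, \<chi>', p). ((\<chi>, p), (\<chi>', p), (\<chi> \<oplus>\<^bsub>C\<^esub> \<chi>', p :: 'p)))"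
  define g where "g = (\<lambda>(\<chi>, r, p, p'). ((r \<odot>\<^bsub>C\<^esub> \<chi>, p), (\<chi>, p'), (\<chi>, r \<odot>\<^bsub>P\<^esub> p \<oplus>\<^bsub>P\<^esub> p')))"
  define v where "v = (\<lambda>(\<chi> :: 'c, p :: 'p, q :: qz). ((\<chi>, p), q))"
  let ?E = "e ` (carrier C \<times> carrier C \<times> carrier P)" and ?G = "g ` (carrier C \<times> triples R P)"
  have "\<exists>x. (\<forall>(i, j, k)\<in>?E \<union> ?G. x k = x i + x j) \<and> (\<forall>(i, q)\<in>v ` V. x i = q)"
  proof (rule qz_compact)
    fix F1 F2 assume F: "finite F1" "F1 \<subseteq> ?E \<union> ?G" "finite F2" "F2 \<subseteq> v ` V"
    \<comment> \<open>The equations from \<open>g\<close> and the prescribed values are cut down to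
      finite sets, while local solutions satisfy all the equations from \<open>e\<close>.\<close>
    obtain W where W: "finite W" "W \<subseteq> carrier C \<times> triples R P" "F1 \<inter> ?G = g ` W"
      using finite_subset_image[of "F1 \<inter> ?G" g "carrier C \<times> triples R P"] F(1) by auto
    obtain V' where V': "finite V'" "V' \<subseteq> V" "F2 = v ` V'" using finite_subset_image[OF F(3,4)] by auto
    have "finite (snd ` W)" "snd ` W \<subseteq> triples R P" using W by auto
    from local[OF this V'(1,2)] obtain \<beta> where
      \<beta>1: "\<forall>\<chi>\<in>carrier C. \<forall>\<chi>'\<in>carrier C. \<forall>p\<in>carrier P. \<beta> (\<chi> \<oplus>\<^bsub>C\<^esub> \<chi>') p = \<beta> \<chi> p + \<beta> \<chi>' p"
      and \<beta>2: "\<forall>(r, p, p')\<in>snd ` W. \<forall>\<chi>\<in>carrier C. \<beta> \<chi> (r \<odot>\<^bsub>P\<^esub> p \<oplus>\<^bsub>P\<^esub> p') = \<beta> (r \<odot>\<^bsub>C\<^esub> \<chi>) p + \<beta> \<chi> p'"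
      and \<beta>3: "\<forall>(\<chi>, p, q)\<in>V'. \<beta> \<chi> p = q" by (elim exE conjE)
    have "\<forall>(i, j, k)\<in>F1. case_prod \<beta> k = case_prod \<beta> i + case_prod \<beta> j"
    proof
      fix c assume c: "c \<in> F1"
      show "case c of (i, j, k) \<Rightarrow> case_prod \<beta> k = case_prod \<beta> i + case_prod \<beta> j"
      proof (cases "c \<in> ?G")
        case True
        then have "c \<in> g ` W" using c W(3) by blast
        then obtain \<chi> r p p' where w: "(\<chi>, r, p, p') \<in> W" "c = g (\<chi>, r, p, p')" by auto
        have "(r, p, p') \<in> snd ` W" using w(1) by force
        from bspec[OF \<beta>2 this] have "\<beta> \<chi> (r \<odot>\<^bsub>P\<^esub> p \<oplus>\<^bsub>P\<^esub> p') = \<beta> (r \<odot>\<^bsub>C\<^esub> \<chi>) p + \<beta> \<chi> p'" using w(1) W(2) by auto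
        then show ?thesis by (simp add: w(2) g_def)
      next
        case False
        then obtain \<chi> \<chi>' p where w: "\<chi> \<in> carrier C" "\<chi>' \<in> carrier C" "p \<in> carrier P" "c = e (\<chi>, \<chi>', p)" using c F(2) by auto
        then show ?thesis using \<beta>1 by (simp add: e_def)
      qed
    qed
    moreover have "\<forall>(i, q)\<in>F2. case_prod \<beta> i = q" using \<beta>3 unfolding V'(3) v_def by auto
    ultimately show "\<exists>x. (\<forall>(i, j, k)\<in>F1. x k = x i + x j) \<and> (\<forall>(i, q)\<in>F2. x i = q)" by (intro exI[of _ "case_prod \<beta>"]) blast
  qed
  then obtain x where x: "\<forall>(i, j, k)\<in>?E \<union> ?G. x k = x i + x j" "\<forall>(i, q)\<in>v ` V. x i = q" by blast
  have x1: "x (\<chi> \<oplus>\<^bsub>C\<^esub> \<chi>', p) = x (\<chi>, p) + x (\<chi>', p)" if "\<chi> \<in> carrier C" "\<chi>' \<in> carrier C" "p \<in> carrier P" for \<chi> \<chi>' p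
  proof -
    have "e (\<chi>, \<chi>', p) \<in> ?E \<union> ?G" using that by blast
    from bspec[OF x(1) this] show ?thesis by (simp add: e_def)
  qed
  have x2: "x (\<chi>, r \<odot>\<^bsub>P\<^esub> p \<oplus>\<^bsub>P\<^esub> p') = x (r \<odot>\<^bsub>C\<^esub> \<chi>, p) + x (\<chi>, p')"
    if "\<chi> \<in> carrier C" "r \<in> carrier R" "p \<in> carrier P" "p' \<in> carrier P" for \<chi> r p p'
  proof -
    have "g (\<chi>, r, p, p') \<in> ?E \<union> ?G" using that by (intro UnI2 imageI) (simp add: triples_def)
    from bspec[OF x(1) this] show ?thesis by (simp add: g_def)
  qed
  \<comment> \<open>The scalar 1 isolates additivity in the second argument; below, the second
    summand zero isolates balancedness.\<close>
  have x3: "x (\<chi>, p \<oplus>\<^bsub>P\<^esub> p') = x (\<chi>, p) + x (\<chi>, p')" if "\<chi> \<in> carrier C" "p \<in> carrier P" "p' \<in> carrier P" for \<chi> p p'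
    using x2[OF that(1) P.R.one_closed that(2,3)] that C.smult_one[OF that(1)] by (simp add: P.smult_one)
  have x0: "x (\<chi>, \<zero>\<^bsub>P\<^esub>) = 0" if "\<chi> \<in> carrier C" for \<chi> using x3[OF that P.M.zero_closed P.M.zero_closed] by simp
  have x4: "x (r \<odot>\<^bsub>C\<^esub> \<chi>, p) = x (\<chi>, r \<odot>\<^bsub>P\<^esub> p)" if "\<chi> \<in> carrier C" "r \<in> carrier R" "p \<in> carrier P" for \<chi> r p
    using x2[OF that P.M.zero_closed] x0[OF that(1)] that by simp
  show ?thesis
  proof (rule bexI)
    let ?h = "\<lambda>\<chi>\<in>carrier C. \<lambda>p\<in>carrier P. x (\<chi>, p)"
    show "?h \<in> mhom (opp R) C (cm P)"
      by (rule mhomI) (auto simp: cm_carrier x1 x3 x4 fun_eq_iff)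
    show "\<forall>(\<chi>, p, q)\<in>V. ?h \<chi> p = q"
    proof
      fix c assume c: "c \<in> V"
      obtain \<chi> p q where cc: "c = (\<chi>, p, q)" by (cases c)
      have "v c \<in> v ` V" using c by blast
      from bspec[OF x(2) this] show "case c of (\<chi>, p, q) \<Rightarrow> ?h \<chi> p = q" using c V by (auto simp: v_def cc)
    qed
  qed
qed

text \<open>Up to finitely many equations, \<open>X\<close> is a retract of \<open>P\<close>, where the embedding \<open>b D\<close> may depend on the finite set
  of equations that it has to respect. Both maps below come from the algebraic compactness of \<open>\<rat>/\<int>\<close>.\<close>

lemma retract_cm_of_local_splitting:
  fixes X :: "('r, 'a) module" and P :: "('r, 'p) module" and b :: "('r \<times> 'a \<times> 'a) set \<Rightarrow> 'a \<Rightarrow> 'p"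
  assumes X: "left_module R X" and P: "left_module R P"
    and b: "\<And>D. finite D \<Longrightarrow> D \<subseteq> triples R X \<Longrightarrow> respects_on D X P (b D)"
    and split: "\<And>E Q. finite E \<Longrightarrow> E \<subseteq> triples R P \<Longrightarrow> finite Q \<Longrightarrow>
      (\<And>D a. (D, a) \<in> Q \<Longrightarrow> finite D \<and> D \<subseteq> triples R X \<and> a \<in> carrier X) \<Longrightarrow>
      \<exists>\<sigma>. respects_on E P X \<sigma> \<and> (\<forall>(D, a)\<in>Q. \<sigma> (b D a) = a)"
  shows "retract (opp R) (cm X) (cm P)"
proof -
  interpret X: left_module R X by fact
  interpret P: left_module R P by fact
  interpret CX: left_module "opp R" "cm X" by (rule left_module_cm[OF X])
  interpret CP: left_module "opp R" "cm P" by (rule left_module_cm[OF P])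
  have bc: "b D a \<in> carrier P" if "finite D" "D \<subseteq> triples R X" "a \<in> carrier X" for D a
    using b[OF that(1,2)] that(3) unfolding respects_on_def by blast
  let ?Q = "{(D, a). finite D \<and> D \<subseteq> triples R X \<and> a \<in> carrier X}"
  \<comment> \<open>The section \<open>s\<close> must give \<open>s \<chi>\<close> the value
    \<open>\<chi> a\<close> at \<open>b D a\<close> for all finite \<open>D\<close> simultaneously,
    since the retraction built afterwards meets a different \<open>D\<close> in each finite
    subsystem.\<close>
  define v where "v = (\<lambda>(\<chi> :: 'a \<Rightarrow> qz, D, a). (\<chi>, b D a, \<chi> a))"
  have "\<exists>h\<in>mhom (opp R) (cm X) (cm P). \<forall>(\<chi>, p, q)\<in>v ` (carrier (cm X) \<times> ?Q). h \<chi> p = q"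
  proof (rule hom_to_cm_exists[OF CX.left_module_axioms P])
    show "v ` (carrier (cm X) \<times> ?Q) \<subseteq> carrier (cm X) \<times> carrier P \<times> UNIV" using bc by (auto simp: v_def)
    fix E V' assume E: "finite E" "E \<subseteq> triples R P" and V': "finite V'" "V' \<subseteq> v ` (carrier (cm X) \<times> ?Q)"
    obtain W where W: "finite W" "W \<subseteq> carrier (cm X) \<times> ?Q" "V' = v ` W" using finite_subset_image[OF V'] by auto
    have "\<exists>\<sigma>. respects_on E P X \<sigma> \<and> (\<forall>(D, a)\<in>snd ` W. \<sigma> (b D a) = a)"
      by (rule split[OF E]) (use W in auto)
    then obtain \<sigma> where \<sigma>: "respects_on E P X \<sigma>" "\<forall>(D, a)\<in>snd ` W. \<sigma> (b D a) = a" by blast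
    have \<sigma>c: "\<sigma> p \<in> carrier X" if "p \<in> carrier P" for p using \<sigma>(1) that unfolding respects_on_def by blast
    show "\<exists>\<beta>. (\<forall>\<chi>\<in>carrier (cm X). \<forall>\<chi>'\<in>carrier (cm X). \<forall>p\<in>carrier P. \<beta> (\<chi> \<oplus>\<^bsub>cm X\<^esub> \<chi>') p = \<beta> \<chi> p + \<beta> \<chi>' p) \<and>
        (\<forall>(r, p, p')\<in>E. \<forall>\<chi>\<in>carrier (cm X). \<beta> \<chi> (r \<odot>\<^bsub>P\<^esub> p \<oplus>\<^bsub>P\<^esub> p') = \<beta> (r \<odot>\<^bsub>cm X\<^esub> \<chi>) p + \<beta> \<chi> p') \<and>
        (\<forall>(\<chi>, p, q)\<in>V'. \<beta> \<chi> p = q)"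
    \<comment> \<open>Composing characters with an approximate retraction is additive in the
      character and linear in \<open>p\<close> at the triples of \<open>E\<close>.\<close>
    proof (intro exI[of _ "\<lambda>\<chi> p. \<chi> (\<sigma> p)"] conjI ballI)
      show "(\<chi> \<oplus>\<^bsub>cm X\<^esub> \<chi>') (\<sigma> p) = \<chi> (\<sigma> p) + \<chi>' (\<sigma> p)" if "p \<in> carrier P" for \<chi> \<chi>' p using \<sigma>c[OF that] by simp
      show "case t of (r, p, p') \<Rightarrow> \<forall>\<chi>\<in>carrier (cm X). \<chi> (\<sigma> (r \<odot>\<^bsub>P\<^esub> p \<oplus>\<^bsub>P\<^esub> p')) = (r \<odot>\<^bsub>cm X\<^esub> \<chi>) (\<sigma> p) + \<chi> (\<sigma> p')"
        if t: "t \<in> E" for t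
      proof -
        obtain r p p' where tt: "t = (r, p, p')" by (cases t)
        have c: "r \<in> carrier R" "p \<in> carrier P" "p' \<in> carrier P" using t E(2) tt by (auto simp: triples_def)
        have "\<sigma> (r \<odot>\<^bsub>P\<^esub> p \<oplus>\<^bsub>P\<^esub> p') = r \<odot>\<^bsub>X\<^esub> \<sigma> p \<oplus>\<^bsub>X\<^esub> \<sigma> p'" using \<sigma>(1) t tt unfolding respects_on_def by auto
        then show ?thesis using c \<sigma>c by (simp add: tt cm_add)
      qed
      show "case c of (\<chi>, p, q) \<Rightarrow> \<chi> (\<sigma> p) = q" if c: "c \<in> V'" for c
      proof -
        obtain \<chi> D a where w: "(\<chi>, D, a) \<in> W" "c = v (\<chi>, D, a)" using c unfolding W(3) by auto
        have "(D, a) \<in> snd ` W" using w(1) by force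
        from bspec[OF \<sigma>(2) this] show ?thesis by (simp add: w(2) v_def)
      qed
    qed
  qed
  then obtain s where s: "s \<in> mhom (opp R) (cm X) (cm P)" "\<forall>(\<chi>, p, q)\<in>v ` (carrier (cm X) \<times> ?Q). s \<chi> p = q" by blast
  have sb: "s \<chi> (b D a) = \<chi> a" if "\<chi> \<in> carrier (cm X)" "finite D" "D \<subseteq> triples R X" "a \<in> carrier X" for \<chi> D a
  proof -
    have "v (\<chi>, D, a) \<in> v ` (carrier (cm X) \<times> ?Q)" using that by blast
    from bspec[OF s(2) this] show ?thesis by (simp add: v_def)
  qed
  \<comment> \<open>The retraction is prescribed on the image of \<open>s\<close>. Locally it is
    composition with \<open>b D\<close>, which has the prescribed values there by
    \<open>sb\<close>.\<close>
  let ?V = "(\<lambda>(\<chi>, a). (s \<chi>, a, \<chi> a)) ` (carrier (cm X) \<times> carrier X)"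
  have "\<exists>h\<in>mhom (opp R) (cm P) (cm X). \<forall>(\<theta>, a, q)\<in>?V. h \<theta> a = q"
  proof (rule hom_to_cm_exists[OF CP.left_module_axioms X])
    show "?V \<subseteq> carrier (cm P) \<times> carrier X \<times> UNIV" using mhom_closed[OF s(1)] by auto
    fix D V' assume D: "finite D" "D \<subseteq> triples R X" and V': "finite V'" "V' \<subseteq> ?V"
    show "\<exists>\<beta>. (\<forall>\<chi>\<in>carrier (cm P). \<forall>\<chi>'\<in>carrier (cm P). \<forall>p\<in>carrier X. \<beta> (\<chi> \<oplus>\<^bsub>cm P\<^esub> \<chi>') p = \<beta> \<chi> p + \<beta> \<chi>' p) \<and>
        (\<forall>(r, p, p')\<in>D. \<forall>\<chi>\<in>carrier (cm P). \<beta> \<chi> (r \<odot>\<^bsub>X\<^esub> p \<oplus>\<^bsub>X\<^esub> p') = \<beta> (r \<odot>\<^bsub>cm P\<^esub> \<chi>) p + \<beta> \<chi> p') \<and>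
        (\<forall>(\<chi>, p, q)\<in>V'. \<beta> \<chi> p = q)"
    proof (intro exI[of _ "\<lambda>\<theta> a. \<theta> (b D a)"] conjI ballI)
      show "(\<chi> \<oplus>\<^bsub>cm P\<^esub> \<chi>') (b D a) = \<chi> (b D a) + \<chi>' (b D a)" if "a \<in> carrier X" for \<chi> \<chi>' a using bc[OF D that] by simp
      show "case t of (r, p, p') \<Rightarrow> \<forall>\<chi>\<in>carrier (cm P). \<chi> (b D (r \<odot>\<^bsub>X\<^esub> p \<oplus>\<^bsub>X\<^esub> p')) = (r \<odot>\<^bsub>cm P\<^esub> \<chi>) (b D p) + \<chi> (b D p')"
        if t: "t \<in> D" for t
      proof -
        obtain r p p' where tt: "t = (r, p, p')" by (cases t)
        have c: "r \<in> carrier R" "p \<in> carrier X" "p' \<in> carrier X" using t D(2) tt by (auto simp: triples_def)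
        have "b D (r \<odot>\<^bsub>X\<^esub> p \<oplus>\<^bsub>X\<^esub> p') = r \<odot>\<^bsub>P\<^esub> b D p \<oplus>\<^bsub>P\<^esub> b D p'" using b[OF D] t tt unfolding respects_on_def by auto
        then show ?thesis using c bc[OF D] by (simp add: tt cm_add)
      qed
      show "case c of (\<theta>, a, q) \<Rightarrow> \<theta> (b D a) = q" if "c \<in> V'" for c
        using that V'(2) sb[OF _ D] by auto
    qed
  qed
  then obtain r where r: "r \<in> mhom (opp R) (cm P) (cm X)" "\<forall>(\<theta>, a, q)\<in>?V. r \<theta> a = q" by blast
  have "r (s \<chi>) = \<chi>" if \<chi>: "\<chi> \<in> carrier (cm X)" for \<chi>
  proof (rule cm_eqI[OF mhom_closed[OF r(1) mhom_closed[OF s(1) \<chi>]] \<chi>])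
    fix a assume a: "a \<in> carrier X"
    have "(s \<chi>, a, \<chi> a) \<in> ?V" using \<chi> a by force
    from bspec[OF r(2) this] show "r (s \<chi>) a = \<chi> a" by simp
  qed
  then show ?thesis unfolding retract_def using s(1) r(1) by blast
qed

subsection \<open>Definability from closure properties\<close>

text \<open>The coefficients of \<open>r y_i + y_j - y_k\<close>, the shape that linearity of a map
  at a triple takes in terms of its values. The contributions are added, not distinguished by cases,
  because indices may coincide.\<close>

definition quad_row :: "'r ring \<Rightarrow> 'r \<times> nat \<times> nat \<times> nat \<Rightarrow> nat \<Rightarrow> 'r" where
  "quad_row R = (\<lambda>(r, i, j, k) v. (if v = i then r else \<zero>\<^bsub>R\<^esub>) \<oplus>\<^bsub>R\<^esub>
     ((if v = j then \<one>\<^bsub>R\<^esub> else \<zero>\<^bsub>R\<^esub>) \<oplus>\<^bsub>R\<^esub> (if v = k then \<ominus>\<^bsub>R\<^esub> \<one>\<^bsub>R\<^esub> else \<zero>\<^bsub>R\<^esub>)))"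

definition quad_sat :: "('r, 'a) module \<Rightarrow> (nat \<Rightarrow> 'a) \<Rightarrow> 'r \<times> nat \<times> nat \<times> nat \<Rightarrow> bool" where
  "quad_sat M y = (\<lambda>(r, i, j, k). y k = r \<odot>\<^bsub>M\<^esub> y i \<oplus>\<^bsub>M\<^esub> y j)"

definition quads :: "'r ring \<Rightarrow> nat \<Rightarrow> ('r \<times> nat \<times> nat \<times> nat) set" where
  "quads R N = carrier R \<times> {..<N} \<times> {..<N} \<times> {..<N}"

context left_module
begin

lemma lin_delta: "r \<in> carrier R \<Longrightarrow> vec M n x \<Longrightarrow> i < n \<Longrightarrow> lin M n (\<lambda>v. if v = i then r else \<zero>\<^bsub>R\<^esub>) x = r \<odot>\<^bsub>M\<^esub> x i"
proof -
  assume r: "r \<in> carrier R" and x: "vec M n x" and i: "i < n"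
  have "lin M n (\<lambda>v. if v = i then r else \<zero>\<^bsub>R\<^esub>) x = msum M (\<lambda>j. if j = i then r \<odot>\<^bsub>M\<^esub> x i else \<zero>\<^bsub>M\<^esub>) n"
    unfolding lin_def using x by (intro msum_cong) (auto simp: vec_def)
  also have "\<dots> = r \<odot>\<^bsub>M\<^esub> x i" using x r i by (intro M.msum_delta) (auto simp: vec_def)
  finally show ?thesis .
qed

lemma coeffs_quad_row: "q \<in> quads R n \<Longrightarrow> coeffs R n (quad_row R q)"
  by (auto simp: quads_def quad_row_def coeffs_def)

lemma lin_quad_row:
  assumes q: "q \<in> quads R n" and y: "vec M n y"
  shows "lin M n (quad_row R q) y = \<zero>\<^bsub>M\<^esub> \<longleftrightarrow> quad_sat M y q"
proof -
  obtain r i j k where qq: "q = (r, i, j, k)" by (cases q)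
  have r: "r \<in> carrier R" and ijk: "i < n" "j < n" "k < n" using q by (auto simp: qq quads_def)
  have m: "y i \<in> carrier M" "y j \<in> carrier M" "y k \<in> carrier M" using y ijk by (auto simp: vec_def)
  let ?\<delta> = "\<lambda>r i v. if v = i then r else \<zero>\<^bsub>R\<^esub>"
  have c: "coeffs R n (?\<delta> r i)" "coeffs R n (?\<delta> \<one>\<^bsub>R\<^esub> j)" "coeffs R n (?\<delta> (\<ominus>\<^bsub>R\<^esub> \<one>\<^bsub>R\<^esub>) k)"
    using r by (auto simp: coeffs_def)
  have c2: "coeffs R n (\<lambda>v. ?\<delta> \<one>\<^bsub>R\<^esub> j v \<oplus>\<^bsub>R\<^esub> ?\<delta> (\<ominus>\<^bsub>R\<^esub> \<one>\<^bsub>R\<^esub>) k v)" by (auto simp: coeffs_def)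
  have "lin M n (quad_row R q) y = lin M n (\<lambda>v. ?\<delta> r i v \<oplus>\<^bsub>R\<^esub> (?\<delta> \<one>\<^bsub>R\<^esub> j v \<oplus>\<^bsub>R\<^esub> ?\<delta> (\<ominus>\<^bsub>R\<^esub> \<one>\<^bsub>R\<^esub>) k v)) y"
    by (simp add: quad_row_def qq)
  also have "\<dots> = lin M n (?\<delta> r i) y \<oplus>\<^bsub>M\<^esub> (lin M n (?\<delta> \<one>\<^bsub>R\<^esub> j) y \<oplus>\<^bsub>M\<^esub> lin M n (?\<delta> (\<ominus>\<^bsub>R\<^esub> \<one>\<^bsub>R\<^esub>) k) y)"
    by (simp only: lin_add[OF c(1) c2 y] lin_add[OF c(2,3) y])
  also have "\<dots> = r \<odot>\<^bsub>M\<^esub> y i \<oplus>\<^bsub>M\<^esub> (y j \<oplus>\<^bsub>M\<^esub> \<ominus>\<^bsub>M\<^esub> y k)"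
    using r m by (simp add: lin_delta[OF _ y] ijk smult_one uminus_smult)
  also have "\<dots> = (r \<odot>\<^bsub>M\<^esub> y i \<oplus>\<^bsub>M\<^esub> y j) \<oplus>\<^bsub>M\<^esub> \<ominus>\<^bsub>M\<^esub> y k" using r m by (simp add: M.a_assoc)
  finally show ?thesis using eq_of_add_uminus[of "r \<odot>\<^bsub>M\<^esub> y i \<oplus>\<^bsub>M\<^esub> y j" "y k"] r m by (auto simp: quad_sat_def qq)
qed

end

lemma fp_morphism_of_quads:
  assumes U: "inaccessible TYPE('u)" and R: "ring R" "tiny TYPE('u) (carrier R)"
    and S: "finite S" "S \<subseteq> quads R n" and T: "finite T" "T \<subseteq> quads R (n + d)"
  shows "\<exists>p \<in> fp_morphisms R. \<forall>X\<in>(Modules R :: ('r, 'u) module set). factors R p X \<longleftrightarrow>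
    (\<forall>x. vec X n x \<longrightarrow> (\<forall>q\<in>S. quad_sat X x q) \<longrightarrow>
       (\<exists>y. vec X (n + d) y \<and> (\<forall>i<n. y i = x i) \<and> (\<forall>q\<in>T. quad_sat X y q)))"
proof -
  obtain ss where ss: "set ss = S" using finite_list[OF S(1)] by blast
  obtain ts where ts: "set ts = T" using finite_list[OF T(1)] by blast
  let ?H = "\<lambda>i. quad_row R (ss ! i)" and ?K = "\<lambda>i. quad_row R (ts ! i)"
  interpret L: left_module R "reg R" by (rule left_module_reg[OF R(1)])
  have nS: "ss ! i \<in> quads R n" if "i < length ss" for i using ss S(2) that nth_mem by blast
  have nT: "ts ! i \<in> quads R (n + d)" if "i < length ts" for i using ts T(2) that nth_mem by blast
  have H: "mat R (length ss) n ?H" using L.coeffs_quad_row[OF nS] by (simp add: mat_def coeffs_def)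
  have K: "mat R (length ts) (n + d) ?K" using L.coeffs_quad_row[OF nT] by (simp add: mat_def coeffs_def)
  obtain A :: "('r, 'u) module" and B f \<alpha> where A: "(A, B, f) \<in> fp_morphisms R" "presents R A n \<alpha> (length ss) ?H"
    "\<forall>M\<in>Modules R. \<forall>g\<in>mhom R A M. g \<in> hom_image R (A, B, f) M \<longleftrightarrow>
       (\<exists>y. vec M (n + d) y \<and> (\<forall>i<n. y i = g (\<alpha> i)) \<and> (\<forall>i<length ts. act M (n + d) ?K y i = \<zero>\<^bsub>M\<^esub>))"
    using fp_morphism_extending[OF U R H K] by blast
  show ?thesis
  proof (rule bexI[OF _ A(1)], rule ballI)
    fix X :: "('r, 'u) module" assume X: "X \<in> Modules R"
    interpret X: left_module R X by (rule Modules_lm[OF X])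
    have satS: "(\<forall>i<length ss. act X n ?H x i = \<zero>\<^bsub>X\<^esub>) \<longleftrightarrow> (\<forall>q\<in>S. quad_sat X x q)" if "vec X n x" for x
      using X.lin_quad_row[OF nS that] unfolding ss[symmetric] all_set_conv_all_nth act_eq_lin by blast
    have satT: "(\<forall>i<length ts. act X (n + d) ?K y i = \<zero>\<^bsub>X\<^esub>) \<longleftrightarrow> (\<forall>q\<in>T. quad_sat X y q)" if "vec X (n + d) y" for y
      using X.lin_quad_row[OF nT that] unfolding ts[symmetric] all_set_conv_all_nth act_eq_lin by blast
    have im: "g \<in> hom_image R (A, B, f) X \<longleftrightarrow>
       (\<exists>y. vec X (n + d) y \<and> (\<forall>i<n. y i = g (\<alpha> i)) \<and> (\<forall>q\<in>T. quad_sat X y q))" if "g \<in> mhom R A X" for g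
      using bspec[OF bspec[OF A(3) X] that] by (simp cong: conj_cong add: satT)
    show "factors R (A, B, f) X \<longleftrightarrow> (\<forall>x. vec X n x \<longrightarrow> (\<forall>q\<in>S. quad_sat X x q) \<longrightarrow>
       (\<exists>y. vec X (n + d) y \<and> (\<forall>i<n. y i = x i) \<and> (\<forall>q\<in>T. quad_sat X y q)))" (is "_ \<longleftrightarrow> ?rhs")
    proof
      assume fac: "factors R (A, B, f) X"
      show ?rhs
      proof (intro allI impI)
        fix x assume x: "vec X n x" "\<forall>q\<in>S. quad_sat X x q"
        obtain g where g: "g \<in> mhom R A X" "\<forall>j<n. g (\<alpha> j) = x j"
          using presents_hom[OF A(2) X.left_module_axioms x(1)] satS[OF x(1)] x(2) by blast
        have "g \<in> hom_image R (A, B, f) X" using fac g(1) by (auto simp: factors_def)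
        then show "\<exists>y. vec X (n + d) y \<and> (\<forall>i<n. y i = x i) \<and> (\<forall>q\<in>T. quad_sat X y q)"
          using im[OF g(1)] g(2) by auto
      qed
    next
      assume rhs: ?rhs
      show "factors R (A, B, f) X" unfolding factors_def
      proof
        fix g assume "g \<in> mhom R (fst (A, B, f)) X"
        then have g: "g \<in> mhom R A X" by simp
        note sol = presents_solution[OF A(2) X.left_module_axioms g]
        have "\<forall>q\<in>S. quad_sat X (\<lambda>j. g (\<alpha> j)) q" using satS[OF sol(1)] sol(2) by blast
        then show "g \<in> hom_image R (A, B, f) X" using im[OF g] rhs sol(1) by blast
      qed
    qed
  qed
qed

text \<open>The unknowns are indexed by natural numbers, \<open>T\<close> holds the equations
  between them, and \<open>Q\<close> equates unknowns with parameters. The parameters are elements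
  of a fixed module, transported to \<open>X\<close> by \<open>b\<close>, so one system can be posed
  in every module.\<close>

definition solvable :: "('r, 'x) module \<Rightarrow> ('r \<times> nat \<times> nat \<times> nat) set \<Rightarrow> (nat \<times> 'a) set \<Rightarrow> ('a \<Rightarrow> 'x) \<Rightarrow> bool" where
  "solvable X T Q b \<longleftrightarrow> (\<exists>\<tau>. (\<forall>j. \<tau> j \<in> carrier X) \<and> (\<forall>q\<in>T. quad_sat X \<tau> q) \<and> (\<forall>(i, a)\<in>Q. \<tau> i = b a))"

text \<open>The finitely many parameters become the generators of the source, subject to the
  relations recorded in \<open>D\<close>; the unknowns with their equations are adjoined in the
  target. Maps from the source are the assignments that respect \<open>D\<close>.\<close>

lemma fp_morphism_of_systems:
  fixes M :: "('r, 'u) module"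
  assumes U: "inaccessible TYPE('u)" and R: "ring R" "tiny TYPE('u) (carrier R)" and M: "left_module R M"
    and D: "finite D" "D \<subseteq> triples R M"
    and T: "finite T" "T \<subseteq> carrier R \<times> UNIV" and Q: "finite Q" "Q \<subseteq> UNIV \<times> carrier M"
  shows "\<exists>p \<in> fp_morphisms R. \<forall>X\<in>(Modules R :: ('r, 'u) module set). factors R p X \<longleftrightarrow>
    (\<forall>b. respects_on D M X b \<longrightarrow> solvable X T Q b)"
proof -
  interpret M: left_module R M by fact
  \<comment> \<open>All elements of \<open>M\<close> that are mentioned by the relations or by the
    equations with parameters; \<open>e\<close> numbers them below.\<close>
  define V where "V = (\<Union>(r, x, y)\<in>D. {x, y, r \<odot>\<^bsub>M\<^esub> x \<oplus>\<^bsub>M\<^esub> y}) \<union> snd ` Q"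
  have Vfin: "finite V" and VM: "V \<subseteq> carrier M"
    using D Q by (auto simp: V_def triples_def)
  have DV: "x \<in> V" "y \<in> V" "r \<odot>\<^bsub>M\<^esub> x \<oplus>\<^bsub>M\<^esub> y \<in> V" if "(r, x, y) \<in> D" for r x y using that by (force simp: V_def)+
  have QV: "a \<in> V" if "(i, a) \<in> Q" for i a using that by (force simp: V_def)
  obtain e where e: "bij_betw e V {0..<card V}" using ex_bij_betw_finite_nat[OF Vfin] by blast
  let ?n = "card V" and ?e' = "the_inv_into V e"
  have en: "e a < ?n" and e'e: "?e' (e a) = a" if "a \<in> V" for a
    using e that by (auto simp: bij_betw_def the_inv_into_f_f)
  have e'V: "?e' i \<in> V" "e (?e' i) = i" if "i < ?n" for i
    using e that by (auto simp: bij_betw_def f_the_inv_into_f intro!: the_inv_into_into)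
  have "finite (\<Union>(r, i, j, k)\<in>T. {i, j, k})" "finite (fst ` Q)" using T(1) Q(1) by auto
  then have "finite ((\<Union>(r, i, j, k)\<in>T. {i, j, k}) \<union> fst ` Q)" by simp
  then obtain d where d: "(\<Union>(r, i, j, k)\<in>T. {i, j, k}) \<union> fst ` Q \<subseteq> {..<d}"
    using finite_nat_bounded by blast
  have Td: "i < d" "j < d" "k < d" "r \<in> carrier R" if "(r, i, j, k) \<in> T" for r i j k using d T(2) that by (force+)
  have Qd: "i < d" if "(i, a) \<in> Q" for i a using d that by force
  define S where "S = (\<lambda>(r, x, y). (r, e x, e y, e (r \<odot>\<^bsub>M\<^esub> x \<oplus>\<^bsub>M\<^esub> y))) ` D"
  \<comment> \<open>Unknown \<open>i\<close> receives the index \<open>?n + i\<close>, after the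
    parameters. An equation with a parameter is written as a quadruple with scalar zero:
    \<open>y (?n + i)\<close> equals zero times \<open>y (e a)\<close> plus
    \<open>y (e a)\<close>.\<close>
  define T' where "T' = (\<lambda>(r, i, j, k). (r, ?n + i, ?n + j, ?n + k)) ` T \<union> (\<lambda>(i, a). (\<zero>\<^bsub>R\<^esub>, e a, e a, ?n + i)) ` Q"
  have S: "finite S" "S \<subseteq> quads R ?n" using D DV en by (auto simp: S_def quads_def triples_def)
  have T': "finite T'" "T' \<subseteq> quads R (?n + d)"
    using T(1) Q(1) Td Qd en QV by (auto simp: T'_def quads_def trans_less_add1)
  obtain p where p: "p \<in> fp_morphisms R" "\<And>X :: ('r, 'u) module. X \<in> Modules R \<Longrightarrow> factors R p X \<longleftrightarrow>
    (\<forall>x. vec X ?n x \<longrightarrow> (\<forall>q\<in>S. quad_sat X x q) \<longrightarrow>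
       (\<exists>y. vec X (?n + d) y \<and> (\<forall>i<?n. y i = x i) \<and> (\<forall>q\<in>T'. quad_sat X y q)))"
    using fp_morphism_of_quads[OF U R S T'] by blast
  show ?thesis
  proof (rule bexI[OF _ p(1)], rule ballI)
    fix X :: "('r, 'u) module" assume X: "X \<in> Modules R"
    interpret X: left_module R X by (rule Modules_lm[OF X])
    show "factors R p X \<longleftrightarrow> (\<forall>b. respects_on D M X b \<longrightarrow> solvable X T Q b)"
      unfolding p(2)[OF X]
    proof (intro iffI allI impI)
      fix b assume *: "\<forall>x. vec X ?n x \<longrightarrow> (\<forall>q\<in>S. quad_sat X x q) \<longrightarrow>
          (\<exists>y. vec X (?n + d) y \<and> (\<forall>i<?n. y i = x i) \<and> (\<forall>q\<in>T'. quad_sat X y q))"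
        and b: "respects_on D M X b"
      have bc: "b a \<in> carrier X" if "a \<in> carrier M" for a using b that unfolding respects_on_def by blast
      have bD: "b (r \<odot>\<^bsub>M\<^esub> x \<oplus>\<^bsub>M\<^esub> y) = r \<odot>\<^bsub>X\<^esub> b x \<oplus>\<^bsub>X\<^esub> b y" if "(r, x, y) \<in> D" for r x y
        using b that unfolding respects_on_def by auto
      let ?x = "\<lambda>i. b (?e' i)"
      have "vec X ?n ?x" using e'V VM bc by (auto simp: vec_def)
      moreover have "\<forall>q\<in>S. quad_sat X ?x q" by (auto simp: S_def quad_sat_def e'e DV bD)
      ultimately obtain y where y: "vec X (?n + d) y" "\<forall>i<?n. y i = ?x i" "\<forall>q\<in>T'. quad_sat X y q" using * by blast
      show "solvable X T Q b" unfolding solvable_def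
      \<comment> \<open>Unknowns from \<open>d\<close> on occur in no equation; they get the value
        zero because \<open>solvable\<close> asks for a value of each unknown.\<close>
      proof (intro exI[of _ "\<lambda>j. if j < d then y (?n + j) else \<zero>\<^bsub>X\<^esub>"] conjI allI ballI)
        show "(if j < d then y (?n + j) else \<zero>\<^bsub>X\<^esub>) \<in> carrier X" for j using y(1) by (simp add: vec_def)
        show "quad_sat X (\<lambda>j. if j < d then y (?n + j) else \<zero>\<^bsub>X\<^esub>) q" if q: "q \<in> T" for q
        proof -
          obtain r i j k where qq: "q = (r, i, j, k)" by (cases q)
          have "(r, ?n + i, ?n + j, ?n + k) \<in> T'" using q unfolding qq T'_def by force
          then show ?thesis using y(3) Td q unfolding qq by (auto simp: quad_sat_def)
        qed
        show "case c of (i, a) \<Rightarrow> (if i < d then y (?n + i) else \<zero>\<^bsub>X\<^esub>) = b a" if c: "c \<in> Q" for c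
        proof -
          obtain i a where cc: "c = (i, a)" by (cases c)
          have "(\<zero>\<^bsub>R\<^esub>, e a, e a, ?n + i) \<in> T'" using c unfolding cc T'_def by force
          then have "y (?n + i) = \<zero>\<^bsub>R\<^esub> \<odot>\<^bsub>X\<^esub> y (e a) \<oplus>\<^bsub>X\<^esub> y (e a)" using y(3) by (auto simp: quad_sat_def)
          moreover have "a \<in> V" using QV c cc by blast
          moreover have "y (e a) = b a" using y(2) en[OF \<open>a \<in> V\<close>] e'e[OF \<open>a \<in> V\<close>] by simp
          moreover have "b a \<in> carrier X" using bc VM \<open>a \<in> V\<close> by blast
          ultimately show ?thesis using Qd c cc by simp
        qed
      qed
    next
      fix x assume *: "\<forall>b. respects_on D M X b \<longrightarrow> solvable X T Q b" and x: "vec X ?n x" "\<forall>q\<in>S. quad_sat X x q"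
      \<comment> \<open>Outside \<open>V\<close> the parameter map is irrelevant to \<open>D\<close>
        and \<open>Q\<close>, so zero is put there to stay in the carrier.\<close>
      let ?b = "\<lambda>a. if a \<in> V then x (e a) else \<zero>\<^bsub>X\<^esub>"
      have "?b (r \<odot>\<^bsub>M\<^esub> a \<oplus>\<^bsub>M\<^esub> c) = r \<odot>\<^bsub>X\<^esub> ?b a \<oplus>\<^bsub>X\<^esub> ?b c" if t: "(r, a, c) \<in> D" for r a c
      proof -
        have "(r, e a, e c, e (r \<odot>\<^bsub>M\<^esub> a \<oplus>\<^bsub>M\<^esub> c)) \<in> S" using t unfolding S_def by force
        from bspec[OF x(2) this] show ?thesis using DV[OF t] by (simp add: quad_sat_def)
      qed
      moreover have "?b \<in> carrier M \<rightarrow> carrier X" using x(1) en by (auto simp: vec_def)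
      ultimately have "respects_on D M X ?b" unfolding respects_on_def by blast
      then obtain \<tau> where \<tau>: "\<And>j. \<tau> j \<in> carrier X" "\<forall>q\<in>T. quad_sat X \<tau> q" "\<forall>(i, a)\<in>Q. \<tau> i = ?b a"
        using * unfolding solvable_def by blast
      let ?y = "append_vec ?n x \<tau>"
      have "vec X (?n + d) ?y" using x(1) \<tau>(1) by (intro vec_append) (auto simp: vec_def)
      moreover have "quad_sat X ?y q" if "q \<in> T'" for q
        using that unfolding T'_def
      proof (elim UnE imageE)
        fix t assume t: "t \<in> T" "q = (case t of (r, i, j, k) \<Rightarrow> (r, ?n + i, ?n + j, ?n + k))"
        obtain r i j k where tt: "t = (r, i, j, k)" by (cases t)
        show ?thesis using \<tau>(2) t unfolding tt by (auto simp: quad_sat_def)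
      next
        fix c assume c: "c \<in> Q" "q = (case c of (i, a) \<Rightarrow> (\<zero>\<^bsub>R\<^esub>, e a, e a, ?n + i))"
        obtain i a where cc: "c = (i, a)" by (cases c)
        have a: "a \<in> V" using QV c cc by blast
        have "\<tau> i = x (e a)" using \<tau>(3) c a unfolding cc by auto
        moreover have "x (e a) \<in> carrier X" using x(1) en[OF a] by (simp add: vec_def)
        ultimately show ?thesis using c(2) en[OF a] unfolding cc by (simp add: quad_sat_def)
      qed
      ultimately show "\<exists>y. vec X (?n + d) y \<and> (\<forall>i<?n. y i = x i) \<and> (\<forall>q\<in>T'. quad_sat X y q)"
        by (intro exI[of _ ?y]) auto
    qed
  qed
qed

section \<open>From unsolvable systems to definability\<close>

text \<open>The class contains, up to retracts, products of modules that violate prescribed conditions: this holds if it is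
  closed under products, and also if its dual is closed under coproducts.\<close>

definition enough_products :: "'r ring \<Rightarrow> ('r, 'u) module set \<Rightarrow> bool" where
  "enough_products R A \<longleftrightarrow> (\<forall>(I :: 'u set) F. small I \<and> (\<forall>i\<in>I. F i \<in> A) \<longrightarrow>
     (\<exists>F'. (\<forall>i\<in>I. F' i \<in> Modules R \<and> (\<forall>p\<in>fp_morphisms R. factors R p (F' i) \<longrightarrow> factors R p (F i))) \<and>
        (\<exists>N\<in>A. retract R (prod_module I F') N)))"

text \<open>The product has a coordinate for every finite system unsolvable in \<open>M\<close>,
  where that system is also unsolvable with suitably transported parameters. A system read off from
  elements of the product is solved in each coordinate by projection, so it cannot be among the
  unsolvable ones; this gives the approximate splitting.\<close>

theorem definable_of_enough_products:
  fixes A B :: "('r, 'u) module set"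
  assumes U: "inaccessible TYPE('u)" and R: "ring R" "tiny TYPE('u) (carrier R)"
    and AB: "duality_pair R A B" and prods: "enough_products R A"
  shows "definable R A"
proof -
  have AM: "A \<subseteq> Modules R" and BM: "B \<subseteq> Modules (opp R)" using AB by (auto simp: duality_pair_def)
  define P where "P = {p \<in> fp_morphisms R. \<forall>X\<in>A. factors R p X}"
  have "M \<in> A" if M: "M \<in> Modules R" and fac: "\<forall>p\<in>P. factors R p M" for M
  proof -
    note lM = Modules_lm[OF M]
    interpret M: left_module R M by (rule lM)
    \<comment> \<open>\<open>D\<close> is part of the index because it says which relations between
      the parameters must survive when they are transported to another module.\<close>
    define J where "J = {(D, T, Q). finite D \<and> D \<subseteq> triples R M \<and> finite T \<and> T \<subseteq> carrier R \<times> (UNIV :: (nat \<times> nat \<times> nat) set) \<and>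
      finite Q \<and> Q \<subseteq> (UNIV :: nat set) \<times> carrier M \<and> \<not> solvable M T Q (\<lambda>a. a)}"
    have "tiny TYPE('u) J"
    proof (rule tiny_subset)
      note t = tiny_Times[OF U]
      have n: "tiny TYPE('u) (UNIV :: nat set)" by (rule tiny_nat[OF U])
      have n3: "tiny TYPE('u) (UNIV :: (nat \<times> nat \<times> nat) set)"
        using t[OF n t[OF n n]] by simp
      show "tiny TYPE('u) (Pow (triples R M) \<times> Pow (carrier R \<times> (UNIV :: (nat \<times> nat \<times> nat) set)) \<times> Pow ((UNIV :: nat set) \<times> carrier M))"
        unfolding triples_def by (intro t tiny_Pow[OF U] R(2) Modules_tiny[OF M] n n3)
      show "J \<subseteq> Pow (triples R M) \<times> Pow (carrier R \<times> UNIV) \<times> Pow (UNIV \<times> carrier M)" by (auto simp: J_def)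
    qed
    then obtain \<iota> :: "_ \<Rightarrow> 'u" where \<iota>: "inj_on \<iota> J" "small (\<iota> ` J)" by (rule tiny_embed)
    let ?I = "\<iota> ` J" and ?\<delta> = "the_inv_into J \<iota>"
    have \<delta>\<iota>: "?\<delta> (\<iota> j) = j" if "j \<in> J" for j using \<iota>(1) that by (rule the_inv_into_f_f)
    have "\<exists>p\<in>fp_morphisms R. (\<forall>X\<in>(Modules R :: ('r, 'u) module set). factors R p X \<longleftrightarrow>
        (\<forall>b. respects_on (fst j) M X b \<longrightarrow> solvable X (fst (snd j)) (snd (snd j)) b)) \<and> \<not> factors R p M" if "j \<in> J" for j
    proof -
      obtain D T Q where j: "j = (D, T, Q)" by (cases j)
      have c: "finite D" "D \<subseteq> triples R M" "finite T" "T \<subseteq> carrier R \<times> UNIV" "finite Q" "Q \<subseteq> UNIV \<times> carrier M"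
        "\<not> solvable M T Q (\<lambda>a. a)" using that unfolding j J_def by auto
      obtain p where p: "p \<in> fp_morphisms R" "\<forall>X\<in>(Modules R :: ('r, 'u) module set). factors R p X \<longleftrightarrow>
          (\<forall>b. respects_on D M X b \<longrightarrow> solvable X T Q b)"
        using fp_morphism_of_systems[OF U R lM c(1-6)] by blast
      \<comment> \<open>The identity respects every relation, so the unsolvable system violates its
        own condition in \<open>M\<close>.\<close>
      have "respects_on D M M (\<lambda>a. a)" by (auto simp: respects_on_def)
      then have "\<not> factors R p M" using p(2) M c(7) by blast
      then show ?thesis using p unfolding j by (intro bexI[of _ p]) auto
    qed
    then obtain p where p: "\<And>j. j \<in> J \<Longrightarrow> p j \<in> fp_morphisms R"
      "\<And>j X. j \<in> J \<Longrightarrow> X \<in> Modules R \<Longrightarrow> factors R (p j) X \<longleftrightarrow>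
        (\<forall>b. respects_on (fst j) M X b \<longrightarrow> solvable X (fst (snd j)) (snd (snd j)) b)"
      "\<And>j. j \<in> J \<Longrightarrow> \<not> factors R (p j) M" by metis
    have "\<exists>X\<in>A. \<not> factors R (p j) X" if "j \<in> J" for j
      using p(1,3)[OF that] fac unfolding P_def by blast
    then obtain X where X: "\<And>j. j \<in> J \<Longrightarrow> X j \<in> A" "\<And>j. j \<in> J \<Longrightarrow> \<not> factors R (p j) (X j)" by metis
    have "\<forall>i\<in>?I. X (?\<delta> i) \<in> A" using X(1) \<delta>\<iota> by auto
    then have "\<exists>F'. (\<forall>i\<in>?I. F' i \<in> Modules R \<and> (\<forall>p\<in>fp_morphisms R. factors R p (F' i) \<longrightarrow> factors R p (X (?\<delta> i)))) \<and>
        (\<exists>N\<in>A. retract R (prod_module ?I F') N)"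
      using prods[unfolded enough_products_def, rule_format, of ?I "\<lambda>i. X (?\<delta> i)"] \<iota>(2) by blast
    then obtain F' N where F': "\<And>i. i \<in> ?I \<Longrightarrow> F' i \<in> Modules R"
      "\<And>i p. i \<in> ?I \<Longrightarrow> p \<in> fp_morphisms R \<Longrightarrow> factors R p (F' i) \<Longrightarrow> factors R p (X (?\<delta> i))"
      and N: "N \<in> A" "retract R (prod_module ?I F') N" by blast
    define G where "G j = F' (\<iota> j)" for j
    have "\<exists>b. respects_on (fst j) M (G j) b \<and> \<not> solvable (G j) (fst (snd j)) (snd (snd j)) b" if j: "j \<in> J" for j
      using p(2)[OF j F'(1)[OF imageI[OF j]]] F'(2)[OF imageI[OF j] p(1)[OF j]] X(2)[OF j] unfolding \<delta>\<iota>[OF j] G_def by blast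
    then obtain b where b: "\<And>j. j \<in> J \<Longrightarrow> respects_on (fst j) M (G j) (b j)"
      "\<And>j. j \<in> J \<Longrightarrow> \<not> solvable (G j) (fst (snd j)) (snd (snd j)) (b j)" by metis
    let ?Pr = "prod_module ?I F'"
    have lF: "left_module R (F' i)" if "i \<in> ?I" for i using F'(1)[OF that] by (rule Modules_lm)
    have lP: "left_module R ?Pr" by (rule left_module_prod[OF R(1) lF])
    interpret Pr: left_module R ?Pr by (rule lP)
    \<comment> \<open>A coordinate is used when its map respects all of \<open>D\<close> and is set
      to zero otherwise; either way \<open>D\<close> is respected. No single map has to respect all
      relations of \<open>M\<close>.\<close>
    define \<beta> where "\<beta> D a = (\<lambda>i\<in>?I. if D \<subseteq> fst (?\<delta> i) then b (?\<delta> i) a else \<zero>\<^bsub>F' i\<^esub>)" for D a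
    have \<beta>\<iota>: "\<beta> D a (\<iota> j) = b j a" if "j \<in> J" "D \<subseteq> fst j" for D a j using that \<delta>\<iota> by (simp add: \<beta>_def)
    have bG: "b j a \<in> carrier (G j)" if "j \<in> J" "a \<in> carrier M" for j a
      using b(1)[OF that(1)] that(2) unfolding respects_on_def by blast
    have \<beta>P: "\<beta> D a \<in> carrier ?Pr" if a: "a \<in> carrier M" for D a
      unfolding prod_module_simps(1) \<beta>_def restrict_PiE_iff
    proof
      fix i assume "i \<in> ?I"
      then obtain j where j: "j \<in> J" "i = \<iota> j" by (rule imageE)
      interpret Fj: left_module R "F' (\<iota> j)" by (rule lF[OF imageI[OF j(1)]])
      show "(if D \<subseteq> fst (?\<delta> i) then b (?\<delta> i) a else \<zero>\<^bsub>F' i\<^esub>) \<in> carrier (F' i)"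
        unfolding j(2) \<delta>\<iota>[OF j(1)] using bG[OF j(1) a] by (simp add: G_def)
    qed
    have "retract (opp R) (cm M) (cm ?Pr)"
    proof (rule retract_cm_of_local_splitting[OF lM lP])
      fix D assume D: "finite D" "D \<subseteq> triples R M"
      show "respects_on D M ?Pr (\<beta> D)"
        unfolding respects_on_def
      proof (intro conjI funcsetI ballI)
        show \<beta>c: "\<beta> D a \<in> carrier ?Pr" if "a \<in> carrier M" for a by (rule \<beta>P[OF that])
        fix t assume t: "t \<in> D"
        obtain r x y where tt: "t = (r, x, y)" by (cases t)
        have c: "r \<in> carrier R" "x \<in> carrier M" "y \<in> carrier M" using t D(2) tt by (auto simp: triples_def)
        have eq: "(if D \<subseteq> fst j then b j (r \<odot>\<^bsub>M\<^esub> x \<oplus>\<^bsub>M\<^esub> y) else \<zero>\<^bsub>F' (\<iota> j)\<^esub>) =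
          r \<odot>\<^bsub>F' (\<iota> j)\<^esub> (if D \<subseteq> fst j then b j x else \<zero>\<^bsub>F' (\<iota> j)\<^esub>) \<oplus>\<^bsub>F' (\<iota> j)\<^esub> (if D \<subseteq> fst j then b j y else \<zero>\<^bsub>F' (\<iota> j)\<^esub>)"
          if j: "j \<in> J" for j
        proof -
          interpret Fj: left_module R "F' (\<iota> j)" by (rule lF[OF imageI[OF j]])
          show ?thesis using b(1)[OF j] t c unfolding tt respects_on_def G_def by auto
        qed
        show "case t of (r, x, y) \<Rightarrow> \<beta> D (r \<odot>\<^bsub>M\<^esub> x \<oplus>\<^bsub>M\<^esub> y) = r \<odot>\<^bsub>?Pr\<^esub> \<beta> D x \<oplus>\<^bsub>?Pr\<^esub> \<beta> D y"
          unfolding tt prod.case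
        proof (rule PiE_ext)
          show "\<beta> D (r \<odot>\<^bsub>M\<^esub> x \<oplus>\<^bsub>M\<^esub> y) \<in> (\<Pi>\<^sub>E i\<in>?I. carrier (F' i))" using \<beta>c[of "r \<odot>\<^bsub>M\<^esub> x \<oplus>\<^bsub>M\<^esub> y"] c by simp
          show "r \<odot>\<^bsub>?Pr\<^esub> \<beta> D x \<oplus>\<^bsub>?Pr\<^esub> \<beta> D y \<in> (\<Pi>\<^sub>E i\<in>?I. carrier (F' i))"
            using Pr.M.a_closed[OF Pr.smult_closed[OF c(1) \<beta>c[OF c(2)]] \<beta>c[OF c(3)]] by simp
          fix i assume "i \<in> ?I"
          then obtain j where j: "j \<in> J" "i = \<iota> j" by blast
          then show "\<beta> D (r \<odot>\<^bsub>M\<^esub> x \<oplus>\<^bsub>M\<^esub> y) i = (r \<odot>\<^bsub>?Pr\<^esub> \<beta> D x \<oplus>\<^bsub>?Pr\<^esub> \<beta> D y) i"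
            using eq[OF j(1)] by (simp add: \<beta>_def \<delta>\<iota> split del: if_split cong: if_cong)
        qed
      qed
    next
      fix E Q assume E: "finite E" "E \<subseteq> triples R ?Pr" and Q: "finite Q"
        and Qm: "\<And>D a. (D, a) \<in> Q \<Longrightarrow> finite D \<and> D \<subseteq> triples R M \<and> a \<in> carrier M"
      \<comment> \<open>The elements of the product on which the splitting is constrained. Numbered
        by \<open>e\<close> they become the unknowns, the triples in \<open>E\<close> the equations,
        and the requirements at \<open>\<beta> D a\<close> the equations with parameters.\<close>
      define V where "V = (\<Union>(r, x, y)\<in>E. {x, y, r \<odot>\<^bsub>?Pr\<^esub> x \<oplus>\<^bsub>?Pr\<^esub> y}) \<union> (\<lambda>(D, a). \<beta> D a) ` Q"
      have Vfin: "finite V" using E(1) Q by (auto simp: V_def)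
      have EV: "x \<in> V" "y \<in> V" "r \<odot>\<^bsub>?Pr\<^esub> x \<oplus>\<^bsub>?Pr\<^esub> y \<in> V" if "(r, x, y) \<in> E" for r x y
        using that unfolding V_def by (force simp del: prod_module_simps)+
      have QV: "\<beta> D a \<in> V" if "(D, a) \<in> Q" for D a using that by (force simp: V_def)
      obtain e :: "_ \<Rightarrow> nat" where e: "inj_on e V" using finite_imp_inj_to_nat_seg[OF Vfin] by blast
      define T where "T = (\<lambda>(r, x, y). (r, e x, e y, e (r \<odot>\<^bsub>?Pr\<^esub> x \<oplus>\<^bsub>?Pr\<^esub> y))) ` E"
      define Q' where "Q' = (\<lambda>(D, a). (e (\<beta> D a), a)) ` Q"
      \<comment> \<open>The union of all finite sets occurring in \<open>Q\<close>: in the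
        coordinate of this system each \<open>\<beta> D' a\<close> is then given by the map of that
        coordinate and not by the default zero.\<close>
      define D where "D = \<Union>(fst ` Q)"
      have D: "finite D" "D \<subseteq> triples R M"
        using Q Qm[THEN conjunct1] Qm[THEN conjunct2, THEN conjunct1, THEN subsetD] unfolding D_def by auto
      have "finite T" "finite Q'" using E(1) Q by (simp_all add: T_def Q'_def)
      moreover have "T \<subseteq> carrier R \<times> UNIV" using E(2) by (auto simp: T_def triples_def simp del: prod_module_simps)
      moreover have "Q' \<subseteq> UNIV \<times> carrier M" using Qm by (auto simp: Q'_def)
      ultimately have fin: "finite D" "D \<subseteq> triples R M" "finite T" "T \<subseteq> carrier R \<times> UNIV" "finite Q'" "Q' \<subseteq> UNIV \<times> carrier M"
        using D by simp_all
      have "solvable M T Q' (\<lambda>a. a)"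
      proof (rule ccontr)
        assume "\<not> solvable M T Q' (\<lambda>a. a)"
        then have j: "(D, T, Q') \<in> J" using fin by (simp add: J_def)
        let ?j = "(D, T, Q')"
        interpret Fj: left_module R "G ?j" unfolding G_def by (rule lF[OF imageI[OF j]])
        \<comment> \<open>Projection to the coordinate attached to this very system: it solves the
          equations with the transported parameters, contrary to the choice of that
          coordinate.\<close>
        let ?\<tau> = "\<lambda>i. if i \<in> e ` V then the_inv_into V e i (\<iota> ?j) else \<zero>\<^bsub>G ?j\<^esub>"
        have \<tau>: "?\<tau> (e v) = v (\<iota> ?j)" if "v \<in> V" for v using that e by (simp add: the_inv_into_f_f)
        have VP: "v \<in> carrier ?Pr" if "v \<in> V" for v
        proof -
          have "\<beta> D' a \<in> carrier ?Pr" if "(D', a) \<in> Q" for D' a using \<beta>P Qm[OF that] by blast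
          moreover have "x \<in> carrier ?Pr \<and> y \<in> carrier ?Pr \<and> r \<odot>\<^bsub>?Pr\<^esub> x \<oplus>\<^bsub>?Pr\<^esub> y \<in> carrier ?Pr" if "(r, x, y) \<in> E" for r x y
            using subsetD[OF E(2) that] Pr.M.a_closed Pr.smult_closed unfolding triples_def by blast
          ultimately show ?thesis using that unfolding V_def by (auto simp del: prod_module_simps)
        qed
        have "solvable (G ?j) T Q' (b ?j)"
          unfolding solvable_def
        proof (intro exI[of _ ?\<tau>] conjI allI ballI)
          show "?\<tau> i \<in> carrier (G ?j)" for i
          proof (cases "i \<in> e ` V")
            case True
            then obtain v where v: "v \<in> V" "i = e v" by blast
            show ?thesis unfolding v(2) \<tau>[OF v(1)] using VP[OF v(1)] j unfolding G_def by (auto dest: PiE_mem)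
          qed simp
          show "quad_sat (G ?j) ?\<tau> q" if q: "q \<in> T" for q
          proof -
            obtain r x y where w: "(r, x, y) \<in> E" "q = (r, e x, e y, e (r \<odot>\<^bsub>?Pr\<^esub> x \<oplus>\<^bsub>?Pr\<^esub> y))" using q unfolding T_def by (auto simp del: prod_module_simps)
            have "(r \<odot>\<^bsub>?Pr\<^esub> x \<oplus>\<^bsub>?Pr\<^esub> y) (\<iota> ?j) = r \<odot>\<^bsub>G ?j\<^esub> x (\<iota> ?j) \<oplus>\<^bsub>G ?j\<^esub> y (\<iota> ?j)" using j by (simp add: G_def)
            then show ?thesis unfolding w(2) quad_sat_def prod.case \<tau>[OF EV(1)[OF w(1)]] \<tau>[OF EV(2)[OF w(1)]] \<tau>[OF EV(3)[OF w(1)]] .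
          qed
          show "case c of (i, a) \<Rightarrow> ?\<tau> i = b ?j a" if c: "c \<in> Q'" for c
          proof -
            obtain D' a where w: "(D', a) \<in> Q" "c = (e (\<beta> D' a), a)" using c unfolding Q'_def by auto
            have "D' \<subseteq> D" using w(1) by (force simp: D_def)
            then have "\<beta> D' a (\<iota> ?j) = b ?j a" using \<beta>\<iota>[OF j, of D'] by simp
            then show ?thesis unfolding w(2) prod.case \<tau>[OF QV[OF w(1)]] .
          qed
        qed
        then show False using b(2)[OF j] by simp
      qed
      then obtain \<tau> where \<tau>: "\<And>j. \<tau> j \<in> carrier M" "\<forall>q\<in>T. quad_sat M \<tau> q" "\<forall>(i, a)\<in>Q'. \<tau> i = a"
        unfolding solvable_def by blast
      show "\<exists>\<sigma>. respects_on E ?Pr M \<sigma> \<and> (\<forall>(D, a)\<in>Q. \<sigma> (\<beta> D a) = a)"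
      proof (intro exI[of _ "\<lambda>v. \<tau> (e v)"] conjI ballI)
        show "respects_on E ?Pr M (\<lambda>v. \<tau> (e v))" unfolding respects_on_def
        proof (intro conjI funcsetI \<tau>(1) ballI)
          fix t assume t: "t \<in> E"
          obtain r x y where tt: "t = (r, x, y)" by (cases t)
          have "(r, e x, e y, e (r \<odot>\<^bsub>?Pr\<^esub> x \<oplus>\<^bsub>?Pr\<^esub> y)) \<in> T" using t unfolding T_def tt by (force simp del: prod_module_simps)
          from bspec[OF \<tau>(2) this] show "case t of (r, x, y) \<Rightarrow> \<tau> (e (r \<odot>\<^bsub>?Pr\<^esub> x \<oplus>\<^bsub>?Pr\<^esub> y)) = r \<odot>\<^bsub>M\<^esub> \<tau> (e x) \<oplus>\<^bsub>M\<^esub> \<tau> (e y)"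
            unfolding tt quad_sat_def prod.case .
        qed
        fix c assume c: "c \<in> Q"
        obtain D' a where cc: "c = (D', a)" by (cases c)
        have "(e (\<beta> D' a), a) \<in> Q'" using c unfolding Q'_def cc by force
        from bspec[OF \<tau>(3) this] show "case c of (D, a) \<Rightarrow> \<tau> (e (\<beta> D a)) = a" by (simp add: cc)
      qed
    qed
    moreover have NM: "N \<in> Modules R" using N(1) AM by blast
    moreover have "retract (opp R) (cm ?Pr) (cm N)" by (rule retract_cm[OF lP Modules_lm[OF NM] N(2)])
    ultimately have r1: "retract (opp R) (cm M) (cm N)"
      using retract_trans[OF left_module_cm[OF lM] left_module_cm[OF Modules_lm[OF NM]]] by blast
    obtain Z where Z: "Z \<in> B" "retract (opp R) (cm N) Z" using duality_pair_iff[OF U AB NM] N(1) by blast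
    have lZ: "left_module (opp R) Z" using Z(1) BM Modules_lm by blast
    have "retract (opp R) (cm M) Z" by (rule retract_trans[OF left_module_cm[OF lM] lZ r1 Z(2)])
    then show "M \<in> A" using duality_pair_iff[OF U AB M] Z(1) by blast
  qed
  then have "A = {M \<in> Modules R. \<forall>p\<in>P. factors R p M}" using AM unfolding P_def by blast
  moreover have "P \<subseteq> fp_morphisms R" by (auto simp: P_def)
  ultimately show ?thesis unfolding definable_iff by blast
qed

section \<open>Products from closure under products or under coproducts of the dual class\<close>

lemma closed_products_enough:
  fixes A :: "('r, 'u) module set"
  assumes R: "ring R" and A: "A \<subseteq> Modules R" and c: "closed_products R A"
  shows "enough_products R A"
  unfolding enough_products_def
proof (intro allI impI, elim conjE)
  fix I :: "'u set" and F assume I: "small I" "\<forall>i\<in>I. F i \<in> A"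
  then have "belongs R (prod_module I F) A" using c unfolding closed_products_def by blast
  then obtain N where N: "N \<in> A" "mod_iso R (prod_module I F) N" unfolding belongs_def by blast
  have F: "F i \<in> Modules R" if "i \<in> I" for i using I(2) A that by blast
  have "retract R (prod_module I F) N" using mod_iso_retract(1)[OF left_module_prod[OF R] N(2)] F Modules_lm by blast
  then show "\<exists>F'. (\<forall>i\<in>I. F' i \<in> Modules R \<and> (\<forall>p\<in>fp_morphisms R. factors R p (F' i) \<longrightarrow> factors R p (F i))) \<and>
        (\<exists>N\<in>A. retract R (prod_module I F') N)"
    using F N(1) by (intro exI[of _ F]) blast
qed

lemma mhom_coprod_inj:
  assumes S: "ring S" and Y: "\<And>i. i \<in> I \<Longrightarrow> left_module S (Y i)" and i: "i \<in> I"
  shows "(\<lambda>y\<in>carrier (Y i). \<lambda>j\<in>I. if j = i then y else \<zero>\<^bsub>Y j\<^esub>) \<in> mhom S (Y i) (coprod_module I Y)"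
proof -
  interpret Yi: left_module S "Y i" by (rule Y[OF i])
  have z: "\<zero>\<^bsub>Y j\<^esub> \<in> carrier (Y j)" "\<zero>\<^bsub>Y j\<^esub> \<oplus>\<^bsub>Y j\<^esub> \<zero>\<^bsub>Y j\<^esub> = \<zero>\<^bsub>Y j\<^esub>"
    "r \<in> carrier S \<Longrightarrow> r \<odot>\<^bsub>Y j\<^esub> \<zero>\<^bsub>Y j\<^esub> = \<zero>\<^bsub>Y j\<^esub>" if "j \<in> I" for j r
  proof -
    interpret Yj: left_module S "Y j" by (rule Y[OF that])
    show "\<zero>\<^bsub>Y j\<^esub> \<in> carrier (Y j)" "\<zero>\<^bsub>Y j\<^esub> \<oplus>\<^bsub>Y j\<^esub> \<zero>\<^bsub>Y j\<^esub> = \<zero>\<^bsub>Y j\<^esub>"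
      "r \<in> carrier S \<Longrightarrow> r \<odot>\<^bsub>Y j\<^esub> \<zero>\<^bsub>Y j\<^esub> = \<zero>\<^bsub>Y j\<^esub>" by simp_all
  qed
  have fin: "finite {j \<in> I. (\<lambda>j\<in>I. if j = i then y else \<zero>\<^bsub>Y j\<^esub>) j \<noteq> \<zero>\<^bsub>Y j\<^esub>}" for y
    by (rule finite_subset[of _ "{i}"]) auto
  show ?thesis
  proof (rule mhomI)
    show "(\<lambda>y\<in>carrier (Y i). \<lambda>j\<in>I. if j = i then y else \<zero>\<^bsub>Y j\<^esub>) x \<in> carrier (coprod_module I Y)"
      if "x \<in> carrier (Y i)" for x using that fin z by (simp add: coprod_carrier)
  qed (use i z in \<open>auto simp: fun_eq_iff Yi.smult_closed\<close>)
qed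

text \<open>A family of characters acts on a finitely supported element by a finite sum, and a
  character of the coproduct is restricted to the summands. These maps realise the product of
  character modules as the characters of the coproduct; the maps \<open>s i\<close> and
  \<open>p i\<close> pass to retracts of them.\<close>

lemma retract_prod_cm_coprod:
  assumes S: "ring S" and Y: "\<And>i. i \<in> I \<Longrightarrow> left_module S (Y i)"
    and F: "\<And>i. i \<in> I \<Longrightarrow> left_module (opp S) (F i)"
    and r: "\<And>i. i \<in> I \<Longrightarrow> retract (opp S) (F i) (cm (Y i))"
  shows "retract (opp S) (prod_module I F) (cm (coprod_module I Y))"
proof -
  let ?C = "coprod_module I Y" and ?P = "prod_module I F"
  have "\<forall>i\<in>I. \<exists>s p. s \<in> mhom (opp S) (F i) (cm (Y i)) \<and> p \<in> mhom (opp S) (cm (Y i)) (F i) \<and> (\<forall>x\<in>carrier (F i). p (s x) = x)"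
    using r unfolding retract_def by blast
  then obtain s where "\<forall>i\<in>I. \<exists>p. s i \<in> mhom (opp S) (F i) (cm (Y i)) \<and> p \<in> mhom (opp S) (cm (Y i)) (F i) \<and> (\<forall>x\<in>carrier (F i). p (s i x) = x)"
    by (rule bchoice[THEN exE])
  then obtain p where "\<forall>i\<in>I. s i \<in> mhom (opp S) (F i) (cm (Y i)) \<and> p i \<in> mhom (opp S) (cm (Y i)) (F i) \<and> (\<forall>x\<in>carrier (F i). p i (s i x) = x)"
    by (rule bchoice[THEN exE])
  then have s: "\<And>i. i \<in> I \<Longrightarrow> s i \<in> mhom (opp S) (F i) (cm (Y i))"
    and p: "\<And>i. i \<in> I \<Longrightarrow> p i \<in> mhom (opp S) (cm (Y i)) (F i)"
    and ps: "\<And>i x. i \<in> I \<Longrightarrow> x \<in> carrier (F i) \<Longrightarrow> p i (s i x) = x" by simp_all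
  interpret C: left_module S ?C by (rule left_module_coprod[OF S Y])
  interpret P: left_module "opp S" ?P by (rule left_module_prod[OF ring_opp[OF S] F])
  interpret CC: left_module "opp S" "cm ?C" by (rule left_module_cm[OF C.left_module_axioms])
  define supp where "supp x = {i \<in> I. x i \<noteq> \<zero>\<^bsub>Y i\<^esub>}" for x
  have fin: "finite (supp x)" if "x \<in> carrier ?C" for x using that by (simp add: coprod_carrier supp_def)
  have xi: "x i \<in> carrier (Y i)" if "x \<in> carrier ?C" "i \<in> I" for x i using that by (auto simp: coprod_carrier)
  have \<phi>i: "\<phi> i \<in> carrier (F i)" if "\<phi> \<in> carrier ?P" "i \<in> I" for \<phi> i using that by auto
  note sc = mhom_closed[OF s \<phi>i]
  have s0: "s i (\<phi> i) \<zero>\<^bsub>Y i\<^esub> = 0" if "\<phi> \<in> carrier ?P" "i \<in> I" for \<phi> i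
    using cm_zero[OF left_module.abelian_group_M[OF Y[OF that(2)]] sc[OF that(2,1,2)]] .
  define \<sigma> where "\<sigma> \<phi> = (\<lambda>x\<in>carrier ?C. \<Sum>i\<in>supp x. s i (\<phi> i) (x i))" for \<phi>
  \<comment> \<open>The sum may be taken over any finite set of indices containing the support,
    which lets elements with different supports share one index set.\<close>
  have \<sigma>: "\<sigma> \<phi> x = (\<Sum>i\<in>T. s i (\<phi> i) (x i))"
    if "\<phi> \<in> carrier ?P" "x \<in> carrier ?C" "finite T" "supp x \<subseteq> T" "T \<subseteq> I" for \<phi> x T
  proof -
    have "s i (\<phi> i) (x i) = 0" if "i \<in> T - supp x" for i
    proof -
      have "i \<in> I" "x i = \<zero>\<^bsub>Y i\<^esub>" using that \<open>T \<subseteq> I\<close> unfolding supp_def by auto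
      then show ?thesis using s0[OF \<open>\<phi> \<in> carrier ?P\<close>] by simp
    qed
    then show ?thesis using that(2) unfolding \<sigma>_def by (simp add: sum.mono_neutral_left[OF that(3,4)])
  qed
  have suppI: "supp x \<subseteq> I" for x by (auto simp: supp_def)
  have \<sigma>c: "\<sigma> \<phi> \<in> carrier (cm ?C)" if \<phi>: "\<phi> \<in> carrier ?P" for \<phi>
    unfolding cm_carrier
  proof (intro conjI ballI)
    show "\<sigma> \<phi> \<in> extensional (carrier ?C)" by (simp add: \<sigma>_def)
    fix x y assume x: "x \<in> carrier ?C" and y: "y \<in> carrier ?C"
    let ?T = "supp x \<union> supp y \<union> supp (x \<oplus>\<^bsub>?C\<^esub> y)"
    have T: "finite ?T" "?T \<subseteq> I" using fin x y C.M.a_closed[OF x y] suppI by auto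
    have sub: "supp x \<subseteq> ?T" "supp y \<subseteq> ?T" by blast+
    have "\<sigma> \<phi> (x \<oplus>\<^bsub>?C\<^esub> y) = (\<Sum>i\<in>?T. s i (\<phi> i) ((x \<oplus>\<^bsub>?C\<^esub> y) i))"
      using T by (intro \<sigma> \<phi> C.M.a_closed x y) auto
    also have "\<dots> = (\<Sum>i\<in>?T. s i (\<phi> i) (x i) + s i (\<phi> i) (y i))"
    proof (rule sum.cong[OF refl])
      fix i assume "i \<in> ?T"
      then have i: "i \<in> I" using T(2) by blast
      show "s i (\<phi> i) ((x \<oplus>\<^bsub>?C\<^esub> y) i) = s i (\<phi> i) (x i) + s i (\<phi> i) (y i)"
        using i cm_add[OF sc[OF i \<phi> i] xi[OF x i] xi[OF y i]] by simp
    qed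
    also have "\<dots> = \<sigma> \<phi> x + \<sigma> \<phi> y"
      by (simp only: sum.distrib \<sigma>[OF \<phi> x T(1) _ T(2)] \<sigma>[OF \<phi> y T(1) _ T(2)] sub)
    finally show "\<sigma> \<phi> (x \<oplus>\<^bsub>?C\<^esub> y) = \<sigma> \<phi> x + \<sigma> \<phi> y" .
  qed
  have \<sigma>h: "(\<lambda>\<phi>\<in>carrier ?P. \<sigma> \<phi>) \<in> mhom (opp S) ?P (cm ?C)"
  proof (rule mhomI)
    fix \<phi> \<psi> assume \<phi>: "\<phi> \<in> carrier ?P" and \<psi>: "\<psi> \<in> carrier ?P"
    have "\<sigma> (\<phi> \<oplus>\<^bsub>?P\<^esub> \<psi>) = \<sigma> \<phi> \<oplus>\<^bsub>cm ?C\<^esub> \<sigma> \<psi>"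
    proof (rule cm_eqI[OF \<sigma>c[OF P.M.a_closed[OF \<phi> \<psi>]] CC.M.a_closed[OF \<sigma>c[OF \<phi>] \<sigma>c[OF \<psi>]]])
      fix x assume x: "x \<in> carrier ?C"
      have "s i ((\<phi> \<oplus>\<^bsub>?P\<^esub> \<psi>) i) (x i) = s i (\<phi> i) (x i) + s i (\<psi> i) (x i)" if i: "i \<in> I" for i
        using i mhom_add[OF s[OF i] \<phi>i[OF \<phi> i] \<phi>i[OF \<psi> i]] xi[OF x i] by simp
      then have "(\<Sum>i\<in>supp x. s i ((\<phi> \<oplus>\<^bsub>?P\<^esub> \<psi>) i) (x i)) = (\<Sum>i\<in>supp x. s i (\<phi> i) (x i) + s i (\<psi> i) (x i))"
        using suppI by (intro sum.cong) auto
      then show "\<sigma> (\<phi> \<oplus>\<^bsub>?P\<^esub> \<psi>) x = (\<sigma> \<phi> \<oplus>\<^bsub>cm ?C\<^esub> \<sigma> \<psi>) x"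
        using x by (simp add: \<sigma>_def sum.distrib del: prod_module_simps coprod_module_simps)
    qed
    then show "(\<lambda>\<phi>\<in>carrier ?P. \<sigma> \<phi>) (\<phi> \<oplus>\<^bsub>?P\<^esub> \<psi>) = (\<lambda>\<phi>\<in>carrier ?P. \<sigma> \<phi>) \<phi> \<oplus>\<^bsub>cm ?C\<^esub> (\<lambda>\<phi>\<in>carrier ?P. \<sigma> \<phi>) \<psi>"
      using \<phi> \<psi> P.M.a_closed[OF \<phi> \<psi>] by (simp del: prod_module_simps cm_simps)
  next
    fix a \<phi> assume a: "a \<in> carrier (opp S)" and \<phi>: "\<phi> \<in> carrier ?P"
    have "\<sigma> (a \<odot>\<^bsub>?P\<^esub> \<phi>) = a \<odot>\<^bsub>cm ?C\<^esub> \<sigma> \<phi>"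
    proof (rule cm_eqI[OF \<sigma>c[OF P.smult_closed[OF a \<phi>]] CC.smult_closed[OF a \<sigma>c[OF \<phi>]]])
      fix x assume x: "x \<in> carrier ?C"
      let ?y = "a \<odot>\<^bsub>?C\<^esub> x"
      have y: "?y \<in> carrier ?C" using a x by (simp del: coprod_module_simps add: C.smult_closed)
      have eq: "s i ((a \<odot>\<^bsub>?P\<^esub> \<phi>) i) (x i) = s i (\<phi> i) (?y i)" if i: "i \<in> I" for i
        using i mhom_smult[OF s[OF i] a \<phi>i[OF \<phi> i]] xi[OF x i] by simp
      let ?T = "supp x \<union> supp ?y"
      have T: "finite ?T" "?T \<subseteq> I" using fin x y suppI by auto
      have "\<sigma> (a \<odot>\<^bsub>?P\<^esub> \<phi>) x = (\<Sum>i\<in>?T. s i ((a \<odot>\<^bsub>?P\<^esub> \<phi>) i) (x i))"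
        by (rule \<sigma>[OF P.smult_closed[OF a \<phi>] x T(1) Un_upper1 T(2)])
      also have "\<dots> = (\<Sum>i\<in>?T. s i (\<phi> i) (?y i))" using eq T(2) by (intro sum.cong) auto
      also have "\<dots> = \<sigma> \<phi> ?y" by (rule \<sigma>[OF \<phi> y T(1) Un_upper2 T(2), symmetric])
      finally show "\<sigma> (a \<odot>\<^bsub>?P\<^esub> \<phi>) x = (a \<odot>\<^bsub>cm ?C\<^esub> \<sigma> \<phi>) x"
        using x by (simp del: prod_module_simps coprod_module_simps)
    qed
    then show "(\<lambda>\<phi>\<in>carrier ?P. \<sigma> \<phi>) (a \<odot>\<^bsub>?P\<^esub> \<phi>) = a \<odot>\<^bsub>cm ?C\<^esub> (\<lambda>\<phi>\<in>carrier ?P. \<sigma> \<phi>) \<phi>"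
      using \<phi> P.smult_closed[OF a \<phi>] by (simp del: prod_module_simps cm_simps)
  qed (use \<sigma>c in \<open>simp_all del: prod_module_simps\<close>)
  define \<iota> where "\<iota> i = (\<lambda>y\<in>carrier (Y i). \<lambda>j\<in>I. if j = i then y else \<zero>\<^bsub>Y j\<^esub>)" for i
  have \<iota>: "\<iota> i \<in> mhom S (Y i) ?C" if "i \<in> I" for i unfolding \<iota>_def by (rule mhom_coprod_inj[OF S Y that])
  have c\<iota>: "cmap (Y i) ?C (\<iota> i) \<in> mhom (opp S) (cm ?C) (cm (Y i))" if "i \<in> I" for i
    by (rule cmap_mhom[OF Y[OF that] C.left_module_axioms \<iota>[OF that]])
  define \<pi> where "\<pi> \<chi> = (\<lambda>i\<in>I. p i (cmap (Y i) ?C (\<iota> i) \<chi>))" for \<chi>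
  have \<pi>h: "(\<lambda>\<chi>\<in>carrier (cm ?C). \<pi> \<chi>) \<in> mhom (opp S) (cm ?C) ?P"
  proof (rule mhomI)
    show "(\<lambda>\<chi>\<in>carrier (cm ?C). \<pi> \<chi>) \<chi> \<in> carrier ?P" if "\<chi> \<in> carrier (cm ?C)" for \<chi>
      using that mhom_closed[OF p mhom_closed[OF c\<iota>]] by (simp add: \<pi>_def)
    show "(\<lambda>\<chi>\<in>carrier (cm ?C). \<pi> \<chi>) (\<chi> \<oplus>\<^bsub>cm ?C\<^esub> \<theta>) = (\<lambda>\<chi>\<in>carrier (cm ?C). \<pi> \<chi>) \<chi> \<oplus>\<^bsub>?P\<^esub> (\<lambda>\<chi>\<in>carrier (cm ?C). \<pi> \<chi>) \<theta>"
      if "\<chi> \<in> carrier (cm ?C)" "\<theta> \<in> carrier (cm ?C)" for \<chi> \<theta>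
      using that CC.M.a_closed[OF that] mhom_closed[OF c\<iota>]
      by (simp del: cm_simps add: \<pi>_def fun_eq_iff mhom_add[OF c\<iota>] mhom_add[OF p])
    show "(\<lambda>\<chi>\<in>carrier (cm ?C). \<pi> \<chi>) (a \<odot>\<^bsub>cm ?C\<^esub> \<chi>) = a \<odot>\<^bsub>?P\<^esub> (\<lambda>\<chi>\<in>carrier (cm ?C). \<pi> \<chi>) \<chi>"
      if "a \<in> carrier (opp S)" "\<chi> \<in> carrier (cm ?C)" for a \<chi>
      using that CC.smult_closed[OF that] mhom_closed[OF c\<iota>]
      by (simp del: cm_simps opp_simps add: \<pi>_def fun_eq_iff mhom_smult[OF c\<iota>] mhom_smult[OF p])
  qed simp
  have "\<pi> (\<sigma> \<phi>) = \<phi>" if \<phi>: "\<phi> \<in> carrier ?P" for \<phi>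
  proof (rule PiE_ext)
    show "\<pi> (\<sigma> \<phi>) \<in> (\<Pi>\<^sub>E i\<in>I. carrier (F i))"
      using mhom_closed[OF \<pi>h \<sigma>c[OF \<phi>]] \<sigma>c[OF \<phi>] by simp
    show "\<phi> \<in> (\<Pi>\<^sub>E i\<in>I. carrier (F i))" using \<phi> by simp
    fix i assume i: "i \<in> I"
    have "cmap (Y i) ?C (\<iota> i) (\<sigma> \<phi>) = s i (\<phi> i)"
    proof (rule cm_eqI[OF mhom_closed[OF c\<iota>[OF i] \<sigma>c[OF \<phi>]] sc[OF i \<phi> i]])
      fix y assume y: "y \<in> carrier (Y i)"
      have "\<sigma> \<phi> (\<iota> i y) = (\<Sum>j\<in>{i}. s j (\<phi> j) (\<iota> i y j))"
        using mhom_closed[OF \<iota>[OF i] y] i y by (intro \<sigma> \<phi>) (auto simp: supp_def \<iota>_def)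
      also have "\<dots> = s i (\<phi> i) y" using i y by (simp add: \<iota>_def)
      finally show "cmap (Y i) ?C (\<iota> i) (\<sigma> \<phi>) y = s i (\<phi> i) y" using y \<sigma>c[OF \<phi>] by (simp add: cmap_def)
    qed
    then show "\<pi> (\<sigma> \<phi>) i = \<phi> i" using i ps[OF i \<phi>i[OF \<phi> i]] by (simp add: \<pi>_def)
  qed
  then show ?thesis unfolding retract_def
    by (intro bexI[OF _ \<sigma>h] bexI[OF _ \<pi>h]) (use \<sigma>c in \<open>simp del: prod_module_simps\<close>)
qed

text \<open>Two dualities take a condition from \<open>cm Y\<close> to its dual on \<open>Y\<close>,
  then along the retract to \<open>cm X\<close>, and back to the condition on \<open>X\<close>. So
  replacing \<open>X\<close> by its double dual creates no new valid conditions.\<close>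

lemma factors_of_bidual:
  fixes X F :: "('r, 'u) module" and Y :: "('r, 'u) module"
  assumes p: "p \<in> fp_morphisms R" and X: "left_module R X" and Y: "left_module (opp R) Y" and LF: "left_module R F"
    and XY: "retract (opp R) (cm X) Y" and YF: "retract R (cm Y) F" and fac: "factors R p F"
  shows "factors R p X"
proof -
  obtain n m l k H G K where s: "system_pair R n m l k H G K"
    "\<And>M. left_module R M \<Longrightarrow> (factors R p M \<longleftrightarrow> pp_cond M n m l k H G K)"
    using factors_system[OF p] by blast
  interpret system_pair R n m l k H G K by (rule s(1))
  have cY: "left_module R (cm Y)" using left_module_cm[OF Y] by simp
  have "cond (cm Y)" by (rule cond_retract[OF cY LF YF]) (use s(2)[OF LF] fac in simp)
  then have "dual (cm X)" by (intro dual_retract[OF left_module_cm[OF X] Y XY]) (simp add: dual_iff_cond_cm[OF Y])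
  then show ?thesis by (simp add: s(2)[OF X] cond_iff_dual_cm[OF X])
qed

text \<open>The module \<open>X i\<close> is replaced by a copy \<open>F i\<close> of
  \<open>cm (Y i)\<close>, where \<open>Y i\<close> in \<open>B\<close> has \<open>cm (X i)\<close>
  as a retract. The product of these copies is a retract of the characters of the coproduct of the
  \<open>Y i\<close>, and that coproduct belongs to \<open>B\<close>.\<close>

lemma closed_coproducts_enough:
  fixes A B :: "('r, 'u) module set"
  assumes U: "inaccessible TYPE('u)" and R: "ring R" "tiny TYPE('u) (carrier R)"
    and AB: "symmetric_duality_pair R A B" and c: "closed_coproducts (opp R) B"
  shows "enough_products R A"
  unfolding enough_products_def
proof (intro allI impI, elim conjE)
  fix I :: "'u set" and X assume I: "small I" "\<forall>i\<in>I. X i \<in> A"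
  have AB: "duality_pair R A B" and BA: "duality_pair (opp R) B A"
    using AB by (simp_all add: symmetric_duality_pair_def)
  have AM: "A \<subseteq> Modules R" and BM: "B \<subseteq> Modules (opp R)" using AB by (simp_all add: duality_pair_def)
  have lA: "left_module R M" if "M \<in> A" for M using AM that Modules_lm by blast
  have lB: "left_module (opp R) M" if "M \<in> B" for M using BM that Modules_lm by blast
  have "\<exists>Y\<in>B. retract (opp R) (cm (X i)) Y" if "i \<in> I" for i
    using duality_pair_iff[OF U AB subsetD[OF AM]] I(2) that by blast
  then have "\<forall>i\<in>I. \<exists>Y. Y \<in> B \<and> retract (opp R) (cm (X i)) Y" by blast
  then obtain Y where "\<forall>i\<in>I. Y i \<in> B \<and> retract (opp R) (cm (X i)) (Y i)" by (rule bchoice[THEN exE])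
  then have Y: "\<And>i. i \<in> I \<Longrightarrow> Y i \<in> B" "\<And>i. i \<in> I \<Longrightarrow> retract (opp R) (cm (X i)) (Y i)" by simp_all
  have cY: "left_module R (cm (Y i))" if "i \<in> I" for i using left_module_cm[OF lB[OF Y(1)[OF that]]] by simp
  have "\<exists>F :: ('r, 'u) module. F \<in> Modules R \<and> mod_iso R (cm (Y i)) F" if "i \<in> I" for i
    by (rule tiny_copy[OF cY[OF that] tiny_cm[OF U Modules_tiny[OF subsetD[OF BM Y(1)[OF that]]]]])
  then have "\<forall>i\<in>I. \<exists>F :: ('r, 'u) module. F \<in> Modules R \<and> mod_iso R (cm (Y i)) F" by blast
  then obtain F :: "'u \<Rightarrow> ('r, 'u) module" where "\<forall>i\<in>I. F i \<in> Modules R \<and> mod_iso R (cm (Y i)) (F i)" by (rule bchoice[THEN exE])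
  then have F: "\<And>i. i \<in> I \<Longrightarrow> F i \<in> Modules R" "\<And>i. i \<in> I \<Longrightarrow> mod_iso R (cm (Y i)) (F i)" by simp_all
  have lF: "left_module R (F i)" if "i \<in> I" for i by (rule Modules_lm[OF F(1)[OF that]])
  have rF: "retract R (cm (Y i)) (F i)" "retract R (F i) (cm (Y i))" if "i \<in> I" for i
    by (rule mod_iso_retract[OF cY[OF that] F(2)[OF that]])+
  have fac: "factors R p (X i)" if "i \<in> I" "p \<in> fp_morphisms R" "factors R p (F i)" for i p
    by (rule factors_of_bidual[OF that(2) lA lB[OF Y(1)[OF that(1)]] lF[OF that(1)] Y(2)[OF that(1)] rF(1)[OF that(1)] that(3)])
      (use I(2) that(1) in blast)
  let ?C = "coprod_module I Y"
  have lC: "left_module (opp R) ?C" by (rule left_module_coprod[OF ring_opp[OF R(1)] lB[OF Y(1)]])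
  have "belongs (opp R) ?C B" using c I(1) Y(1) unfolding closed_coproducts_def by blast
  then obtain W where W: "W \<in> B" "mod_iso (opp R) ?C W" unfolding belongs_def by blast
  \<comment> \<open>Symmetry of the pair enters here: characters of a member of \<open>B\<close>
    lead back to \<open>A\<close>.\<close>
  obtain N where N: "N \<in> A" "retract R (cm W) N"
    using duality_pair_iff[OF U BA subsetD[OF BM W(1)]] W(1) by auto
  have lP: "left_module R (prod_module I F)" by (rule left_module_prod[OF R(1) lF])
  have "retract R (prod_module I F) (cm ?C)"
    using retract_prod_cm_coprod[OF ring_opp[OF R(1)] lB[OF Y(1)], of I "\<lambda>i. i" F] lF rF(2) by simp
  moreover have "retract R (cm ?C) (cm W)"
    using retract_cm[OF lC lB[OF W(1)] mod_iso_retract(1)[OF lC W(2)]] by simp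
  moreover have "left_module R (cm W)" using left_module_cm[OF lB[OF W(1)]] by simp
  ultimately have "retract R (prod_module I F) (cm W)" using retract_trans[OF lP] by blast
  then have "retract R (prod_module I F) N" by (rule retract_trans[OF lP lA[OF N(1)] _ N(2)])
  then show "\<exists>F'. (\<forall>i\<in>I. F' i \<in> Modules R \<and> (\<forall>p\<in>fp_morphisms R. factors R p (F' i) \<longrightarrow> factors R p (X i))) \<and>
      (\<exists>N\<in>A. retract R (prod_module I F') N)"
    using F(1) fac N(1) by (intro exI[of _ F] conjI ballI impI bexI[of _ N]) simp_all
qed

section \<open>Symmetric duality pairs and the equivalences\<close>

lemma symmetric_duality_pair_swap:
  "symmetric_duality_pair R A B \<Longrightarrow> symmetric_duality_pair (opp R) B A"
  by (simp add: symmetric_duality_pair_def)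

lemma symmetric_duality_pair_definable:
  fixes A B :: "('r, 'u) module set"
  assumes U: "inaccessible TYPE('u)" and R: "ring R" "tiny TYPE('u) (carrier R)"
    and AB: "symmetric_duality_pair R A B" and c: "closed_products R A \<or> closed_coproducts (opp R) B"
  shows "definable R A"
proof -
  have d: "duality_pair R A B" using AB by (simp add: symmetric_duality_pair_def)
  have "enough_products R A"
    using c closed_products_enough[OF R(1)] closed_coproducts_enough[OF U R AB] d by (auto simp: duality_pair_def)
  then show ?thesis by (rule definable_of_enough_products[OF U R d])
qed

text \<open>In a symmetric pair the first class determines the second: membership in
  \<open>B\<close> is read off from the character module and \<open>A\<close>, and the dual class of
  \<open>A\<close> obeys the same rule.\<close>

lemma symmetric_duality_pair_eq_dual:
  fixes A B :: "('r, 'u) module set"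
  assumes U: "inaccessible TYPE('u)" and R: "ring R" "tiny TYPE('u) (carrier R)"
    and AB: "symmetric_duality_pair R A B" and A: "definable R A"
  shows "B = dual_class R A"
proof -
  have 1: "duality_pair (opp R) B A" using AB by (simp add: symmetric_duality_pair_def)
  have 2: "duality_pair (opp R) (dual_class R A) A"
    using definable_symmetric_duality_pair[OF U R A] by (simp add: symmetric_duality_pair_def)
  have "N \<in> B \<longleftrightarrow> N \<in> dual_class R A" if "N \<in> Modules (opp R)" for N
    using duality_pair_iff[OF U 1 that] duality_pair_iff[OF U 2 that] by simp
  then show ?thesis using 1 2 unfolding duality_pair_def by blast
qed

theorem theorem6p4:
  fixes R :: "'r ring"
  assumes universe: "inaccessible TYPE('u)"
    and ring: "ring R"
    and small_ring: "|carrier R| <o |UNIV :: 'u set|"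
  shows "(\<forall>D :: ('r, 'u) module set. definable R D \<longrightarrow>
            symmetric_duality_pair R D (dual_class R D) \<and>
            product_closed_duality_pair R D (dual_class R D)) \<and>
         (\<forall>A B :: ('r, 'u) module set. symmetric_duality_pair R A B \<longrightarrow>
            ((closed_coproducts R A \<or> closed_coproducts (opp R) B) \<longleftrightarrow>
             (closed_products R A \<or> closed_products (opp R) B)) \<and>
            ((closed_products R A \<or> closed_products (opp R) B) \<longleftrightarrow>
             (definable R A \<and> B = dual_class R A)) \<and>
            ((definable R A \<and> B = dual_class R A) \<longleftrightarrow>
             (definable (opp R) B \<and> A = dual_class (opp R) B)) \<and>
            (closed_coproducts R A \<or> closed_coproducts (opp R) B \<or>
             closed_products R A \<or> closed_products (opp R) B \<longrightarrow>
               closed_coproducts R A \<and> closed_coproducts (opp R) B \<and>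
               closed_products R A \<and> closed_products (opp R) B \<and>
               definable R A \<and> definable (opp R) B))"
proof (intro conjI allI impI)
  have tiny: "tiny TYPE('u) (carrier R)" using small_ring by (simp add: tiny_def)
  fix D :: "('r, 'u) module set" assume D: "definable R D"
  show s: "symmetric_duality_pair R D (dual_class R D)"
    by (rule definable_symmetric_duality_pair[OF universe ring tiny D])
  show "product_closed_duality_pair R D (dual_class R D)"
    using s definable_closed(1)[OF universe ring D]
    by (simp add: product_closed_duality_pair_def symmetric_duality_pair_def)
next
  have tiny: "tiny TYPE('u) (carrier R)" using small_ring by (simp add: tiny_def)
  then have tiny': "tiny TYPE('u) (carrier (opp R))" by simp
  note ring' = ring_opp[OF ring]
  fix A B :: "('r, 'u) module set" assume AB: "symmetric_duality_pair R A B"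
  note BA = symmetric_duality_pair_swap[OF AB]
  have A: "definable R A" if "closed_products R A \<or> closed_coproducts (opp R) B"
    using symmetric_duality_pair_definable[OF universe ring tiny AB that] .
  \<comment> \<open>The swapped pair over \<open>opp R\<close>: closure of \<open>A\<close> under
    coproducts now plays the part that closure of \<open>B\<close> under coproducts plays for
    \<open>A\<close>.\<close>
  have B: "definable (opp R) B" if "closed_products (opp R) B \<or> closed_coproducts R A"
    using symmetric_duality_pair_definable[OF universe ring' tiny' BA] that by simp
  have AdB: "B = dual_class R A" if "definable R A"
    by (rule symmetric_duality_pair_eq_dual[OF universe ring tiny AB that])
  have BdA: "A = dual_class (opp R) B" if "definable (opp R) B"
    by (rule symmetric_duality_pair_eq_dual[OF universe ring' tiny' BA that])
  \<comment> \<open>Definability crosses over because the partner of a definable class is its dual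
    class, which is definable.\<close>
  have A_B: "definable (opp R) B" if "definable R A"
    using definable_dual_class[OF universe ring tiny, of A] AdB[OF that] by simp
  have B_A: "definable R A" if "definable (opp R) B"
    using definable_dual_class[OF universe ring' tiny', of B] BdA[OF that] by simp
  note cA = definable_closed(1,2)[OF universe ring, of A] and cB = definable_closed(1,2)[OF universe ring', of B]
  show "(closed_coproducts R A \<or> closed_coproducts (opp R) B) = (closed_products R A \<or> closed_products (opp R) B)"
    using A B A_B B_A cA cB by blast
  show "(closed_products R A \<or> closed_products (opp R) B) = (definable R A \<and> B = dual_class R A)"
    using A B B_A AdB cA by blast
  show "(definable R A \<and> B = dual_class R A) = (definable (opp R) B \<and> A = dual_class (opp R) B)"
    using A_B B_A AdB BdA by blast
  assume "closed_coproducts R A \<or> closed_coproducts (opp R) B \<or> closed_products R A \<or> closed_products (opp R) B"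
  then have "definable R A" "definable (opp R) B" using A B A_B B_A by blast+
  then show "closed_coproducts R A" "closed_coproducts (opp R) B" "closed_products R A" "closed_products (opp R) B"
    "definable R A" "definable (opp R) B" using cA cB by blast+
qed

end
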